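(* Let $\alpha\in(0,1]$, let $f\in\operatorname{Lip}_\alpha(\mathbb{C})$, and let $E\subset\mathbb{D}$ be a compact set. Assume that $f$ is a mapping of finite distortion on $\mathbb{C}\setminus E$, with distortion function $K$ such that $K(z)=1$ whenever $|z|>1$, and $$\exp\left(\frac{K}{\log(e+K)}\right)\in L^p(\mathbb{D})$$ for some $p>0$. If $\dim(E)<2\alpha$, then $f$ is a mapping of finite distortion on $\mathbb{C}$.
   Context: $\mathbb{D}$ is the open unit disk of $\mathbb{C}$ and $\dim$ denotes Hausdorff dimension. For $\alpha\in(0,1]$, a function $f:\mathbb{C}\to\mathbb{C}$ belongs to $\operatorname{Lip}_\alpha(\mathbb{C})$ if there is a constant $C$ such that $|f(z)-f(w)|\leq C|z-w|^\alpha$ whenever $z,w\in\mathbb{C}$ satisfy $|z-w|<1$. For an open set $\Omega\subset\mathbb{C}$, a mapping $f:\Omega\to\mathbb{C}$ is a mapping of finite distortion on $\Omega$, with distortion function $K$, if $f\in W^{1,1}_{loc}(\Omega)$, its Jacobian determinant satisfies $Jf\in L^1_{loc}(\Omega)$, and $|Df(z)|^2\leq K(z)\,Jf(z)$ for almost every $z\in\Omega$, where $|Df(z)|$ is the operator norm of the differential and $K$ is a measurable function with $K(z)\in[1,\infty)$ for almost every $z\in\Omega$. When $K$ is only given on $\mathbb{C}\setminus E$, the integrability condition on $\mathbb{D}$ is understood on $\mathbb{D}\setminus E$. Saying that $f$ is a mapping of finite distortion on $\mathbb{C}$ means that this holds on $\Omega=\mathbb{C}$ for some such $K$. *)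

theory Defs
  imports "HOL-Analysis.Analysis"
begin

text \<open>
  The case distinction implements the conventions that the empty set contributes nothing and that
  \<open>0\<^sup>0 = 1\<close> (whereas \<open>0 powr 0 = 0\<close>), so that the 0-dimensional measure is the counting measure.
\<close>

definition diam_pow :: "real \<Rightarrow> 'a::metric_space set \<Rightarrow> ennreal" where
  "diam_pow s U = (if U = {} then 0 else if s = 0 then 1 else ennreal (diameter U powr s))"

text \<open>
  Covers are required to consist of bounded sets because \<open>diameter\<close> is a real number, and is
  unspecified for unbounded sets. The usual normalising constant is omitted; it does not affect
  the dimension.
\<close>

definition hausdorff_premeasure :: "real \<Rightarrow> real \<Rightarrow> 'a::metric_space set \<Rightarrow> ennreal" where
  "hausdorff_premeasure s \<delta> A =
     (INF U \<in> {U :: nat \<Rightarrow> 'a set. A \<subseteq> (\<Union>i. U i) \<and> (\<forall>i. bounded (U i) \<and> diameter (U i) \<le> \<delta>)}.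
        \<Sum>i. diam_pow s (U i))"

definition hausdorff_measure :: "real \<Rightarrow> 'a::metric_space set \<Rightarrow> ennreal" where
  "hausdorff_measure s A = (SUP \<delta> \<in> {0<..}. hausdorff_premeasure s \<delta> A)"

definition hausdorff_dim :: "'a::metric_space set \<Rightarrow> ereal" where
  "hausdorff_dim A = (INF s \<in> {s. 0 \<le> s \<and> hausdorff_measure s A = 0}. ereal s)"

definition Lip :: "real \<Rightarrow> (complex \<Rightarrow> complex) set" where
  "Lip \<alpha> = {f. \<exists>C. \<forall>z w. cmod (z - w) < 1 \<longrightarrow> cmod (f z - f w) \<le> C * cmod (z - w) powr \<alpha>}"

definition Lp_on :: "real \<Rightarrow> 'a::euclidean_space set \<Rightarrow> ('a \<Rightarrow> real) set" where
  "Lp_on p S = {g. g \<in> borel_measurable (lebesgue_on S) \<and>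
                   (\<lambda>x. \<bar>g x\<bar> powr p) absolutely_integrable_on S}"

definition L1_loc :: "'a::euclidean_space set \<Rightarrow> ('a \<Rightarrow> 'b::euclidean_space) set" where
  "L1_loc \<Omega> = {f. \<forall>C. compact C \<and> C \<subseteq> \<Omega> \<longrightarrow> f absolutely_integrable_on C}"

primrec Ck :: "nat \<Rightarrow> ('a::euclidean_space \<Rightarrow> real) \<Rightarrow> bool" where
  "Ck 0 \<phi> \<longleftrightarrow> continuous_on UNIV \<phi>"
| "Ck (Suc k) \<phi> \<longleftrightarrow>
     (\<forall>x. \<phi> differentiable (at x)) \<and>
     (\<forall>b\<in>Basis. Ck k (\<lambda>x. frechet_derivative \<phi> (at x) b))"

definition test_functions :: "'a::euclidean_space set \<Rightarrow> ('a \<Rightarrow> real) set" where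
  "test_functions \<Omega> =
     {\<phi>. (\<forall>k. Ck k \<phi>) \<and> compact (closure {x. \<phi> x \<noteq> 0}) \<and> closure {x. \<phi> x \<noteq> 0} \<subseteq> \<Omega>}"

definition weak_partial ::
  "'a::euclidean_space set \<Rightarrow> 'a \<Rightarrow> ('a \<Rightarrow> 'b::euclidean_space) \<Rightarrow> ('a \<Rightarrow> 'b) \<Rightarrow> bool" where
  "weak_partial \<Omega> b f g \<longleftrightarrow>
     (\<forall>\<phi>\<in>test_functions \<Omega>.
        (LINT x:\<Omega>|lebesgue. frechet_derivative \<phi> (at x) b *\<^sub>R f x) =
        - (LINT x:\<Omega>|lebesgue. \<phi> x *\<^sub>R g x))"

text \<open>
  \<open>f\<close> belongs to the local Sobolev space \<open>W(1,1)\<close> on \<open>\<Omega>\<close> iff it satisfies the following for some \<open>D\<close>, which is then its weak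
  differential and is determined almost everywhere on \<open>\<Omega>\<close>.
\<close>

definition W11_loc_differential ::
  "'a::euclidean_space set \<Rightarrow> ('a \<Rightarrow> 'b::euclidean_space) \<Rightarrow> ('a \<Rightarrow> 'a \<Rightarrow>\<^sub>L 'b) \<Rightarrow> bool" where
  "W11_loc_differential \<Omega> f D \<longleftrightarrow>
     f \<in> L1_loc \<Omega> \<and>
     (\<forall>b\<in>Basis. (\<lambda>x. D x b) \<in> L1_loc \<Omega> \<and> weak_partial \<Omega> b f (\<lambda>x. D x b))"

text \<open>The determinant of a real-linear map of the plane in the real basis \<open>1, \<i>\<close>.\<close>

definition jacobian :: "(complex \<Rightarrow>\<^sub>L complex) \<Rightarrow> real" where
  "jacobian A = Re (A 1) * Im (A \<i>) - Re (A \<i>) * Im (A 1)"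

text \<open>The norm of a bounded linear function is its operator norm.\<close>

definition finite_distortion :: "complex set \<Rightarrow> (complex \<Rightarrow> complex) \<Rightarrow> (complex \<Rightarrow> real) \<Rightarrow> bool" where
  "finite_distortion \<Omega> f K \<longleftrightarrow>
     open \<Omega> \<and>
     K \<in> borel_measurable (lebesgue_on \<Omega>) \<and>
     (AE z in lebesgue_on \<Omega>. 1 \<le> K z) \<and>
     (\<exists>D. W11_loc_differential \<Omega> f D \<and>
          (\<lambda>z. jacobian (D z)) \<in> L1_loc \<Omega> \<and>
          (AE z in lebesgue_on \<Omega>. (norm (D z))\<^sup>2 \<le> K z * jacobian (D z)))"

end

theory Submission
  imports Defs
begin

text \<open>
  Let \<open>D\<close> be the weak differential and \<open>J\<close> the Jacobian of \<open>f\<close> off \<open>E\<close>. Since \<open>dim E < 2 \<alpha>\<close>, the set \<open>E\<close> has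
  coverings by finitely many discs of radii \<open>r\<^sub>i\<close> with \<open>\<Sum> r\<^sub>i powr (2 \<alpha>)\<close> arbitrarily small. Their images lie
  in discs of radii \<open>C r\<^sub>i powr \<alpha>\<close>, so that \<open>f ` E\<close> is a null set (\<open>negligible_Holder_image\<close>). Extend \<open>D\<close> by
  \<open>0\<close> and \<open>K\<close> by \<open>1\<close> to \<open>E\<close>. The distortion inequality then holds on \<open>E\<close>, and it remains to show that \<open>J\<close> and
  \<open>D\<close> are integrable near \<open>E\<close>, and that \<open>D\<close> is the weak differential of \<open>f\<close> across \<open>E\<close>.

  The heart of the matter is the integrability of \<open>J\<close>. Let \<open>h\<close> be a bounded function on the plane with a
  bounded primitive \<open>H\<close> in the first variable, so that \<open>d (H dy) = h dx dy\<close>. If \<open>\<psi>\<close> is a cutoff function with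
  \<open>\<psi> = 1\<close> near \<open>E\<close>, and \<open>h = 0\<close> near \<open>f ` E\<close>, then Stokes' theorem for the pulled back form suggests
  \<open>\<integral> \<psi> h(f) J = - \<integral> H(f) d\<psi> \<and> d(Im f)\<close>. The right-hand side only involves \<open>f\<close> away from \<open>E\<close>, and is bounded
  in terms of \<open>sup H\<close>. Letting \<open>h\<close> converge to the indicator function of the complement of \<open>f ` E\<close>, Fatou's
  lemma shows that \<open>J\<close> is integrable off the preimage of \<open>f ` E\<close>. On this preimage \<open>J = 0\<close> almost everywhere,
  because \<open>f ` E\<close> is a null set: this follows from the same identity away from \<open>E\<close>, with \<open>h\<close> converging to the
  indicator function of a null set (\<open>jacobian_null_preimage\<close>, \<open>jacobian_integrable_across\<close>).

  The identity itself (\<open>pullback_identity\<close>) is obvious for smooth maps, but \<open>D\<close> is merely integrable, not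
  square integrable, so that approximation by mollification does not control the Jacobian. This is where the
  condition on \<open>K\<close> enters. Since \<open>\<Sum> 1 / (k log k)\<close> diverges, exponential integrability of \<open>K / log (e + K)\<close> and
  \<open>|D|\<^sup>2 \<le> K J\<close> give levels \<open>l\<close> tending to infinity along which \<open>l \<integral>\<^bsub>|D| > l\<^esub> |D|\<close> tends to \<open>0\<close>
  (\<open>tail_integral_small\<close>). By the weak type estimate for the maximal function, \<open>f\<close> is then close to a map
  whose Lipschitz constant is comparable with \<open>l\<close>, off a set whose area is small compared with \<open>1 / l\<^sup>2\<close>
  (\<open>lipschitz_truncation\<close>, \<open>truncated_approximation\<close>). The Jacobian of the approximation has small integral over this set, and
  the identity passes to the limit.

  Finally \<open>|D| \<le> K + J\<close> is integrable, because \<open>K\<close> is (\<open>distortion_le_exp\<close>). To see that \<open>D\<close> is the weak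
  differential across \<open>E\<close>, split a test function \<open>\<phi>\<close> by a partition of unity \<open>\<eta>\<^sub>i\<close> subordinate to discs of a
  covering of \<open>E\<close>. Since \<open>\<integral> \<partial>(\<phi> \<eta>\<^sub>i) = 0\<close>, a constant may be subtracted from \<open>f\<close>, and
  \<open>\<integral> \<partial>(\<phi> \<eta>\<^sub>i) (f - f(x\<^sub>i))\<close> is of order \<open>r\<^sub>i powr (1 + \<alpha>)\<close>, at most \<open>r\<^sub>i powr (2 \<alpha>)\<close>. The sum tends to \<open>0\<close> with the
  covering (\<open>weak_partial_removable\<close>).
\<close>

section \<open>Smooth functions\<close>

lemma Ck_SucI:
  fixes f :: "'a::euclidean_space \<Rightarrow> real"
  assumes "\<And>x. (f has_derivative F x) (at x)" and "\<And>b. b \<in> Basis \<Longrightarrow> Ck k (\<lambda>x. F x b)"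
  shows "Ck (Suc k) f"
proof -
  have "frechet_derivative f (at x) = F x" for x
    using frechet_derivative_at[OF assms(1)[of x]] by simp
  then show ?thesis
    using assms by (auto simp: differentiable_def)
qed

lemma Ck_Suc_deriv:
  fixes f :: "'a::euclidean_space \<Rightarrow> real"
  assumes "Ck (Suc k) f"
  shows "(f has_derivative frechet_derivative f (at x)) (at x)"
  using assms frechet_derivative_works by auto

lemma Ck_Suc_imp_Ck:
  fixes f :: "'a::euclidean_space \<Rightarrow> real"
  shows "Ck (Suc k) f \<Longrightarrow> Ck k f"
proof (induction k arbitrary: f)
  case 0
  then show ?case
    by (auto intro!: differentiable_imp_continuous_on simp: differentiable_on_def)
next
  case (Suc k)
  then show ?case by (metis Ck.simps(2))
qed

lemma Ck_add:
  fixes f g :: "'a::euclidean_space \<Rightarrow> real"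
  shows "Ck k f \<Longrightarrow> Ck k g \<Longrightarrow> Ck k (\<lambda>x. f x + g x)"
proof (induction k arbitrary: f g)
  case 0
  then show ?case by (auto intro!: continuous_intros)
next
  case (Suc k)
  show ?case
    by (rule Ck_SucI[OF has_derivative_add[OF Ck_Suc_deriv[OF Suc.prems(1)] Ck_Suc_deriv[OF Suc.prems(2)]]])
      (use Suc in auto)
qed

lemma Ck_const [simp]: "Ck k (\<lambda>x::'a::euclidean_space. c)"
proof (induction k arbitrary: c)
  case (Suc k)
  show ?case by (rule Ck_SucI[OF has_derivative_const]) (use Suc in auto)
qed auto

lemma Ck_mult:
  fixes f g :: "'a::euclidean_space \<Rightarrow> real"
  shows "Ck k f \<Longrightarrow> Ck k g \<Longrightarrow> Ck k (\<lambda>x. f x * g x)"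
proof (induction k arbitrary: f g)
  case 0
  then show ?case by (auto intro!: continuous_intros)
next
  case (Suc k)
  show ?case
    by (rule Ck_SucI[OF has_derivative_mult[OF Ck_Suc_deriv[OF Suc.prems(1)] Ck_Suc_deriv[OF Suc.prems(2)]]],
        rule Ck_add; rule Suc.IH)
      (use Suc.prems Ck_Suc_imp_Ck in auto)
qed

lemma Ck_diff:
  fixes f g :: "'a::euclidean_space \<Rightarrow> real"
  assumes "Ck k f" "Ck k g" shows "Ck k (\<lambda>x. f x - g x)"
  using Ck_add[OF assms(1) Ck_mult[OF Ck_const[of k "-1"] assms(2)]] by simp

lemma Ck_affine:
  fixes f :: "'a::euclidean_space \<Rightarrow> real"
  shows "Ck k f \<Longrightarrow> Ck k (\<lambda>x. f (c *\<^sub>R x + a))"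
proof (induction k arbitrary: f)
  case 0
  then have "continuous_on UNIV f" by simp
  then show ?case by (auto intro!: continuous_on_compose2[of UNIV f] continuous_intros)
next
  case (Suc k)
  have d: "((\<lambda>x. f (c *\<^sub>R x + a)) has_derivative (\<lambda>v. frechet_derivative f (at (c *\<^sub>R x + a)) (c *\<^sub>R v))) (at x)" for x
    by (rule has_derivative_compose[OF _ Ck_Suc_deriv[OF Suc.prems], of "\<lambda>x. c *\<^sub>R x + a"])
       (auto intro!: derivative_eq_intros)
  have l: "frechet_derivative f (at y) (c *\<^sub>R v) = c * frechet_derivative f (at y) v" for y v
    using linear_frechet_derivative[of f "at y"] Suc.prems by (simp add: linear_cmul)
  show ?case
    by (rule Ck_SucI[OF d], unfold l, rule Ck_mult[OF Ck_const Suc.IH]) (use Suc.prems in auto)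
qed

definition smooth :: "('a::euclidean_space \<Rightarrow> real) \<Rightarrow> bool" where
  "smooth \<phi> \<longleftrightarrow> (\<forall>k. Ck k \<phi>)"

lemma smooth_continuous: "smooth \<phi> \<Longrightarrow> continuous_on S \<phi>"
  unfolding smooth_def using continuous_on_subset[of UNIV \<phi> S] by (metis Ck.simps(1) subset_UNIV)

text \<open>
  The derivative of a member of this family is a linear combination of members. Smoothness of
  \<open>exp (-1/t)\<close>, extended by zero, therefore follows by an induction on the order for the whole family.
\<close>

definition bump_part :: "nat \<Rightarrow> real \<Rightarrow> real" where
  "bump_part n t = (if 0 < t then exp (- 1 / t) / t ^ n else 0)"

lemma bump_part_tendsto: "(bump_part n \<longlongrightarrow> 0) (at 0)"
proof -
  have "((\<lambda>t. inverse t ^ n / exp (inverse t)) \<longlongrightarrow> (0::real)) (at_right 0)"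
    by (rule filterlim_compose[OF tendsto_power_div_exp_0 filterlim_inverse_at_top_right])
  then have r: "(bump_part n \<longlongrightarrow> 0) (at_right 0)"
    by (rule Lim_transform_eventually)
       (simp add: eventually_at_filter bump_part_def exp_minus power_inverse field_simps)
  have "\<forall>\<^sub>F t in at_left 0. (0::real) = bump_part n t"
    by (simp add: eventually_at_filter bump_part_def)
  then have l: "(bump_part n \<longlongrightarrow> 0) (at_left 0)"
    by (rule Lim_transform_eventually[OF tendsto_const])
  show ?thesis using filterlim_split_at[OF l r] .
qed

lemma bump_part_deriv:
  "(bump_part n has_real_derivative (bump_part (n + 2) t - real n * bump_part (n + 1) t)) (at t)"
proof -
  consider "t > 0" | "t < 0" | "t = 0" by linarith
  then show ?thesis
  proof cases
    case 1
    have "((\<lambda>t. exp (- 1 / t) / t ^ n) has_real_derivative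
        (bump_part (n + 2) t - real n * bump_part (n + 1) t)) (at t)"
      using 1
      apply (auto intro!: derivative_eq_intros simp: bump_part_def)
      apply (cases n)
       apply (auto simp: field_simps power2_eq_square)
      done
    then show ?thesis
      by (rule has_field_derivative_transform_within_open[of _ _ _ "{0<..}"]) (use 1 in \<open>auto simp: bump_part_def\<close>)
  next
    case 2
    have "((\<lambda>t. 0) has_real_derivative (bump_part (n + 2) t - real n * bump_part (n + 1) t)) (at t)"
      using 2 by (auto simp: bump_part_def)
    then show ?thesis
      by (rule has_field_derivative_transform_within_open[of _ _ _ "{..<0}"]) (use 2 in \<open>auto simp: bump_part_def\<close>)
  next
    case 3
    have "((\<lambda>h. (bump_part n (0 + h) - bump_part n 0) / h) \<longlongrightarrow> 0) (at 0)"
      by (rule Lim_transform_eventually[OF bump_part_tendsto[of "Suc n"]])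
         (auto simp: bump_part_def eventually_at_filter)
    then show ?thesis
      using 3 by (simp add: DERIV_def bump_part_def)
  qed
qed

lemma bump_part_Ck:
  fixes L :: "'a::euclidean_space \<Rightarrow> real"
  assumes L: "bounded_linear L"
  shows "Ck k (\<lambda>x. c * bump_part n (a + L x))"
proof (induction k arbitrary: c n)
  case 0
  have "continuous_on UNIV (bump_part n)"
    by (rule DERIV_continuous_on) (rule has_field_derivative_at_within[OF bump_part_deriv])
  then have "continuous_on UNIV (\<lambda>x. bump_part n (a + L x))"
    by (rule continuous_on_compose2[OF _ continuous_on_add[OF continuous_on_const linear_continuous_on[OF L]]]) auto
  then show ?case by (auto intro!: continuous_intros)
next
  case (Suc k)
  have 1: "((\<lambda>x. a + L x) has_derivative L) (at x)" for x
    using bounded_linear_imp_has_derivative[OF L] by (auto intro!: derivative_eq_intros)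
  have 2: "(bump_part n has_derivative (\<lambda>v. (bump_part (n + 2) t - real n * bump_part (n + 1) t) * v)) (at t)" for t
    using bump_part_deriv[of n t] unfolding has_field_derivative_def by simp
  have d: "((\<lambda>x. c * bump_part n (a + L x)) has_derivative
     (\<lambda>v. c * ((bump_part (n + 2) (a + L x) - real n * bump_part (n + 1) (a + L x)) * L v))) (at x)" for x
    by (rule has_derivative_mult_right[OF has_derivative_compose[OF 1 2]])
  have "Ck k (\<lambda>x. (c * L b) * bump_part (n + 2) (a + L x) + (- (c * L b * real n)) * bump_part (n + 1) (a + L x))" for b
    by (rule Ck_add; rule Suc.IH)
  then have "Ck k (\<lambda>x. c * ((bump_part (n + 2) (a + L x) - real n * bump_part (n + 1) (a + L x)) * L b))" for b
    by (simp add: algebra_simps)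
  then show ?case by (rule Ck_SucI[OF d])
qed

lemma continuous_compact_support_integrable:
  fixes u :: "complex \<Rightarrow> 'b::{banach, second_countable_topology}"
  assumes "continuous_on UNIV u" and "\<And>x. R < cmod x \<Longrightarrow> u x = 0"
  shows "integrable lborel u"
proof -
  have "integrable lborel (\<lambda>x. indicator (cball 0 R) x *\<^sub>R u x)"
    by (rule borel_integrable_compact) (use assms continuous_on_subset[of UNIV u] in auto)
  moreover have "(\<lambda>x. indicator (cball 0 R) x *\<^sub>R u x) = u"
    using assms(2) by (force simp: indicator_def not_le)
  ultimately show ?thesis by simp
qed

definition mollifier :: "real \<Rightarrow> (complex \<Rightarrow> real) \<Rightarrow> bool" where
  "mollifier \<sigma> k \<longleftrightarrow> smooth k \<and> (\<forall>x. 0 \<le> k x) \<and> (\<forall>x. \<sigma> < cmod x \<longrightarrow> k x = 0) \<and>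
     (\<forall>x. k (- x) = k x) \<and> has_bochner_integral lborel k 1"

lemma mollifier_exists:
  assumes "0 < \<sigma>"
  shows "\<exists>k. mollifier \<sigma> k"
proof -
  define e where "e = (\<lambda>L x. bump_part 0 (\<sigma>/2 + L (x::complex)))"
  \<comment> \<open>The support of this product is a square contained in the disc of radius \<open>\<sigma>\<close>.\<close>
  define b where "b = (\<lambda>x. e Re x * e (\<lambda>x. - Re x) x * (e Im x * e (\<lambda>x. - Im x) x))"
  have e: "Ck k (e L)" if "bounded_linear L" for k L
    using bump_part_Ck[OF that, of k 1 0 "\<sigma>/2"] by (simp add: e_def)
  have "smooth b" unfolding smooth_def b_def
    by (auto intro!: Ck_mult e bounded_linear_Re bounded_linear_Im bounded_linear_minus)
  have pos: "0 \<le> b x" for x by (simp add: b_def e_def bump_part_def)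
  have even: "b (- x) = b x" for x by (simp add: b_def e_def)
  have sup: "b x = 0" if "\<sigma> < cmod x" for x
  proof (rule ccontr)
    assume "b x \<noteq> 0"
    then have "\<bar>Re x\<bar> < \<sigma>/2" "\<bar>Im x\<bar> < \<sigma>/2"
      by (auto simp: b_def e_def bump_part_def split: if_splits)
    then show False using cmod_le[of x] that by simp
  qed
  have cont: "continuous_on UNIV b" using \<open>smooth b\<close> by (rule smooth_continuous)
  have int: "integrable lborel b"
    by (rule continuous_compact_support_integrable[OF cont sup])
  have "integral\<^sup>L lborel b \<noteq> 0"
  proof
    assume "integral\<^sup>L lborel b = 0"
    then have "AE x in lborel. b x = 0"
      using integral_nonneg_eq_0_iff_AE[OF int] pos by auto
    then have "AE x in lebesgue. b x = 0" by (rule AE_completion)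
    then have "negligible {x. b x \<noteq> 0}"
      using AE_iff_null_sets[of "{x. b x \<noteq> 0}" lebesgue]
      by (simp add: eventually_ae_filter_negligible) (meson negligible_subset)
    moreover have "open {x. b x \<noteq> 0}"
      using open_Collect_neq[OF cont continuous_on_const] by simp
    moreover have "0 \<in> {x. b x \<noteq> 0}" using assms by (simp add: b_def e_def bump_part_def)
    ultimately show False using open_not_negligible by blast
  qed
  then have I: "0 < integral\<^sup>L lborel b"
    using integral_nonneg_AE[of b lborel] pos by (simp add: less_le)
  have "mollifier \<sigma> (\<lambda>x. (1 / integral\<^sup>L lborel b) * b x)"
    unfolding mollifier_def
  proof (intro conjI allI impI)
    show "smooth (\<lambda>x. (1 / integral\<^sup>L lborel b) * b x)"
      using \<open>smooth b\<close> unfolding smooth_def by (intro allI Ck_mult Ck_const) blast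
    show "has_bochner_integral lborel (\<lambda>x. (1 / integral\<^sup>L lborel b) * b x) 1"
      using has_bochner_integral_mult_right[OF has_bochner_integral_integrable[OF int], of "1 / integral\<^sup>L lborel b"] I
      by simp
  qed (use pos I sup even in auto)
  then show ?thesis by blast
qed

section \<open>Functions of class C1\<close>

text \<open>
  The partial derivatives are parameters rather than values of a derivative operator, so that the integral
  identities below can name them.
\<close>

definition C1 :: "(complex \<Rightarrow> 'b::real_normed_vector) \<Rightarrow> (complex \<Rightarrow> 'b) \<Rightarrow> (complex \<Rightarrow> 'b) \<Rightarrow> bool" where
  "C1 f f1 f2 \<longleftrightarrow> (\<forall>x. (f has_derivative (\<lambda>v. Re v *\<^sub>R f1 x + Im v *\<^sub>R f2 x)) (at x)) \<and>
     continuous_on UNIV f1 \<and> continuous_on UNIV f2"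

lemma C1_continuous: "C1 f f1 f2 \<Longrightarrow> continuous_on S f"
  unfolding C1_def by (meson continuous_at_imp_continuous_on has_derivative_continuous)

lemma C1_continuous_partials:
  assumes "C1 f f1 f2" shows "continuous_on S f1" "continuous_on S f2"
  using assms continuous_on_subset[of UNIV _ S] unfolding C1_def by blast+

lemma smooth_partial_smooth:
  fixes \<phi> :: "complex \<Rightarrow> real"
  assumes "smooth \<phi>" "b \<in> {1, \<i>}"
  shows "smooth (\<lambda>x. frechet_derivative \<phi> (at x) b)"
  using assms unfolding smooth_def by (metis Basis_complex_def Ck.simps(2))

lemma smooth_C1:
  fixes \<phi> :: "complex \<Rightarrow> real"
  assumes "smooth \<phi>"
  shows "C1 \<phi> (\<lambda>x. frechet_derivative \<phi> (at x) 1) (\<lambda>x. frechet_derivative \<phi> (at x) \<i>)"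
proof -
  have d: "(\<phi> has_derivative frechet_derivative \<phi> (at x)) (at x)" for x
    using assms Ck_Suc_deriv unfolding smooth_def by blast
  have "frechet_derivative \<phi> (at x) = (\<lambda>v. Re v *\<^sub>R frechet_derivative \<phi> (at x) 1 + Im v *\<^sub>R frechet_derivative \<phi> (at x) \<i>)" for x
  proof
    fix v
    interpret bounded_linear "frechet_derivative \<phi> (at x)" using d has_derivative_bounded_linear by blast
    have "v = Re v *\<^sub>R 1 + Im v *\<^sub>R \<i>" by (simp add: complex_eq_iff)
    then show "frechet_derivative \<phi> (at x) v = Re v *\<^sub>R frechet_derivative \<phi> (at x) 1 + Im v *\<^sub>R frechet_derivative \<phi> (at x) \<i>"
      by (metis add scaleR)
  qed
  then show ?thesis
    unfolding C1_def using d smooth_continuous[OF smooth_partial_smooth[OF assms]] by auto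
qed

text \<open>
  The linear map with given partial derivatives, in the normed space where the rule for differentiation
  under the integral sign takes its derivatives.
\<close>

definition partials :: "'b \<Rightarrow> 'b \<Rightarrow> complex \<Rightarrow>\<^sub>L 'b::real_normed_vector" where
  "partials a b = (blinfun_scaleR_left a o\<^sub>L Blinfun Re) + (blinfun_scaleR_left b o\<^sub>L Blinfun Im)"

lemma partials_apply [simp]: "blinfun_apply (partials a b) v = Re v *\<^sub>R a + Im v *\<^sub>R b"
  by (simp add: partials_def blinfun.bilinear_simps bounded_linear_Blinfun_apply bounded_linear_Re bounded_linear_Im)

lemma partials_eq: "blinfun_apply (partials a b) = (\<lambda>v. Re v *\<^sub>R a + Im v *\<^sub>R b)"
  by (rule ext) simp

lemma continuous_on_partials [continuous_intros]:
  "continuous_on S f \<Longrightarrow> continuous_on S g \<Longrightarrow> continuous_on S (\<lambda>x. partials (f x) (g x))"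
  unfolding partials_def by (intro continuous_intros)

lemma C1_Leibniz:
  fixes \<phi> :: "complex \<Rightarrow> 't::euclidean_space \<Rightarrow> 'b::euclidean_space"
  assumes d: "\<And>x t. t \<in> cbox a b \<Longrightarrow> ((\<lambda>x. \<phi> x t) has_derivative (\<lambda>v. Re v *\<^sub>R \<phi>1 x t + Im v *\<^sub>R \<phi>2 x t)) (at x)"
    and c: "\<And>x. continuous_on (cbox a b) (\<phi> x)"
    and c1: "continuous_on (UNIV \<times> cbox a b) (\<lambda>(x, t). \<phi>1 x t)"
    and c2: "continuous_on (UNIV \<times> cbox a b) (\<lambda>(x, t). \<phi>2 x t)"
  shows "C1 (\<lambda>x. integral (cbox a b) (\<phi> x)) (\<lambda>x. integral (cbox a b) (\<phi>1 x)) (\<lambda>x. integral (cbox a b) (\<phi>2 x))"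
  unfolding C1_def
proof (intro conjI allI)
  show "continuous_on UNIV (\<lambda>x. integral (cbox a b) (\<phi>1 x))"
       "continuous_on UNIV (\<lambda>x. integral (cbox a b) (\<phi>2 x))"
    by (rule integral_continuous_on_param[OF c1], rule integral_continuous_on_param[OF c2])
  fix x
  have cc: "continuous_on (UNIV \<times> cbox a b) (\<lambda>(x, t). partials (\<phi>1 x t) (\<phi>2 x t))"
    using c1 c2 by (auto simp: case_prod_beta intro!: continuous_intros)
  have L: "((\<lambda>x. integral (cbox a b) (\<phi> x)) has_derivative
      blinfun_apply (integral (cbox a b) (\<lambda>t. partials (\<phi>1 x t) (\<phi>2 x t)))) (at x within UNIV)"
    by (rule leibniz_rule[OF _ integrable_continuous[OF c] cc]) (use d in \<open>auto simp: partials_eq\<close>)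
  have ci: "continuous_on (cbox a b) (\<lambda>t. \<psi> x t)" if "continuous_on (UNIV \<times> cbox a b) (\<lambda>(x, t). \<psi> x t)" for \<psi> :: "complex \<Rightarrow> 't \<Rightarrow> 'c::topological_space"
  proof -
    have "continuous_on (cbox a b) (\<lambda>t. (x, t))" by (intro continuous_intros)
    from continuous_on_compose2[OF that this] show ?thesis by auto
  qed
  have "blinfun_apply (integral (cbox a b) (\<lambda>t. partials (\<phi>1 x t) (\<phi>2 x t))) v
     = Re v *\<^sub>R integral (cbox a b) (\<phi>1 x) + Im v *\<^sub>R integral (cbox a b) (\<phi>2 x)" for v
  proof -
    have "blinfun_apply (integral (cbox a b) (\<lambda>t. partials (\<phi>1 x t) (\<phi>2 x t))) v
        = integral (cbox a b) (\<lambda>t. Re v *\<^sub>R \<phi>1 x t + Im v *\<^sub>R \<phi>2 x t)"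
      using blinfun_apply_integral[OF integrable_continuous[OF ci[OF cc]], of v] by simp
    also have "\<dots> = Re v *\<^sub>R integral (cbox a b) (\<phi>1 x) + Im v *\<^sub>R integral (cbox a b) (\<phi>2 x)"
      by (simp add: integral_add integrable_cmul integrable_continuous[OF ci[OF c1]] integrable_continuous[OF ci[OF c2]])
    finally show ?thesis .
  qed
  then show "((\<lambda>x. integral (cbox a b) (\<phi> x)) has_derivative
      (\<lambda>v. Re v *\<^sub>R integral (cbox a b) (\<phi>1 x) + Im v *\<^sub>R integral (cbox a b) (\<phi>2 x))) (at x)"
    using L by (auto simp: fun_eq_iff elim!: has_derivative_eq_rhs)
qed

section \<open>Convolution and integration by parts\<close>

lemma lborel_integral_box:
  fixes F :: "complex \<Rightarrow> 'b::euclidean_space"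
  assumes c: "continuous_on UNIV F" and z: "\<And>x. x \<notin> cbox a b \<Longrightarrow> F x = 0"
  shows "integral\<^sup>L lborel F = integral (cbox a b) F"
proof -
  obtain R where R: "\<And>x. x \<in> cbox a b \<Longrightarrow> norm x \<le> R"
    using bounded_cbox[of a b] unfolding bounded_iff by blast
  have "integrable lborel F"
    by (rule continuous_compact_support_integrable[OF c, of R]) (use R z in \<open>meson not_le\<close>)
  then have 1: "(F has_integral integral\<^sup>L lborel F) UNIV"
    by (rule has_integral_integral_lborel)
  have "F integrable_on cbox a b" by (rule integrable_continuous) (use c continuous_on_subset in blast)
  then have 2: "(F has_integral integral (cbox a b) F) (cbox a b)" by (rule integrable_integral)
  have "(F has_integral integral (cbox a b) F) UNIV"
    by (rule has_integral_on_superset[OF 2]) (use z in auto)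
  with 1 show ?thesis by (rule has_integral_unique)
qed

lemma lborel_integral_translate:
  fixes F :: "complex \<Rightarrow> 'b::{banach, second_countable_topology}"
  assumes "F \<in> borel_measurable borel"
  shows "(LINT z|lborel. F (z + c)) = integral\<^sup>L lborel F"
proof -
  have "integral\<^sup>L lborel F = integral\<^sup>L (distr lborel borel ((+) c)) F"
    by (simp add: lborel_distr_plus)
  also have "\<dots> = (LINT z|lborel. F (c + z))"
    by (rule integral_distr) (use assms in auto)
  finally show ?thesis by (simp add: add.commute)
qed

lemma C1_partials_unique:
  assumes "C1 f f1 f2" "(f has_derivative F) (at x)"
  shows "f1 x = F 1" "f2 x = F \<i>"
proof -
  have "F = (\<lambda>v. Re v *\<^sub>R f1 x + Im v *\<^sub>R f2 x)"
    using assms has_derivative_unique unfolding C1_def by blast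
  then show "f1 x = F 1" "f2 x = F \<i>" by auto
qed

lemma C1_support:
  assumes f: "C1 f f1 f2" and z: "\<And>x. \<sigma> < cmod x \<Longrightarrow> f x = 0" and x: "\<sigma> < cmod x"
  shows "f1 x = 0" "f2 x = 0"
proof -
  have "open {x. \<sigma> < cmod x}" by (intro open_Collect_less continuous_intros)
  then have d: "(f has_derivative (\<lambda>v. 0)) (at x)"
    by (rule has_derivative_transform_within_open[OF has_derivative_const[of 0]]) (use z x in auto)
  show "f1 x = 0" "f2 x = 0" using C1_partials_unique[OF f d] by simp_all
qed

definition conv :: "(complex \<Rightarrow> real) \<Rightarrow> (complex \<Rightarrow> 'b::{banach, second_countable_topology}) \<Rightarrow> complex \<Rightarrow> 'b" where
  "conv k u x = (LINT z|lborel. k (x - z) *\<^sub>R u z)"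

text \<open>
  A convolution with a compactly supported kernel is locally an integral over a fixed box, where
  differentiation under the integral sign is available.
\<close>

definition nbox :: "complex \<Rightarrow> real \<Rightarrow> complex set" where
  "nbox x c = cbox (x - Complex c c) (x + Complex c c)"

lemma notin_nbox: "z \<notin> nbox x c \<Longrightarrow> c < cmod (z - x)"
  using abs_Re_le_cmod[of "z - x"] abs_Im_le_cmod[of "z - x"]
  by (auto simp: nbox_def in_cbox_complex_iff)

lemma conv_box:
  fixes u :: "complex \<Rightarrow> 'b::euclidean_space"
  assumes k: "continuous_on UNIV k" "\<And>x. \<sigma> < cmod x \<Longrightarrow> k x = 0" and u: "continuous_on UNIV u"
    and x: "dist x x0 < 1"
  shows "conv k u x = integral (nbox x0 (\<sigma> + 1)) (\<lambda>z. k (x - z) *\<^sub>R u z)"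
  unfolding conv_def nbox_def
proof (rule lborel_integral_box)
  show "continuous_on UNIV (\<lambda>z. k (x - z) *\<^sub>R u z)"
    by (intro continuous_intros u continuous_on_compose2[OF k(1)]) auto
  fix z assume "z \<notin> cbox (x0 - Complex (\<sigma> + 1) (\<sigma> + 1)) (x0 + Complex (\<sigma> + 1) (\<sigma> + 1))"
  then have "\<sigma> + 1 < dist z x0" using notin_nbox unfolding nbox_def dist_norm by blast
  also have "\<dots> \<le> dist z x + dist x x0" by (rule dist_triangle)
  finally have "\<sigma> < cmod (x - z)" using x by (simp add: dist_norm norm_minus_commute)
  then show "k (x - z) *\<^sub>R u z = 0" using k by simp
qed

lemma continuous_on_conv_kernel:
  fixes u :: "complex \<Rightarrow> 'b::real_normed_vector"
  assumes "continuous_on UNIV k" "continuous_on UNIV u"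
  shows "continuous_on S (\<lambda>(x, z). k (x - z) *\<^sub>R u z)"
  unfolding case_prod_beta
  by (intro continuous_intros continuous_on_compose2[OF assms(1)] continuous_on_compose2[OF assms(2)]) auto

lemma conv_continuous:
  fixes u :: "complex \<Rightarrow> 'b::euclidean_space"
  assumes k: "continuous_on UNIV k" "\<And>x. \<sigma> < cmod x \<Longrightarrow> k x = 0" and u: "continuous_on UNIV u"
  shows "continuous_on UNIV (conv k u)"
proof (rule continuous_at_imp_continuous_on, intro ballI)
  fix x0
  have cb: "conv k u x = integral (nbox x0 (\<sigma> + 1)) (\<lambda>z. k (x - z) *\<^sub>R u z)" if "dist x x0 < 1" for x
    by (rule conv_box[OF k u that])
  have "continuous_on UNIV (\<lambda>x. integral (nbox x0 (\<sigma> + 1)) (\<lambda>z. k (x - z) *\<^sub>R u z))"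
    unfolding nbox_def by (rule integral_continuous_on_param) (rule continuous_on_conv_kernel[OF k(1) u])
  then have "continuous_on (ball x0 1) (conv k u)"
    by (subst continuous_on_cong[OF refl, where g="\<lambda>x. integral (nbox x0 (\<sigma> + 1)) (\<lambda>z. k (x - z) *\<^sub>R u z)"])
      (auto simp: dist_commute cb intro: continuous_on_subset)
  then show "isCont (conv k u) x0"
    by (simp add: continuous_on_eq_continuous_at)
qed

lemma conv_C1:
  fixes u :: "complex \<Rightarrow> 'b::euclidean_space"
  assumes k: "C1 k k1 k2" "\<And>x. \<sigma> < cmod x \<Longrightarrow> k x = 0" and u: "continuous_on UNIV u"
  shows "C1 (conv k u) (conv k1 u) (conv k2 u)"
proof -
  note s = C1_support[OF k]
  have kc: "continuous_on UNIV k" "continuous_on UNIV k1" "continuous_on UNIV k2"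
    using k(1) C1_continuous C1_continuous_partials by blast+
  have "(conv k u has_derivative (\<lambda>v. Re v *\<^sub>R conv k1 u x0 + Im v *\<^sub>R conv k2 u x0)) (at x0)" for x0
  proof -
    let ?B = "nbox x0 (\<sigma> + 1)"
    have cb: "conv k' u x = integral ?B (\<lambda>z. k' (x - z) *\<^sub>R u z)"
      if "continuous_on UNIV k'" "\<And>x. \<sigma> < cmod x \<Longrightarrow> k' x = 0" "dist x x0 < 1" for k' x
      by (rule conv_box[OF that(1) _ u that(3)]) (rule that(2))
    have "C1 (\<lambda>x. integral ?B (\<lambda>z. k (x - z) *\<^sub>R u z)) (\<lambda>x. integral ?B (\<lambda>z. k1 (x - z) *\<^sub>R u z))
        (\<lambda>x. integral ?B (\<lambda>z. k2 (x - z) *\<^sub>R u z))"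
      unfolding nbox_def
    proof (rule C1_Leibniz)
      fix x t
      have "(k has_derivative (\<lambda>v. Re v *\<^sub>R k1 (x - t) + Im v *\<^sub>R k2 (x - t))) (at (x - t))"
        using k(1) unfolding C1_def by blast
      moreover have "((\<lambda>x. x - t) has_derivative (\<lambda>v. v)) (at x)"
        by (auto intro!: derivative_eq_intros)
      ultimately have "((\<lambda>x. k (x - t)) has_derivative (\<lambda>v. Re v *\<^sub>R k1 (x - t) + Im v *\<^sub>R k2 (x - t))) (at x)"
        using has_derivative_compose by blast
      from has_derivative_scaleR_left[OF this, of "u t"]
      show "((\<lambda>x. k (x - t) *\<^sub>R u t) has_derivative
          (\<lambda>v. Re v *\<^sub>R k1 (x - t) *\<^sub>R u t + Im v *\<^sub>R k2 (x - t) *\<^sub>R u t)) (at x)"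
        by (simp add: scaleR_left_distrib)
    next
      show "continuous_on (cbox (x0 - Complex (\<sigma> + 1) (\<sigma> + 1)) (x0 + Complex (\<sigma> + 1) (\<sigma> + 1))) (\<lambda>z. k (x - z) *\<^sub>R u z)" for x
        by (intro continuous_intros continuous_on_compose2[OF kc(1)] continuous_on_compose2[OF u]) auto
    qed (rule continuous_on_conv_kernel kc u)+
    then have "((\<lambda>x. integral ?B (\<lambda>z. k (x - z) *\<^sub>R u z)) has_derivative
      (\<lambda>v. Re v *\<^sub>R integral ?B (\<lambda>z. k1 (x0 - z) *\<^sub>R u z) + Im v *\<^sub>R integral ?B (\<lambda>z. k2 (x0 - z) *\<^sub>R u z))) (at x0)"
      unfolding C1_def by blast
    moreover have "integral ?B (\<lambda>z. k1 (x0 - z) *\<^sub>R u z) = conv k1 u x0"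
       "integral ?B (\<lambda>z. k2 (x0 - z) *\<^sub>R u z) = conv k2 u x0"
      using cb[of k1 x0] cb[of k2 x0] kc s by simp_all
    ultimately have "((\<lambda>x. integral ?B (\<lambda>z. k (x - z) *\<^sub>R u z)) has_derivative
      (\<lambda>v. Re v *\<^sub>R conv k1 u x0 + Im v *\<^sub>R conv k2 u x0)) (at x0)" by simp
    then show ?thesis
      by (rule has_derivative_transform_within_open[of _ _ _ _ "ball x0 1"])
         (use cb[of k] kc(1) k(2) in \<open>auto simp: dist_commute\<close>)
  qed
  then show ?thesis
    unfolding C1_def using conv_continuous[OF kc(2) _ u, of \<sigma>] conv_continuous[OF kc(3) _ u, of \<sigma>] s by blast
qed

lemma conv_smooth:
  fixes u :: "complex \<Rightarrow> real"
  assumes "smooth k" "\<And>x. \<sigma> < cmod x \<Longrightarrow> k x = 0" and u: "continuous_on UNIV u"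
  shows "smooth (conv k u)"
proof -
  have "Ck n (conv k u)" for n
    using assms(1,2)
  proof (induction n arbitrary: k)
    case 0
    then show ?case using conv_continuous[OF smooth_continuous _ u, of k \<sigma>] by simp
  next
    case (Suc n)
    note c = smooth_C1[OF Suc.prems(1)]
    note C = conv_C1[OF c Suc.prems(2) u]
    have d: "(conv k u has_derivative (\<lambda>v. Re v *\<^sub>R conv (\<lambda>x. frechet_derivative k (at x) 1) u x
        + Im v *\<^sub>R conv (\<lambda>x. frechet_derivative k (at x) \<i>) u x)) (at x)" for x
      using C unfolding C1_def by blast
    have "Ck n (conv (\<lambda>x. frechet_derivative k (at x) 1) u)" "Ck n (conv (\<lambda>x. frechet_derivative k (at x) \<i>) u)"
      using Suc.IH[OF smooth_partial_smooth[OF Suc.prems(1)]] C1_support[OF c Suc.prems(2)] by auto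
    then show ?case
      by (intro Ck_SucI[OF d]) (auto simp: Basis_complex_def)
  qed
  then show ?thesis by (simp add: smooth_def)
qed

lemma C1_reflect:
  assumes "C1 f f1 f2"
  shows "C1 (\<lambda>x. f (- x)) (\<lambda>x. - f1 (- x)) (\<lambda>x. - f2 (- x))"
proof -
  have "((\<lambda>x. f (- x)) has_derivative (\<lambda>v. Re v *\<^sub>R - f1 (- x) + Im v *\<^sub>R - f2 (- x))) (at x)" for x
  proof -
    have "(f has_derivative (\<lambda>v. Re v *\<^sub>R f1 (- x) + Im v *\<^sub>R f2 (- x))) (at (- x))"
      using assms unfolding C1_def by blast
    from has_derivative_compose[OF has_derivative_minus[OF has_derivative_ident] this]
    show ?thesis by simp
  qed
  moreover have "continuous_on UNIV (\<lambda>x. - f1 (- x))" "continuous_on UNIV (\<lambda>x. - f2 (- x))"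
    using C1_continuous_partials[OF assms, of UNIV]
    by (auto intro!: continuous_intros continuous_on_compose2[of UNIV f1] continuous_on_compose2[of UNIV f2])
  ultimately show ?thesis unfolding C1_def by blast
qed

text \<open>The integral of a compactly supported function does not change under translations, so its
  derivative with respect to the translation vanishes.\<close>

lemma integral_C1_partials_0:
  fixes u :: "complex \<Rightarrow> real"
  assumes u: "C1 u u1 u2" and z: "\<And>x. R < cmod x \<Longrightarrow> u x = 0"
  shows "integral\<^sup>L lborel u1 = 0" "integral\<^sup>L lborel u2 = 0"
proof -
  let ?c = "\<lambda>x. conv (\<lambda>x. u (- x)) (\<lambda>_. 1::real) x"
  have C: "C1 ?c (conv (\<lambda>x. - u1 (- x)) (\<lambda>_. 1)) (conv (\<lambda>x. - u2 (- x)) (\<lambda>_. 1))"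
    by (rule conv_C1[OF C1_reflect[OF u], of R]) (auto intro: z)
  have "u \<in> borel_measurable borel"
    using C1_continuous[OF u, of UNIV] by (rule borel_measurable_continuous_onI)
  then have "?c = (\<lambda>x. integral\<^sup>L lborel u)"
    unfolding conv_def using lborel_integral_translate[of u "- _"] by simp
  then have d: "(?c has_derivative (\<lambda>v. 0)) (at 0)" by simp
  show "integral\<^sup>L lborel u1 = 0" "integral\<^sup>L lborel u2 = 0"
    using C1_partials_unique[OF C d] by (simp_all add: conv_def)
qed

lemma C1_mult:
  fixes f g :: "complex \<Rightarrow> real"
  assumes f: "C1 f f1 f2" and g: "C1 g g1 g2"
  shows "C1 (\<lambda>x. f x * g x) (\<lambda>x. f x * g1 x + f1 x * g x) (\<lambda>x. f x * g2 x + f2 x * g x)"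
proof -
  have "((\<lambda>x. f x * g x) has_derivative (\<lambda>v. Re v *\<^sub>R (f x * g1 x + f1 x * g x) + Im v *\<^sub>R (f x * g2 x + f2 x * g x))) (at x)" for x
  proof -
    have "(f has_derivative (\<lambda>v. Re v *\<^sub>R f1 x + Im v *\<^sub>R f2 x)) (at x)" "(g has_derivative (\<lambda>v. Re v *\<^sub>R g1 x + Im v *\<^sub>R g2 x)) (at x)"
      using f g unfolding C1_def by blast+
    from has_derivative_mult[OF this] show ?thesis
      by (rule has_derivative_eq_rhs) (auto simp: algebra_simps)
  qed
  then show ?thesis
    unfolding C1_def using C1_continuous[OF f] C1_continuous[OF g] C1_continuous_partials[OF f] C1_continuous_partials[OF g]
    by (auto intro!: continuous_intros)
qed

lemma C1_translate:
  assumes "C1 f f1 f2"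
  shows "C1 (\<lambda>x. f (x + c)) (\<lambda>x. f1 (x + c)) (\<lambda>x. f2 (x + c))"
proof -
  have "((\<lambda>x. f (x + c)) has_derivative (\<lambda>v. Re v *\<^sub>R f1 (x + c) + Im v *\<^sub>R f2 (x + c))) (at x)" for x
  proof -
    have "(f has_derivative (\<lambda>v. Re v *\<^sub>R f1 (x + c) + Im v *\<^sub>R f2 (x + c))) (at (x + c))"
      using assms unfolding C1_def by blast
    moreover have "((\<lambda>x. x + c) has_derivative (\<lambda>v. v)) (at x)"
      by (auto intro!: derivative_eq_intros)
    ultimately show ?thesis using has_derivative_compose by blast
  qed
  moreover have "continuous_on UNIV (\<lambda>x. f1 (x + c))" "continuous_on UNIV (\<lambda>x. f2 (x + c))"
    using C1_continuous_partials[OF assms, of UNIV]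
    by (auto intro!: continuous_intros continuous_on_compose2[of UNIV f1] continuous_on_compose2[of UNIV f2])
  ultimately show ?thesis unfolding C1_def by blast
qed

text \<open>
  Jacobians are null Lagrangians. Comparing the two ways to differentiate
  \<open>\<integral> \<partial>\<^sub>1 w (z - x) v z = - \<integral> w (z - x) \<partial>\<^sub>1 v z\<close> in direction \<open>\<i>\<close> at \<open>x = 0\<close> avoids second
  derivatives.
\<close>

lemma integral_jacobian_C1_0:
  fixes w v :: "complex \<Rightarrow> real"
  assumes w: "C1 w w1 w2" and z: "\<And>x. R < cmod x \<Longrightarrow> w x = 0" and v: "C1 v v1 v2"
  shows "(LINT x|lborel. w1 x * v2 x - w2 x * v1 x) = 0"
proof -
  note wc = C1_continuous[OF w] C1_continuous_partials[OF w] and vc = C1_continuous[OF v] C1_continuous_partials[OF v]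
  note wz = C1_support[OF w z]
  let ?B = "nbox 0 R"
  have nb: "R < cmod x" if "x \<notin> ?B" for x using notin_nbox[OF that] by simp
  have bx: "integral\<^sup>L lborel F = integral ?B F" if "continuous_on UNIV F" "\<And>x. R < cmod x \<Longrightarrow> F x = 0" for F :: "complex \<Rightarrow> real"
    unfolding nbox_def by (rule lborel_integral_box[OF that(1)]) (use nb that(2) in \<open>auto simp: nbox_def\<close>)
  define G where "G = (\<lambda>x. integral ?B (\<lambda>z. w1 z * v (z + x)))"
  have G: "C1 G (\<lambda>x. integral ?B (\<lambda>z. w1 z * v1 (z + x))) (\<lambda>x. integral ?B (\<lambda>z. w1 z * v2 (z + x)))"
    unfolding G_def nbox_def
  proof (rule C1_Leibniz)
    show "((\<lambda>x. w1 t * v (t + x)) has_derivative (\<lambda>va. Re va *\<^sub>R (w1 t * v1 (t + x)) + Im va *\<^sub>R (w1 t * v2 (t + x)))) (at x)" for x t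
    proof -
      have "((\<lambda>x. v (x + t)) has_derivative (\<lambda>h. Re h *\<^sub>R v1 (x + t) + Im h *\<^sub>R v2 (x + t))) (at x)"
        using C1_translate[OF v, of t] unfolding C1_def by blast
      from has_derivative_mult_right[OF this, of "w1 t"] show ?thesis
        by (simp add: algebra_simps)
    qed
  qed (auto simp: case_prod_beta intro!: continuous_intros continuous_on_compose2[OF vc(1)] continuous_on_compose2[OF vc(2)] continuous_on_compose2[OF vc(3)]
        continuous_on_compose2[OF wc(2)] wc(2))
  have eq: "G x = - conv (\<lambda>x. w (- x)) v1 x" for x
  proof -
    have "G x = (LINT z|lborel. w1 z * v (z + x))"
      unfolding G_def by (rule bx[symmetric]) (auto simp: wz intro!: continuous_intros wc continuous_on_compose2[OF vc(1)])
    also have "\<dots> = (LINT z|lborel. w1 (z - x) * v z)"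
    proof -
      have "(\<lambda>z. w1 z * v (z + x)) \<in> borel_measurable borel"
        by (intro borel_measurable_continuous_onI continuous_intros wc continuous_on_compose2[OF vc(1)]) auto
      from lborel_integral_translate[OF this, of "- x"] show ?thesis by simp
    qed
    also have "\<dots> = - (LINT z|lborel. w (z - x) * v1 z)"
    proof -
      have C: "C1 (\<lambda>z. w (z + - x) * v z) (\<lambda>z. w (z + - x) * v1 z + w1 (z + - x) * v z) (\<lambda>z. w (z + - x) * v2 z + w2 (z + - x) * v z)"
        by (rule C1_mult[OF C1_translate[OF w] v])
      have far: "R < cmod (z - x)" if "R + cmod x < cmod z" for z
        using that norm_triangle_ineq2[of z x] by simp
      have 0: "(LINT z|lborel. w (z + - x) * v1 z + w1 (z + - x) * v z) = 0"
        by (rule integral_C1_partials_0(1)[OF C, of "R + cmod x"]) (use far z in auto)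
      have "integrable lborel (\<lambda>z. w (z - x) * v1 z)" "integrable lborel (\<lambda>z. w1 (z - x) * v z)"
        by (rule continuous_compact_support_integrable[of _ "R + cmod x"];
            auto intro!: continuous_intros vc continuous_on_compose2[OF wc(1)] continuous_on_compose2[OF wc(2)] simp: z wz far)+
      with 0 show ?thesis by simp
    qed
    finally show ?thesis by (simp add: conv_def)
  qed
  have "C1 (\<lambda>x. conv (\<lambda>x. w (- x)) v1 x) (conv (\<lambda>x. - w1 (- x)) v1) (conv (\<lambda>x. - w2 (- x)) v1)"
    by (rule conv_C1[OF C1_reflect[OF w], of R]) (auto intro: z vc)
  then have "((\<lambda>x. conv (\<lambda>x. w (- x)) v1 x) has_derivative
      (\<lambda>h. Re h *\<^sub>R conv (\<lambda>x. - w1 (- x)) v1 0 + Im h *\<^sub>R conv (\<lambda>x. - w2 (- x)) v1 0)) (at 0)"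
    unfolding C1_def by blast
  from has_derivative_minus[OF this]
  have d: "(G has_derivative (\<lambda>h. - (Re h *\<^sub>R conv (\<lambda>x. - w1 (- x)) v1 0 + Im h *\<^sub>R conv (\<lambda>x. - w2 (- x)) v1 0))) (at 0)"
    by (simp add: eq[abs_def])
  have "integral ?B (\<lambda>z. w1 z * v2 z) = (LINT z|lborel. w2 z * v1 z)"
    using C1_partials_unique(2)[OF G d] by (simp add: conv_def)
  moreover have "integral ?B (\<lambda>z. w1 z * v2 z) = (LINT z|lborel. w1 z * v2 z)"
    by (rule bx[symmetric]) (auto simp: wz intro!: continuous_intros wc vc)
  moreover have "integrable lborel (\<lambda>z. w1 z * v2 z)" "integrable lborel (\<lambda>z. w2 z * v1 z)"
    by (rule continuous_compact_support_integrable[of _ R]; auto simp: wz intro!: continuous_intros wc vc)+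
  ultimately show ?thesis by simp
qed

section \<open>Mollification in L1\<close>

text \<open>
  A measurable function is an almost everywhere limit of continuous functions. Cutting off domain and values
  makes dominated convergence applicable, first to the truncations \<open>h m\<close> of \<open>G\<close>, then to the truncated
  continuous functions \<open>u n\<close> for a fixed \<open>m\<close>.
\<close>

lemma L1_dense_continuous:
  fixes G :: "complex \<Rightarrow> complex"
  assumes G: "integrable lborel G" and e: "0 < e"
  shows "\<exists>u R. continuous_on UNIV u \<and> (\<forall>x. R < cmod x \<longrightarrow> u x = 0) \<and> (LINT x|lborel. norm (G x - u x)) < e"
proof -
  have [measurable]: "G \<in> borel_measurable borel" using G by auto
  have "G \<in> borel_measurable lebesgue"
    using borel_measurable_integrable[OF G] by (rule measurable_completion)
  then have "G measurable_on UNIV"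
    using lebesgue_measurable_imp_measurable_on[of G UNIV] by simp
  then obtain N g where N: "negligible N" and gc: "\<And>n. continuous_on UNIV (g n)"
    and gl: "\<And>x. x \<notin> N \<Longrightarrow> (\<lambda>n. g n x) \<longlonglongrightarrow> G x"
    unfolding measurable_on_def by auto
  have [measurable]: "g n \<in> borel_measurable borel" for n by (rule borel_measurable_continuous_onI[OF gc])
  have "AE x in lebesgue. (\<lambda>n. g n x) \<longlonglongrightarrow> G x"
    unfolding eventually_ae_filter_negligible using N gl by blast
  then have AE: "AE x in lborel. (\<lambda>n. g n x) \<longlonglongrightarrow> G x"
    by (simp add: AE_completion_iff)
  define cl where "cl = (\<lambda>(m::real) (y::complex). (m / max m (norm y)) *\<^sub>R y)"
  define cut where "cut = (\<lambda>m x. max 0 (min 1 (m + 1 - cmod x)))"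
  have cl1: "norm (cl m y) \<le> m" if "0 < m" for m y
    using that by (auto simp: cl_def max_def field_simps)
  have cl2: "norm (cl m y) \<le> norm y" if "0 < m" for m y
    using that by (auto simp: cl_def max_def field_simps)
  have clc: "continuous_on UNIV (cl m)" if "0 < m" for m
    unfolding cl_def by (intro continuous_intros) (use that in \<open>auto simp: max_def\<close>)
  have cutb: "0 \<le> cut m x" "cut m x \<le> 1" for m x by (auto simp: cut_def)
  have cutc: "continuous_on UNIV (cut m)" for m unfolding cut_def by (intro continuous_intros)
  have [measurable]: "cut m \<in> borel_measurable borel" for m by (rule borel_measurable_continuous_onI[OF cutc])
  have clm: "(\<lambda>x. cl m (f x)) \<in> borel_measurable borel" if "0 < m" "f \<in> borel_measurable borel" for m and f :: "complex \<Rightarrow> complex"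
    using measurable_compose[OF that(2) borel_measurable_continuous_onI[OF clc[OF that(1)]]] .
  define h where "h = (\<lambda>m x. cut m x *\<^sub>R cl m (G x))"
  have hb: "norm (h m x) \<le> norm (G x)" if "0 < m" for m x
    using mult_mono[OF cutb(2)[of m x] cl2[OF that, of "G x"]] cutb(1)[of m x] by (simp add: h_def)
  have hm: "h m \<in> borel_measurable borel" if "0 < m" for m
    unfolding h_def using clm[OF that, of G] by measurable
  have "(\<lambda>n. LINT x|lborel. norm (G x - h (real (Suc n)) x)) \<longlonglongrightarrow> integral\<^sup>L lborel (\<lambda>_::complex. 0::real)"
  proof (rule integral_dominated_convergence[where w="\<lambda>x. 2 * norm (G x)"])
    show "AE x in lborel. (\<lambda>n. norm (G x - h (real (Suc n)) x)) \<longlonglongrightarrow> 0"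
    proof (rule AE_I2)
      fix x
      have "\<forall>\<^sub>F n in sequentially. norm (G x) + cmod x \<le> real n"
        by (meson eventually_sequentiallyI le_trans of_nat_le_iff real_arch_simple order_trans of_nat_mono)
      then have "\<forall>\<^sub>F n in sequentially. 0 = norm (G x - h (real (Suc n)) x)"
      proof eventually_elim
        case (elim n)
        have "cmod x \<le> real n" using elim norm_ge_zero[of "G x"] by linarith
        then have "cut (real (Suc n)) x = 1" by (simp add: cut_def)
        moreover have "cmod (G x) \<le> real n" using elim norm_ge_zero[of x] by linarith
        then have "cl (real (Suc n)) (G x) = G x" by (simp add: cl_def max_def)
        ultimately show ?case by (simp add: h_def)
      qed
      then show "(\<lambda>n. norm (G x - h (real (Suc n)) x)) \<longlonglongrightarrow> 0"
        by (rule Lim_transform_eventually[OF tendsto_const])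
    qed
    show "AE x in lborel. norm (norm (G x - h (real (Suc n)) x)) \<le> 2 * norm (G x)" for n
    proof (rule AE_I2)
      fix x
      show "norm (norm (G x - h (real (Suc n)) x)) \<le> 2 * norm (G x)"
        using norm_triangle_ineq4[of "G x" "h (real (Suc n)) x"] hb[of "real (Suc n)" x] by simp
    qed
    show "integrable lborel (\<lambda>x. 2 * norm (G x))" using G by simp
    show "(\<lambda>x. norm (G x - h (real (Suc n)) x)) \<in> borel_measurable lborel" for n
      using hm[of "real (Suc n)"] by simp
  qed simp
  then have "(\<lambda>n. LINT x|lborel. norm (G x - h (real (Suc n)) x)) \<longlonglongrightarrow> 0" by simp
  from order_tendstoD(2)[OF this, of "e/2"] e
  obtain n0 where n0: "(LINT x|lborel. norm (G x - h (real (Suc n0)) x)) < e/2"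
    by (auto simp: eventually_sequentially)
  define m where "m = real (Suc n0)"
  have m: "0 < m" by (simp add: m_def)
  define u where "u = (\<lambda>n x. cut m x *\<^sub>R cl m (g n x))"
  have uc: "continuous_on UNIV (u n)" for n
    unfolding u_def by (intro continuous_intros cutc continuous_on_compose2[OF clc[OF m]] gc) auto
  have u0: "u n x = 0" if "m + 1 < cmod x" for n x using that by (simp add: u_def cut_def)
  have h0: "h m x = 0" if "m + 1 < cmod x" for x using that by (simp add: h_def cut_def)
  have ub: "norm (u n x) \<le> m" for n x
    using mult_mono[OF cutb(2)[of m x] cl1[OF m, of "g n x"]] cutb(1)[of m x] m by (simp add: u_def)
  have hb': "norm (h m x) \<le> m" for x
    using mult_mono[OF cutb(2)[of m x] cl1[OF m, of "G x"]] cutb(1)[of m x] m by (simp add: h_def)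
  have um: "u n \<in> borel_measurable borel" for n by (rule borel_measurable_continuous_onI[OF uc])
  have "(\<lambda>n. LINT x|lborel. norm (h m x - u n x)) \<longlonglongrightarrow> integral\<^sup>L lborel (\<lambda>_::complex. 0::real)"
  proof (rule integral_dominated_convergence[where w="\<lambda>x. indicator (cball 0 (m + 1)) x * (2 * m)"])
    show "AE x in lborel. (\<lambda>n. norm (h m x - u n x)) \<longlonglongrightarrow> 0"
      using AE
    proof eventually_elim
      case (elim x)
      have "(\<lambda>n. cl m (g n x)) \<longlonglongrightarrow> cl m (G x)"
        using clc[OF m] by (intro isCont_tendsto_compose[OF _ elim]) (simp add: continuous_on_eq_continuous_at)
      then have "(\<lambda>n. u n x) \<longlonglongrightarrow> h m x" unfolding u_def h_def by (intro tendsto_intros)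
      then have "(\<lambda>n. norm (h m x - u n x)) \<longlonglongrightarrow> norm (h m x - h m x)" by (intro tendsto_intros)
      then show ?case by simp
    qed
    show "AE x in lborel. norm (norm (h m x - u n x)) \<le> indicator (cball 0 (m + 1)) x * (2 * m)" for n
    proof (rule AE_I2)
      fix x
      show "norm (norm (h m x - u n x)) \<le> indicator (cball 0 (m + 1)) x * (2 * m)"
        using norm_triangle_ineq4[of "h m x" "u n x"] ub[of n x] hb'[of x] u0[of x n] h0[of x]
        by (auto simp: indicator_def)
    qed
    show "integrable lborel (\<lambda>x::complex. indicator (cball 0 (m + 1)) x * (2 * m))"
      using emeasure_lborel_cball_finite[of "0::complex" "m + 1"] by (simp add: integrable_indicator_iff)
    show "(\<lambda>x. norm (h m x - u n x)) \<in> borel_measurable lborel" for n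
      using hm[OF m] um by simp
  qed simp
  then have "(\<lambda>n. LINT x|lborel. norm (h m x - u n x)) \<longlonglongrightarrow> 0" by simp
  from order_tendstoD(2)[OF this, of "e/2"] e
  obtain n1 where n1: "(LINT x|lborel. norm (h m x - u n1 x)) < e/2"
    by (auto simp: eventually_sequentially)
  have hi: "integrable lborel (h m)"
    by (rule Bochner_Integration.integrable_bound[OF G]) (use hm[OF m] hb[OF m] in auto)
  have ui: "integrable lborel (u n1)"
    by (rule continuous_compact_support_integrable[OF uc, of "m+1"]) (rule u0)
  have "(LINT x|lborel. norm (G x - u n1 x)) \<le> (LINT x|lborel. norm (G x - h m x) + norm (h m x - u n1 x))"
  proof (rule integral_mono)
    show "norm (G x - u n1 x) \<le> norm (G x - h m x) + norm (h m x - u n1 x)" for x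
      using norm_triangle_ineq[of "G x - h m x" "h m x - u n1 x"] by simp
  qed (use G hi ui in simp_all)
  also have "\<dots> = (LINT x|lborel. norm (G x - h m x)) + (LINT x|lborel. norm (h m x - u n1 x))"
    by (rule Bochner_Integration.integral_add) (use G hi ui in simp_all)
  also have "\<dots> < e" using n0 n1 by (simp add: m_def)
  finally show ?thesis using uc[of n1] u0[of _ n1] by blast
qed

lemma mollifierD:
  assumes "mollifier \<sigma> k"
  shows "smooth k" "0 \<le> k x" "\<sigma> < cmod x \<Longrightarrow> k x = 0" "k (- x) = k x" "continuous_on S k"
    "k \<in> borel_measurable borel" "integrable lborel k" "integral\<^sup>L lborel k = 1"
  using assms smooth_continuous[of k] unfolding mollifier_def has_bochner_integral_iff
  by (auto intro: borel_measurable_continuous_onI)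

lemma mollifier_translate:
  assumes k: "mollifier \<sigma> k"
  shows "(LINT z|lborel. k (x - z)) = 1" "integrable lborel (\<lambda>z. k (x - z))"
    "(\<integral>\<^sup>+ z. ennreal (k (x - z)) \<partial>lborel) = 1" "(\<integral>\<^sup>+ z. ennreal (k (z - x)) \<partial>lborel) = 1"
proof -
  have e: "k (x - z) = k (z - x)" for z using mollifierD(4)[OF k, of "z - x"] by simp
  show 1: "(LINT z|lborel. k (x - z)) = 1"
    using lborel_integral_translate[OF mollifierD(6)[OF k], of "- x"] mollifierD(8)[OF k] by (simp add: e)
  show 2: "integrable lborel (\<lambda>z. k (x - z))"
    using 1 not_integrable_integral_eq by fastforce
  show 3: "(\<integral>\<^sup>+ z. ennreal (k (x - z)) \<partial>lborel) = 1"
    using nn_integral_eq_integral[OF 2] 1 mollifierD(2)[OF k] by simp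
  then show "(\<integral>\<^sup>+ z. ennreal (k (z - x)) \<partial>lborel) = 1" by (simp add: e)
qed

lemma mollifier_bounded:
  assumes k: "mollifier \<sigma> k"
  shows "\<exists>B. \<forall>x. k x \<le> B"
proof -
  have "compact (k ` cball 0 \<sigma>)" by (intro compact_continuous_image mollifierD(5)[OF k]) auto
  from compact_imp_bounded[OF this]
  obtain B where "\<forall>y \<in> k ` cball 0 \<sigma>. norm y \<le> B"
    unfolding bounded_iff by blast
  then have B: "\<And>x. x \<in> cball 0 \<sigma> \<Longrightarrow> norm (k x) \<le> B"
    by blast
  have "k x \<le> max 0 B" for x
  proof (cases "\<sigma> < cmod x")
    case False
    then have "norm (k x) \<le> B" using B by simp
    then show ?thesis by auto
  qed (simp add: mollifierD(3)[OF k])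
  then show ?thesis by blast
qed

lemma conv_integrable:
  fixes H :: "complex \<Rightarrow> complex"
  assumes k: "mollifier \<sigma> k" and H: "integrable lborel H"
  shows "integrable lborel (\<lambda>z. k (x - z) *\<^sub>R H z)"
proof -
  obtain B where B: "\<And>x. k x \<le> B" using mollifier_bounded[OF k] by blast
  have [measurable]: "k \<in> borel_measurable borel" "H \<in> borel_measurable borel" using mollifierD[OF k] H by auto
  show ?thesis
  proof (rule Bochner_Integration.integrable_bound[of _ "\<lambda>z. B * norm (H z)"])
    show "AE z in lborel. norm (k (x - z) *\<^sub>R H z) \<le> norm (B * norm (H z))"
    proof (rule AE_I2)
      fix z
      have "k (x - z) * norm (H z) \<le> B * norm (H z)" by (rule mult_right_mono[OF B]) simp
      moreover have "norm (k (x - z) *\<^sub>R H z) = k (x - z) * norm (H z)"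
        using mollifierD(2)[OF k, of "x - z"] by simp
      ultimately show "norm (k (x - z) *\<^sub>R H z) \<le> norm (B * norm (H z))"
        by (metis abs_ge_self order_trans real_norm_def)
    qed
  qed (use H in auto)
qed

lemma conv_L1_bound:
  fixes H :: "complex \<Rightarrow> complex"
  assumes k: "mollifier \<sigma> k" and H: "integrable lborel H"
  shows "(\<integral>\<^sup>+ x. norm (conv k H x) \<partial>lborel) \<le> (\<integral>\<^sup>+ x. norm (H x) \<partial>lborel)"
proof -
  have [measurable]: "k \<in> borel_measurable borel" "H \<in> borel_measurable borel" using mollifierD[OF k] H by auto
  have "(\<integral>\<^sup>+ x. norm (conv k H x) \<partial>lborel) \<le> (\<integral>\<^sup>+ x. \<integral>\<^sup>+ z. ennreal (k (x - z)) * norm (H z) \<partial>lborel \<partial>lborel)"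
  proof (rule nn_integral_mono)
    fix x
    have "ennreal (norm (conv k H x)) \<le> (\<integral>\<^sup>+ z. ennreal (norm (k (x - z) *\<^sub>R H z)) \<partial>lborel)"
      unfolding conv_def by (rule integral_norm_bound_ennreal[OF conv_integrable[OF k H]])
    also have "\<dots> = (\<integral>\<^sup>+ z. ennreal (k (x - z)) * norm (H z) \<partial>lborel)"
      using mollifierD(2)[OF k] by (simp add: ennreal_mult')
    finally show "ennreal (norm (conv k H x)) \<le> (\<integral>\<^sup>+ z. ennreal (k (x - z)) * norm (H z) \<partial>lborel)" .
  qed
  also have "\<dots> = (\<integral>\<^sup>+ z. \<integral>\<^sup>+ x. ennreal (k (x - z)) * norm (H z) \<partial>lborel \<partial>lborel)"
    by (rule lborel_pair.Fubini') measurable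
  also have "\<dots> = (\<integral>\<^sup>+ z. norm (H z) \<partial>lborel)"
    by (simp add: nn_integral_multc mollifier_translate(4)[OF k])
  finally show ?thesis .
qed

lemma conv_measurable:
  fixes H :: "complex \<Rightarrow> complex"
  assumes k: "mollifier \<sigma> k" and [measurable]: "H \<in> borel_measurable borel"
  shows "conv k H \<in> borel_measurable borel"
proof -
  have [measurable]: "k \<in> borel_measurable borel" using mollifierD[OF k] by auto
  show ?thesis unfolding conv_def[abs_def] by measurable
qed

lemma conv_diff_bound:
  fixes u :: "complex \<Rightarrow> 'b::euclidean_space"
  assumes k: "mollifier \<sigma> k" and u: "continuous_on UNIV u"
    and M: "\<And>z. dist z x \<le> \<sigma> \<Longrightarrow> norm (u z - u x) \<le> M"
  shows "norm (conv k u x - u x) \<le> M"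
proof -
  have kc: "continuous_on UNIV (\<lambda>z. k (x - z))"
    by (intro continuous_on_compose2[OF mollifierD(5)[OF k, of UNIV]] continuous_intros) auto
  have far: "k (x - z) = 0" if "cmod x + \<sigma> < cmod z" for z
    using that norm_triangle_ineq2[of z x] by (intro mollifierD(3)[OF k]) (simp add: norm_minus_commute)
  have i1: "integrable lborel (\<lambda>z. k (x - z) *\<^sub>R u z)"
    by (rule continuous_compact_support_integrable[of _ "cmod x + \<sigma>"]) (auto intro!: continuous_intros kc u simp: far)
  have i2: "integrable lborel (\<lambda>z. k (x - z) *\<^sub>R u x)" using mollifier_translate(2)[OF k] by simp
  have "conv k u x - u x = (LINT z|lborel. k (x - z) *\<^sub>R u z - k (x - z) *\<^sub>R u x)"
    using i1 i2 mollifier_translate(1,2)[OF k, of x] by (simp add: conv_def)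
  also have "norm \<dots> \<le> (LINT z|lborel. k (x - z) * M)"
  proof (rule order_trans[OF integral_norm_bound integral_mono])
    fix z
    show "norm (k (x - z) *\<^sub>R u z - k (x - z) *\<^sub>R u x) \<le> k (x - z) * M"
    proof (cases "\<sigma> < cmod (x - z)")
      case False
      then have "norm (u z - u x) \<le> M" by (intro M) (simp add: dist_norm norm_minus_commute)
      then show ?thesis using mollifierD(2)[OF k, of "x - z"]
        by (simp flip: scaleR_diff_right add: mult_left_mono)
    qed (simp add: mollifierD(3)[OF k])
  qed (use i1 i2 mollifier_translate(2)[OF k] in auto)
  also have "\<dots> = M" using mollifier_translate(1)[OF k] by simp
  finally show ?thesis .
qed

text \<open>
  Convolution with a mollifier is a contraction of L1, so it suffices to consider a dense set of functions,
  and uniform continuity settles the case of a continuous function with compact support.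
\<close>

lemma mollify_L1_tendsto:
  fixes G :: "complex \<Rightarrow> complex"
  assumes G: "integrable lborel G" and e: "0 < e"
  shows "\<exists>\<delta>>0. \<forall>\<sigma> k. 0 < \<sigma> \<longrightarrow> \<sigma> < \<delta> \<longrightarrow> mollifier \<sigma> k \<longrightarrow> (\<integral>\<^sup>+ x. norm (conv k G x - G x) \<partial>lborel) < ennreal e"
proof -
  obtain u R where u: "continuous_on UNIV u" and R: "\<And>x. R < cmod x \<Longrightarrow> u x = 0"
    and uG: "(LINT x|lborel. norm (G x - u x)) < e / 4"
    using L1_dense_continuous[OF G, of "e/4"] e by auto
  have ui: "integrable lborel u" by (rule continuous_compact_support_integrable[OF u R])
  have [measurable]: "G \<in> borel_measurable borel" "u \<in> borel_measurable borel" using G ui by auto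
  define V where "V = measure lborel (cball (0::complex) (R + 1)) + 1"
  have V: "0 < V" unfolding V_def by (simp add: add_nonneg_pos)
  have uu: "uniformly_continuous_on (cball 0 (R + 3)) u"
    by (rule compact_uniformly_continuous) (use u continuous_on_subset in auto)
  obtain d where d: "0 < d" and dd: "\<And>x z. x \<in> cball 0 (R+3) \<Longrightarrow> z \<in> cball 0 (R+3) \<Longrightarrow> dist z x < d \<Longrightarrow> norm (u z - u x) < e / (4 * V)"
    using uu e V unfolding uniformly_continuous_on_def dist_norm by (metis divide_pos_pos mult_pos_pos zero_less_numeral)
  show ?thesis
  proof (intro exI conjI allI impI)
    show "0 < min d 1" using d by simp
    fix \<sigma> k assume \<sigma>: "0 < \<sigma>" "\<sigma> < min d 1" and k: "mollifier \<sigma> k"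
    have [measurable]: "conv k G \<in> borel_measurable borel" "conv k u \<in> borel_measurable borel" "conv k (\<lambda>x. G x - u x) \<in> borel_measurable borel"
      by (rule conv_measurable[OF k]; measurable)+
    have split: "conv k G x - G x = conv k (\<lambda>x. G x - u x) x + (conv k u x - u x) + (u x - G x)" for x
      using conv_integrable[OF k G, of x] conv_integrable[OF k ui, of x]
      by (simp add: conv_def scaleR_diff_right)
    have mid: "norm (conv k u x - u x) \<le> e / (4 * V) * indicator (cball 0 (R + 1)) x" for x
    proof (cases "x \<in> cball 0 (R+1)")
      case True
      have "norm (conv k u x - u x) \<le> e / (4 * V)"
      proof (rule conv_diff_bound[OF k u])
        fix z assume z: "dist z x \<le> \<sigma>"
        have "cmod z \<le> cmod x + dist z x" by (metis add.commute dist_norm norm_triangle_sub)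
        then show "norm (u z - u x) \<le> e / (4 * V)"
          using z True \<sigma> by (intro less_imp_le dd) auto
      qed
      then show ?thesis using True by simp
    next
      case False
      have "norm (conv k u x - u x) \<le> 0"
      proof (rule conv_diff_bound[OF k u])
        fix z assume z: "dist z x \<le> \<sigma>"
        have "cmod x \<le> cmod z + dist z x" by (metis dist_norm norm_triangle_sub dist_commute)
        then have "R < cmod z" "R < cmod x" using z False \<sigma> by auto
        then show "norm (u z - u x) \<le> 0" using R by simp
      qed
      then show ?thesis using False by simp
    qed
    have "(\<integral>\<^sup>+ x. norm (conv k G x - G x) \<partial>lborel)
      \<le> (\<integral>\<^sup>+ x. ennreal (norm (conv k (\<lambda>x. G x - u x) x)) + ennreal (e / (4 * V)) * indicator (cball 0 (R + 1)) x + ennreal (norm (G x - u x)) \<partial>lborel)"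
    proof (rule nn_integral_mono)
      fix x
      have "norm (conv k G x - G x) \<le> norm (conv k (\<lambda>x. G x - u x) x) + norm (conv k u x - u x) + norm (G x - u x)"
        unfolding split by (metis (no_types, lifting) norm_minus_commute norm_triangle_mono norm_triangle_ineq order_refl)
      also have "\<dots> \<le> norm (conv k (\<lambda>x. G x - u x) x) + e / (4 * V) * indicator (cball 0 (R + 1)) x + norm (G x - u x)"
        using mid[of x] by simp
      finally show "ennreal (norm (conv k G x - G x)) \<le> ennreal (norm (conv k (\<lambda>x. G x - u x) x)) + ennreal (e / (4 * V)) * indicator (cball 0 (R + 1)) x + ennreal (norm (G x - u x))"
        using e V by (cases "x \<in> cball 0 (R+1)") (simp_all flip: ennreal_plus add: ennreal_leI)
    qed
    also have "\<dots> = (\<integral>\<^sup>+ x. norm (conv k (\<lambda>x. G x - u x) x) \<partial>lborel) + ennreal (e / (4 * V)) * emeasure lborel (cball (0::complex) (R + 1)) + (\<integral>\<^sup>+ x. norm (G x - u x) \<partial>lborel)"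
    proof -
      have 1: "(\<lambda>x. ennreal (norm (conv k (\<lambda>x. G x - u x) x))) \<in> borel_measurable lborel"
        and 2: "(\<lambda>x. ennreal (e / (4 * V)) * indicator (cball 0 (R + 1)) x) \<in> borel_measurable (lborel :: complex measure)"
        and 3: "(\<lambda>x. ennreal (norm (G x - u x))) \<in> borel_measurable lborel"
        by (measurable, simp, measurable)
      show ?thesis
        by (simp add: nn_integral_add[OF borel_measurable_add[OF 1 2] 3] nn_integral_add[OF 1 2] nn_integral_cmult_indicator)
    qed
    also have "\<dots> \<le> (\<integral>\<^sup>+ x. norm (G x - u x) \<partial>lborel) + ennreal (e / (4 * V)) * emeasure lborel (cball (0::complex) (R + 1)) + (\<integral>\<^sup>+ x. norm (G x - u x) \<partial>lborel)"
      using conv_L1_bound[OF k, of "\<lambda>x. G x - u x"] G ui by (intro add_mono) auto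
    also have "\<dots> = ennreal ((LINT x|lborel. norm (G x - u x)) + e / (4 * V) * measure lborel (cball (0::complex) (R + 1)) + (LINT x|lborel. norm (G x - u x)))"
    proof -
      define I where "I = (LINT x|lborel. norm (G x - u x))"
      define W where "W = measure lborel (cball (0::complex) (R + 1))"
      have I: "(\<integral>\<^sup>+ x. norm (G x - u x) \<partial>lborel) = ennreal I" "0 \<le> I"
        unfolding I_def using G ui by (auto intro!: nn_integral_eq_integral)
      have W: "emeasure lborel (cball (0::complex) (R + 1)) = ennreal W" "0 \<le> W"
        unfolding W_def using emeasure_lborel_cball_finite[of "0::complex" "R+1"]
        by (auto intro!: emeasure_eq_ennreal_measure)
      have c: "0 \<le> e / (4 * V)" using e V by simp
      have "ennreal (I + e / (4 * V) * W + I) = ennreal I + ennreal (e / (4 * V)) * ennreal W + ennreal I"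
        by (simp only: ennreal_plus[OF add_nonneg_nonneg[OF I(2) mult_nonneg_nonneg[OF c W(2)]] I(2)]
            ennreal_plus[OF I(2) mult_nonneg_nonneg[OF c W(2)]] ennreal_mult'[OF c])
      then show ?thesis unfolding I(1) W(1) I_def[symmetric] W_def[symmetric] by simp
    qed
    also have "\<dots> < ennreal e"
    proof (rule ennreal_lessI[OF e])
      have "e / (4 * V) * measure lborel (cball (0::complex) (R + 1)) \<le> e / (4 * V) * V"
        using e V by (intro mult_left_mono) (auto simp: V_def)
      also have "\<dots> = e / 4" using V by simp
      finally show "(LINT x|lborel. norm (G x - u x)) + e / (4 * V) * measure lborel (cball (0::complex) (R + 1)) + (LINT x|lborel. norm (G x - u x)) < e"
        using uG e by linarith
    qed
    finally show "(\<integral>\<^sup>+ x. norm (conv k G x - G x) \<partial>lborel) < ennreal e" .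
  qed
qed

section \<open>Mollification of weak derivatives\<close>

text \<open>
  Convolutions are estimated by Fubini's theorem for Borel functions, whereas local integrability refers to
  Lebesgue measurable functions.
\<close>

lemma integrable_lebesgue_borel_version:
  fixes g :: "complex \<Rightarrow> complex"
  assumes g: "integrable lebesgue g"
  shows "\<exists>h. integrable lborel h \<and> (AE x in lborel. g x = h x)"
proof -
  have m: "(\<lambda>x. Re (g x)) \<in> borel_measurable lebesgue" "(\<lambda>x. Im (g x)) \<in> borel_measurable lebesgue"
    using borel_measurable_integrable[OF g] by measurable
  obtain a where a: "a \<in> borel_measurable lborel" "AE x in lborel. Re (g x) = a x"
    using completion_ex_borel_measurable_real[OF m(1)] by blast
  obtain b where b: "b \<in> borel_measurable lborel" "AE x in lborel. Im (g x) = b x"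
    using completion_ex_borel_measurable_real[OF m(2)] by blast
  define h where "h = (\<lambda>x. Complex (a x) (b x))"
  have hm: "h \<in> borel_measurable lborel"
    unfolding h_def Complex_eq using a(1) b(1) by measurable
  have ae: "AE x in lborel. g x = h x"
    using a(2) b(2) by eventually_elim (simp add: h_def complex_eq_iff)
  have "integrable lebesgue h"
    by (rule integrable_cong_AE_imp[OF g measurable_completion[OF hm]])
       (use AE_completion[OF ae] in \<open>auto elim!: eventually_mono\<close>)
  then have "integrable lborel h" using integrable_completion[OF hm] by simp
  with ae show ?thesis by blast
qed

lemma mollifier_test_function:
  assumes k: "mollifier \<sigma> k" and x: "cball x \<sigma> \<subseteq> \<Omega>"
  shows "(\<lambda>z. k (x - z)) \<in> test_functions \<Omega>"
proof -
  have "Ck n (\<lambda>z. k (x - z))" for n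
    using Ck_affine[of n k "-1" x] mollifierD(1)[OF k] by (simp add: smooth_def)
  moreover have "{z. k (x - z) \<noteq> 0} \<subseteq> cball x \<sigma>"
    using mollifierD(3)[OF k] by (auto simp: dist_norm) (meson not_le)
  then have c: "closure {z. k (x - z) \<noteq> 0} \<subseteq> cball x \<sigma>"
    by (rule closure_minimal) simp
  then have "compact (closure {z. k (x - z) \<noteq> 0})"
    by (meson bounded_cball bounded_subset closed_closure compact_eq_bounded_closed)
  ultimately show ?thesis using c x by (auto simp: test_functions_def)
qed

text \<open>
  The translates of the reflected mollifier are test functions for the weak derivative.
\<close>

lemma conv_weak_partial:
  fixes f d :: "complex \<Rightarrow> complex"
  assumes f: "continuous_on UNIV f" and b: "b \<in> {1, \<i>}"
    and w: "weak_partial \<Omega> b f d" and k: "mollifier \<sigma> k" and x: "cball x \<sigma> \<subseteq> \<Omega>"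
  shows "conv (\<lambda>y. frechet_derivative k (at y) b) f x = (LINT z:\<Omega>|lebesgue. k (x - z) *\<^sub>R d z)"
proof -
  let ?kb = "\<lambda>y. frechet_derivative k (at y) b"
  have kb: "smooth ?kb" using smooth_partial_smooth[OF mollifierD(1)[OF k] b] .
  have kbc: "continuous_on UNIV (\<lambda>z. ?kb (x - z))"
    by (intro continuous_on_compose2[OF smooth_continuous[OF kb, of UNIV]] continuous_intros) auto
  have C: "C1 k (\<lambda>x. frechet_derivative k (at x) 1) (\<lambda>x. frechet_derivative k (at x) \<i>)"
    by (rule smooth_C1[OF mollifierD(1)[OF k]])
  have kb0: "?kb y = 0" if "\<sigma> < cmod y" for y
    using C1_support[OF C, of \<sigma> y] mollifierD(3)[OF k] that b by auto
  have fd: "frechet_derivative (\<lambda>z. k (x - z)) (at z) b = - ?kb (x - z)" for z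
  proof -
    have 1: "(k has_derivative frechet_derivative k (at (x - z))) (at (x - z))"
      using mollifierD(1)[OF k] Ck_Suc_deriv unfolding smooth_def by blast
    have 2: "((\<lambda>z. x - z) has_derivative (\<lambda>v. - v)) (at z)" by (auto intro!: derivative_eq_intros)
    have "((\<lambda>z. k (x - z)) has_derivative (\<lambda>v. frechet_derivative k (at (x - z)) (- v))) (at z)"
      using has_derivative_compose[OF 2 1] .
    from frechet_derivative_at[OF this] have "frechet_derivative (\<lambda>z. k (x - z)) (at z) b = frechet_derivative k (at (x - z)) (- b)"
      by metis
    also have "\<dots> = - ?kb (x - z)"
      using linear_neg[OF has_derivative_linear[OF 1]] by simp
    finally show ?thesis .
  qed
  have "(LINT z:\<Omega>|lebesgue. - (?kb (x - z) *\<^sub>R f z)) = - (LINT z:\<Omega>|lebesgue. k (x - z) *\<^sub>R d z)"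
    using w mollifier_test_function[OF k x] unfolding weak_partial_def fd by (fastforce simp: fd)
  then have 1: "(LINT z|lebesgue. (indicator \<Omega> z * ?kb (x - z)) *\<^sub>R f z) = (LINT z:\<Omega>|lebesgue. k (x - z) *\<^sub>R d z)"
    by (simp add: set_lebesgue_integral_def)
  have 2: "(\<lambda>z. (indicator \<Omega> z * ?kb (x - z)) *\<^sub>R f z) = (\<lambda>z. ?kb (x - z) *\<^sub>R f z)"
  proof
    fix z
    have "z \<in> \<Omega> \<or> ?kb (x - z) = 0"
    proof (cases "z \<in> cball x \<sigma>")
      case False
      then show ?thesis using kb0[of "x - z"] by (simp add: dist_norm)
    qed (use x in blast)
    then show "(indicator \<Omega> z * ?kb (x - z)) *\<^sub>R f z = ?kb (x - z) *\<^sub>R f z" by auto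
  qed
  have "(LINT z|lebesgue. ?kb (x - z) *\<^sub>R f z) = (LINT z:\<Omega>|lebesgue. k (x - z) *\<^sub>R d z)"
    using 1 unfolding 2 .
  moreover have "(\<lambda>z. ?kb (x - z) *\<^sub>R f z) \<in> borel_measurable lborel"
    using borel_measurable_continuous_onI[OF continuous_on_scaleR[OF kbc f]] by simp
  ultimately show ?thesis by (simp add: conv_def integral_completion)
qed

lemma weak_partial_mollify_L1:
  fixes f d :: "complex \<Rightarrow> complex"
  assumes \<Omega>: "open \<Omega>" and f: "continuous_on UNIV f" and b: "b \<in> {1, \<i>}" and d: "d \<in> L1_loc \<Omega>"
    and w: "weak_partial \<Omega> b f d" and U: "compact U" "U \<subseteq> \<Omega>" and e: "0 < e"
  shows "\<exists>\<delta>>0. \<forall>\<sigma> k. 0 < \<sigma> \<longrightarrow> \<sigma> < \<delta> \<longrightarrow> mollifier \<sigma> k \<longrightarrow>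
    (LINT x:U|lebesgue. norm (conv (\<lambda>y. frechet_derivative k (at y) b) f x - d x)) < e"
proof -
  obtain r where r: "0 < r" "(\<Union>x\<in>U. cball x r) \<subseteq> \<Omega>"
    using compact_subset_open_imp_cball_epsilon_subset[OF U(1) \<Omega> U(2)] by blast
  define W where "W = (\<Union>x\<in>U. cball x r)"
  have "compact W"
    using compact_sums'[OF U(1) compact_cball[of 0 r]] unfolding W_def
    by (rule back_subst[of compact]) (force simp: dist_norm norm_minus_commute intro: exI[of _ "_ - _"])
  define d0 where "d0 = (\<lambda>x. indicator W x *\<^sub>R d x)"
  have d0: "integrable lebesgue d0"
    using d \<open>compact W\<close> r(2) unfolding L1_loc_def W_def d0_def set_integrable_def by auto
  obtain h where h: "integrable lborel h" and hae: "AE x in lborel. d0 x = h x"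
    using integrable_lebesgue_borel_version[OF d0] by blast
  note hae' = AE_completion[OF hae]
  have hm [measurable]: "h \<in> borel_measurable borel" using h by auto
  obtain \<delta> where \<delta>: "0 < \<delta>" and conv: "\<And>\<sigma> k. 0 < \<sigma> \<Longrightarrow> \<sigma> < \<delta> \<Longrightarrow> mollifier \<sigma> k \<Longrightarrow> (\<integral>\<^sup>+ x. norm (conv k h x - h x) \<partial>lborel) < ennreal e"
    using mollify_L1_tendsto[OF h e] by blast
  show ?thesis
  proof (intro exI conjI allI impI)
    show "0 < min \<delta> r" using \<delta> r by simp
    fix \<sigma> k assume \<sigma>: "0 < \<sigma>" "\<sigma> < min \<delta> r" and k: "mollifier \<sigma> k"
    let ?kf = "conv (\<lambda>y. frechet_derivative k (at y) b) f"
    have eq: "?kf x = conv k h x" if x: "x \<in> U" for x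
    proof -
      have sub: "cball x \<sigma> \<subseteq> W" using x \<sigma> by (force simp: W_def)
      have "?kf x = (LINT z:\<Omega>|lebesgue. k (x - z) *\<^sub>R d z)"
        by (rule conv_weak_partial[OF f b w k]) (use sub r(2) in \<open>auto simp: W_def\<close>)
      also have "\<dots> = (LINT z|lebesgue. k (x - z) *\<^sub>R d0 z)"
        unfolding set_lebesgue_integral_def
      proof (rule Bochner_Integration.integral_cong[OF refl])
        fix z
        have "k (x - z) = 0" if "z \<notin> W"
        proof (rule mollifierD(3)[OF k])
          have "z \<notin> cball x \<sigma>" using that sub by blast
          then show "\<sigma> < cmod (x - z)" by (simp add: dist_norm)
        qed
        moreover have "W \<subseteq> \<Omega>" using r(2) by (simp add: W_def)
        ultimately show "indicator \<Omega> z *\<^sub>R k (x - z) *\<^sub>R d z = k (x - z) *\<^sub>R d0 z"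
          by (cases "z \<in> W") (auto simp: d0_def indicator_def)
      qed
      also have "\<dots> = (LINT z|lebesgue. k (x - z) *\<^sub>R h z)"
      proof (rule integral_cong_AE)
        have "(\<lambda>z. k (x - z)) \<in> borel_measurable lborel" using mollifier_translate(2)[OF k] by auto
        then have km: "(\<lambda>z. k (x - z)) \<in> borel_measurable lebesgue" by (rule measurable_completion)
        show "(\<lambda>z. k (x - z) *\<^sub>R d0 z) \<in> borel_measurable lebesgue"
          using km borel_measurable_integrable[OF d0] by measurable
        have "h \<in> borel_measurable lebesgue" using h by (intro measurable_completion) auto
        then show "(\<lambda>z. k (x - z) *\<^sub>R h z) \<in> borel_measurable lebesgue"
          using km by measurable
        show "AE z in lebesgue. k (x - z) *\<^sub>R d0 z = k (x - z) *\<^sub>R h z"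
          using hae' by eventually_elim simp
      qed
      also have "\<dots> = conv k h x"
        unfolding conv_def using conv_integrable[OF k h, of x] by (intro integral_completion) auto
      finally show ?thesis .
    qed
    have cm: "conv k h \<in> borel_measurable borel" by (rule conv_measurable[OF k hm])
    have fin: "integrable lborel (\<lambda>x. norm (conv k h x - h x))"
      using conv[of \<sigma> k] \<sigma> k cm by (intro integrableI_bounded) (auto simp: less_top[symmetric] intro: order.strict_trans)
    have Ub: "U \<in> sets borel" using U(1) by (simp add: borel_compact)
    have UW: "U \<subseteq> W" using r by (force simp: W_def)
    have "(LINT x:U|lebesgue. norm (?kf x - d x)) = (LINT x|lebesgue. indicator U x * norm (conv k h x - d0 x))"
      unfolding set_lebesgue_integral_def
      by (rule Bochner_Integration.integral_cong[OF refl]) (use UW eq in \<open>auto simp: indicator_def d0_def\<close>)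
    also have "\<dots> = (LINT x|lebesgue. indicator U x * norm (conv k h x - h x))"
    proof (rule integral_cong_AE)
      have [measurable]: "conv k h \<in> borel_measurable lebesgue" using cm by (intro measurable_completion) auto
      have [measurable]: "U \<in> sets lebesgue" using Ub by auto
      have [measurable]: "d0 \<in> borel_measurable lebesgue" "h \<in> borel_measurable lebesgue"
        using d0 measurable_completion[of h lborel borel] by auto
      show "(\<lambda>x. indicator U x * norm (conv k h x - d0 x)) \<in> borel_measurable lebesgue"
           "(\<lambda>x. indicator U x * norm (conv k h x - h x)) \<in> borel_measurable lebesgue"
        by measurable
      show "AE x in lebesgue. indicator U x * norm (conv k h x - d0 x) = indicator U x * norm (conv k h x - h x)"
        using hae' by eventually_elim simp
    qed
    also have "\<dots> = (LINT x|lborel. indicator U x * norm (conv k h x - h x))"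
      by (rule integral_completion) (use cm Ub in measurable)
    also have "\<dots> \<le> (LINT x|lborel. norm (conv k h x - h x))"
    proof (rule integral_mono)
      show "integrable lborel (\<lambda>x. indicator U x * norm (conv k h x - h x))"
        using integrable_mult_indicator[OF _ fin, of U] Ub by simp
    qed (use fin in \<open>auto simp: indicator_def\<close>)
    also have "\<dots> < e"
    proof -
      have "ennreal (LINT x|lborel. norm (conv k h x - h x)) < ennreal e"
        using nn_integral_eq_integral[OF fin] conv[of \<sigma> k] \<sigma> k by simp
      then show ?thesis by (simp add: ennreal_less_iff integral_nonneg_AE)
    qed
    finally show "(LINT x:U|lebesgue. norm (?kf x - d x)) < e" .
  qed
qed

lemma weak_approx:
  fixes f d1 d2 :: "complex \<Rightarrow> complex"
  assumes \<Omega>: "open \<Omega>" and f: "continuous_on UNIV f" and d: "d1 \<in> L1_loc \<Omega>" "d2 \<in> L1_loc \<Omega>"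
    and w: "weak_partial \<Omega> 1 f d1" "weak_partial \<Omega> \<i> f d2" and U: "compact U" "U \<subseteq> \<Omega>" and e: "0 < e"
  shows "\<exists>\<phi> a b. C1 \<phi> a b \<and> (\<forall>x\<in>cball 0 R. norm (\<phi> x - f x) \<le> e) \<and>
    (LINT x:U|lebesgue. norm (a x - d1 x)) < e \<and> (LINT x:U|lebesgue. norm (b x - d2 x)) < e"
proof -
  obtain r1 where r1: "0 < r1" "\<And>\<sigma> k. 0 < \<sigma> \<Longrightarrow> \<sigma> < r1 \<Longrightarrow> mollifier \<sigma> k \<Longrightarrow>
    (LINT x:U|lebesgue. norm (conv (\<lambda>y. frechet_derivative k (at y) 1) f x - d1 x)) < e"
    using weak_partial_mollify_L1[OF \<Omega> f _ d(1) w(1) U e] by auto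
  obtain r2 where r2: "0 < r2" "\<And>\<sigma> k. 0 < \<sigma> \<Longrightarrow> \<sigma> < r2 \<Longrightarrow> mollifier \<sigma> k \<Longrightarrow>
    (LINT x:U|lebesgue. norm (conv (\<lambda>y. frechet_derivative k (at y) \<i>) f x - d2 x)) < e"
    using weak_partial_mollify_L1[OF \<Omega> f _ d(2) w(2) U e] by auto
  have uu: "uniformly_continuous_on (cball 0 (R + 1)) f"
    by (rule compact_uniformly_continuous) (use f continuous_on_subset in auto)
  obtain r3 where r3: "0 < r3" "\<And>x z. x \<in> cball 0 (R+1) \<Longrightarrow> z \<in> cball 0 (R+1) \<Longrightarrow> dist z x < r3 \<Longrightarrow> norm (f z - f x) < e"
    using uu e unfolding uniformly_continuous_on_def dist_norm by metis
  define \<sigma> where "\<sigma> = min (min r1 r2) (min r3 1) / 2"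
  have \<sigma>: "0 < \<sigma>" "\<sigma> < r1" "\<sigma> < r2" "\<sigma> < r3" "\<sigma> < 1" using r1(1) r2(1) r3(1) by (auto simp: \<sigma>_def)
  obtain k where k: "mollifier \<sigma> k" using mollifier_exists[OF \<sigma>(1)] by blast
  have "C1 (conv k f) (conv (\<lambda>y. frechet_derivative k (at y) 1) f) (conv (\<lambda>y. frechet_derivative k (at y) \<i>) f)"
    by (rule conv_C1[OF smooth_C1[OF mollifierD(1)[OF k]] _ f, of \<sigma>]) (rule mollifierD(3)[OF k])
  moreover have "norm (conv k f x - f x) \<le> e" if x: "x \<in> cball 0 R" for x
  proof (rule conv_diff_bound[OF k f])
    fix z assume z: "dist z x \<le> \<sigma>"
    have "cmod z \<le> cmod x + dist z x" by (metis add.commute dist_norm norm_triangle_sub)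
    then show "norm (f z - f x) \<le> e"
      using z x \<sigma> by (intro less_imp_le r3(2)) auto
  qed
  ultimately show ?thesis using r1(2)[OF \<sigma>(1,2) k] r2(2)[OF \<sigma>(1,3) k] by blast
qed

section \<open>Lipschitz truncation\<close>

lemma emeasure_cball_complex: "0 \<le> r \<Longrightarrow> emeasure lborel (cball (x::complex) r) = ennreal (pi * r\<^sup>2)"
  by (simp add: emeasure_cball unit_ball_vol_2)

lemma measure_cball_complex: "0 \<le> r \<Longrightarrow> measure lborel (cball (x::complex) r) = pi * r\<^sup>2"
  by (simp add: measure_def emeasure_cball_complex)

text \<open>
  By Vitali's covering lemma, the discs on which the mean of \<open>g\<close> exceeds \<open>l\<close> contain a countable disjoint
  family whose fivefold enlargements cover all of them; \<open>V\<close> is the union of the enlargements. The part of \<open>g\<close> below \<open>l / 2\<close> contributes at most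
  half of such a mean, whence the restriction to a superlevel set and the constant \<open>50 = 2 * 5\<^sup>2\<close>.
\<close>

lemma maximal_function_weak_type:
  fixes g :: "complex \<Rightarrow> real"
  assumes g: "integrable lborel g" and pos: "\<And>x. 0 \<le> g x" and l: "0 < l"
  shows "\<exists>V\<in>sets borel. (\<forall>x. x \<notin> V \<longrightarrow> (\<forall>r>0. (LINT z:cball x r|lborel. g z) \<le> l * pi * r\<^sup>2)) \<and>
    emeasure lborel V \<le> ennreal (50 / l) * (\<integral>\<^sup>+ x. ennreal (g x) * indicator {x. l / 2 < g x} x \<partial>lborel)"
proof -
  have [measurable]: "g \<in> borel_measurable borel" using g by auto
  define K where "K = {(x, r). 0 < r \<and> l * pi * r\<^sup>2 < (LINT z:cball x r|lborel. g z)}"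
  define D where "D = density lborel (\<lambda>x. ennreal (g x) * indicator {x. l / 2 < g x} x)"
  have gb: "set_integrable lborel (cball x r) g" for x r
    unfolding set_integrable_def using g by (intro integrable_mult_indicator) auto
  have K: "0 < snd i \<and> snd i \<le> 1 + (LINT z|lborel. g z) / (l * pi)" if iK: "i \<in> K" for i
  proof -
    obtain x r where i: "i = (x, r)" and r: "0 < r" and lt: "l * pi * r\<^sup>2 < (LINT z:cball x r|lborel. g z)"
      using iK by (cases i) (auto simp: K_def)
    have "(LINT z:cball x r|lborel. g z) \<le> (LINT z|lborel. g z)"
      unfolding set_lebesgue_integral_def
      by (rule integral_mono) (use g pos gb[of x r] in \<open>auto simp: indicator_def set_integrable_def\<close>)
    with lt have "r\<^sup>2 \<le> (LINT z|lborel. g z) / (l * pi)"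
      using l by (simp add: field_simps)
    moreover have "r \<le> 1 + r\<^sup>2"
    proof -
      have "2 * r \<le> r\<^sup>2 + 1" using zero_le_power2[of "r - 1"] unfolding power2_diff by simp
      then show ?thesis using r by linarith
    qed
    ultimately show ?thesis using i r by simp
  qed
  obtain C where C: "countable C" "C \<subseteq> K"
    and dis: "pairwise (\<lambda>i j. disjnt (cball (fst i) (snd i)) (cball (fst j) (snd j))) C"
    and cov: "(\<Union>i\<in>K. cball (fst i) (snd i)) \<subseteq> (\<Union>i\<in>C. cball (fst i) (5 * snd i))"
    by (rule Vitali_covering_lemma_cballs[where S="\<Union>i\<in>K. cball (fst i) (snd i)" and K=K and a=fst and r=snd, OF order_refl])
       (rule K, assumption, rule that, assumption+)
  define h where "h = from_nat_into C"
  define N where "N = to_nat_on C ` C"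
  have hC: "h n \<in> C" if "n \<in> N" for n using that C(1) by (auto simp: h_def N_def)
  have hinj: "n = m" if "n \<in> N" "m \<in> N" "h n = h m" for n m using that C(1) by (auto simp: h_def N_def)
  have hsurj: "\<exists>n\<in>N. h n = i" if "i \<in> C" for i using that C(1) by (auto simp: h_def N_def)
  define Y where "Y = (\<lambda>n. if n \<in> N then cball (fst (h n)) (snd (h n)) else {})"
  define Z where "Z = (\<lambda>n. if n \<in> N then cball (fst (h n)) (5 * snd (h n)) else {})"
  define V where "V = (\<Union>n. Z n)"
  have sub: "(\<Union>i\<in>K. cball (fst i) (snd i)) \<subseteq> V"
  proof -
    have "(\<Union>i\<in>C. cball (fst i) (5 * snd i)) \<subseteq> V"
    proof
      fix y assume "y \<in> (\<Union>i\<in>C. cball (fst i) (5 * snd i))"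
      then obtain i where i: "i \<in> C" "y \<in> cball (fst i) (5 * snd i)" by blast
      obtain n where "n \<in> N" "h n = i" using hsurj[OF i(1)] by blast
      with i(2) have "y \<in> Z n" by (simp add: Z_def)
      then show "y \<in> V" unfolding V_def by blast
    qed
    then show ?thesis using cov by blast
  qed
  have Zm [measurable]: "Z n \<in> sets borel" and Ym [measurable]: "Y n \<in> sets borel" for n by (auto simp: Z_def Y_def)
  have "disjoint_family Y"
    unfolding disjoint_family_on_def
  proof (intro ballI impI)
    fix m n :: nat assume "m \<noteq> n"
    show "Y m \<inter> Y n = {}"
    proof (cases "m \<in> N \<and> n \<in> N")
      case True
      then have "h m \<noteq> h n" using hinj \<open>m \<noteq> n\<close> by blast
      then show ?thesis using True dis hC unfolding pairwise_def disjnt_def Y_def by simp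
    qed (auto simp: Y_def)
  qed
  have est: "emeasure lborel (Z n) \<le> ennreal (50 / l) * emeasure D (Y n)" for n
  proof (cases "n \<in> N")
    case True
    obtain x r where i: "h n = (x, r)" and r: "0 < r" and lt: "l * pi * r\<^sup>2 < (LINT z:cball x r|lborel. g z)"
      using C(2) hC[OF True] by (auto simp: K_def)
    have i1: "set_integrable lborel (cball x r) (\<lambda>z. g z * indicator {x. l / 2 < g x} z)"
      unfolding set_integrable_def using g by (intro integrable_mult_indicator integrable_real_mult_indicator) auto
    have i2: "set_integrable lborel (cball x r) (\<lambda>z. l / 2)"
      using emeasure_cball_complex[of r x] r by (auto simp: set_integrable_def integrable_indicator_iff)
    have "(LINT z:cball x r|lborel. g z) \<le> (LINT z:cball x r|lborel. l / 2 + g z * indicator {x. l / 2 < g x} z)"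
      by (rule set_integral_mono[OF gb set_integral_add(1)[OF i2 i1]]) (use l in \<open>auto simp: indicator_def\<close>)
    also have "\<dots> = l / 2 * (pi * r\<^sup>2) + (LINT z:cball x r|lborel. g z * indicator {x. l / 2 < g x} z)"
      using set_integral_add(2)[OF i2 i1] r measure_cball_complex[of r x] emeasure_cball_complex[of r x]
      by (simp add: set_lebesgue_integral_def)
    finally have "l * pi * r\<^sup>2 / 2 \<le> (LINT z:cball x r|lborel. g z * indicator {x. l / 2 < g x} z)"
      using lt by (simp add: field_simps)
    then have "pi * (5 * r)\<^sup>2 \<le> 50 / l * (LINT z:cball x r|lborel. g z * indicator {x. l / 2 < g x} z)"
      using l by (simp add: field_simps power2_eq_square)
    then have "ennreal (pi * (5 * r)\<^sup>2) \<le> ennreal (50 / l) * ennreal (LINT z:cball x r|lborel. g z * indicator {x. l / 2 < g x} z)"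
      using l by (simp add: ennreal_leI flip: ennreal_mult')
    also have "ennreal (LINT z:cball x r|lborel. g z * indicator {x. l / 2 < g x} z) = emeasure D (cball x r)"
    proof -
      have "ennreal (LINT z:cball x r|lborel. g z * indicator {x. l / 2 < g x} z)
         = (\<integral>\<^sup>+ z. ennreal (indicator (cball x r) z *\<^sub>R (g z * indicator {x. l / 2 < g x} z)) \<partial>lborel)"
        unfolding set_lebesgue_integral_def
        by (rule nn_integral_eq_integral[symmetric]) (use i1 pos in \<open>auto simp: set_integrable_def\<close>)
      also have "\<dots> = (\<integral>\<^sup>+ z. ennreal (g z) * indicator {x. l / 2 < g x} z * indicator (cball x r) z \<partial>lborel)"
        by (rule nn_integral_cong) (auto simp: indicator_def)
      also have "\<dots> = emeasure D (cball x r)"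
        unfolding D_def by (subst emeasure_density) auto
      finally show ?thesis .
    qed
    finally show ?thesis using True i r emeasure_cball_complex[of "5 * r" x] by (simp add: Z_def Y_def)
  qed (simp add: Z_def)
  have "emeasure lborel V \<le> (\<Sum>n. emeasure lborel (Z n))"
    unfolding V_def by (rule emeasure_subadditive_countably) auto
  also have "\<dots> \<le> (\<Sum>n. ennreal (50 / l) * emeasure D (Y n))"
    by (rule suminf_le[OF est]) auto
  also have "\<dots> = ennreal (50 / l) * emeasure D (\<Union>n. Y n)"
    using suminf_emeasure[of Y D] \<open>disjoint_family Y\<close> by (simp add: D_def image_subset_iff)
  also have "\<dots> \<le> ennreal (50 / l) * emeasure D (space D)"
    by (intro mult_left_mono emeasure_mono) (auto simp: D_def)
  also have "emeasure D (space D) = (\<integral>\<^sup>+ x. ennreal (g x) * indicator {x. l / 2 < g x} x \<partial>lborel)"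
    unfolding D_def by (subst emeasure_density) auto
  finally have 1: "emeasure lborel V \<le> ennreal (50 / l) * (\<integral>\<^sup>+ x. ennreal (g x) * indicator {x. l / 2 < g x} x \<partial>lborel)" .
  have 2: "(LINT z:cball x r|lborel. g z) \<le> l * pi * r\<^sup>2" if "x \<notin> V" "0 < r" for x r
  proof (rule ccontr)
    assume "\<not> ?thesis"
    then have "(x, r) \<in> K" using that by (auto simp: K_def)
    then have "x \<in> V" using sub that(2) by force
    with that show False by simp
  qed
  show ?thesis
    using 1 2 by (intro bexI[of _ V]) (auto simp: V_def)
qed

lemma lborel_integral_affine:
  fixes F :: "complex \<Rightarrow> 'b::{banach, second_countable_topology}"
  assumes F: "F \<in> borel_measurable borel" and c: "c \<noteq> 0"
  shows "integral\<^sup>L lborel F = c\<^sup>2 *\<^sub>R (LINT y|lborel. F (x + c *\<^sub>R y))"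
  using F by (subst lborel_affine[OF c, of x]) (simp add: integral_density integral_distr)

lemma lborel_integral_reflect:
  fixes F :: "complex \<Rightarrow> 'b::{banach, second_countable_topology}"
  assumes "F \<in> borel_measurable borel"
  shows "(LINT y|lborel. F (- y)) = integral\<^sup>L lborel F"
  using lborel_integral_affine[OF assms, of "-1" 0] by simp

lemma conv_Lipschitz:
  fixes u :: "complex \<Rightarrow> real"
  assumes k: "mollifier \<sigma> k" and u: "\<And>x y. \<bar>u x - u y\<bar> \<le> L * dist x y"
  shows "\<bar>conv k u x - conv k u y\<bar> \<le> L * dist x y"
proof -
  have L: "0 \<le> L" using u[of 0 1] by (simp add: dist_norm)
  have uc: "continuous_on UNIV u"
  proof (rule continuous_onI)
    fix z :: complex and e :: real assume e: "0 < e"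
    have "dist (u x) (u z) \<le> e" if "dist x z < e / (L + 1)" for x
    proof -
      have "dist (u x) (u z) \<le> L * dist x z" using u by (simp add: dist_real_def)
      also have "\<dots> \<le> (L + 1) * dist x z" by (intro mult_right_mono) auto
      also have "\<dots> \<le> e" using that L by (simp add: field_simps)
      finally show ?thesis .
    qed
    then show "\<exists>d>0. \<forall>x'\<in>UNIV. dist x' z < d \<longrightarrow> dist (u x') (u z) \<le> e"
      using e L by (intro exI[of _ "e / (L + 1)"]) auto
  qed
  have eq: "conv k u x = (LINT z|lborel. k z * u (z + x))" and int: "integrable lborel (\<lambda>z. k z * u (z + x))" for x
  proof -
    have c: "continuous_on UNIV (\<lambda>z. k z * u (z + x))"
      by (intro continuous_intros mollifierD(5)[OF k] continuous_on_compose2[OF uc]) auto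
    then have m: "(\<lambda>z. k z * u (z + x)) \<in> borel_measurable borel" by (rule borel_measurable_continuous_onI)
    show "integrable lborel (\<lambda>z. k z * u (z + x))"
      by (rule continuous_compact_support_integrable[OF c, of \<sigma>]) (simp add: mollifierD(3)[OF k])
    have e: "k (x - z) = k (z - x)" for z using mollifierD(4)[OF k, of "z - x"] by simp
    show "conv k u x = (LINT z|lborel. k z * u (z + x))"
      using lborel_integral_translate[OF m, of "- x"] by (simp add: conv_def e)
  qed
  have "\<bar>conv k u x - conv k u y\<bar> = norm (LINT z|lborel. k z * u (z + x) - k z * u (z + y))"
    unfolding eq using int[of x] int[of y] by simp
  also have "\<dots> \<le> (LINT z|lborel. k z * (L * dist x y))"
  proof (rule order_trans[OF integral_norm_bound integral_mono])
    fix z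
    have "\<bar>u (z + x) - u (z + y)\<bar> \<le> L * dist x y" using u[of "z + x" "z + y"] by (simp add: dist_norm)
    then show "norm (k z * u (z + x) - k z * u (z + y)) \<le> k z * (L * dist x y)"
      using mollifierD(2)[OF k, of z] by (simp flip: right_diff_distrib add: abs_mult mult_left_mono)
  qed (use int[of x] int[of y] mollifierD(7)[OF k] in auto)
  also have "\<dots> = L * dist x y" using mollifierD(8)[OF k] by simp
  finally show ?thesis .
qed

lemma C1_Lipschitz_partials:
  assumes f: "C1 f f1 f2" and L: "\<And>x y. norm (f x - f y) \<le> L * dist x y"
  shows "norm (f1 x) \<le> L" "norm (f2 x) \<le> L"
proof -
  have d: "(f has_derivative (\<lambda>v. Re v *\<^sub>R f1 x + Im v *\<^sub>R f2 x)) (at x)"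
    using f unfolding C1_def by blast
  have "norm (Re v *\<^sub>R f1 x + Im v *\<^sub>R f2 x) \<le> L" if v: "norm v = 1" for v
  proof -
    have g: "((\<lambda>t. x + t *\<^sub>R v) has_vector_derivative v) (at 0)"
      by (auto intro!: derivative_eq_intros)
    have "((f \<circ> (\<lambda>t. x + t *\<^sub>R v)) has_derivative (\<lambda>v. Re v *\<^sub>R f1 x + Im v *\<^sub>R f2 x) \<circ> (\<lambda>t. t *\<^sub>R v)) (at 0)"
      by (rule diff_chain_at) (use g d in \<open>auto simp: has_vector_derivative_def\<close>)
    then have "((f \<circ> (\<lambda>t. x + t *\<^sub>R v)) has_vector_derivative (Re v *\<^sub>R f1 x + Im v *\<^sub>R f2 x)) (at 0)"
      by (simp add: has_vector_derivative_def o_def scaleR_add_right)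
    then have "((\<lambda>t. (f (x + t *\<^sub>R v) - f x - t *\<^sub>R (Re v *\<^sub>R f1 x + Im v *\<^sub>R f2 x)) /\<^sub>R \<bar>t\<bar>) \<longlongrightarrow> 0) (at 0)"
      by (simp add: has_vector_derivative_def has_derivative_def o_def)
    from tendsto_norm_zero[OF this]
    have "((\<lambda>t. norm ((f (x + t *\<^sub>R v) - f x) /\<^sub>R t - (Re v *\<^sub>R f1 x + Im v *\<^sub>R f2 x))) \<longlongrightarrow> 0) (at 0)"
    proof (rule Lim_transform_eventually)
      have "norm ((X - t *\<^sub>R D) /\<^sub>R \<bar>t\<bar>) = norm (X /\<^sub>R t - D)" if "t \<noteq> 0" for X D :: 'a and t :: real
      proof -
        have "X /\<^sub>R t - D = (X - t *\<^sub>R D) /\<^sub>R t" using that by (simp add: scaleR_diff_right)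
        then show ?thesis by simp
      qed
      then show "\<forall>\<^sub>F t in at 0. norm ((f (x + t *\<^sub>R v) - f x - t *\<^sub>R (Re v *\<^sub>R f1 x + Im v *\<^sub>R f2 x)) /\<^sub>R \<bar>t\<bar>)
          = norm ((f (x + t *\<^sub>R v) - f x) /\<^sub>R t - (Re v *\<^sub>R f1 x + Im v *\<^sub>R f2 x))"
        by (simp add: eventually_at_filter)
    qed
    then have "((\<lambda>t. (f (x + t *\<^sub>R v) - f x) /\<^sub>R t) \<longlongrightarrow> Re v *\<^sub>R f1 x + Im v *\<^sub>R f2 x) (at 0)"
      by (rule LIM_zero_cancel[OF tendsto_norm_zero_cancel])
    from tendsto_norm[OF this] show ?thesis
    proof (rule tendsto_upperbound)
      show "\<forall>\<^sub>F t in at 0. norm ((f (x + t *\<^sub>R v) - f x) /\<^sub>R t) \<le> L"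
        unfolding eventually_at_filter
      proof (rule always_eventually, intro allI impI)
        fix t :: real assume "t \<noteq> 0"
        then show "norm ((f (x + t *\<^sub>R v) - f x) /\<^sub>R t) \<le> L"
          using L[of "x + t *\<^sub>R v" x] v unfolding norm_scaleR by (simp add: dist_norm field_simps)
      qed
    qed simp
  qed
  from this[of 1] this[of \<i>] show "norm (f1 x) \<le> L" "norm (f2 x) \<le> L" by simp_all
qed

text \<open>
  Let the good set be the complement of \<open>V\<close>. Averaging over discs whose radius \<open>s x\<close> is comparable with the
  distance to the good set turns the bound for the maximal function on the good set into a bound for the
  gradient on \<open>W\<close>, while almost nothing is changed on the good set itself. The radius stays small because
  \<open>V\<close>, by its area, contains no disc of radius \<open>t\<close>.
\<close>

lemma lipschitz_truncation:
  fixes \<phi> a b :: "complex \<Rightarrow> complex"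
  assumes \<rho>: "mollifier 1 \<rho>" and B: "\<And>y. \<rho> y \<le> B"
    and \<phi>: "C1 \<phi> a b" and U: "compact U" and t: "0 < t" and \<tau>: "0 < \<tau>" and l: "0 < l"
    and W: "\<And>x. x \<in> W \<Longrightarrow> cball x (2 * t) \<subseteq> U"
    and V: "V \<in> sets borel" "emeasure lborel V < ennreal (pi * t\<^sup>2)"
    and M: "\<And>x r. x \<notin> V \<Longrightarrow> 0 < r \<Longrightarrow>
       (LINT z:cball x r|lborel. indicator U z * (norm (a z) + norm (b z))) \<le> l * pi * r\<^sup>2"
  shows "\<exists>h h1 h2. C1 h h1 h2 \<and>
     (\<forall>x M. (\<forall>z. dist z x \<le> 2 * t \<longrightarrow> norm (\<phi> z - \<phi> x) \<le> M) \<longrightarrow> norm (h x - \<phi> x) \<le> M) \<and>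
     (\<forall>x\<in>W. norm (h1 x) \<le> 32 * pi * B * l \<and> norm (h2 x) \<le> 32 * pi * B * l) \<and>
     (\<forall>x\<in>W - V. norm (h1 x - a x) \<le> \<tau> \<and> norm (h2 x - b x) \<le> \<tau>)"
proof -
  note \<phi>c = C1_continuous[OF \<phi>, of UNIV] and ac = C1_continuous_partials(1)[OF \<phi>, of UNIV]
    and bc = C1_continuous_partials(2)[OF \<phi>, of UNIV]
  have am [measurable]: "a \<in> borel_measurable borel" "b \<in> borel_measurable borel"
    using ac bc by (auto intro: borel_measurable_continuous_onI)
  have Um [measurable]: "U \<in> sets borel" using U by (rule borel_compact)
  have "uniformly_continuous_on U a" "uniformly_continuous_on U b"
    using U ac bc continuous_on_subset by (blast intro: compact_uniformly_continuous)+
  then obtain da db where da: "0 < da" "\<And>x z. x \<in> U \<Longrightarrow> z \<in> U \<Longrightarrow> dist z x < da \<Longrightarrow> dist (a z) (a x) < \<tau> / 4"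
    and db: "0 < db" "\<And>x z. x \<in> U \<Longrightarrow> z \<in> U \<Longrightarrow> dist z x < db \<Longrightarrow> dist (b z) (b x) < \<tau> / 4"
    using \<tau> unfolding uniformly_continuous_on_def by (metis divide_pos_pos zero_less_numeral)
  define \<epsilon> where "\<epsilon> = min t (min da db) / 4"
  have \<epsilon>: "0 < \<epsilon>" "3 * \<epsilon> \<le> t" "3 * \<epsilon> < da" "3 * \<epsilon> < db" using t da(1) db(1) by (auto simp: \<epsilon>_def)
  obtain k where k: "mollifier \<epsilon> k" using mollifier_exists[OF \<epsilon>(1)] by blast
  define F where "F = - V"
  define \<delta> where "\<delta> = (\<lambda>x. infdist x F)"
  have near: "\<delta> x < t" and Fne: "F \<noteq> {}" for x
  proof -
    have "\<not> ball x t \<subseteq> V"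
    proof
      assume "ball x t \<subseteq> V"
      then have "emeasure lborel (ball x t) \<le> emeasure lborel V" using V(1) by (intro emeasure_mono) auto
      then show False using V(2) t by (simp add: emeasure_ball unit_ball_vol_2)
    qed
    then obtain y where y: "y \<in> ball x t" "y \<in> F" unfolding F_def by blast
    then have "\<delta> x \<le> dist x y" unfolding \<delta>_def by (intro infdist_le)
    with y show "\<delta> x < t" "F \<noteq> {}" by auto
  qed
  have \<delta>L: "\<bar>\<delta> x - \<delta> y\<bar> \<le> 1 * dist x y" for x y
    using infdist_triangle[of x F y] infdist_triangle[of y F x] by (simp add: \<delta>_def dist_commute abs_le_iff)
  have \<delta>c: "continuous_on UNIV \<delta>" unfolding \<delta>_def by (intro continuous_intros)
  define k1 where "k1 = (\<lambda>y. frechet_derivative k (at y) 1)"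
  define k2 where "k2 = (\<lambda>y. frechet_derivative k (at y) \<i>)"
  \<comment> \<open>a differentiable substitute for the distance \<open>\<delta>\<close> to the good set, bounded away from 0\<close>
  define s where "s = (\<lambda>x. conv k \<delta> x + 2 * \<epsilon>)"
  define s1 where "s1 = conv k1 \<delta>"
  define s2 where "s2 = conv k2 \<delta>"
  have C: "C1 (conv k \<delta>) s1 s2"
    unfolding s1_def s2_def k1_def k2_def
    by (rule conv_C1[OF smooth_C1[OF mollifierD(1)[OF k]] _ \<delta>c, of \<epsilon>]) (rule mollifierD(3)[OF k])
  have sC: "C1 s s1 s2"
    using C unfolding C1_def s_def by (auto intro!: derivative_eq_intros)
  have "norm (conv k \<delta> x - conv k \<delta> y) \<le> 1 * dist x y" for x y
    using conv_Lipschitz[OF k \<delta>L] by simp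
  note sb = C1_Lipschitz_partials[OF C this, simplified]
  have "norm (conv k \<delta> x - \<delta> x) \<le> \<epsilon>" for x
  proof (rule conv_diff_bound[OF k \<delta>c])
    fix z assume "dist z x \<le> \<epsilon>"
    then show "norm (\<delta> z - \<delta> x) \<le> \<epsilon>" using \<delta>L[of z x] by simp
  qed
  then have slo: "\<delta> x + \<epsilon> \<le> s x" and shi: "s x \<le> \<delta> x + 3 * \<epsilon>" for x
    by (smt (verit) s_def real_norm_def)+
  have d0: "0 \<le> \<delta> x" for x by (simp add: \<delta>_def infdist_nonneg)
  have spos: "0 < s x" for x using slo[of x] d0[of x] \<epsilon> by linarith
  have s2t: "s x \<le> 2 * t" for x using shi[of x] near[of x] \<epsilon> by linarith
  note scont = C1_continuous[OF sC, of UNIV]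
  note s1c = C1_continuous_partials(1)[OF sC, of UNIV] and s2c = C1_continuous_partials(2)[OF sC, of UNIV]
  define p where "p = (\<lambda>x y. x + s x *\<^sub>R y)"
  note \<rho>c = mollifierD(5)[OF \<rho>, of UNIV]
  have \<rho>0: "\<rho> y = 0" if "1 < cmod y" for y using mollifierD(3)[OF \<rho> that] .
  define G where "G = (\<lambda>x y. \<rho> y *\<^sub>R \<phi> (p x y))"
  define G1 where "G1 = (\<lambda>x y. \<rho> y *\<^sub>R ((1 + s1 x * Re y) *\<^sub>R a (p x y) + (s1 x * Im y) *\<^sub>R b (p x y)))"
  define G2 where "G2 = (\<lambda>x y. \<rho> y *\<^sub>R ((s2 x * Re y) *\<^sub>R a (p x y) + (1 + s2 x * Im y) *\<^sub>R b (p x y)))"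
  have pc: "continuous_on S (\<lambda>z. p (fst z) (snd z))" for S
    unfolding p_def by (intro continuous_intros continuous_on_compose2[OF scont]) auto
  have cG: "continuous_on S (\<lambda>(x, y). G x y)" "continuous_on S (\<lambda>(x, y). G1 x y)" "continuous_on S (\<lambda>(x, y). G2 x y)" for S
    unfolding G_def G1_def G2_def case_prod_beta
    by (intro continuous_intros pc continuous_on_compose2[OF \<rho>c] continuous_on_compose2[OF \<phi>c] continuous_on_compose2[OF ac]
        continuous_on_compose2[OF bc] continuous_on_compose2[OF s1c] continuous_on_compose2[OF s2c]; auto)+
  have slice: "continuous_on S (f x)" if "\<And>S. continuous_on S (\<lambda>(x, y). f x y)" for S and f :: "complex \<Rightarrow> complex \<Rightarrow> complex" and x
  proof -
    have "continuous_on S (\<lambda>y. (x, y))" by (intro continuous_intros)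
    from continuous_on_compose2[OF that[of UNIV] this] show ?thesis by auto
  qed
  note cGx = slice[OF cG(1)] slice[OF cG(2)] slice[OF cG(3)]
  have bx: "integral\<^sup>L lborel f = integral (nbox 0 1) f" and fi: "integrable lborel f"
    if "continuous_on UNIV f" "\<And>y. 1 < cmod y \<Longrightarrow> f y = 0" for f :: "complex \<Rightarrow> complex"
  proof -
    show "integral\<^sup>L lborel f = integral (nbox 0 1) f"
      unfolding nbox_def
    proof (rule lborel_integral_box[OF that(1)])
      fix y assume "y \<notin> cbox (0 - Complex 1 1) (0 + Complex 1 1)"
      then have "1 < cmod y" using notin_nbox[of y 0 1] by (simp add: nbox_def)
      then show "f y = 0" by (rule that(2))
    qed
    show "integrable lborel f" by (rule continuous_compact_support_integrable[OF that])
  qed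
  define h where "h = (\<lambda>x. LINT y|lborel. G x y)"
  define h1 where "h1 = (\<lambda>x. LINT y|lborel. G1 x y)"
  define h2 where "h2 = (\<lambda>x. LINT y|lborel. G2 x y)"
  have z: "G x y = 0" "G1 x y = 0" "G2 x y = 0" if "1 < cmod y" for x y
    using \<rho>0[OF that] by (auto simp: G_def G1_def G2_def)
  have "h = (\<lambda>x. integral (nbox 0 1) (G x))" "h1 = (\<lambda>x. integral (nbox 0 1) (G1 x))" "h2 = (\<lambda>x. integral (nbox 0 1) (G2 x))"
    unfolding h_def h1_def h2_def using bx[OF cGx(1)] bx[OF cGx(2)] bx[OF cGx(3)] z by auto
  moreover have "C1 (\<lambda>x. integral (nbox 0 1) (G x)) (\<lambda>x. integral (nbox 0 1) (G1 x)) (\<lambda>x. integral (nbox 0 1) (G2 x))"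
    unfolding nbox_def
  proof (rule C1_Leibniz)
    fix x y
    have "(s has_derivative (\<lambda>v. Re v * s1 x + Im v * s2 x)) (at x)" using sC unfolding C1_def by simp
    then have "((\<lambda>x. p x y) has_derivative (\<lambda>v. v + (Re v * s1 x + Im v * s2 x) *\<^sub>R y)) (at x)"
      unfolding p_def by (auto intro!: derivative_eq_intros)
    moreover have "(\<phi> has_derivative (\<lambda>v. Re v *\<^sub>R a (p x y) + Im v *\<^sub>R b (p x y))) (at (p x y))"
      using \<phi> unfolding C1_def by blast
    ultimately have "((\<lambda>x. \<phi> (p x y)) has_derivative (\<lambda>v. Re (v + (Re v * s1 x + Im v * s2 x) *\<^sub>R y) *\<^sub>R a (p x y)
        + Im (v + (Re v * s1 x + Im v * s2 x) *\<^sub>R y) *\<^sub>R b (p x y))) (at x)"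
      by (rule has_derivative_compose)
    from has_derivative_scaleR_right[OF this, of "\<rho> y"]
    show "((\<lambda>x. G x y) has_derivative (\<lambda>v. Re v *\<^sub>R G1 x y + Im v *\<^sub>R G2 x y)) (at x)"
      unfolding G_def by (rule has_derivative_eq_rhs) (auto simp: G1_def G2_def fun_eq_iff algebra_simps)
  qed (use cG cGx in auto)
  ultimately have hC: "C1 h h1 h2" by simp
  have \<rho>i: "integrable lborel \<rho>" "integral\<^sup>L lborel \<rho> = 1" using mollifierD[OF \<rho>] by auto
  have osc: "norm (h x - \<phi> x) \<le> M" if M: "\<And>z. dist z x \<le> 2 * t \<Longrightarrow> norm (\<phi> z - \<phi> x) \<le> M" for x M
  proof -
    have i: "integrable lborel (G x)" by (rule fi[OF cGx(1)]) (rule z)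
    have i2: "integrable lborel (\<lambda>y. \<rho> y *\<^sub>R \<phi> x)" using \<rho>i by simp
    have "h x - \<phi> x = (LINT y|lborel. G x y - \<rho> y *\<^sub>R \<phi> x)"
      unfolding h_def using i i2 \<rho>i by simp
    also have "norm \<dots> \<le> (LINT y|lborel. \<rho> y * M)"
    proof (rule order_trans[OF integral_norm_bound integral_mono])
      fix y
      show "norm (G x y - \<rho> y *\<^sub>R \<phi> x) \<le> \<rho> y * M"
      proof (cases "1 < cmod y")
        case False
        then have "s x * cmod y \<le> s x" using spos[of x] by (simp add: mult_left_le)
        moreover have "dist (p x y) x = s x * cmod y" using spos[of x] by (simp add: p_def dist_norm)
        ultimately have "norm (\<phi> (p x y) - \<phi> x) \<le> M"
          using s2t[of x] by (intro M) linarith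
        then show ?thesis using mollifierD(2)[OF \<rho>, of y]
          by (simp add: G_def mult_left_mono flip: scaleR_diff_right)
      qed (simp add: \<rho>0 z)
    qed (use i i2 \<rho>i in auto)
    also have "\<dots> = M" using \<rho>i by simp
    finally show ?thesis .
  qed
  have re: "\<bar>Re y\<bar> \<le> 1" "\<bar>Im y\<bar> \<le> 1" if "\<not> 1 < cmod y" for y
    using that abs_Re_le_cmod[of y] abs_Im_le_cmod[of y] by linarith+
  have c2: "\<bar>1 + c * d\<bar> \<le> 2" "\<bar>c * d\<bar> \<le> 2" if "\<bar>c\<bar> \<le> 1" "\<bar>d\<bar> \<le> 1" for c d :: real
  proof -
    have "\<bar>c * d\<bar> \<le> 1 * 1" unfolding abs_mult using that by (intro mult_mono) auto
    then show "\<bar>1 + c * d\<bar> \<le> 2" "\<bar>c * d\<bar> \<le> 2" by linarith+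
  qed
  have lin: "norm (\<alpha> *\<^sub>R A + \<beta> *\<^sub>R A') \<le> 2 * (norm A + norm A')" if "\<bar>\<alpha>\<bar> \<le> 2" "\<bar>\<beta>\<bar> \<le> 2" for \<alpha> \<beta> :: real and A A' :: complex
  proof -
    have "norm (\<alpha> *\<^sub>R A + \<beta> *\<^sub>R A') \<le> \<bar>\<alpha>\<bar> * norm A + \<bar>\<beta>\<bar> * norm A'"
      using norm_triangle_ineq[of "\<alpha> *\<^sub>R A" "\<beta> *\<^sub>R A'"] by simp
    also have "\<dots> \<le> 2 * norm A + 2 * norm A'" using that by (intro add_mono mult_right_mono) auto
    finally show ?thesis by simp
  qed
  define g where "g = (\<lambda>z. indicator U z * (norm (a z) + norm (b z)))"
  have gpos: "0 \<le> g z" for z by (simp add: g_def)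
  have gi: "integrable lborel g"
    using borel_integrable_compact[OF U, of "\<lambda>z. norm (a z) + norm (b z)"] ac bc
    by (simp add: g_def continuous_on_subset[OF _ subset_UNIV] continuous_on_add continuous_on_norm)
  have gm [measurable]: "g \<in> borel_measurable borel" using gi by auto
  have big: "norm (h1 x) \<le> 32 * pi * B * l \<and> norm (h2 x) \<le> 32 * pi * B * l" if x: "x \<in> W" for x
  proof -
    have B0: "0 \<le> B" using B[of 0] mollifierD(2)[OF \<rho>, of 0] by linarith
    have sub: "cball x (s x) \<subseteq> U" using W[OF x] s2t[of x] by force
    define Gx where "Gx = (\<lambda>z. indicator (cball x (s x)) z * g z)"
    have Gxm [measurable]: "Gx \<in> borel_measurable borel"
      unfolding Gx_def by (intro borel_measurable_times borel_measurable_indicator gm) simp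
    have Gxi: "integrable lborel Gx" using integrable_mult_indicator[OF _ gi, of "cball x (s x)"] by (simp add: Gx_def)
    have "Gx \<in> borel_measurable borel" by measurable
    note aff = lborel_integral_affine[OF this, of "s x" x]
    have inti: "integrable lborel (\<lambda>y. 2 * B * Gx (x + s x *\<^sub>R y))"
    proof (cases "(LINT z|lborel. Gx z) = 0")
      case True
      have "AE z in lborel. Gx z = 0"
        using integral_nonneg_eq_0_iff_AE[OF Gxi] True gpos by (auto simp: Gx_def)
      have "(\<lambda>y. Gx (x + s x *\<^sub>R y)) \<in> borel_measurable borel" by measurable
      then have "integrable lborel (\<lambda>y. Gx (x + s x *\<^sub>R y)) \<longleftrightarrow> (\<integral>\<^sup>+ y. ennreal (Gx (x + s x *\<^sub>R y)) \<partial>lborel) < \<infinity>"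
        by (subst integrable_iff_bounded) (auto simp: Gx_def gpos)
      moreover have "(\<integral>\<^sup>+ z. ennreal (Gx z) \<partial>lborel) = ennreal ((s x)\<^sup>2) * (\<integral>\<^sup>+ y. ennreal (Gx (x + s x *\<^sub>R y)) \<partial>lborel)"
        using spos[of x] by (subst lborel_affine[of "s x" x]) (simp_all add: nn_integral_density nn_integral_distr nn_integral_cmult ennreal_power)
      moreover have "(\<integral>\<^sup>+ z. ennreal (Gx z) \<partial>lborel) < \<infinity>"
        using Gxi by (simp add: integrable_iff_bounded Gx_def gpos abs_of_nonneg)
      ultimately have "integrable lborel (\<lambda>y. Gx (x + s x *\<^sub>R y))"
        using spos[of x] by (auto simp: ennreal_mult_less_top ennreal_mult_eq_top_iff less_top)
      then show ?thesis by simp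
    next
      case False
      then have "(LINT y|lborel. Gx (x + s x *\<^sub>R y)) \<noteq> 0" using aff spos[of x] by auto
      then have "integrable lborel (\<lambda>y. Gx (x + s x *\<^sub>R y))" using not_integrable_integral_eq by blast
      then show ?thesis by simp
    qed
    have pt: "norm (\<rho> y *\<^sub>R (\<alpha> *\<^sub>R a (p x y) + \<beta> *\<^sub>R b (p x y))) \<le> 2 * B * Gx (x + s x *\<^sub>R y)"
      if "\<not> 1 < cmod y \<Longrightarrow> \<bar>\<alpha>\<bar> \<le> 2" "\<not> 1 < cmod y \<Longrightarrow> \<bar>\<beta>\<bar> \<le> 2" for y \<alpha> \<beta>
    proof (cases "1 < cmod y")
      case True
      then show ?thesis using \<rho>0[OF True] B0 by (simp add: Gx_def gpos)
    next
      case False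
      then have "s x * cmod y \<le> s x" using spos[of x] by (simp add: mult_left_le)
      moreover have "dist x (x + s x *\<^sub>R y) = s x * cmod y" using spos[of x] by (simp add: dist_norm)
      ultimately have "x + s x *\<^sub>R y \<in> cball x (s x)" unfolding mem_cball by linarith
      moreover from this have "p x y \<in> U" using sub by (auto simp: p_def)
      ultimately have Gp: "Gx (x + s x *\<^sub>R y) = norm (a (p x y)) + norm (b (p x y))"
        by (simp add: Gx_def g_def p_def)
      have "norm (\<rho> y *\<^sub>R (\<alpha> *\<^sub>R a (p x y) + \<beta> *\<^sub>R b (p x y))) = \<rho> y * norm (\<alpha> *\<^sub>R a (p x y) + \<beta> *\<^sub>R b (p x y))"
        using mollifierD(2)[OF \<rho>, of y] by simp
      also have "\<dots> \<le> B * (2 * (norm (a (p x y)) + norm (b (p x y))))"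
        using mollifierD(2)[OF \<rho>, of y] B lin[OF that] False by (intro mult_mono) (auto simp: B0)
      finally show ?thesis by (simp add: Gp algebra_simps)
    qed
    obtain x' where x': "x' \<in> F" "dist x x' < \<delta> x + \<epsilon>"
    proof -
      have "(INF y\<in>F. dist x y) < \<delta> x + \<epsilon>" using \<epsilon> Fne by (simp add: \<delta>_def infdist_notempty)
      moreover have "bdd_below (dist x ` F)" by (rule bdd_belowI2[of _ 0]) simp
      ultimately show thesis using that cINF_less_iff[OF Fne] by blast
    qed
    \<comment> \<open>The disc is enlarged to one centred at a good point, where the maximal function is bounded.\<close>
    have cb: "cball x (s x) \<subseteq> cball x' (4 * s x)"
    proof
      fix z assume "z \<in> cball x (s x)"
      then have "dist x' z \<le> dist x x' + s x" by (metis add_left_mono dist_commute dist_triangle_le mem_cball)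
      also have "\<dots> \<le> 4 * s x" using x'(2) slo[of x] d0[of x] spos[of x] by linarith
      finally show "z \<in> cball x' (4 * s x)" by simp
    qed
    have "(LINT z|lborel. Gx z) \<le> (LINT z:cball x' (4 * s x)|lborel. g z)"
      unfolding set_lebesgue_integral_def
    proof (rule integral_mono)
      show "integrable lborel (\<lambda>z. indicator (cball x' (4 * s x)) z *\<^sub>R g z)"
        using integrable_mult_indicator[OF _ gi, of "cball x' (4 * s x)"] by simp
      show "Gx z \<le> indicator (cball x' (4 * s x)) z *\<^sub>R g z" for z
        using cb gpos[of z] by (auto simp: Gx_def indicator_def)
    qed (rule Gxi)
    also have "\<dots> \<le> l * pi * (4 * s x)\<^sup>2"
      unfolding g_def using x'(1) spos[of x] by (intro M) (auto simp: F_def)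
    finally have "(s x)\<^sup>2 * (LINT y|lborel. Gx (x + s x *\<^sub>R y)) \<le> (s x)\<^sup>2 * (16 * l * pi)"
      using aff spos[of x] by (simp add: power2_eq_square algebra_simps)
    then have "(LINT y|lborel. Gx (x + s x *\<^sub>R y)) \<le> 16 * l * pi" using spos[of x] by simp
    then have "2 * B * (LINT y|lborel. Gx (x + s x *\<^sub>R y)) \<le> 2 * B * (16 * l * pi)"
      using B0 by (intro mult_left_mono) auto
    then have bound: "(LINT y|lborel. 2 * B * Gx (x + s x *\<^sub>R y)) \<le> 32 * pi * B * l"
      by (simp add: algebra_simps)
    have "norm (h1 x) \<le> (LINT y|lborel. 2 * B * Gx (x + s x *\<^sub>R y))"
      unfolding h1_def
    proof (rule order_trans[OF integral_norm_bound integral_mono])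
      show "integrable lborel (\<lambda>y. norm (G1 x y))" using fi[OF cGx(2) z(2)] by simp
      show "norm (G1 x y) \<le> 2 * B * Gx (x + s x *\<^sub>R y)" for y
        unfolding G1_def by (rule pt; rule c2; use re sb in auto)
    qed (rule inti)
    moreover have "norm (h2 x) \<le> (LINT y|lborel. 2 * B * Gx (x + s x *\<^sub>R y))"
      unfolding h2_def
    proof (rule order_trans[OF integral_norm_bound integral_mono])
      show "integrable lborel (\<lambda>y. norm (G2 x y))" using fi[OF cGx(3) z(3)] by simp
      show "norm (G2 x y) \<le> 2 * B * Gx (x + s x *\<^sub>R y)" for y
        unfolding G2_def by (rule pt; rule c2; use re sb in auto)
    qed (rule inti)
    ultimately show ?thesis using bound by linarith
  qed
  \<comment> \<open>On the good set the terms with derivatives of \<open>s\<close> average to 0, up to the oscillation of \<open>a\<close> and \<open>b\<close>, since \<open>\<rho>\<close> is even.\<close>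
  have odd: "(LINT y|lborel. \<rho> y * l y) = 0" "integrable lborel (\<lambda>y. \<rho> y * l y)"
    if l: "continuous_on UNIV l" "\<And>y. l (- y) = - l y" for l :: "complex \<Rightarrow> real"
  proof -
    have c: "continuous_on UNIV (\<lambda>y. \<rho> y * l y)" by (intro continuous_intros \<rho>c l)
    show "integrable lborel (\<lambda>y. \<rho> y * l y)"
      by (rule continuous_compact_support_integrable[OF c, of 1]) (simp add: \<rho>0)
    have "(LINT y|lborel. \<rho> (- y) * l (- y)) = (LINT y|lborel. \<rho> y * l y)"
      using lborel_integral_reflect[OF borel_measurable_continuous_onI[OF c]] by simp
    then show "(LINT y|lborel. \<rho> y * l y) = 0" by (simp add: l(2) mollifierD(4)[OF \<rho>])
  qed
  note oddR = odd[OF continuous_on_Re[OF continuous_on_id], simplified] and oddI = odd[OF continuous_on_Im[OF continuous_on_id], simplified]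
  have close: "norm (h1 x - a x) \<le> \<tau> \<and> norm (h2 x - b x) \<le> \<tau>" if x: "x \<in> W - V" for x
  proof -
    have "\<delta> x = 0" using x by (simp add: \<delta>_def F_def)
    then have sx: "s x \<le> 3 * \<epsilon>" using shi[of x] by simp
    have xU: "cball x (2 * t) \<subseteq> U" "x \<in> U" using W x t by (auto simp: subset_eq)
    have pt: "norm (\<rho> y *\<^sub>R (\<alpha> *\<^sub>R (a (p x y) - a x) + \<beta> *\<^sub>R (b (p x y) - b x))) \<le> \<rho> y * \<tau>"
      if "\<not> 1 < cmod y \<Longrightarrow> \<bar>\<alpha>\<bar> \<le> 2" "\<not> 1 < cmod y \<Longrightarrow> \<bar>\<beta>\<bar> \<le> 2" for y \<alpha> \<beta>
    proof (cases "1 < cmod y")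
      case False
      then have "s x * cmod y \<le> s x" using spos[of x] by (simp add: mult_left_le)
      moreover have "dist (p x y) x = s x * cmod y" using spos[of x] by (simp add: p_def dist_norm)
      ultimately have d: "dist (p x y) x \<le> s x" by linarith
      then have "p x y \<in> U" using xU s2t[of x] by (auto simp: dist_commute subset_eq)
      then have "norm (a (p x y) - a x) \<le> \<tau> / 4" "norm (b (p x y) - b x) \<le> \<tau> / 4"
        using da(2)[OF xU(2), of "p x y"] db(2)[OF xU(2), of "p x y"] d sx \<epsilon> by (simp_all add: dist_norm)
      then have "2 * (norm (a (p x y) - a x) + norm (b (p x y) - b x)) \<le> 2 * (\<tau> / 4 + \<tau> / 4)"
        by (intro mult_left_mono add_mono) auto
      then have "norm (\<alpha> *\<^sub>R (a (p x y) - a x) + \<beta> *\<^sub>R (b (p x y) - b x)) \<le> 2 * (\<tau> / 4 + \<tau> / 4)"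
        by (rule order_trans[OF lin[OF that[OF False]]])
      then have "norm (\<alpha> *\<^sub>R (a (p x y) - a x) + \<beta> *\<^sub>R (b (p x y) - b x)) \<le> \<tau>" by simp
      then show ?thesis using mollifierD(2)[OF \<rho>, of y] by (simp add: mult_left_mono)
    qed (simp add: \<rho>0)
    have i: "integrable lborel (G1 x)" "integrable lborel (G2 x)" using fi[OF cGx(2) z(2)] fi[OF cGx(3) z(3)] by auto
    have j: "integrable lborel (\<lambda>y. \<rho> y *\<^sub>R A + (\<rho> y * Re y) *\<^sub>R A' + (\<rho> y * Im y) *\<^sub>R A'')"
      "(LINT y|lborel. \<rho> y *\<^sub>R A + (\<rho> y * Re y) *\<^sub>R A' + (\<rho> y * Im y) *\<^sub>R A'') = A" for A A' A'' :: complex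
      using \<rho>i oddR oddI by simp_all
    have "h1 x - a x = (LINT y|lborel. G1 x y - (\<rho> y *\<^sub>R a x + (\<rho> y * Re y) *\<^sub>R (s1 x *\<^sub>R a x) + (\<rho> y * Im y) *\<^sub>R (s1 x *\<^sub>R b x)))"
      unfolding h1_def Bochner_Integration.integral_diff[OF i(1) j(1)] j(2) ..
    also have "norm \<dots> \<le> (LINT y|lborel. \<rho> y * \<tau>)"
    proof (rule order_trans[OF integral_norm_bound integral_mono])
      fix y
      have "G1 x y - (\<rho> y *\<^sub>R a x + (\<rho> y * Re y) *\<^sub>R (s1 x *\<^sub>R a x) + (\<rho> y * Im y) *\<^sub>R (s1 x *\<^sub>R b x))
         = \<rho> y *\<^sub>R ((1 + s1 x * Re y) *\<^sub>R (a (p x y) - a x) + (s1 x * Im y) *\<^sub>R (b (p x y) - b x))"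
        by (simp add: G1_def algebra_simps)
      also have "norm \<dots> \<le> \<rho> y * \<tau>" by (rule pt; rule c2; use re sb in auto)
      finally show "norm (G1 x y - (\<rho> y *\<^sub>R a x + (\<rho> y * Re y) *\<^sub>R (s1 x *\<^sub>R a x) + (\<rho> y * Im y) *\<^sub>R (s1 x *\<^sub>R b x))) \<le> \<rho> y * \<tau>" .
    next
      show "integrable lborel (\<lambda>y. norm (G1 x y - (\<rho> y *\<^sub>R a x + (\<rho> y * Re y) *\<^sub>R (s1 x *\<^sub>R a x) + (\<rho> y * Im y) *\<^sub>R (s1 x *\<^sub>R b x))))"
        by (intro integrable_norm Bochner_Integration.integrable_diff i j)
    qed (use \<rho>i in auto)
    finally have 1: "norm (h1 x - a x) \<le> \<tau>" using \<rho>i by simp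
    have "h2 x - b x = (LINT y|lborel. G2 x y - (\<rho> y *\<^sub>R b x + (\<rho> y * Re y) *\<^sub>R (s2 x *\<^sub>R a x) + (\<rho> y * Im y) *\<^sub>R (s2 x *\<^sub>R b x)))"
      unfolding h2_def Bochner_Integration.integral_diff[OF i(2) j(1)] j(2) ..
    also have "norm \<dots> \<le> (LINT y|lborel. \<rho> y * \<tau>)"
    proof (rule order_trans[OF integral_norm_bound integral_mono])
      fix y
      have "G2 x y - (\<rho> y *\<^sub>R b x + (\<rho> y * Re y) *\<^sub>R (s2 x *\<^sub>R a x) + (\<rho> y * Im y) *\<^sub>R (s2 x *\<^sub>R b x))
         = \<rho> y *\<^sub>R ((s2 x * Re y) *\<^sub>R (a (p x y) - a x) + (1 + s2 x * Im y) *\<^sub>R (b (p x y) - b x))"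
        by (simp add: G2_def algebra_simps)
      also have "norm \<dots> \<le> \<rho> y * \<tau>" by (rule pt; rule c2; use re sb in auto)
      finally show "norm (G2 x y - (\<rho> y *\<^sub>R b x + (\<rho> y * Re y) *\<^sub>R (s2 x *\<^sub>R a x) + (\<rho> y * Im y) *\<^sub>R (s2 x *\<^sub>R b x))) \<le> \<rho> y * \<tau>" .
    next
      show "integrable lborel (\<lambda>y. norm (G2 x y - (\<rho> y *\<^sub>R b x + (\<rho> y * Re y) *\<^sub>R (s2 x *\<^sub>R a x) + (\<rho> y * Im y) *\<^sub>R (s2 x *\<^sub>R b x))))"
        by (intro integrable_norm Bochner_Integration.integrable_diff i j)
    qed (use \<rho>i in auto)
    finally show ?thesis using 1 \<rho>i by simp
  qed
  show ?thesis using hC osc big close by blast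
qed

section \<open>Gradient tails under exponential integrability of the distortion\<close>

lemma integrable_superlevel:
  fixes g :: "'a \<Rightarrow> real"
  assumes g: "integrable M g"
  shows "integrable M (\<lambda>x. g x * indicator {x. c < g x} x)"
proof (rule Bochner_Integration.integrable_bound[OF g])
  have [measurable]: "g \<in> borel_measurable M" using g by auto
  have "(\<lambda>x. if c < g x then g x else 0) \<in> borel_measurable M" by measurable
  moreover have "(\<lambda>x. g x * indicator {x. c < g x} x) = (\<lambda>x. if c < g x then g x else 0)"
    by (auto simp: indicator_def)
  ultimately show "(\<lambda>x. g x * indicator {x. c < g x} x) \<in> borel_measurable M" by simp
qed (auto simp: indicator_def)

lemma integral_small_on_small_sets:
  fixes u :: "'a \<Rightarrow> real"
  assumes u: "integrable M u" and pos: "\<And>x. 0 \<le> u x" and e: "0 < e"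
  shows "\<exists>d>0. \<forall>A\<in>sets M. emeasure M A < ennreal d \<longrightarrow> (LINT x:A|M. u x) < e"
proof -
  have [measurable]: "u \<in> borel_measurable M" using u by auto
  have "(\<lambda>n. LINT x|M. u x * indicator {x. real n < u x} x) \<longlonglongrightarrow> integral\<^sup>L M (\<lambda>x. 0::real)"
  proof (rule integral_dominated_convergence[where w=u])
    show "AE x in M. (\<lambda>n. u x * indicator {x. real n < u x} x) \<longlonglongrightarrow> 0"
    proof (rule AE_I2)
      fix x
      obtain N :: nat where N: "u x \<le> real N" using real_arch_simple by blast
      have "\<forall>\<^sub>F n in sequentially. 0 = u x * indicator {x. real n < u x} x"
        using eventually_ge_at_top[of N]
      proof eventually_elim
        case (elim n)
        then have "u x \<le> real n" using N by linarith
        then show ?case by simp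
      qed
      then show "(\<lambda>n. u x * indicator {x. real n < u x} x) \<longlonglongrightarrow> 0"
        by (rule Lim_transform_eventually[OF tendsto_const])
    qed
    show "AE x in M. norm (u x * indicator {x. real n < u x} x) \<le> u x" for n
      by (rule AE_I2) (use pos in \<open>auto simp: indicator_def\<close>)
  qed (use u integrable_superlevel[OF u] in auto)
  then have "(\<lambda>n. LINT x|M. u x * indicator {x. real n < u x} x) \<longlonglongrightarrow> 0" by simp
  from order_tendstoD(2)[OF this, of "e/2"] e
  obtain n where n: "(LINT x|M. u x * indicator {x. real n < u x} x) < e/2"
    by (auto simp: eventually_sequentially)
  define d where "d = e / (2 * (real n + 1))"
  have d: "0 < d" using e by (simp add: d_def)
  show ?thesis
  proof (intro exI conjI ballI impI)
    fix A assume A [measurable]: "A \<in> sets M" and Ad: "emeasure M A < ennreal d"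
    then have fin: "emeasure M A < \<infinity>" using less_le_trans top_greatest by fastforce
    have md: "measure M A < d" using Ad fin d by (simp add: emeasure_eq_ennreal_measure ennreal_less_iff)
    have i1: "integrable M (\<lambda>x. u x * indicator {x. real n < u x} x)"
      by (rule integrable_superlevel[OF u])
    have "(LINT x:A|M. u x) \<le> (LINT x|M. u x * indicator {x. real n < u x} x + real n * indicator A x)"
      unfolding set_lebesgue_integral_def
    proof (rule integral_mono)
      show "integrable M (\<lambda>x. indicator A x *\<^sub>R u x)" by (rule integrable_mult_indicator[OF A u])
      show "integrable M (\<lambda>x. u x * indicator {x. real n < u x} x + real n * indicator A x)"
        using i1 fin by (intro Bochner_Integration.integrable_add integrable_mult_right) (auto simp: integrable_indicator_iff)
      show "indicator A x *\<^sub>R u x \<le> u x * indicator {x. real n < u x} x + real n * indicator A x" for x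
        using pos[of x] by (auto simp: indicator_def)
    qed
    also have "\<dots> = (LINT x|M. u x * indicator {x. real n < u x} x) + real n * measure M A"
      using i1 fin by (subst Bochner_Integration.integral_add) (auto simp: integrable_indicator_iff)
    also have "real n * measure M A \<le> (real n + 1) * d" using md d by (intro mult_mono) auto
    also have "(real n + 1) * d = e / 2" by (simp add: d_def field_simps)
    finally show "(LINT x:A|M. u x) < e" using n by linarith
  qed (rule d)
qed

lemma div_ln_mono:
  fixes s t :: real
  assumes "0 \<le> s" "s \<le> t"
  shows "s / ln (exp 1 + s) \<le> t / ln (exp 1 + t)"
proof -
  have e: "0 < exp 1 + s" "0 < exp 1 + t" using assms by (auto intro: add_pos_nonneg)
  have l1: "1 \<le> ln (exp 1 + s)"
    using ln_le_cancel_iff[of "exp 1" "exp 1 + s"] assms e by simp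
  have l2: "ln (exp 1 + s) \<le> ln (exp 1 + t)" using assms e by simp
  have "ln (exp 1 + t) - ln (exp 1 + s) = ln ((exp 1 + t) / (exp 1 + s))" using e by (simp add: ln_div)
  also have "\<dots> \<le> (exp 1 + t) / (exp 1 + s) - 1" using e by (intro ln_le_minus_one) simp
  also have "\<dots> = (t - s) / (exp 1 + s)" using e by (simp add: field_simps)
  finally have "s * (ln (exp 1 + t) - ln (exp 1 + s)) \<le> s * ((t - s) / (exp 1 + s))"
    using assms by (intro mult_left_mono)
  also have "\<dots> = (s / (exp 1 + s)) * (t - s)" by simp
  also have "\<dots> \<le> 1 * (t - s)" using assms e by (intro mult_right_mono) auto
  also have "\<dots> \<le> ln (exp 1 + s) * (t - s)" using assms l1 by (intro mult_right_mono) auto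
  finally have "s * ln (exp 1 + t) \<le> t * ln (exp 1 + s)" by (simp add: algebra_simps)
  then show ?thesis using l1 l2 by (simp add: field_simps)
qed

lemma ln_Suc_le: "0 < u \<Longrightarrow> ln (u + 1) \<le> ln u + 1 / (u::real)"
proof -
  assume u: "0 < u"
  have "ln (u + 1) - ln u = ln ((u + 1) / u)" using u by (simp add: ln_div)
  also have "\<dots> \<le> (u + 1) / u - 1" using u by (intro ln_le_minus_one) simp
  also have "\<dots> = 1 / u" using u by (simp add: field_simps)
  finally show ?thesis by simp
qed

text \<open>
  A shift of the sequence \<open>k log k\<close>, whose reciprocals have a divergent sum. The shift makes the logarithm at
  least \<open>1\<close> and the growth so slow that consecutive quotients are at most \<open>3/2\<close>.
\<close>

definition divergent_weight :: "nat \<Rightarrow> real" where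
  "divergent_weight k = (real k + 8) * ln (real k + 8)"

lemma ln_ge_1: "1 \<le> ln (real k + 8)"
proof -
  have "exp 1 \<le> real k + 8" using exp_le by linarith
  then show ?thesis by (metis exp_gt_zero ln_exp ln_le_cancel_iff order_less_le_trans)
qed

lemma divergent_weight_ge: "8 \<le> divergent_weight k"
  using mult_mono[of 8 "real k + 8" 1 "ln (real k + 8)"] ln_ge_1[of k] by (simp add: divergent_weight_def)

lemma divergent_weight_Suc: "divergent_weight (Suc k) \<le> 3/2 * divergent_weight k"
proof -
  define u where "u = real k + 8"
  have u: "8 \<le> u" "1 \<le> ln u" using ln_ge_1[of k] by (auto simp: u_def)
  have "ln (u + 1) \<le> ln u + 1 / u" using u by (intro ln_Suc_le) simp
  also have "1 / u \<le> 1 / 8 * ln u"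
  proof -
    have "1 / u \<le> 1 / 8" using u by (simp add: field_simps)
    then show ?thesis using u by linarith
  qed
  finally have 1: "ln (u + 1) \<le> 9 / 8 * ln u" by simp
  have "(u + 1) * ln (u + 1) \<le> (9 / 8 * u) * (9 / 8 * ln u)"
    using u 1 by (intro mult_mono) auto
  also have "\<dots> \<le> 3/2 * (u * ln u)" using u by simp
  finally show ?thesis by (simp add: divergent_weight_def u_def algebra_simps)
qed

text \<open>
  The quotients of consecutive summands are at least \<open>4/3\<close>, so the sum is comparable with its last term.
\<close>

lemma sum_power2_over_weight: "(\<Sum>k\<le>m. 2 ^ k / divergent_weight k) \<le> 4 * 2 ^ m / divergent_weight m"
proof (induction m)
  case 0
  then show ?case using divergent_weight_ge[of 0] by (simp add: field_simps)
next
  case (Suc m)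
  have p: "0 < divergent_weight m" "0 < divergent_weight (Suc m)" using divergent_weight_ge[of m] divergent_weight_ge[of "Suc m"] by linarith+
  have "1 / divergent_weight m \<le> 3/2 / divergent_weight (Suc m)"
    using divergent_weight_Suc[of m] p by (simp add: field_simps)
  then have "4 * 2 ^ m * (1 / divergent_weight m) \<le> 4 * 2 ^ m * (3/2 / divergent_weight (Suc m))"
    by (intro mult_left_mono) auto
  with Suc show ?case by simp
qed

text \<open>
  The sum is compared with the telescoping differences of \<open>log log\<close>.
\<close>

lemma sum_inverse_weight_unbounded: "\<exists>n. b < (\<Sum>k\<in>{m..<n}. 1 / divergent_weight k)"
proof -
  define L where "L = (\<lambda>k. ln (ln (real k + 8)))"
  have step: "L (Suc k) - L k \<le> 1 / divergent_weight k" for k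
  proof -
    define u where "u = real k + 8"
    have u: "8 \<le> u" "1 \<le> ln u" using ln_ge_1[of k] by (auto simp: u_def)
    have p: "0 < ln (u + 1)" using u by simp
    have "ln (ln (u + 1)) - ln (ln u) = ln (ln (u + 1) / ln u)" using u p by (simp add: ln_div)
    also have "\<dots> \<le> ln (u + 1) / ln u - 1" using u p by (intro ln_le_minus_one) simp
    also have "\<dots> \<le> (ln u + 1 / u) / ln u - 1"
      using u ln_Suc_le[of u] by (intro diff_right_mono divide_right_mono) auto
    also have "\<dots> = 1 / (u * ln u)" using u by (simp add: field_simps)
    finally show ?thesis by (simp add: L_def divergent_weight_def u_def add_ac)
  qed
  have tel: "L n - L m \<le> (\<Sum>k\<in>{m..<n}. 1 / divergent_weight k)" if "m \<le> n" for n
    using that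
  proof (induction n rule: dec_induct)
    case (step n)
    then show ?case using \<open>\<And>k. L (Suc k) - L k \<le> 1 / divergent_weight k\<close>[of n] by simp
  qed simp
  have "filterlim L at_top sequentially"
    unfolding L_def
    by (intro filterlim_compose[OF ln_at_top] filterlim_tendsto_add_at_top[OF tendsto_const, of _ _ 8, simplified add.commute]
       filterlim_real_sequentially)
  then have "\<forall>\<^sub>F n in sequentially. b + L m + 1 \<le> L n" by (simp add: filterlim_at_top)
  then have "\<forall>\<^sub>F n in sequentially. b + L m + 1 \<le> L n \<and> m \<le> n"
    using eventually_ge_at_top[of m] by eventually_elim simp
  then obtain n where "b + L m + 1 \<le> L n" "m \<le> n" by (auto simp: eventually_sequentially)
  then show ?thesis using tel[of n] by (intro exI[of _ n]) linarith
qed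

lemma dyadic_bracket:
  fixes x :: real
  assumes "1 < x"
  shows "\<exists>m. 2 ^ m < x \<and> x \<le> 2 ^ Suc m"
proof -
  obtain n where "x < 2 ^ n" using real_arch_pow[of 2 x] by auto
  then have ex: "x \<le> 2 ^ n" by simp
  define k where "k = (LEAST n. x \<le> 2 ^ n)"
  have k: "x \<le> 2 ^ k" unfolding k_def by (rule LeastI[of _ n]) (rule ex)
  have "k \<noteq> 0" using k assms by (intro notI) simp
  then obtain m where m: "k = Suc m" by (cases k) auto
  have "\<not> x \<le> 2 ^ m" using not_less_Least[of m "\<lambda>n. x \<le> 2 ^ n"] m by (simp add: k_def)
  then show ?thesis using k m by (intro exI[of _ m]) simp
qed

text \<open>
  If \<open>t\<close> is at least a large multiple of \<open>m log m\<close>, then \<open>t / log (e + t)\<close> is at least a large multiple of \<open>m\<close>: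
  the factor \<open>A\<close> enters the numerator, but only its logarithm enters the denominator.
\<close>

lemma weight_constant:
  fixes p :: real
  assumes p: "0 < p"
  shows "\<exists>A\<ge>1. \<forall>m t. A * divergent_weight m \<le> t \<longrightarrow> 4 ^ Suc m \<le> exp (p * (t / ln (exp 1 + t)))"
proof -
  define b where "b = max 2 (8 / p)"
  define A where "A = b\<^sup>2"
  have b: "2 \<le> b" "8 / p \<le> b" by (auto simp: b_def)
  have A: "1 \<le> A" unfolding A_def using b by (intro one_le_power) simp
  have e3: "exp 1 \<le> (3::real)" by (rule exp_le)
  have eA: "0 < exp 1 + A" using A by (intro add_pos_nonneg) auto
  have lA: "ln (exp 1 + A) \<le> 2 * b"
  proof -
    have "exp 1 + A \<le> (1 + b) ^ 2" using b e3 by (simp add: A_def power2_eq_square algebra_simps)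
    moreover have "0 < exp 1 + A" using A by (intro add_pos_nonneg) auto
    moreover have "0 < (1 + b) ^ 2" using b by simp
    ultimately have "ln (exp 1 + A) \<le> ln ((1 + b) ^ 2)" by (subst ln_le_cancel_iff)
    also have "\<dots> = 2 * ln (1 + b)" using b by (simp add: ln_realpow)
    also have "\<dots> \<le> 2 * b" using ln_add_one_self_le_self[of b] b by simp
    finally show ?thesis .
  qed
  have "4 ^ Suc m \<le> exp (p * (t / ln (exp 1 + t)))" if t: "A * divergent_weight m \<le> t" for m t
  proof -
    define u where "u = real m + 8"
    define s where "s = A * (u * ln u)"
    have u: "8 \<le> u" "1 \<le> ln u" using ln_ge_1[of m] by (auto simp: u_def)
    have s0: "0 \<le> s" using A u by (simp add: s_def)
    have st: "s \<le> t" using t by (simp add: s_def u_def divergent_weight_def)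
    have lnu: "ln u \<le> u" using ln_le_minus_one[of u] u by linarith
    have "exp 1 + s \<le> (exp 1 + A) * u\<^sup>2"
    proof -
      have "exp 1 * 1 \<le> exp 1 * u\<^sup>2" using u by (intro mult_left_mono one_le_power) auto
      moreover have "A * (u * ln u) \<le> A * (u * u)" using u A lnu by (intro mult_left_mono) auto
      ultimately have "exp 1 * 1 + A * (u * ln u) \<le> exp 1 * u\<^sup>2 + A * (u * u)" by (rule add_mono)
      then show ?thesis by (simp add: s_def power2_eq_square distrib_right)
    qed
    then have "ln (exp 1 + s) \<le> ln ((exp 1 + A) * u\<^sup>2)"
      using s0 A u by (subst ln_le_cancel_iff) (auto intro!: mult_pos_pos add_pos_nonneg)
    also have "\<dots> = ln (exp 1 + A) + 2 * ln u" using u A by (subst ln_mult) (use eA in \<open>auto simp: ln_realpow\<close>)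
    also have "\<dots> \<le> 2 * b * ln u + b * ln u"
    proof (rule add_mono)
      have "2 * b * 1 \<le> 2 * b * ln u" using b u by (intro mult_left_mono) auto
      then show "ln (exp 1 + A) \<le> 2 * b * ln u" using lA by simp
      show "2 * ln u \<le> b * ln u" using b u by (intro mult_right_mono) auto
    qed
    also have "\<dots> \<le> 4 * b * ln u" using b u by (simp add: algebra_simps)
    finally have ls: "ln (exp 1 + s) \<le> 4 * b * ln u" .
    have lpos: "0 < ln (exp 1 + s)"
    proof -
      have "1 < exp 1 + s" using s0 exp_ge_add_one_self[of "1::real"] by linarith
      then show ?thesis by simp
    qed
    have "2 * u \<le> p * (b / 4 * u)"
    proof -
      have "8 \<le> p * b" using b(2) p by (simp add: field_simps)
      then have "8 * u \<le> p * b * u" using u by (intro mult_right_mono) auto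
      then show ?thesis by simp
    qed
    also have "b / 4 * u = s / (4 * b * ln u)" using b u by (simp add: s_def A_def power2_eq_square)
    also have "\<dots> \<le> s / ln (exp 1 + s)" using ls lpos s0 by (intro divide_left_mono) auto
    also have "\<dots> \<le> t / ln (exp 1 + t)" by (rule div_ln_mono[OF s0 st])
    finally have 1: "2 * u \<le> p * (t / ln (exp 1 + t))" using p by (simp add: mult_left_mono)
    have "(4::real) ^ Suc m = 2 ^ (2 * Suc m)" by (simp add: power_mult)
    also have "\<dots> \<le> exp 1 ^ (2 * Suc m)"
      using exp_ge_add_one_self[of "1::real"] by (intro power_mono) auto
    also have "\<dots> = exp (real (2 * Suc m))" by (metis exp_of_nat_mult mult.right_neutral)
    also have "\<dots> \<le> exp (2 * u)" by (simp add: u_def)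
    also have "\<dots> \<le> exp (p * (t / ln (exp 1 + t)))" using 1 by simp
    finally show ?thesis .
  qed
  with A show ?thesis by blast
qed

text \<open>
  Suppose that the quantity stays above \<open>e\<close> for all levels above \<open>L\<close>. Summing it over the levels \<open>2\<^sup>k\<close> with
  weights \<open>1 / (k log k)\<close> gives a divergent series. The sum is also the integral of a function \<open>F\<close> which, where
  \<open>2\<^sup>m < g \<le> 2\<^sup>m\<^sup>+\<^sup>1\<close>, is at most a multiple of \<open>g\<^sup>2 / (m log m)\<close>. If \<open>K\<close> is at most a multiple of
  \<open>m log m\<close>, this is dominated by \<open>J\<close>; otherwise \<open>g\<^sup>2 \<le> 4\<^sup>m\<^sup>+\<^sup>1\<close> is dominated by \<open>P\<close>. So the integrals are
  bounded, a contradiction.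
\<close>

lemma tail_integral_small:
  fixes g J K P :: "'a \<Rightarrow> real"
  assumes g: "integrable M g" "\<And>x. 0 \<le> g x" and J: "integrable M J" and P: "integrable M P"
    and p: "0 < p"
    and ae: "AE x in M. 0 \<le> J x \<and> (g x)\<^sup>2 \<le> c * (K x * J x) \<and> exp (p * (K x / ln (exp 1 + K x))) \<le> P x"
    and c: "0 < c" and e: "0 < e"
  shows "\<exists>l>L. l * (LINT x|M. g x * indicator {x. l < g x} x) < e"
proof (rule ccontr)
  assume not: "\<not> ?thesis"
  have [measurable]: "g \<in> borel_measurable M" using g by auto
  obtain A where A: "1 \<le> A" and Aw: "\<And>m t. A * divergent_weight m \<le> t \<Longrightarrow> 4 ^ Suc m \<le> exp (p * (t / ln (exp 1 + t)))"
    using weight_constant[OF p] by blast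
  obtain m0 where m0: "max L 1 < 2 ^ m0" using real_arch_pow[of 2 "max L 1"] by auto
  let ?w = divergent_weight
  define F where "F = (\<lambda>n x. \<Sum>k\<in>{m0..<n}. 2 ^ k / ?w k * (g x * indicator {x. 2 ^ k < g x} x))"
  have wpos: "0 < ?w k" for k using divergent_weight_ge[of k] by linarith
  have Fi: "integrable M (F n)" for n
    unfolding F_def by (intro Bochner_Integration.integrable_sum integrable_mult_right integrable_superlevel g)
  have pt: "F n x \<le> 4 * A * c * J x + 4 * P x"
    if x: "0 \<le> J x" "(g x)\<^sup>2 \<le> c * (K x * J x)" "exp (p * (K x / ln (exp 1 + K x))) \<le> P x" for n x
  proof -
    have P0: "0 \<le> P x" using x(3) exp_ge_zero order_trans by blast
    show ?thesis
    proof (cases "1 < g x")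
      case False
      have "indicator {x. 2 ^ k < g x} x = (0::real)" for k
      proof -
        have "(1::real) \<le> 2 ^ k" by simp
        then have "\<not> 2 ^ k < g x" using False by linarith
        then show ?thesis by simp
      qed
      then have "F n x = 0" by (simp add: F_def)
      then show ?thesis using x(1) P0 A c by simp
    next
      case True
      obtain m where m: "2 ^ m < g x" "g x \<le> 2 ^ Suc m" using dyadic_bracket[OF True] by blast
      have "F n x \<le> (\<Sum>k\<le>m. 2 ^ k / ?w k * g x)"
        unfolding F_def
      proof -
        have z: "k \<le> m" if "2 ^ k < g x" for k
        proof (rule ccontr)
          assume "\<not> k \<le> m"
          then have "(2::real) ^ Suc m \<le> 2 ^ k" by (intro power_increasing) auto
          then show False using that m(2) by linarith
        qed
        have "(\<Sum>k\<in>{m0..<n}. 2 ^ k / ?w k * (g x * indicator {x. 2 ^ k < g x} x))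
            \<le> (\<Sum>k\<in>{m0..<n}. if k \<le> m then 2 ^ k / ?w k * g x else 0)"
          using z wpos g(2)[of x] by (intro sum_mono) (auto simp: indicator_def less_imp_le)
        also have "\<dots> = (\<Sum>k\<in>{m0..<n} \<inter> {..m}. 2 ^ k / ?w k * g x)"
          by (subst sum.inter_restrict) (simp_all only: finite_atLeastLessThan atMost_iff)
        also have "\<dots> \<le> (\<Sum>k\<le>m. 2 ^ k / ?w k * g x)"
          using wpos g(2)[of x] by (intro sum_mono2) (auto simp: less_imp_le)
        finally show "(\<Sum>k\<in>{m0..<n}. 2 ^ k / ?w k * (g x * indicator {x. 2 ^ k < g x} x)) \<le> (\<Sum>k\<le>m. 2 ^ k / ?w k * g x)" .
      qed
      also have "\<dots> = (\<Sum>k\<le>m. 2 ^ k / ?w k) * g x" by (simp add: sum_distrib_right)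
      also have "\<dots> \<le> (4 * 2 ^ m / ?w m) * g x"
        using sum_power2_over_weight[of m] g(2)[of x] by (intro mult_right_mono) auto
      also have "\<dots> \<le> (4 * g x / ?w m) * g x"
        using m(1) wpos[of m] g(2)[of x] by (intro mult_right_mono divide_right_mono) auto
      also have "\<dots> = 4 * ((g x)\<^sup>2 / ?w m)" by (simp add: power2_eq_square)
      finally have 1: "F n x \<le> 4 * ((g x)\<^sup>2 / ?w m)" .
      show ?thesis
      proof (cases "A * ?w m \<le> K x")
        case True
        have "(g x)\<^sup>2 \<le> (2 ^ Suc m)\<^sup>2" using m(2) g(2)[of x] by (intro power_mono)
        also have "\<dots> = 4 ^ Suc m" by (simp add: power2_eq_square flip: power_mult_distrib)
        also have "\<dots> \<le> P x" using Aw[OF True] x(3) by linarith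
        finally have "(g x)\<^sup>2 \<le> P x" .
        then have "(g x)\<^sup>2 / ?w m \<le> P x / 1"
          using divergent_weight_ge[of m] P0 by (intro frac_le) auto
        moreover have "0 \<le> 4 * A * c * J x" using A c x(1) by simp
        ultimately show ?thesis using 1 by linarith
      next
        case False
        have "(g x)\<^sup>2 \<le> c * (A * ?w m * J x)"
          using x(1,2) False c by (meson less_eq_real_def linorder_not_le mult_left_mono mult_right_mono order_trans)
        then have "(g x)\<^sup>2 / ?w m \<le> A * c * J x" using wpos[of m] by (simp add: field_simps)
        then show ?thesis using 1 P0 by linarith
      qed
    qed
  qed
  define I where "I = (LINT x|M. 4 * A * c * J x + 4 * P x)"
  have bound: "(LINT x|M. F n x) \<le> I" for n
    unfolding I_def
  proof (rule integral_mono_AE[OF Fi])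
    show "AE x in M. F n x \<le> 4 * A * c * J x + 4 * P x" using ae by eventually_elim (rule pt; simp)
  qed (use J P in simp)
  have "e * (\<Sum>k\<in>{m0..<n}. 1 / ?w k) \<le> (LINT x|M. F n x)" for n
  proof -
    have "(LINT x|M. F n x) = (\<Sum>k\<in>{m0..<n}. 2 ^ k / ?w k * (LINT x|M. g x * indicator {x. 2 ^ k < g x} x))"
      unfolding F_def
      by (subst Bochner_Integration.integral_sum) (auto intro!: integrable_mult_right integrable_superlevel g)
    also have "\<dots> \<ge> (\<Sum>k\<in>{m0..<n}. e * (1 / ?w k))"
    proof (rule sum_mono)
      fix k assume k: "k \<in> {m0..<n}"
      have "(2::real) ^ m0 \<le> 2 ^ k" using k by (intro power_increasing) auto
      then have "L < 2 ^ k" using m0 by linarith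
      then have "e \<le> 2 ^ k * (LINT x|M. g x * indicator {x. 2 ^ k < g x} x)" using not by force
      then have "e / ?w k \<le> 2 ^ k * (LINT x|M. g x * indicator {x. 2 ^ k < g x} x) / ?w k"
        using wpos[of k] by (intro divide_right_mono) auto
      then show "e * (1 / ?w k) \<le> 2 ^ k / ?w k * (LINT x|M. g x * indicator {x. 2 ^ k < g x} x)" by simp
    qed
    finally show ?thesis by (simp add: sum_distrib_left)
  qed
  then have "e * (\<Sum>k\<in>{m0..<n}. 1 / ?w k) \<le> I" for n using bound order_trans by blast
  moreover obtain n where "I / e < (\<Sum>k\<in>{m0..<n}. 1 / ?w k)" using sum_inverse_weight_unbounded by blast
  ultimately show False using e by (simp add: field_simps) (meson not_le)
qed

section \<open>Pullback of 2-forms off a singular set\<close>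

definition jac :: "complex \<Rightarrow> complex \<Rightarrow> real" where
  "jac a b = Re a * Im b - Re b * Im a"

lemma jac_bound: "\<bar>jac a b\<bar> \<le> norm a * norm b"
proof -
  have "jac a b = Im (cnj a * b)" by (simp add: jac_def)
  then show ?thesis using abs_Im_le_cmod[of "cnj a * b"] by (simp add: norm_mult)
qed

lemma jac_diff_bound: "\<bar>jac p q - jac a b\<bar> \<le> norm (p - a) * norm q + norm a * norm (q - b)"
proof -
  have "jac p q - jac a b = jac (p - a) q + jac a (q - b)" by (simp add: jac_def algebra_simps)
  then show ?thesis using jac_bound[of "p - a" q] jac_bound[of a "q - b"] by linarith
qed

lemma C1_compose:
  fixes H :: "complex \<Rightarrow> real" and \<phi> :: "complex \<Rightarrow> complex"
  assumes H: "C1 H H1 H2" and \<phi>: "C1 \<phi> p q"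
  shows "C1 (\<lambda>x. H (\<phi> x)) (\<lambda>x. Re (p x) * H1 (\<phi> x) + Im (p x) * H2 (\<phi> x)) (\<lambda>x. Re (q x) * H1 (\<phi> x) + Im (q x) * H2 (\<phi> x))"
proof -
  note c = C1_continuous[OF \<phi>, of UNIV] C1_continuous_partials[OF \<phi>, of UNIV] C1_continuous_partials[OF H, of UNIV]
  have "((\<lambda>x. H (\<phi> x)) has_derivative (\<lambda>v. Re v *\<^sub>R (Re (p x) * H1 (\<phi> x) + Im (p x) * H2 (\<phi> x)) + Im v *\<^sub>R (Re (q x) * H1 (\<phi> x) + Im (q x) * H2 (\<phi> x)))) (at x)" for x
  proof -
    have "(\<phi> has_derivative (\<lambda>v. Re v *\<^sub>R p x + Im v *\<^sub>R q x)) (at x)"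
         "(H has_derivative (\<lambda>v. Re v *\<^sub>R H1 (\<phi> x) + Im v *\<^sub>R H2 (\<phi> x))) (at (\<phi> x))"
      using H \<phi> unfolding C1_def by blast+
    from has_derivative_compose[OF this] show ?thesis
      by (rule has_derivative_eq_rhs) (auto simp: algebra_simps)
  qed
  then show ?thesis
    unfolding C1_def
    by (auto intro!: continuous_intros c continuous_on_compose2[OF c(4)] continuous_on_compose2[OF c(5)])
qed

lemma C1_Im:
  fixes \<phi> :: "complex \<Rightarrow> complex"
  assumes \<phi>: "C1 \<phi> p q"
  shows "C1 (\<lambda>x. Im (\<phi> x)) (\<lambda>x. Im (p x)) (\<lambda>x. Im (q x))"
proof -
  have "((\<lambda>x. Im (\<phi> x)) has_derivative (\<lambda>v. Re v *\<^sub>R Im (p x) + Im v *\<^sub>R Im (q x))) (at x)" for x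
  proof -
    have "(\<phi> has_derivative (\<lambda>v. Re v *\<^sub>R p x + Im v *\<^sub>R q x)) (at x)" using \<phi> unfolding C1_def by blast
    from has_derivative_Im[OF this] show ?thesis by simp
  qed
  then show ?thesis unfolding C1_def using C1_continuous_partials[OF \<phi>, of UNIV] by (auto intro!: continuous_intros)
qed

text \<open>
  This is \<open>\<integral> d (\<psi> H(\<phi>)) \<and> d (Im \<phi>) = 0\<close>: the form \<open>h dx dy = d (H dy)\<close> is pulled back and tested
  against \<open>\<psi>\<close>.
\<close>

lemma pullback_identity_C1:
  fixes \<phi> p q :: "complex \<Rightarrow> complex"
  assumes \<psi>: "C1 \<psi> \<psi>1 \<psi>2" "\<And>x. R < cmod x \<Longrightarrow> \<psi> x = 0" and H: "C1 H h H2" and \<phi>: "C1 \<phi> p q"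
  shows "(LINT x|lborel. \<psi> x * h (\<phi> x) * jac (p x) (q x) + H (\<phi> x) * (\<psi>1 x * Im (q x) - \<psi>2 x * Im (p x))) = 0"
proof -
  have "(LINT x|lborel. (\<psi> x * (Re (p x) * h (\<phi> x) + Im (p x) * H2 (\<phi> x)) + \<psi>1 x * H (\<phi> x)) * Im (q x)
      - (\<psi> x * (Re (q x) * h (\<phi> x) + Im (q x) * H2 (\<phi> x)) + \<psi>2 x * H (\<phi> x)) * Im (p x)) = 0"
    by (rule integral_jacobian_C1_0[OF C1_mult[OF \<psi>(1) C1_compose[OF H \<phi>]] _ C1_Im[OF \<phi>], of R])
       (simp add: \<psi>(2))
  moreover have "(\<psi> x * (Re (p x) * h (\<phi> x) + Im (p x) * H2 (\<phi> x)) + \<psi>1 x * H (\<phi> x)) * Im (q x)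
      - (\<psi> x * (Re (q x) * h (\<phi> x) + Im (q x) * H2 (\<phi> x)) + \<psi>2 x * H (\<phi> x)) * Im (p x)
     = \<psi> x * h (\<phi> x) * jac (p x) (q x) + H (\<phi> x) * (\<psi>1 x * Im (q x) - \<psi>2 x * Im (p x))" for x
    by (simp add: jac_def algebra_simps)
  ultimately show ?thesis by simp
qed

lemma set_integrable_continuous:
  fixes c :: "complex \<Rightarrow> 'b::euclidean_space"
  assumes "compact U" "continuous_on U c"
  shows "set_integrable lebesgue U c"
proof -
  have "integrable lborel (\<lambda>x. indicator U x *\<^sub>R c x)" by (rule borel_integrable_compact[OF assms])
  then show ?thesis unfolding set_integrable_def by (simp add: integrable_completion)
qed

lemma set_integrable_mult_continuous:
  fixes c u :: "complex \<Rightarrow> real"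
  assumes U: "compact U" and c: "continuous_on U c" and u: "set_integrable lebesgue U u"
  shows "set_integrable lebesgue U (\<lambda>x. c x * u x)"
proof -
  have Ul: "U \<in> sets lebesgue" using borel_compact[OF U] by simp
  show ?thesis
    by (rule absolutely_integrable_bounded_measurable_product[OF bilinear_times continuous_imp_measurable_on_sets_lebesgue[OF c Ul] Ul _ u])
       (use compact_continuous_image[OF c U] compact_imp_bounded in blast)
qed

lemma set_integrable_compact_subset:
  fixes u :: "complex \<Rightarrow> 'b::euclidean_space"
  assumes "set_integrable lebesgue U u" "compact W" "W \<subseteq> U"
  shows "set_integrable lebesgue W u"
  by (rule set_integrable_subset[OF assms(1) _ assms(3)]) (use borel_compact[OF assms(2)] in simp)

text \<open>
  If \<open>g \<le> l / 4\<close> at a point where \<open>G > l / 2\<close>, then \<open>G\<close> is at most twice the perturbation \<open>d\<close>.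
\<close>

lemma superlevel_perturbation:
  fixes g d l :: real
  assumes "0 \<le> g" "0 \<le> d" "G \<le> g + d"
  shows "G * indicator {x. l / 2 < x} G \<le> g * indicator {x. l / 4 < x} g + 2 * d"
proof (cases "l / 2 < G")
  case True
  then show ?thesis using assms by (cases "l / 4 < g") (auto simp: indicator_def)
qed (use assms in \<open>auto simp: indicator_def\<close>)

text \<open>
  The gradient of \<open>f\<close> off \<open>E\<close> is merely integrable. The last assumption replaces square integrability: it
  supplies arbitrarily large levels \<open>l\<close> at which a Lipschitz truncation of \<open>f\<close> changes the gradient only on
  sets that are small compared with \<open>1 / l\<^sup>2\<close>.
\<close>

locale singular_set =
  fixes E :: "complex set" and f d1 d2 :: "complex \<Rightarrow> complex"
  assumes E: "compact E" "E \<noteq> {}" and f: "continuous_on UNIV f"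
    and d: "d1 \<in> L1_loc (- E)" "d2 \<in> L1_loc (- E)"
    and w: "weak_partial (- E) 1 f d1" "weak_partial (- E) \<i> f d2"
    and J: "(\<lambda>x. jac (d1 x) (d2 x)) \<in> L1_loc (- E)"
    and tail: "\<And>U e L. compact U \<Longrightarrow> U \<subseteq> - E \<Longrightarrow> 0 < e \<Longrightarrow>
      \<exists>l>L. l * (LINT x:U|lebesgue. (norm (d1 x) + norm (d2 x)) * indicator {x. l < norm (d1 x) + norm (d2 x)} x) < e"
begin

definition g :: "complex \<Rightarrow> real" where "g x = norm (d1 x) + norm (d2 x)"

lemma integrable_compact:
  assumes U: "compact U" "U \<subseteq> - E"
  shows "set_integrable lebesgue U d1" "set_integrable lebesgue U d2"
    "set_integrable lebesgue U (\<lambda>x. jac (d1 x) (d2 x))" "set_integrable lebesgue U g"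
    "set_integrable lebesgue U (\<lambda>x. Im (d1 x))" "set_integrable lebesgue U (\<lambda>x. Im (d2 x))"
proof -
  show 1: "set_integrable lebesgue U d1" "set_integrable lebesgue U d2" "set_integrable lebesgue U (\<lambda>x. jac (d1 x) (d2 x))"
    using d J U unfolding L1_loc_def by auto
  have "set_integrable lebesgue U (\<lambda>x. norm (d1 x) + norm (d2 x))"
    by (intro set_integral_add set_integrable_norm 1)
  then show "set_integrable lebesgue U g" by (simp add: g_def[abs_def])
  show "set_integrable lebesgue U (\<lambda>x. Im (d1 x))" "set_integrable lebesgue U (\<lambda>x. Im (d2 x))"
    using absolutely_integrable_linear[OF 1(1) bounded_linear_Im] absolutely_integrable_linear[OF 1(2) bounded_linear_Im]
    by (simp_all add: o_def)
qed

lemma compact_away: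
  assumes "0 < r"
  shows "compact {x \<in> cball 0 R. r \<le> infdist x E}" "{x \<in> cball 0 R. r \<le> infdist x E} \<subseteq> - E"
proof -
  have "closed {x. r \<le> infdist x E}" by (intro closed_Collect_le continuous_intros)
  then have "compact (cball 0 R \<inter> {x. r \<le> infdist x E})" by (intro compact_Int_closed) auto
  then show "compact {x \<in> cball 0 R. r \<le> infdist x E}" by (simp add: Int_def)
  show "{x \<in> cball 0 R. r \<le> infdist x E} \<subseteq> - E" using assms by auto
qed

text \<open>
  The function \<open>f\<close> is mollified and then truncated at a level \<open>l\<close>. The set \<open>Bad\<close> is the set \<open>V\<close> where the
  truncation may change the mollification, together with the set where the gradient of \<open>f\<close> is large. The
  tail estimate bounds the areas of these two sets by \<open>400 * \<epsilon> / l\<^sup>2\<close> and \<open>16 * \<epsilon> / l\<^sup>2\<close>.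
\<close>

lemma truncated_approximation:
  assumes \<rho>: "mollifier 1 \<rho>" and B: "\<And>y. \<rho> y \<le> B"
    and R: "0 < R" and \<eta>: "0 < \<eta>" and \<epsilon>: "0 < \<epsilon>" "\<epsilon> < 1" and t: "0 < t" "2 * t \<le> \<eta>" "2 * t \<le> 1"
    and \<omega>: "0 < \<omega>" and dd: "0 < dd"
    and osc: "\<forall>x\<in>cball 0 (R + 1). \<forall>z\<in>cball 0 (R + 1). dist z x \<le> 2 * t \<longrightarrow> norm (f z - f x) \<le> \<omega> / 4"
    and W_def: "W = {x \<in> cball 0 R. 2 * \<eta> \<le> infdist x E}"
  shows "\<exists>\<phi> p q l Bad D. C1 \<phi> p q \<and> 1 \<le> l \<and> (\<forall>x\<in>cball 0 R. norm (\<phi> x - f x) < \<omega>) \<and>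
    Bad \<in> sets lebesgue \<and> emeasure lebesgue Bad < ennreal dd \<and> l\<^sup>2 * measure lebesgue Bad \<le> 416 * \<epsilon> \<and>
    (\<forall>x\<in>W. norm (p x) \<le> 32 * pi * B * l \<and> norm (q x) \<le> 32 * pi * B * l) \<and>
    (\<forall>x\<in>W - Bad. g x \<le> l \<and> norm (p x - d1 x) + norm (q x - d2 x) \<le> D x) \<and>
    (\<forall>x. 0 \<le> D x) \<and> set_integrable lebesgue W D \<and> l * (LINT x:W|lebesgue. D x) \<le> 2 * (1 + measure lebesgue W) * \<epsilon>"
proof -
  define U where "U = {x \<in> cball 0 (R + 1). \<eta> \<le> infdist x E}"
  have U: "compact U" "U \<subseteq> - E" unfolding U_def using compact_away[OF \<eta>] by blast+
  have W: "compact W" "W \<subseteq> - E" unfolding W_def using compact_away[of "2 * \<eta>"] \<eta> by auto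
  have WU: "W \<subseteq> U" using \<eta> by (auto simp: W_def U_def)
  have Ul: "U \<in> sets lebesgue" "W \<in> sets lebesgue" using borel_compact[OF U(1)] borel_compact[OF W(1)] by auto
  note iU = integrable_compact[OF U]
  have g0: "0 \<le> g x" for x by (simp add: g_def)
  \<comment> \<open>large enough that \<open>Bad\<close> has area below \<open>dd\<close>, and \<open>V\<close> contains no disc of radius \<open>t\<close>\<close>
  define L where "L = 1 + 416 / dd + 400 / t\<^sup>2"
  have L: "1 \<le> L" "416 / dd < L" "400 / t\<^sup>2 < L" using dd t unfolding L_def by (auto simp: add_pos_nonneg add_nonneg_pos)
  obtain l0 where l0: "L < l0" and "l0 * (LINT x:U|lebesgue. g x * indicator {x. l0 < g x} x) < \<epsilon>"
    using tail[OF U \<epsilon>(1), of L] by (auto simp: g_def)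
  define I where "I = (LINT x:U|lebesgue. g x * indicator {x. l0 < g x} x)"
  have I: "l0 * I < \<epsilon>" unfolding I_def by fact
  \<comment> \<open>A factor 2 is lost in the maximal function estimate, another one in \<open>superlevel_perturbation\<close>.\<close>
  define l where "l = 4 * l0"
  have l: "4 \<le> l" "L < l" "0 < l0" "1 \<le> l0" using l0 L by (auto simp: l_def)
  define e where "e = min (\<epsilon> / l) (\<omega> / 8)"
  have e0: "0 < e" unfolding e_def using \<epsilon> \<omega> l by simp
  have "e \<le> \<epsilon> / l" "e \<le> \<omega> / 8" by (simp_all only: e_def min.cobounded1 min.cobounded2)
  note e = e0 this
  have el: "l * e \<le> \<epsilon>" using e(2) l by (simp add: field_simps)
  obtain \<phi> a b where \<phi>: "C1 \<phi> a b" and \<phi>f: "\<And>x. x \<in> cball 0 (R + 1) \<Longrightarrow> norm (\<phi> x - f x) \<le> e"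
    and a: "(LINT x:U|lebesgue. norm (a x - d1 x)) < e" and b: "(LINT x:U|lebesgue. norm (b x - d2 x)) < e"
    using weak_approx[OF _ f d w U e(1), of "R + 1"] compact_imp_closed[OF E(1)] by (auto simp: open_Compl)
  note cont = C1_continuous_partials[OF \<phi>]
  define \<delta> where "\<delta> = (\<lambda>x. norm (a x - d1 x) + norm (b x - d2 x))"
  have \<delta>i: "set_integrable lebesgue U (\<lambda>x. norm (a x - d1 x))" "set_integrable lebesgue U (\<lambda>x. norm (b x - d2 x))"
    by (intro set_integrable_norm set_integral_diff set_integrable_continuous U cont iU)+
  then have \<delta>: "set_integrable lebesgue U \<delta>" and \<delta>e: "(LINT x:U|lebesgue. \<delta> x) < 2 * e"
    unfolding \<delta>_def using a b by (auto simp: set_integral_add)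
  have \<delta>0: "0 \<le> \<delta> x" for x by (simp add: \<delta>_def)
  define G where "G = (\<lambda>x. indicator U x * (norm (a x) + norm (b x)))"
  have Gi: "integrable lborel G"
    using borel_integrable_compact[OF U(1), of "\<lambda>x. norm (a x) + norm (b x)"] cont
    by (simp add: G_def continuous_on_add continuous_on_norm)
  have G0: "0 \<le> G x" for x by (simp add: G_def)
  have gsi: "set_integrable lebesgue U (\<lambda>x. g x * indicator {x. l0 < g x} x)"
  proof -
    have "integrable lebesgue (\<lambda>x. (indicator U x *\<^sub>R g x) * indicator {x. l0 < indicator U x *\<^sub>R g x} x)"
      by (rule integrable_superlevel) (use iU(4) in \<open>simp add: set_integrable_def\<close>)
    moreover have "(\<lambda>x. (indicator U x *\<^sub>R g x) * indicator {x. l0 < indicator U x *\<^sub>R g x} x)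
        = (\<lambda>x. indicator U x *\<^sub>R (g x * indicator {x. l0 < g x} x))"
      by (auto simp: indicator_def)
    ultimately show ?thesis by (simp add: set_integrable_def)
  qed
  have I0: "0 \<le> I" unfolding I_def set_lebesgue_integral_def using g0 by (intro integral_nonneg_AE) (auto simp: indicator_def)
  have nnG: "(\<integral>\<^sup>+ x. ennreal (G x) * indicator {x. l / 2 < G x} x \<partial>lborel) \<le> ennreal (I + 4 * e)"
  proof -
    have i: "set_integrable lebesgue U (\<lambda>x. g x * indicator {x. l0 < g x} x + 2 * \<delta> x)"
      by (intro set_integral_add(1) gsi set_integrable_mult_right \<delta>)
    have "(\<integral>\<^sup>+ x. ennreal (G x) * indicator {x. l / 2 < G x} x \<partial>lborel) = (\<integral>\<^sup>+ x. ennreal (G x) * indicator {x. l / 2 < G x} x \<partial>lebesgue)"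
      by (rule nn_integral_completion[symmetric])
    also have "\<dots> \<le> (\<integral>\<^sup>+ x. ennreal (indicator U x *\<^sub>R (g x * indicator {x. l0 < g x} x + 2 * \<delta> x)) \<partial>lebesgue)"
    proof (rule nn_integral_mono)
      fix x
      show "ennreal (G x) * indicator {x. l / 2 < G x} x \<le> ennreal (indicator U x *\<^sub>R (g x * indicator {x. l0 < g x} x + 2 * \<delta> x))"
      proof (cases "x \<in> U")
        case True
        have "norm (a x) + norm (b x) \<le> g x + \<delta> x"
          using norm_triangle_ineq[of "a x - d1 x" "d1 x"] norm_triangle_ineq[of "b x - d2 x" "d2 x"] by (simp add: g_def \<delta>_def)
        then have "G x \<le> g x + \<delta> x" using True by (simp add: G_def)
        from superlevel_perturbation[OF g0 \<delta>0 this, of l]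
        have "G x * indicator {x. l / 2 < G x} x \<le> g x * indicator {x. l0 < g x} x + 2 * \<delta> x"
          by (simp add: l_def indicator_def)
        then have "ennreal (G x * indicator {x. l / 2 < G x} x) \<le> ennreal (g x * indicator {x. l0 < g x} x + 2 * \<delta> x)"
          by (rule ennreal_leI)
        moreover have "ennreal (G x * indicator {x. l / 2 < G x} x) = ennreal (G x) * indicator {x. l / 2 < G x} x"
          by (simp add: indicator_def)
        ultimately show ?thesis using True by simp
      qed (simp add: G_def)
    qed
    also have "\<dots> = ennreal (LINT x:U|lebesgue. g x * indicator {x. l0 < g x} x + 2 * \<delta> x)"
      unfolding set_lebesgue_integral_def
      by (rule nn_integral_eq_integral) (use i g0 \<delta>0 in \<open>auto simp: set_integrable_def indicator_def\<close>)
    also have "(LINT x:U|lebesgue. g x * indicator {x. l0 < g x} x + 2 * \<delta> x) = I + 2 * (LINT x:U|lebesgue. \<delta> x)"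
      using gsi \<delta> by (subst set_integral_add) (auto simp: I_def)
    also have "ennreal \<dots> \<le> ennreal (I + 4 * e)" using \<delta>e by (intro ennreal_leI) simp
    finally show ?thesis .
  qed
  obtain V where V: "V \<in> sets borel" and Vmax: "\<And>x r. x \<notin> V \<Longrightarrow> 0 < r \<Longrightarrow> (LINT z:cball x r|lborel. G z) \<le> l * pi * r\<^sup>2"
    and Vm: "emeasure lborel V \<le> ennreal (50 / l) * (\<integral>\<^sup>+ x. ennreal (G x) * indicator {x. l / 2 < G x} x \<partial>lborel)"
    using maximal_function_weak_type[OF Gi G0, of l] l by auto
  have "emeasure lborel V \<le> ennreal (50 / l) * ennreal (I + 4 * e)"
    using Vm nnG by (meson mult_left_mono order_trans zero_le)
  also have "\<dots> = ennreal (50 / l * (I + 4 * e))"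
    using l I0 e by (intro ennreal_mult[symmetric]) auto
  also have "\<dots> \<le> ennreal (400 * \<epsilon> / l\<^sup>2)"
  proof (rule ennreal_leI)
    have "l * (I + 4 * e) \<le> 8 * \<epsilon>" using I el by (simp add: l_def algebra_simps)
    then have "50 * (l * (I + 4 * e)) / l\<^sup>2 \<le> 50 * (8 * \<epsilon>) / l\<^sup>2" by (intro divide_right_mono) auto
    moreover have "50 / l * (I + 4 * e) = 50 * (l * (I + 4 * e)) / l\<^sup>2" using l by (simp add: power2_eq_square)
    ultimately show "50 / l * (I + 4 * e) \<le> 400 * \<epsilon> / l\<^sup>2" by simp
  qed
  finally have Ve: "emeasure lborel V \<le> ennreal (400 * \<epsilon> / l\<^sup>2)" .
  have lsq: "l \<le> l\<^sup>2" using l by (simp add: power2_eq_square)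
  have small: "c * \<epsilon> / l\<^sup>2 < y" if "0 < c" "0 < y" "c / y < L" for c y
  proof -
    have "c / y < l\<^sup>2" using that l lsq by linarith
    then have "c < y * l\<^sup>2" using that by (simp add: field_simps)
    moreover have "c * \<epsilon> \<le> c" using that \<epsilon> by simp
    ultimately have "c * \<epsilon> < y * l\<^sup>2" by linarith
    then show ?thesis using l by (simp add: field_simps)
  qed
  have "400 * \<epsilon> / l\<^sup>2 < t\<^sup>2" by (rule small) (use t L in auto)
  also have "t\<^sup>2 \<le> pi * t\<^sup>2" using mult_right_mono[of 1 pi "t\<^sup>2"] pi_ge_two by simp
  finally have Vt: "emeasure lborel V < ennreal (pi * t\<^sup>2)"
    using Ve \<epsilon> by (intro order.strict_trans1[OF Ve] ennreal_lessI) (use t in auto)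
  have WV: "cball x (2 * t) \<subseteq> U" if x: "x \<in> W" for x
  proof
    fix z assume z: "z \<in> cball x (2 * t)"
    have "cmod z \<le> cmod x + dist x z" by (metis dist_commute dist_norm add.commute norm_triangle_sub)
    moreover have "infdist x E \<le> infdist z E + dist x z" by (rule infdist_triangle)
    ultimately show "z \<in> U" using x z t by (auto simp: U_def W_def)
  qed
  have lpos: "0 < l" using l by simp
  have "\<exists>h h1 h2. C1 h h1 h2 \<and>
     (\<forall>x M. (\<forall>z. dist z x \<le> 2 * t \<longrightarrow> norm (\<phi> z - \<phi> x) \<le> M) \<longrightarrow> norm (h x - \<phi> x) \<le> M) \<and>
     (\<forall>x\<in>W. norm (h1 x) \<le> 32 * pi * B * l \<and> norm (h2 x) \<le> 32 * pi * B * l) \<and>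
     (\<forall>x\<in>W - V. norm (h1 x - a x) \<le> e \<and> norm (h2 x - b x) \<le> e)"
    by (rule lipschitz_truncation[OF \<rho> B \<phi> U(1) t(1) e(1) lpos WV V Vt]) (use Vmax in \<open>auto simp: G_def\<close>)
  then obtain h p q where h: "C1 h p q"
    and hosc: "\<And>x M. (\<And>z. dist z x \<le> 2 * t \<Longrightarrow> norm (\<phi> z - \<phi> x) \<le> M) \<Longrightarrow> norm (h x - \<phi> x) \<le> M"
    and pq: "\<And>x. x \<in> W \<Longrightarrow> norm (p x) \<le> 32 * pi * B * l \<and> norm (q x) \<le> 32 * pi * B * l"
    and close: "\<And>x. x \<in> W - V \<Longrightarrow> norm (p x - a x) \<le> e \<and> norm (q x - b x) \<le> e"
    by blast
  have hf: "norm (h x - f x) < \<omega>" if x: "x \<in> cball 0 R" for x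
  proof -
    have "norm (h x - \<phi> x) \<le> \<omega> / 4 + 2 * e"
    proof (rule hosc)
      fix z assume z: "dist z x \<le> 2 * t"
      have "cmod z \<le> cmod x + dist z x" by (metis dist_norm add.commute norm_triangle_sub)
      then have z': "z \<in> cball 0 (R + 1)" "x \<in> cball 0 (R + 1)" using x z t by auto
      have "norm (\<phi> z - \<phi> x) \<le> norm (\<phi> z - f z) + norm (f z - f x) + norm (\<phi> x - f x)"
        using norm_triangle_ineq4[of "(\<phi> z - f z) + (f z - f x)" "\<phi> x - f x"] norm_triangle_ineq[of "\<phi> z - f z" "f z - f x"] by simp
      then show "norm (\<phi> z - \<phi> x) \<le> \<omega> / 4 + 2 * e"
        using \<phi>f[OF z'(1)] \<phi>f[OF z'(2)] osc[rule_format, OF z'(2,1) z] by linarith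
    qed
    moreover have "norm (\<phi> x - f x) \<le> e" using x by (intro \<phi>f) auto
    ultimately show ?thesis
      using norm_triangle_ineq[of "h x - \<phi> x" "\<phi> x - f x"] e \<omega> by simp
  qed
  define Bad where "Bad = V \<union> {x \<in> U. l0 < g x}"
  have b2: "{x \<in> U. l0 < g x} \<in> sets lebesgue"
  proof -
    have [measurable]: "(\<lambda>x. indicator U x *\<^sub>R g x) \<in> borel_measurable lebesgue"
      using iU(4) unfolding set_integrable_def by auto
    have "{x \<in> space lebesgue. l0 < indicator U x *\<^sub>R g x} \<in> sets lebesgue" by measurable
    moreover have "{x \<in> space lebesgue. l0 < indicator U x *\<^sub>R g x} = {x \<in> U. l0 < g x}"
      using l by (auto simp: indicator_def split: if_splits)
    ultimately show ?thesis by simp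
  qed
  have Badl: "Bad \<in> sets lebesgue" using b2 V by (auto simp: Bad_def)
  have b2m: "emeasure lebesgue {x \<in> U. l0 < g x} \<le> ennreal (16 * \<epsilon> / l\<^sup>2)"
  proof -
    have "ennreal l0 * emeasure lebesgue {x \<in> U. l0 < g x} = (\<integral>\<^sup>+ x. ennreal l0 * indicator {x \<in> U. l0 < g x} x \<partial>lebesgue)"
      using b2 by (simp add: nn_integral_cmult_indicator)
    also have "\<dots> \<le> (\<integral>\<^sup>+ x. ennreal (indicator U x *\<^sub>R (g x * indicator {x. l0 < g x} x)) \<partial>lebesgue)"
      by (rule nn_integral_mono) (auto simp: indicator_def intro: ennreal_leI)
    also have "\<dots> = ennreal I"
      unfolding I_def set_lebesgue_integral_def
      by (rule nn_integral_eq_integral) (use gsi g0 in \<open>auto simp: set_integrable_def indicator_def\<close>)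
    also have "\<dots> \<le> ennreal (l0 * (16 * \<epsilon> / l\<^sup>2))"
    proof (rule ennreal_leI)
      have "I \<le> \<epsilon> / l0" using I l by (simp add: field_simps)
      then show "I \<le> l0 * (16 * \<epsilon> / l\<^sup>2)" using l by (simp add: l_def power2_eq_square field_simps)
    qed
    also have "\<dots> = ennreal l0 * ennreal (16 * \<epsilon> / l\<^sup>2)" using l \<epsilon> by (intro ennreal_mult) auto
    finally show ?thesis using l by (subst (asm) ennreal_mult_le_mult_iff) auto
  qed
  have Bade: "emeasure lebesgue Bad \<le> ennreal (416 * \<epsilon> / l\<^sup>2)"
  proof -
    have "emeasure lebesgue Bad \<le> emeasure lebesgue V + emeasure lebesgue {x \<in> U. l0 < g x}"
      unfolding Bad_def using V b2 by (intro emeasure_subadditive) auto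
    also have "\<dots> \<le> ennreal (400 * \<epsilon> / l\<^sup>2) + ennreal (16 * \<epsilon> / l\<^sup>2)"
      using Ve V b2m by (intro add_mono) auto
    also have "\<dots> = ennreal (416 * \<epsilon> / l\<^sup>2)" using \<epsilon> by (subst ennreal_plus[symmetric]) (auto simp flip: add_divide_distrib)
    finally show ?thesis .
  qed
  have "416 * \<epsilon> / l\<^sup>2 < dd" by (rule small) (use dd L in auto)
  then have Badd: "emeasure lebesgue Bad < ennreal dd"
    using Bade dd by (intro order.strict_trans1[OF Bade] ennreal_lessI) auto
  have "measure lebesgue Bad \<le> 416 * \<epsilon> / l\<^sup>2"
    using Bade \<epsilon> unfolding measure_def by (intro enn2real_leI) auto
  then have Badm: "l\<^sup>2 * measure lebesgue Bad \<le> 416 * \<epsilon>" using l by (simp add: field_simps)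
  define D where "D = (\<lambda>x. \<delta> x + 2 * e)"
  have \<delta>W: "set_integrable lebesgue W \<delta>" by (rule set_integrable_compact_subset[OF \<delta> W(1) WU])
  have cW: "set_integrable lebesgue W (\<lambda>x. 2 * e)" by (rule set_integrable_continuous[OF W(1)]) simp
  have Di: "set_integrable lebesgue W D" unfolding D_def by (rule set_integral_add(1)[OF \<delta>W cW])
  have Dint: "l * (LINT x:W|lebesgue. D x) \<le> 2 * (1 + measure lebesgue W) * \<epsilon>"
  proof -
    have "(LINT x:W|lebesgue. \<delta> x) \<le> (LINT x:U|lebesgue. \<delta> x)"
      unfolding set_lebesgue_integral_def
      by (rule integral_mono) (use \<delta> \<delta>W \<delta>0 WU in \<open>auto simp: set_integrable_def indicator_def\<close>)
    moreover have "(LINT x:W|lebesgue. D x) = (LINT x:W|lebesgue. \<delta> x) + 2 * e * measure lebesgue W"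
      unfolding D_def by (subst set_integral_add(2)[OF \<delta>W cW]) (simp add: set_lebesgue_integral_def)
    ultimately have "(LINT x:W|lebesgue. D x) \<le> 2 * e * (1 + measure lebesgue W)" using \<delta>e by (simp add: algebra_simps)
    then have "l * (LINT x:W|lebesgue. D x) \<le> l * (2 * e * (1 + measure lebesgue W))" using l by (intro mult_left_mono) auto
    also have "\<dots> = (l * e) * (2 * (1 + measure lebesgue W))" by simp
    also have "\<dots> \<le> \<epsilon> * (2 * (1 + measure lebesgue W))" using el by (intro mult_right_mono) auto
    finally show ?thesis by (simp add: algebra_simps)
  qed
  have fin: "g x \<le> l \<and> norm (p x - d1 x) + norm (q x - d2 x) \<le> D x" if x: "x \<in> W - Bad" for x
  proof
    have "g x \<le> l0" using x WU by (auto simp: Bad_def)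
    then show "g x \<le> l" using l by (simp add: l_def)
    have "norm (p x - a x) \<le> e" "norm (q x - b x) \<le> e" using close[of x] x by (auto simp: Bad_def)
    then show "norm (p x - d1 x) + norm (q x - d2 x) \<le> D x"
      using norm_triangle_ineq[of "p x - a x" "a x - d1 x"] norm_triangle_ineq[of "q x - b x" "b x - d2 x"]
      by (simp add: D_def \<delta>_def)
  qed
  have D0: "0 \<le> D x" for x using \<delta>0[of x] e by (simp add: D_def)
  have l1: "1 \<le> l" using l by simp
  show ?thesis
    using h l1 hf Badl Badd Badm pq fin D0 Di Dint by blast
qed

end

lemma abs_mult_le:
  fixes a b A B :: real
  assumes "\<bar>a\<bar> \<le> A" "\<bar>b\<bar> \<le> B"
  shows "\<bar>a * b\<bar> \<le> A * B"
proof -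
  have "0 \<le> A" using assms(1) abs_ge_zero order_trans by blast
  then show ?thesis unfolding abs_mult using assms by (intro mult_mono) auto
qed

text \<open>
  Where the gradients are close, the difference of the Jacobians is at most the distance \<open>D\<close> of the gradients
  times their size, which is controlled by the level \<open>l\<close>; the remaining error is due to the values of \<open>h\<close> and
  \<open>H\<close>.
\<close>

lemma integrand_difference_good:
  fixes p q a b :: complex and M l c \<epsilon> D \<psi> \<psi>1 \<psi>2 h h' H H' :: real
  assumes \<psi>: "\<bar>\<psi>\<bar> \<le> M" "\<bar>\<psi>1\<bar> \<le> M" "\<bar>\<psi>2\<bar> \<le> M" and h: "\<bar>h\<bar> \<le> M" "\<bar>H\<bar> \<le> M"
    and hh: "\<bar>h - h'\<bar> \<le> \<epsilon>" "\<bar>H - H'\<bar> \<le> \<epsilon>" and M: "1 \<le> M" and l: "1 \<le> l" and c: "1 \<le> c"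
    and q: "norm q \<le> c * l" and a: "norm a + norm b \<le> l"
    and D: "norm (p - a) + norm (q - b) \<le> D"
  shows "\<bar>(\<psi> * h * jac p q + H * (\<psi>1 * Im q - \<psi>2 * Im p)) - (\<psi> * h' * jac a b + H' * (\<psi>1 * Im b - \<psi>2 * Im a))\<bar>
    \<le> 3 * M\<^sup>2 * c\<^sup>2 * (l * D + \<epsilon> * (\<bar>jac a b\<bar> + (norm a + norm b)))"
proof -
  define S where "S = \<bar>jac a b\<bar> + (norm a + norm b)"
  have D0: "0 \<le> D" using D norm_ge_zero[of "p - a"] norm_ge_zero[of "q - b"] by linarith
  have \<epsilon>0: "0 \<le> \<epsilon>" using hh(1) by linarith
  have cl: "1 * 1 \<le> c * l" using c l by (intro mult_mono) auto
  have MM: "1 * 1 \<le> M * M" using M by (intro mult_mono) auto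
  have cc: "1 * c \<le> c * c" using c by (intro mult_right_mono) auto
  have lcl: "l \<le> c * l" using mult_right_mono[of 1 c l] c l by simp
  have "\<bar>jac p q - jac a b\<bar> \<le> norm (p - a) * (c * l) + (c * l) * norm (q - b)"
  proof (rule order_trans[OF jac_diff_bound])
    have "norm a \<le> c * l" using a norm_ge_zero[of b] lcl by linarith
    then show "norm (p - a) * norm q + norm a * norm (q - b) \<le> norm (p - a) * (c * l) + c * l * norm (q - b)"
      by (intro add_mono mult_left_mono mult_right_mono q) auto
  qed
  also have "\<dots> = (c * l) * (norm (p - a) + norm (q - b))" by (simp add: algebra_simps)
  also have "\<dots> \<le> (c * l) * D" using D cl by (intro mult_left_mono) auto
  finally have j: "\<bar>jac p q - jac a b\<bar> \<le> c * l * D" .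
  have T1: "\<bar>\<psi> * h * (jac p q - jac a b)\<bar> \<le> M * M * (c * l * D)"
    by (intro abs_mult_le \<psi> h j)
  have T2: "\<bar>\<psi> * (h - h') * jac a b\<bar> \<le> M * \<epsilon> * \<bar>jac a b\<bar>"
    by (intro abs_mult_le \<psi> hh) simp
  have "\<bar>\<psi>1 * Im (q - b) - \<psi>2 * Im (p - a)\<bar> \<le> M * norm (q - b) + M * norm (p - a)"
    using abs_mult_le[OF \<psi>(2) abs_Im_le_cmod[of "q - b"]] abs_mult_le[OF \<psi>(3) abs_Im_le_cmod[of "p - a"]] by linarith
  also have "\<dots> = M * (norm (p - a) + norm (q - b))" by (simp add: algebra_simps)
  also have "\<dots> \<le> M * D" using D M by (intro mult_left_mono) auto
  finally have T3: "\<bar>H * (\<psi>1 * Im (q - b) - \<psi>2 * Im (p - a))\<bar> \<le> M * (M * D)"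
    by (intro abs_mult_le h)
  have "\<bar>\<psi>1 * Im b - \<psi>2 * Im a\<bar> \<le> M * norm b + M * norm a"
    using abs_mult_le[OF \<psi>(2) abs_Im_le_cmod[of b]] abs_mult_le[OF \<psi>(3) abs_Im_le_cmod[of a]] by linarith
  then have "\<bar>\<psi>1 * Im b - \<psi>2 * Im a\<bar> \<le> M * (norm a + norm b)" by (simp add: algebra_simps)
  then have T4: "\<bar>(H - H') * (\<psi>1 * Im b - \<psi>2 * Im a)\<bar> \<le> \<epsilon> * (M * (norm a + norm b))"
    by (intro abs_mult_le hh)
  have eq: "(\<psi> * h * jac p q + H * (\<psi>1 * Im q - \<psi>2 * Im p)) - (\<psi> * h' * jac a b + H' * (\<psi>1 * Im b - \<psi>2 * Im a))
     = \<psi> * h * (jac p q - jac a b) + \<psi> * (h - h') * jac a b + H * (\<psi>1 * Im (q - b) - \<psi>2 * Im (p - a))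
       + (H - H') * (\<psi>1 * Im b - \<psi>2 * Im a)"
    by (simp add: algebra_simps)
  have "\<bar>(\<psi> * h * jac p q + H * (\<psi>1 * Im q - \<psi>2 * Im p)) - (\<psi> * h' * jac a b + H' * (\<psi>1 * Im b - \<psi>2 * Im a))\<bar>
    \<le> M * M * (c * l * D) + M * \<epsilon> * \<bar>jac a b\<bar> + M * (M * D) + \<epsilon> * (M * (norm a + norm b))"
    unfolding eq using T1 T2 T3 T4 by linarith
  also have "\<dots> = (M * M * c) * (l * D) + (M * M) * D + M * (\<epsilon> * S)"
    by (simp add: S_def algebra_simps)
  also have "\<dots> \<le> (M * M * (c * c)) * (l * D) + (M * M * (c * c)) * (l * D) + (3 * (M * M * (c * c))) * (\<epsilon> * S)"
  proof (intro add_mono mult_right_mono)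
    show "M * M * c \<le> M * M * (c * c)" using cc MM by (intro mult_left_mono) auto
    have "(M * M) * D \<le> (M * M) * ((c * c) * (l * D))"
    proof (intro mult_left_mono)
      have "1 * 1 \<le> c * c" using c by (intro mult_mono) auto
      then have "1 * (l * D) \<le> (c * c) * (l * D)" using D0 l by (intro mult_right_mono) auto
      moreover have "1 * D \<le> l * D" using D0 l by (intro mult_right_mono) auto
      ultimately show "D \<le> (c * c) * (l * D)" by simp
    qed (use MM in auto)
    then show "M * M * D \<le> M * M * (c * c) * (l * D)" by (simp add: mult.assoc)
    have "M * 1 \<le> M * M" using M by (intro mult_left_mono) auto
    moreover have "M * M * 1 \<le> M * M * (c * c)" using MM c by (intro mult_left_mono) (auto intro: order_trans[OF _ cc])
    ultimately show "M \<le> 3 * (M * M * (c * c))" using MM by linarith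
  qed (use D0 l \<epsilon>0 in \<open>auto simp: S_def\<close>)
  also have "\<dots> \<le> 3 * M\<^sup>2 * c\<^sup>2 * (l * D + \<epsilon> * S)"
  proof -
    have "0 \<le> M * M * (c * c) * (l * D)" using D0 l by simp
    then show ?thesis by (simp add: power2_eq_square algebra_simps)
  qed
  finally show ?thesis by (simp add: S_def)
qed

text \<open>
  On the bad set the two integrands are estimated separately, the approximation by the square of its
  Lipschitz constant.
\<close>

lemma integrand_difference_bad:
  fixes p q a b :: complex and M l c \<epsilon> D \<psi> \<psi>1 \<psi>2 h h' H H' :: real
  assumes \<psi>: "\<bar>\<psi>\<bar> \<le> M" "\<bar>\<psi>1\<bar> \<le> M" "\<bar>\<psi>2\<bar> \<le> M" and h: "\<bar>h\<bar> \<le> M" "\<bar>H\<bar> \<le> M" "\<bar>h'\<bar> \<le> M" "\<bar>H'\<bar> \<le> M"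
    and M: "1 \<le> M" and l: "1 \<le> l" and c: "1 \<le> c"
    and pq: "norm p \<le> c * l" "norm q \<le> c * l"
  shows "\<bar>(\<psi> * h * jac p q + H * (\<psi>1 * Im q - \<psi>2 * Im p)) - (\<psi> * h' * jac a b + H' * (\<psi>1 * Im b - \<psi>2 * Im a))\<bar>
    \<le> 3 * M\<^sup>2 * c\<^sup>2 * (l\<^sup>2 + (\<bar>jac a b\<bar> + (norm a + norm b)))"
proof -
  define S where "S = \<bar>jac a b\<bar> + (norm a + norm b)"
  have cl: "1 * 1 \<le> c * l" using c l by (intro mult_mono) auto
  have MM: "1 * 1 \<le> M * M" using M by (intro mult_mono) auto
  have c2: "1 * 1 \<le> c * c" using c by (intro mult_mono) auto
  have "\<bar>jac p q\<bar> \<le> norm p * norm q" by (rule jac_bound)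
  also have "\<dots> \<le> (c * l) * (c * l)" using pq cl by (intro mult_mono) auto
  finally have T1: "\<bar>\<psi> * h * jac p q\<bar> \<le> M * M * ((c * l) * (c * l))" by (intro abs_mult_le \<psi> h)
  have im: "\<bar>Im p\<bar> \<le> c * l" "\<bar>Im q\<bar> \<le> c * l" using pq abs_Im_le_cmod[of p] abs_Im_le_cmod[of q] by linarith+
  have "\<bar>\<psi>1 * Im q - \<psi>2 * Im p\<bar> \<le> M * (c * l) + M * (c * l)"
    using abs_mult_le[OF \<psi>(2) im(2)] abs_mult_le[OF \<psi>(3) im(1)] by linarith
  then have T2: "\<bar>H * (\<psi>1 * Im q - \<psi>2 * Im p)\<bar> \<le> M * (M * (c * l) + M * (c * l))" by (intro abs_mult_le h)
  have T3: "\<bar>\<psi> * h' * jac a b\<bar> \<le> M * M * \<bar>jac a b\<bar>" by (intro abs_mult_le \<psi> h) simp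
  have "\<bar>\<psi>1 * Im b - \<psi>2 * Im a\<bar> \<le> M * norm b + M * norm a"
    using abs_mult_le[OF \<psi>(2) abs_Im_le_cmod[of b]] abs_mult_le[OF \<psi>(3) abs_Im_le_cmod[of a]] by linarith
  then have T4: "\<bar>H' * (\<psi>1 * Im b - \<psi>2 * Im a)\<bar> \<le> M * (M * norm b + M * norm a)" by (intro abs_mult_le h)
  have "\<bar>(\<psi> * h * jac p q + H * (\<psi>1 * Im q - \<psi>2 * Im p)) - (\<psi> * h' * jac a b + H' * (\<psi>1 * Im b - \<psi>2 * Im a))\<bar>
    \<le> M * M * ((c * l) * (c * l)) + M * (M * (c * l) + M * (c * l)) + M * M * \<bar>jac a b\<bar> + M * (M * norm b + M * norm a)"
    using T1 T2 T3 T4 by linarith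
  also have "\<dots> = M * M * ((c * l) * (c * l)) + 2 * (M * M) * (c * l) + (M * M) * S"
    by (simp add: S_def algebra_simps)
  also have "\<dots> \<le> M * M * ((c * l) * (c * l)) + 2 * (M * M) * ((c * l) * (c * l)) + 3 * (M * M) * (c * c) * S"
  proof (intro add_mono mult_right_mono mult_left_mono)
    show "c * l \<le> (c * l) * (c * l)" using mult_right_mono[OF cl, of "c * l"] cl by simp
    have "M * M * 1 \<le> M * M * (c * c)" using MM c2 by (intro mult_left_mono) auto
    then show "M * M \<le> 3 * (M * M) * (c * c)" using MM by linarith
  qed (use M MM in \<open>auto simp: S_def\<close>)
  also have "\<dots> = 3 * M\<^sup>2 * c\<^sup>2 * (l\<^sup>2 + S)" by (simp add: power2_eq_square algebra_simps)
  finally show ?thesis by (simp add: S_def)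
qed

lemma continuous_bound_on_compact:
  fixes u :: "complex \<Rightarrow> real"
  assumes "continuous_on UNIV u"
  shows "\<exists>M\<ge>1. \<forall>x\<in>cball 0 r. \<bar>u x\<bar> \<le> M"
proof -
  have "compact (u ` cball 0 r)" by (intro compact_continuous_image continuous_on_subset[OF assms]) auto
  from compact_imp_bounded[OF this] obtain M where "\<forall>y\<in>u ` cball 0 r. norm y \<le> M" unfolding bounded_iff by blast
  then show ?thesis by (intro exI[of _ "max 1 M"]) auto
qed

context singular_set
begin

text \<open>
  The identity for C1 maps passes to the limit along truncated approximations of \<open>f\<close>. The hypotheses
  \<open>flat\<close> and \<open>away\<close> make all integrands vanish near \<open>E\<close>, where nothing is known about the approximation. On
  the good set the difference of the integrands tends to \<open>0\<close> in L1; the bad set contributes at most the square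
  of the Lipschitz constant times its area, and the integral of a fixed function over a small set.
\<close>

lemma pullback_identity:
  assumes \<psi>: "C1 \<psi> \<psi>1 \<psi>2" and supp: "\<And>x. R < cmod x \<Longrightarrow> \<psi> x = 0" and R: "0 < R"
    and H: "C1 H h H2" and \<eta>: "0 < \<eta>"
    and flat: "\<And>x. infdist x E < 2 * \<eta> \<Longrightarrow> \<psi>1 x = 0 \<and> \<psi>2 x = 0"
    and away: "\<And>x w. \<psi> x \<noteq> 0 \<Longrightarrow> infdist x E < 2 * \<eta> \<Longrightarrow> dist w (f x) < \<eta> \<Longrightarrow> h w = 0"
    and W_def: "W = {x \<in> cball 0 R. 2 * \<eta> \<le> infdist x E}"
  shows "(LINT x:W|lebesgue. \<psi> x * h (f x) * jac (d1 x) (d2 x)) + (LINT x:W|lebesgue. H (f x) * (\<psi>1 x * Im (d2 x) - \<psi>2 x * Im (d1 x))) = 0"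
    and "set_integrable lebesgue W (\<lambda>x. \<psi> x * h (f x) * jac (d1 x) (d2 x))"
    and "set_integrable lebesgue W (\<lambda>x. H (f x) * (\<psi>1 x * Im (d2 x) - \<psi>2 x * Im (d1 x)))"
proof -
  note cH = C1_continuous[OF H, of UNIV] C1_continuous_partials(1)[OF H, of UNIV]
  note c\<psi> = C1_continuous[OF \<psi>, of UNIV] C1_continuous_partials[OF \<psi>, of UNIV]
  have W: "compact W" "W \<subseteq> - E" unfolding W_def using compact_away[of "2 * \<eta>"] \<eta> by auto
  have Wl: "W \<in> sets lebesgue" using borel_compact[OF W(1)] by auto
  have WR: "W \<subseteq> cball 0 R" by (auto simp: W_def)
  note iW = integrable_compact[OF W]
  show i1: "set_integrable lebesgue W (\<lambda>x. \<psi> x * h (f x) * jac (d1 x) (d2 x))"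
    by (rule set_integrable_mult_continuous[OF W(1) _ iW(3)])
       (auto intro!: continuous_intros continuous_on_subset[OF c\<psi>(1)] continuous_on_compose2[OF cH(2)] continuous_on_subset[OF f])
  have i21: "set_integrable lebesgue W (\<lambda>x. (H (f x) * \<psi>1 x) * Im (d2 x))"
    by (rule set_integrable_mult_continuous[OF W(1) _ iW(6)])
       (auto intro!: continuous_intros continuous_on_subset[OF c\<psi>(2)] continuous_on_compose2[OF cH(1)] continuous_on_subset[OF f])
  have i22: "set_integrable lebesgue W (\<lambda>x. (H (f x) * \<psi>2 x) * Im (d1 x))"
    by (rule set_integrable_mult_continuous[OF W(1) _ iW(5)])
       (auto intro!: continuous_intros continuous_on_subset[OF c\<psi>(3)] continuous_on_compose2[OF cH(1)] continuous_on_subset[OF f])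
  have "set_integrable lebesgue W (\<lambda>x. (H (f x) * \<psi>1 x) * Im (d2 x) - (H (f x) * \<psi>2 x) * Im (d1 x))"
    by (rule set_integral_diff(1)[OF i21 i22])
  moreover have "(\<lambda>x. (H (f x) * \<psi>1 x) * Im (d2 x) - (H (f x) * \<psi>2 x) * Im (d1 x)) = (\<lambda>x. H (f x) * (\<psi>1 x * Im (d2 x) - \<psi>2 x * Im (d1 x)))"
    by (simp add: algebra_simps)
  ultimately show i2: "set_integrable lebesgue W (\<lambda>x. H (f x) * (\<psi>1 x * Im (d2 x) - \<psi>2 x * Im (d1 x)))" by simp
  define \<Psi> where "\<Psi> = (\<lambda>x. \<psi> x * h (f x) * jac (d1 x) (d2 x) + H (f x) * (\<psi>1 x * Im (d2 x) - \<psi>2 x * Im (d1 x)))"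
  have \<Psi>i: "set_integrable lebesgue W \<Psi>" unfolding \<Psi>_def by (rule set_integral_add(1)[OF i1 i2])
  obtain M1 M2 M3 where M1: "1 \<le> M1" "\<And>x. x \<in> cball 0 R \<Longrightarrow> \<bar>\<psi> x\<bar> \<le> M1" and M2: "1 \<le> M2" "\<And>x. x \<in> cball 0 R \<Longrightarrow> \<bar>\<psi>1 x\<bar> \<le> M2"
    and M3: "1 \<le> M3" "\<And>x. x \<in> cball 0 R \<Longrightarrow> \<bar>\<psi>2 x\<bar> \<le> M3"
    using continuous_bound_on_compact[OF c\<psi>(1), of R] continuous_bound_on_compact[OF c\<psi>(2), of R] continuous_bound_on_compact[OF c\<psi>(3), of R] by blast
  have "continuous_on UNIV (\<lambda>x. norm (f x))" by (intro continuous_intros f)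
  then obtain Rf where Rf: "\<And>x. x \<in> cball 0 R \<Longrightarrow> norm (f x) \<le> Rf"
    using continuous_bound_on_compact[of "\<lambda>x. norm (f x)" R] unfolding abs_norm_cancel by blast
  obtain M4 M5 where M4: "1 \<le> M4" "\<And>w. w \<in> cball 0 (Rf + 1) \<Longrightarrow> \<bar>h w\<bar> \<le> M4" and M5: "1 \<le> M5" "\<And>w. w \<in> cball 0 (Rf + 1) \<Longrightarrow> \<bar>H w\<bar> \<le> M5"
    using continuous_bound_on_compact[OF cH(1), of "Rf + 1"] continuous_bound_on_compact[OF cH(2), of "Rf + 1"] by blast
  define M where "M = M1 + M2 + M3 + M4 + M5"
  have M: "1 \<le> M" using M1(1) M2(1) M3(1) M4(1) M5(1) by (simp add: M_def)
  have b\<psi>: "\<bar>\<psi> x\<bar> \<le> M" "\<bar>\<psi>1 x\<bar> \<le> M" "\<bar>\<psi>2 x\<bar> \<le> M" if "x \<in> cball 0 R" for x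
    using M1(2)[OF that] M2(2)[OF that] M3(2)[OF that] M1(1) M2(1) M3(1) M4(1) M5(1) unfolding M_def by linarith+
  have bH: "\<bar>h w\<bar> \<le> M" "\<bar>H w\<bar> \<le> M" if "w \<in> cball 0 (Rf + 1)" for w
    using M4(2)[OF that] M5(2)[OF that] M1(1) M2(1) M3(1) M4(1) M5(1) unfolding M_def by linarith+
  obtain \<rho> where \<rho>: "mollifier 1 \<rho>" using mollifier_exists[of 1] by auto
  obtain B where B: "\<And>y. \<rho> y \<le> B" using mollifier_bounded[OF \<rho>] by blast
  define c where "c = max 1 (32 * pi * B)"
  have c: "1 \<le> c" "32 * pi * B \<le> c" by (auto simp: c_def)
  define S where "S = (\<lambda>x. \<bar>jac (d1 x) (d2 x)\<bar> + g x)"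
  have Si: "set_integrable lebesgue W S"
    unfolding S_def using set_integrable_norm[OF iW(3)] iW(4) by (auto intro: set_integral_add(1))
  have S0: "0 \<le> S x" for x by (simp add: S_def g_def)
  define Q where "Q = (LINT x:W|lebesgue. S x)"
  define K0 where "K0 = 3 * M\<^sup>2 * c\<^sup>2"
  have K0: "0 < K0" using M c by (simp add: K0_def)
  define Tot where "Tot = K0 * (2 * (1 + measure lebesgue W) + Q + 416 + 1)"
  have Q0: "0 \<le> Q" unfolding Q_def set_lebesgue_integral_def using S0 by (intro integral_nonneg_AE) auto
  have Tot: "0 < Tot"
    unfolding Tot_def
  proof (rule mult_pos_pos[OF K0])
    show "0 < 2 * (1 + measure lebesgue W) + Q + 416 + 1"
      by (intro add_nonneg_pos add_nonneg_nonneg mult_nonneg_nonneg Q0 measure_nonneg) auto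
  qed
  have main: "\<bar>LINT x:W|lebesgue. \<Psi> x\<bar> \<le> Tot * \<epsilon>" if \<epsilon>: "0 < \<epsilon>" "\<epsilon> < 1" for \<epsilon>
  proof -
    have "uniformly_continuous_on (cball 0 (Rf + 1)) h" "uniformly_continuous_on (cball 0 (Rf + 1)) H"
      by (rule compact_uniformly_continuous; auto intro: continuous_on_subset[OF cH(1)] continuous_on_subset[OF cH(2)])+
    then obtain \<omega>1 \<omega>2 where \<omega>1: "0 < \<omega>1" "\<And>w v. w \<in> cball 0 (Rf + 1) \<Longrightarrow> v \<in> cball 0 (Rf + 1) \<Longrightarrow> dist v w < \<omega>1 \<Longrightarrow> dist (h v) (h w) < \<epsilon>"
      and \<omega>2: "0 < \<omega>2" "\<And>w v. w \<in> cball 0 (Rf + 1) \<Longrightarrow> v \<in> cball 0 (Rf + 1) \<Longrightarrow> dist v w < \<omega>2 \<Longrightarrow> dist (H v) (H w) < \<epsilon>"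
      using \<epsilon> unfolding uniformly_continuous_on_def by metis
    define \<omega> where "\<omega> = min (min \<omega>1 \<omega>2) (min 1 \<eta>)"
    have \<omega>: "0 < \<omega>" "\<omega> \<le> \<omega>1" "\<omega> \<le> \<omega>2" "\<omega> \<le> 1" "\<omega> \<le> \<eta>" using \<omega>1(1) \<omega>2(1) \<eta> by (auto simp: \<omega>_def)
    have "uniformly_continuous_on (cball 0 (R + 1)) f"
      by (rule compact_uniformly_continuous) (use f continuous_on_subset in auto)
    moreover have "0 < \<omega> / 4" using \<omega> by simp
    ultimately obtain t0 where t0: "0 < t0" "\<And>x z. x \<in> cball 0 (R + 1) \<Longrightarrow> z \<in> cball 0 (R + 1) \<Longrightarrow> dist z x < t0 \<Longrightarrow> dist (f z) (f x) < \<omega> / 4"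
      unfolding uniformly_continuous_on_def by metis
    define t where "t = min t0 (min \<eta> 1) / 4"
    have t: "0 < t" "2 * t \<le> \<eta>" "2 * t \<le> 1" "2 * t < t0" using t0(1) \<eta> by (auto simp: t_def)
    have osc: "\<forall>x\<in>cball 0 (R + 1). \<forall>z\<in>cball 0 (R + 1). dist z x \<le> 2 * t \<longrightarrow> norm (f z - f x) \<le> \<omega> / 4"
    proof (intro ballI impI)
      fix x z :: complex assume "x \<in> cball 0 (R + 1)" "z \<in> cball 0 (R + 1)" "dist z x \<le> 2 * t"
      then show "norm (f z - f x) \<le> \<omega> / 4" using t0(2)[of x z] t by (simp add: dist_norm)
    qed
    obtain dd where dd: "0 < dd" "\<And>A. A \<in> sets lebesgue \<Longrightarrow> emeasure lebesgue A < ennreal dd \<Longrightarrow> (LINT x:A|lebesgue. indicator W x *\<^sub>R S x) < \<epsilon>"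
      using integral_small_on_small_sets[of lebesgue "\<lambda>x. indicator W x *\<^sub>R S x" \<epsilon>] Si S0 \<epsilon> unfolding set_integrable_def by auto
    obtain \<phi> p q l Bad D where T: "C1 \<phi> p q \<and> 1 \<le> l \<and> (\<forall>x\<in>cball 0 R. norm (\<phi> x - f x) < \<omega>) \<and>
      Bad \<in> sets lebesgue \<and> emeasure lebesgue Bad < ennreal dd \<and> l\<^sup>2 * measure lebesgue Bad \<le> 416 * \<epsilon> \<and>
      (\<forall>x\<in>W. norm (p x) \<le> 32 * pi * B * l \<and> norm (q x) \<le> 32 * pi * B * l) \<and>
      (\<forall>x\<in>W - Bad. g x \<le> l \<and> norm (p x - d1 x) + norm (q x - d2 x) \<le> D x) \<and>
      (\<forall>x. 0 \<le> D x) \<and> set_integrable lebesgue W D \<and> l * (LINT x:W|lebesgue. D x) \<le> 2 * (1 + measure lebesgue W) * \<epsilon>"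
      using truncated_approximation[OF \<rho> B R \<eta> \<epsilon> t(1,2,3) \<omega>(1) dd(1) osc W_def] by (elim exE) (rule that)
    then have \<phi>: "C1 \<phi> p q" and l: "1 \<le> l" and \<phi>f: "\<And>x. x \<in> cball 0 R \<Longrightarrow> norm (\<phi> x - f x) < \<omega>"
      and Bad: "Bad \<in> sets lebesgue" "emeasure lebesgue Bad < ennreal dd" "l\<^sup>2 * measure lebesgue Bad \<le> 416 * \<epsilon>"
      and pq: "\<And>x. x \<in> W \<Longrightarrow> norm (p x) \<le> 32 * pi * B * l \<and> norm (q x) \<le> 32 * pi * B * l"
      and good: "\<And>x. x \<in> W - Bad \<Longrightarrow> g x \<le> l \<and> norm (p x - d1 x) + norm (q x - d2 x) \<le> D x"
      and D: "\<And>x. 0 \<le> D x" "set_integrable lebesgue W D" "l * (LINT x:W|lebesgue. D x) \<le> 2 * (1 + measure lebesgue W) * \<epsilon>"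
      by blast+
    define \<Phi> where "\<Phi> = (\<lambda>x. \<psi> x * h (\<phi> x) * jac (p x) (q x) + H (\<phi> x) * (\<psi>1 x * Im (q x) - \<psi>2 x * Im (p x)))"
    have c\<Phi>: "continuous_on UNIV \<Phi>"
      unfolding \<Phi>_def jac_def
      by (intro continuous_intros c\<psi> continuous_on_compose2[OF cH(1)] continuous_on_compose2[OF cH(2)]
          C1_continuous[OF \<phi>] C1_continuous_partials[OF \<phi>]) auto
    have \<Phi>i: "set_integrable lebesgue W \<Phi>" by (rule set_integrable_continuous[OF W(1) continuous_on_subset[OF c\<Phi>]]) simp
    have \<Phi>0: "\<Phi> x = 0" if "x \<notin> W" for x
    proof (cases "R < cmod x")
      case True
      then show ?thesis using supp C1_support[OF \<psi> supp] by (simp add: \<Phi>_def)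
    next
      case False
      then have xR: "x \<in> cball 0 R" and near: "infdist x E < 2 * \<eta>" using that by (auto simp: W_def)
      have "\<psi> x * h (\<phi> x) = 0"
      proof (cases "\<psi> x = 0")
        case False
        then show ?thesis using away[OF False near, of "\<phi> x"] \<phi>f[OF xR] \<omega> by (simp add: dist_norm)
      qed simp
      then show ?thesis using flat[OF near] by (simp add: \<Phi>_def)
    qed
    have "(LINT x:W|lebesgue. \<Phi> x) = 0"
    proof -
      have "(\<lambda>x. indicator W x *\<^sub>R \<Phi> x) = \<Phi>" using \<Phi>0 by (force simp: indicator_def)
      then have "(LINT x:W|lebesgue. \<Phi> x) = integral\<^sup>L lborel \<Phi>"
        unfolding set_lebesgue_integral_def using borel_measurable_continuous_onI[OF c\<Phi>] by (simp add: integral_completion)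
      also have "\<dots> = 0" unfolding \<Phi>_def by (rule pullback_identity_C1[OF \<psi> supp H \<phi>])
      finally show ?thesis .
    qed
    then have "\<bar>LINT x:W|lebesgue. \<Psi> x\<bar> = norm (LINT x:W|lebesgue. \<Phi> x - \<Psi> x)"
      using set_integral_diff(2)[OF \<Phi>i \<Psi>i] by simp
    also have "\<dots> \<le> (LINT x:W|lebesgue. norm (\<Phi> x - \<Psi> x))"
      by (rule set_integral_norm_bound[OF set_integral_diff(1)[OF \<Phi>i \<Psi>i]])
    also have "\<dots> \<le> (LINT x:W|lebesgue. K0 * (l * D x + \<epsilon> * S x + (l\<^sup>2 * indicator Bad x + indicator Bad x * S x)))"
    proof -
      have bi: "set_integrable lebesgue W (\<lambda>x. l\<^sup>2 * indicator Bad x)"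
        unfolding set_integrable_def
      proof (rule integrable_mult_indicator[OF Wl])
        show "integrable lebesgue (\<lambda>x. l\<^sup>2 * indicator Bad x)"
          using Bad(1,2) by (intro integrable_mult_right) (auto simp: integrable_indicator_iff intro: order.strict_trans[OF _ ennreal_less_top])
      qed
      have si: "set_integrable lebesgue W (\<lambda>x. indicator Bad x * S x)"
        using integrable_mult_indicator[OF Bad(1) Si[unfolded set_integrable_def]] by (simp add: set_integrable_def mult.left_commute)
      note bound_i = set_integral_add(1)[OF set_integral_add(1)[OF set_integrable_mult_right[of l, OF D(2)] set_integrable_mult_right[of \<epsilon>, OF Si]] set_integral_add(1)[OF bi si]]
      have pt: "norm (\<Phi> x - \<Psi> x) \<le> K0 * (l * D x + \<epsilon> * S x + (l\<^sup>2 * indicator Bad x + indicator Bad x * S x))" if x: "x \<in> W" for x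
      proof -
        have xR: "x \<in> cball 0 R" using x WR by blast
        have fx: "f x \<in> cball 0 (Rf + 1)" using Rf[OF xR] by simp
        have "norm (\<phi> x) \<le> norm (f x) + norm (\<phi> x - f x)" by (rule norm_triangle_sub)
        then have \<phi>x: "\<phi> x \<in> cball 0 (Rf + 1)" using Rf[OF xR] \<phi>f[OF xR] \<omega> by simp
        have pql: "norm (p x) \<le> c * l" "norm (q x) \<le> c * l"
          using pq[OF x] mult_right_mono[OF c(2), of l] l by linarith+
        have "dist (\<phi> x) (f x) < \<omega>" using \<phi>f[OF xR] by (simp add: dist_norm)
        then have hh: "\<bar>h (\<phi> x) - h (f x)\<bar> \<le> \<epsilon>" "\<bar>H (\<phi> x) - H (f x)\<bar> \<le> \<epsilon>"
          using \<omega>1(2)[OF fx \<phi>x] \<omega>2(2)[OF fx \<phi>x] \<omega> by (simp_all add: dist_real_def)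
        show ?thesis
        proof (cases "x \<in> Bad")
          case False
          then have gl: "norm (d1 x) + norm (d2 x) \<le> l" and Dx: "norm (p x - d1 x) + norm (q x - d2 x) \<le> D x"
            using good[of x] x by (auto simp: g_def)
          show ?thesis
            using integrand_difference_good[OF b\<psi>[OF xR] bH[OF \<phi>x] hh M l c(1) pql(2) gl Dx] False
            by (simp add: \<Phi>_def \<Psi>_def K0_def S_def g_def)
        next
          case True
          have "norm (\<Phi> x - \<Psi> x) \<le> K0 * (l\<^sup>2 + S x)"
            using integrand_difference_bad[OF b\<psi>[OF xR] bH[OF \<phi>x] bH[OF fx] M l c(1) pql, of "d1 x" "d2 x"]
            by (simp add: \<Phi>_def \<Psi>_def K0_def S_def g_def)
          also have "\<dots> \<le> K0 * (l * D x + \<epsilon> * S x + (l\<^sup>2 + S x))"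
            using K0 D(1)[of x] S0[of x] l \<epsilon> by (intro mult_left_mono) auto
          finally show ?thesis using True by simp
        qed
      qed
      show ?thesis
        by (rule set_integral_mono[OF set_integrable_norm[OF set_integral_diff(1)[OF \<Phi>i \<Psi>i]] set_integrable_mult_right[OF bound_i] pt])
    qed
    also have "\<dots> = K0 * (l * (LINT x:W|lebesgue. D x) + \<epsilon> * Q + ((LINT x:W|lebesgue. l\<^sup>2 * indicator Bad x) + (LINT x:W|lebesgue. indicator Bad x * S x)))"
    proof -
      have bi: "set_integrable lebesgue W (\<lambda>x. l\<^sup>2 * indicator Bad x)"
        unfolding set_integrable_def
      proof (rule integrable_mult_indicator[OF Wl])
        show "integrable lebesgue (\<lambda>x. l\<^sup>2 * indicator Bad x)"
          using Bad(1,2) by (intro integrable_mult_right) (auto simp: integrable_indicator_iff intro: order.strict_trans[OF _ ennreal_less_top])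
      qed
      have si: "set_integrable lebesgue W (\<lambda>x. indicator Bad x * S x)"
        using integrable_mult_indicator[OF Bad(1) Si[unfolded set_integrable_def]] by (simp add: set_integrable_def mult.left_commute)
      note D' = set_integrable_mult_right[of l, OF D(2)] and S' = set_integrable_mult_right[of \<epsilon>, OF Si]
      show ?thesis
        unfolding set_integral_mult_right set_integral_add(2)[OF set_integral_add(1)[OF D' S'] set_integral_add(1)[OF bi si]]
          set_integral_add(2)[OF D' S'] set_integral_add(2)[OF bi si] Q_def ..
    qed
    also have "\<dots> \<le> K0 * (2 * (1 + measure lebesgue W) * \<epsilon> + \<epsilon> * Q + (416 * \<epsilon> + \<epsilon>))"
    proof (intro mult_left_mono add_mono)
      have "(LINT x:W|lebesgue. l\<^sup>2 * indicator Bad x) = l\<^sup>2 * measure lebesgue (W \<inter> Bad)"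
        using Wl Bad(1) by (simp add: set_lebesgue_integral_def mult.left_commute flip: indicator_inter_arith)
      also have "\<dots> \<le> l\<^sup>2 * measure lebesgue Bad"
        using Wl Bad by (intro mult_left_mono measure_mono_fmeasurable) (auto simp: fmeasurable_def intro: order.strict_trans[OF _ ennreal_less_top])
      finally show "(LINT x:W|lebesgue. l\<^sup>2 * indicator Bad x) \<le> 416 * \<epsilon>" using Bad(3) by linarith
      have "(LINT x:W|lebesgue. indicator Bad x * S x) = (LINT x:Bad|lebesgue. indicator W x *\<^sub>R S x)"
        by (simp add: set_lebesgue_integral_def mult.left_commute)
      then show "(LINT x:W|lebesgue. indicator Bad x * S x) \<le> \<epsilon>" using dd(2)[OF Bad(1,2)] by simp
    qed (use D(3) K0 \<epsilon> in auto)
    also have "\<dots> = Tot * \<epsilon>" by (simp add: Tot_def algebra_simps)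
    finally show ?thesis .
  qed
  have "(LINT x:W|lebesgue. \<Psi> x) = 0"
  proof (rule ccontr)
    define X where "X = \<bar>LINT x:W|lebesgue. \<Psi> x\<bar>"
    assume "(LINT x:W|lebesgue. \<Psi> x) \<noteq> 0"
    then have X: "0 < X" by (simp add: X_def)
    define \<epsilon> where "\<epsilon> = min (1/2) (X / (2 * Tot))"
    have "0 < \<epsilon>" "\<epsilon> < 1" using X Tot by (auto simp: \<epsilon>_def)
    then have "X \<le> Tot * \<epsilon>" unfolding X_def by (rule main)
    also have "\<dots> \<le> Tot * (X / (2 * Tot))" using Tot unfolding \<epsilon>_def by (intro mult_left_mono) auto
    also have "\<dots> = X / 2" using Tot by simp
    finally show False using X by simp
  qed
  then show "(LINT x:W|lebesgue. \<psi> x * h (f x) * jac (d1 x) (d2 x)) + (LINT x:W|lebesgue. H (f x) * (\<psi>1 x * Im (d2 x) - \<psi>2 x * Im (d1 x))) = 0"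
    unfolding \<Psi>_def set_integral_add(2)[OF i1 i2] .
qed

end

section \<open>Cutoff functions and primitives\<close>

lemma smooth_cutoff:
  fixes A :: "complex set"
  assumes r: "0 < r"
  shows "\<exists>u. smooth u \<and> (\<forall>x. 0 \<le> u x \<and> u x \<le> 1) \<and> (\<forall>x. infdist x A \<le> r \<longrightarrow> u x = 1) \<and>
    (\<forall>x. 4 * r \<le> infdist x A \<longrightarrow> u x = 0)"
proof -
  define v where "v = (\<lambda>x. max 0 (min 1 (3 - infdist x A / r)))"
  have vc: "continuous_on UNIV v" unfolding v_def using r by (intro continuous_intros) auto
  have v01: "0 \<le> v x" "v x \<le> 1" for x by (auto simp: v_def)
  obtain k where k: "mollifier r k" using mollifier_exists[OF r] by blast
  have sm: "smooth (conv k v)" by (rule conv_smooth[OF mollifierD(1)[OF k] mollifierD(3)[OF k] vc])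
  have i: "integrable lborel (\<lambda>z. k (x - z) * v z)" for x
  proof (rule Bochner_Integration.integrable_bound[OF mollifier_translate(2)[OF k, of x]])
    have "continuous_on UNIV (\<lambda>z. k (x - z) * v z)"
      by (intro continuous_intros vc continuous_on_compose2[OF mollifierD(5)[OF k, of UNIV]]) auto
    then show "(\<lambda>z. k (x - z) * v z) \<in> borel_measurable lborel" by (simp add: borel_measurable_continuous_onI)
    have "k (x - z) * v z \<le> k (x - z)" for z using v01[of z] mollifierD(2)[OF k, of "x - z"] by (simp add: mult_left_le)
    then show "AE z in lborel. norm (k (x - z) * v z) \<le> norm (k (x - z))"
      using v01 mollifierD(2)[OF k] by (intro AE_I2) (simp add: abs_mult)
  qed
  have "0 \<le> conv k v x" for x
    unfolding conv_def using v01 mollifierD(2)[OF k] by (intro integral_nonneg_AE) simp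
  moreover have "conv k v x \<le> 1" for x
  proof -
    have "conv k v x \<le> (LINT z|lborel. k (x - z))"
      unfolding conv_def real_scaleR_def
      by (rule integral_mono[OF i mollifier_translate(2)[OF k]])
         (use v01 mollifierD(2)[OF k] in \<open>simp add: mult_left_le\<close>)
    then show ?thesis using mollifier_translate(1)[OF k] by simp
  qed
  moreover have const: "conv k v x = c" if "\<And>z. dist z x \<le> r \<Longrightarrow> v z = c" for x c
  proof -
    have "norm (conv k v x - v x) \<le> 0"
      by (rule conv_diff_bound[OF k vc]) (use that[of x] that r in simp)
    then show ?thesis using that[of x] r by simp
  qed
  moreover have "conv k v x = 1" if "infdist x A \<le> r" for x
  proof (rule const)
    fix z assume "dist z x \<le> r"
    then have "infdist z A \<le> 2 * r" using infdist_triangle[of z A x] that by linarith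
    then show "v z = 1" using r by (simp add: v_def field_simps)
  qed
  moreover have "conv k v x = 0" if "4 * r \<le> infdist x A" for x
  proof (rule const)
    fix z assume "dist z x \<le> r"
    then have "3 * r \<le> infdist z A" using infdist_triangle[of x A z] that by (simp add: dist_commute)
    then show "v z = 0" using r by (simp add: v_def field_simps)
  qed
  ultimately show ?thesis using sm by blast
qed

text \<open>
  The primitive is \<open>Re w - a\<close> times the mean of \<open>h\<close> over a horizontal segment. Parametrising all these segments by
  the unit interval allows differentiation under the integral sign.
\<close>

lemma C1_primitive:
  fixes h :: "complex \<Rightarrow> real"
  assumes h: "C1 h h1 h2"
  shows "\<exists>H H2. C1 H h H2 \<and> (\<forall>y. H (Complex a y) = 0)"
proof -
  note hc = C1_continuous[OF h, of UNIV] C1_continuous_partials[OF h, of UNIV]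
  define P where "P = (\<lambda>w (t::real). Complex (a + t * (Re w - a)) (Im w))"
  have Pc: "continuous_on S (\<lambda>z. P (fst z) (snd z))" for S
    unfolding P_def Complex_eq by (intro continuous_intros)
  have Pc': "continuous_on S (P w)" for S w unfolding P_def[abs_def] Complex_eq by (intro continuous_intros)
  define I where "I = (\<lambda>w. integral (cbox 0 1) (\<lambda>t. h (P w t)))"
  define I1 where "I1 = (\<lambda>w. integral (cbox 0 1) (\<lambda>t. t * h1 (P w t)))"
  define I2 where "I2 = (\<lambda>w. integral (cbox 0 1) (\<lambda>t. h2 (P w t)))"
  have I: "C1 I I1 I2"
    unfolding I_def I1_def I2_def
  proof (rule C1_Leibniz)
    fix w t
    have "((\<lambda>w. P w t) has_derivative (\<lambda>v. Complex (t * Re v) (Im v))) (at w)"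
      unfolding P_def Complex_eq by (auto intro!: derivative_eq_intros)
    moreover have "(h has_derivative (\<lambda>v. Re v *\<^sub>R h1 (P w t) + Im v *\<^sub>R h2 (P w t))) (at (P w t))"
      using h unfolding C1_def by blast
    ultimately have "((\<lambda>w. h (P w t)) has_derivative (\<lambda>v. Re (Complex (t * Re v) (Im v)) *\<^sub>R h1 (P w t) + Im (Complex (t * Re v) (Im v)) *\<^sub>R h2 (P w t))) (at w)"
      by (rule has_derivative_compose)
    then show "((\<lambda>w. h (P w t)) has_derivative (\<lambda>v. Re v *\<^sub>R (t * h1 (P w t)) + Im v *\<^sub>R h2 (P w t))) (at w)"
      by (simp add: algebra_simps)
  next
    show "continuous_on (cbox 0 1) (\<lambda>t. h (P w t))" for w
      by (intro continuous_on_compose2[OF hc(1)] Pc') auto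
    show "continuous_on (UNIV \<times> cbox 0 1) (\<lambda>(w, t). t * h1 (P w t))"
      unfolding case_prod_beta by (intro continuous_intros continuous_on_compose2[OF hc(2)] Pc) auto
    show "continuous_on (UNIV \<times> cbox 0 1) (\<lambda>(w, t). h2 (P w t))"
      unfolding case_prod_beta by (intro continuous_intros continuous_on_compose2[OF hc(3)] Pc) auto
  qed
  have L: "C1 (\<lambda>w. Re w - a) (\<lambda>_. 1) (\<lambda>_. 0)"
    unfolding C1_def by (auto intro!: derivative_eq_intros)
  have key: "(Re w - a) * I1 w + 1 * I w = h w" for w
  proof -
    have d: "((\<lambda>t. t * h (P w t)) has_vector_derivative (t * ((Re w - a) * h1 (P w t)) + h (P w t))) (at t within {0..1})" for t
    proof -
      have "((\<lambda>t. P w t) has_derivative (\<lambda>s. Complex (s * (Re w - a)) 0)) (at t)"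
        unfolding P_def Complex_eq by (auto intro!: derivative_eq_intros)
      moreover have "(h has_derivative (\<lambda>v. Re v *\<^sub>R h1 (P w t) + Im v *\<^sub>R h2 (P w t))) (at (P w t))"
        using h unfolding C1_def by blast
      ultimately have "((\<lambda>t. h (P w t)) has_derivative (\<lambda>s. Re (Complex (s * (Re w - a)) 0) *\<^sub>R h1 (P w t) + Im (Complex (s * (Re w - a)) 0) *\<^sub>R h2 (P w t))) (at t)"
        by (rule has_derivative_compose)
      then have "((\<lambda>t. h (P w t)) has_real_derivative ((Re w - a) * h1 (P w t))) (at t)"
        unfolding has_field_derivative_def by (rule has_derivative_eq_rhs) auto
      then have "((\<lambda>t. t * h (P w t)) has_real_derivative (t * ((Re w - a) * h1 (P w t)) + h (P w t))) (at t)"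
        by (auto intro!: derivative_eq_intros)
      then show ?thesis
        by (simp add: has_real_derivative_iff_has_vector_derivative has_vector_derivative_at_within)
    qed
    have "((\<lambda>t. t * ((Re w - a) * h1 (P w t)) + h (P w t)) has_integral 1 * h (P w 1) - 0 * h (P w 0)) {0..1}"
      by (rule fundamental_theorem_of_calculus) (use d in auto)
    then have "integral {0..1} (\<lambda>t. t * ((Re w - a) * h1 (P w t)) + h (P w t)) = h w"
      by (simp add: integral_unique P_def)
    moreover have i: "(\<lambda>t. t * h1 (P w t)) integrable_on {0..1}" "(\<lambda>t. h (P w t)) integrable_on {0..1}"
      by (intro integrable_continuous_interval continuous_intros continuous_on_compose2[OF hc(1)] continuous_on_compose2[OF hc(2)] Pc'; simp)+
    have "integral {0..1} (\<lambda>t. t * ((Re w - a) * h1 (P w t)) + h (P w t)) = integral {0..1} (\<lambda>t. (Re w - a) * (t * h1 (P w t)) + h (P w t))"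
      by (simp add: mult.left_commute)
    also have "\<dots> = (Re w - a) * I1 w + I w"
      unfolding I1_def I_def cbox_interval
      by (intro integral_unique has_integral_add has_integral_mult_right integrable_integral i)
    ultimately show ?thesis by simp
  qed
  have "C1 (\<lambda>w. (Re w - a) * I w) h (\<lambda>w. (Re w - a) * I2 w + 0 * I w)"
    using C1_mult[OF L I] unfolding key .
  moreover have "(Re (Complex a y) - a) * I (Complex a y) = 0" for y by simp
  ultimately show ?thesis by blast
qed

lemma integral_along_horizontal:
  fixes H :: "complex \<Rightarrow> real"
  assumes H: "C1 H h H2" and ab: "a \<le> b"
  shows "integral {a..b} (\<lambda>s. h (Complex s y)) = H (Complex b y) - H (Complex a y)"
proof (rule integral_unique[OF fundamental_theorem_of_calculus[OF ab]])
  fix s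
  have "((\<lambda>s. Complex s y) has_derivative (\<lambda>v. Complex v 0)) (at s)"
    unfolding Complex_eq by (auto intro!: derivative_eq_intros)
  moreover have "(H has_derivative (\<lambda>v. Re v *\<^sub>R h (Complex s y) + Im v *\<^sub>R H2 (Complex s y))) (at (Complex s y))"
    using H unfolding C1_def by blast
  ultimately have "((\<lambda>s. H (Complex s y)) has_derivative (\<lambda>v. Re (Complex v 0) *\<^sub>R h (Complex s y) + Im (Complex v 0) *\<^sub>R H2 (Complex s y))) (at s)"
    by (rule has_derivative_compose)
  then have "((\<lambda>s. H (Complex s y)) has_vector_derivative h (Complex s y)) (at s)"
    unfolding has_vector_derivative_def by (rule has_derivative_eq_rhs) auto
  then show "((\<lambda>s. H (Complex s y)) has_vector_derivative h (Complex s y)) (at s within {a..b})"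
    by (rule has_vector_derivative_at_within)
qed

lemma distr_Complex_lborel: "distr (lborel \<Otimes>\<^sub>M lborel) borel (\<lambda>(x, y). Complex x y) = lborel"
proof (rule lborel_eqI[symmetric])
  have m [measurable]: "(\<lambda>(x, y). Complex x y) \<in> borel_measurable (lborel \<Otimes>\<^sub>M lborel)"
    unfolding case_prod_beta Complex_eq by measurable
  fix l u :: complex assume lu: "\<And>b. b \<in> Basis \<Longrightarrow> l \<bullet> b \<le> u \<bullet> b"
  have l1: "Re l \<le> Re u" "Im l \<le> Im u" using lu[of 1] lu[of \<i>] by (auto simp: Basis_complex_def inner_complex_def)
  have "(\<lambda>(x, y). Complex x y) -` box l u \<inter> space (lborel \<Otimes>\<^sub>M lborel) = box (Re l) (Re u) \<times> box (Im l) (Im u)"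
    by (auto simp: in_box_complex_iff space_pair_measure box_real)
  then have "emeasure (distr (lborel \<Otimes>\<^sub>M lborel) borel (\<lambda>(x, y). Complex x y)) (box l u) = emeasure (lborel \<Otimes>\<^sub>M lborel) (box (Re l) (Re u) \<times> box (Im l) (Im u))"
    by (subst emeasure_distr) auto
  also have "\<dots> = emeasure lborel (box (Re l) (Re u)) * emeasure lborel (box (Im l) (Im u))"
    by (rule lborel.emeasure_pair_measure_Times) auto
  also have "\<dots> = ennreal ((Re u - Re l) * (Im u - Im l))"
    using l1 by (simp add: ennreal_mult box_real)
  finally show "emeasure (distr (lborel \<Otimes>\<^sub>M lborel) borel (\<lambda>(x, y). Complex x y)) (box l u) = (\<Prod>b\<in>Basis. (u - l) \<bullet> b)"
    by (simp add: Basis_complex_def inner_complex_def)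
qed simp

lemma nn_integral_complex_iterated:
  assumes [measurable]: "F \<in> borel_measurable borel"
  shows "(\<integral>\<^sup>+ z. F z \<partial>lborel) = (\<integral>\<^sup>+ y. \<integral>\<^sup>+ x. F (Complex x y) \<partial>lborel \<partial>lborel)"
proof -
  have m [measurable]: "(\<lambda>(x, y). Complex x y) \<in> borel_measurable (lborel \<Otimes>\<^sub>M lborel)"
    unfolding case_prod_beta Complex_eq by measurable
  have m2: "(\<lambda>p. F (case p of (x, y) \<Rightarrow> Complex x y)) \<in> borel_measurable (lborel \<Otimes>\<^sub>M lborel)" by measurable
  have "(\<integral>\<^sup>+ z. F z \<partial>lborel) = (\<integral>\<^sup>+ z. F z \<partial>distr (lborel \<Otimes>\<^sub>M lborel) borel (\<lambda>(x, y). Complex x y))"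
    by (simp only: distr_Complex_lborel)
  also have "\<dots> = (\<integral>\<^sup>+ p. F (case p of (x, y) \<Rightarrow> Complex x y) \<partial>(lborel \<Otimes>\<^sub>M lborel))"
    by (rule nn_integral_distr) measurable
  also have "\<dots> = (\<integral>\<^sup>+ y. \<integral>\<^sup>+ x. F (Complex x y) \<partial>lborel \<partial>lborel)"
    using lborel_pair.nn_integral_snd[OF m2] by simp
  finally show ?thesis .
qed

lemma nn_integral_continuous_interval:
  fixes c :: "real \<Rightarrow> real"
  assumes c: "continuous_on {a..b} c" and pos: "\<And>x. x \<in> {a..b} \<Longrightarrow> 0 \<le> c x"
  shows "(\<integral>\<^sup>+ x. ennreal (c x) * indicator {a..b} x \<partial>lborel) = ennreal (integral {a..b} c)"
proof -
  have i: "set_integrable lborel {a..b} c" using borel_integrable_compact[OF compact_Icc c] by (simp add: set_integrable_def)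
  have "(\<integral>\<^sup>+ x. ennreal (c x) * indicator {a..b} x \<partial>lborel) = (\<integral>\<^sup>+ x. ennreal (indicator {a..b} x *\<^sub>R c x) \<partial>lborel)"
    by (rule nn_integral_cong) (auto simp: indicator_def)
  also have "\<dots> = ennreal (LINT x:{a..b}|lborel. c x)"
    unfolding set_lebesgue_integral_def
    by (rule nn_integral_eq_integral) (use i pos in \<open>auto simp: set_integrable_def indicator_def\<close>)
  also have "(LINT x:{a..b}|lborel. c x) = integral {a..b} c" by (rule set_borel_integral_eq_integral(2)[OF i])
  finally show ?thesis .
qed

definition square :: "real \<Rightarrow> complex set" where
  "square R = cbox (Complex (- R) (- R)) (Complex R R)"

lemma square_iff: "w \<in> square R \<longleftrightarrow> \<bar>Re w\<bar> \<le> R \<and> \<bar>Im w\<bar> \<le> R"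
  by (auto simp: square_def in_cbox_complex_iff)

text \<open>
  The horizontal primitive \<open>H\<close> of \<open>h\<close> starts at the left side of the square, so it is bounded by the integral \<open>m\<close>
  of \<open>h\<close> over a full horizontal segment. The primitive \<open>G\<close> of \<open>m\<close> is bounded by the integral of \<open>h\<close> over the
  square; it is small when \<open>h\<close> approximates the indicator function of a null set.
\<close>

lemma primitives_of_bump:
  fixes h :: "complex \<Rightarrow> real"
  assumes h: "C1 h h1 h2" and h01: "\<And>w. 0 \<le> h w" "\<And>w. h w \<le> 1" and R: "0 < R"
  shows "\<exists>H H2 G m. C1 H h H2 \<and> C1 G (\<lambda>_. 0) (\<lambda>w. m (Im w)) \<and>
    (\<forall>y. m y = integral {-R..R} (\<lambda>s. h (Complex s y)) \<and> 0 \<le> m y \<and> m y \<le> 2 * R) \<and>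
    (\<forall>w\<in>square R. 0 \<le> H w \<and> H w \<le> m (Im w) \<and> 0 \<le> G w \<and> ennreal (G w) \<le> (\<integral>\<^sup>+ z. ennreal (h z) * indicator (square R) z \<partial>lborel))"
proof -
  note hc = C1_continuous[OF h, of UNIV]
  have hl: "continuous_on S (\<lambda>s. h (Complex s y))" for S y
    unfolding Complex_eq by (intro continuous_on_compose2[OF hc] continuous_intros) auto
  have hi: "(\<lambda>s. h (Complex s y)) integrable_on {a..b}" for a b y by (rule integrable_continuous_interval[OF hl])
  obtain H H2 where H: "C1 H h H2" and H0: "\<And>y. H (Complex (-R) y) = 0" using C1_primitive[OF h, of "-R"] by blast
  have Heq: "H (Complex x y) = integral {-R..x} (\<lambda>s. h (Complex s y))" if "-R \<le> x" for x y
    using integral_along_horizontal[OF H that, of y] H0 by simp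
  define m where "m = (\<lambda>y. H (Complex R y))"
  have meq: "m y = integral {-R..R} (\<lambda>s. h (Complex s y))" for y unfolding m_def using R by (intro Heq) simp
  have m0: "0 \<le> m y" for y unfolding meq by (rule integral_nonneg[OF hi]) (rule h01)
  have m2: "m y \<le> 2 * R" for y
  proof -
    have "m y \<le> integral {-R..R} (\<lambda>s. 1)" unfolding meq by (rule integral_le[OF hi]) (use h01 in auto)
    then show ?thesis using R by simp
  qed
  have m1: "C1 (\<lambda>w. m (Re w)) (\<lambda>w. H2 (Complex R (Re w))) (\<lambda>w. 0)"
  proof -
    have "C1 (\<lambda>w. Complex R (Re w)) (\<lambda>_. \<i>) (\<lambda>_. 0)"
      unfolding C1_def Complex_eq by (auto intro!: derivative_eq_intros simp: scaleR_conv_of_real mult.commute)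
    from C1_compose[OF H this] show ?thesis by (simp add: m_def)
  qed
  obtain G0 G2 where G0: "C1 G0 (\<lambda>w. m (Re w)) G2" and G00: "\<And>y. G0 (Complex (-R) y) = 0" using C1_primitive[OF m1, of "-R"] by blast
  define G where "G = (\<lambda>w. G0 (Complex (Im w) 0))"
  have G: "C1 G (\<lambda>_. 0) (\<lambda>w. m (Im w))"
  proof -
    have "C1 (\<lambda>w. Complex (Im w) 0) (\<lambda>_. 0) (\<lambda>_. 1)"
      unfolding C1_def Complex_eq by (auto intro!: derivative_eq_intros simp: scaleR_conv_of_real)
    from C1_compose[OF G0 this] show ?thesis by (simp add: G_def)
  qed
  have mc: "continuous_on S m" for S
    unfolding m_def Complex_eq by (intro continuous_on_compose2[OF C1_continuous[OF H, of UNIV]] continuous_intros) auto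
  have mi: "m integrable_on {a..b}" for a b by (rule integrable_continuous_interval[OF mc])
  have total: "ennreal (integral {-R..R} m) = (\<integral>\<^sup>+ z. ennreal (h z) * indicator (square R) z \<partial>lborel)"
  proof -
    have [measurable]: "h \<in> borel_measurable borel" by (rule borel_measurable_continuous_onI[OF hc])
    have [measurable]: "square R \<in> sets borel" by (simp add: square_def)
    have "(\<integral>\<^sup>+ z. ennreal (h z) * indicator (square R) z \<partial>lborel)
       = (\<integral>\<^sup>+ y. \<integral>\<^sup>+ x. ennreal (h (Complex x y)) * indicator (square R) (Complex x y) \<partial>lborel \<partial>lborel)"
      by (rule nn_integral_complex_iterated) measurable
    also have "\<dots> = (\<integral>\<^sup>+ y. (\<integral>\<^sup>+ x. ennreal (h (Complex x y)) * indicator {-R..R} x \<partial>lborel) * indicator {-R..R} y \<partial>lborel)"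
      by (auto simp: indicator_def square_iff abs_le_iff intro!: nn_integral_cong)
    also have "\<dots> = (\<integral>\<^sup>+ y. ennreal (m y) * indicator {-R..R} y \<partial>lborel)"
      unfolding meq by (subst nn_integral_continuous_interval[OF hl]) (use h01 in auto)
    also have "\<dots> = ennreal (integral {-R..R} m)" by (rule nn_integral_continuous_interval[OF mc]) (rule m0)
    finally show ?thesis by simp
  qed
  have sq: "0 \<le> H w \<and> H w \<le> m (Im w) \<and> 0 \<le> G w \<and> ennreal (G w) \<le> (\<integral>\<^sup>+ z. ennreal (h z) * indicator (square R) z \<partial>lborel)"
    if "w \<in> square R" for w
  proof -
    have b: "-R \<le> Re w" "Re w \<le> R" "-R \<le> Im w" "Im w \<le> R" using that by (auto simp: square_iff)
    have Hw: "H w = integral {-R..Re w} (\<lambda>s. h (Complex s (Im w)))" using Heq[OF b(1), of "Im w"] by simp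
    have 1: "0 \<le> H w" unfolding Hw by (rule integral_nonneg[OF hi]) (rule h01)
    have 2: "H w \<le> m (Im w)" unfolding Hw meq by (rule integral_subset_le[OF _ hi hi]) (use b h01 in auto)
    have "G w = integral {-R..Im w} m"
      using integral_along_horizontal[OF G0 b(3), of 0] G00 by (simp add: G_def)
    moreover have "0 \<le> integral {-R..Im w} m" by (rule integral_nonneg[OF mi]) (rule m0)
    moreover have "integral {-R..Im w} m \<le> integral {-R..R} m" by (rule integral_subset_le[OF _ mi mi]) (use b m0 in auto)
    ultimately show ?thesis using 1 2 unfolding total[symmetric] by (simp add: ennreal_leI)
  qed
  show ?thesis
    by (rule exI[of _ H], rule exI[of _ H2], rule exI[of _ G], rule exI[of _ m]) (use H G meq m0 m2 sq in blast)
qed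

section \<open>The Jacobian on preimages of null sets\<close>

lemma compact_subset_cball: "compact W \<Longrightarrow> \<exists>R. W \<subseteq> cball (0::complex) R"
  using compact_imp_bounded[of W] by (force simp: bounded_iff)

text \<open>
  The identities in question are linear in the derivative. Uniform convergence of the maps together with L1
  convergence of their derivatives therefore suffices.
\<close>

lemma limit_identity:
  fixes f d :: "complex \<Rightarrow> complex" and u ub G K :: "complex \<Rightarrow> real"
  assumes W: "compact W" and f: "continuous_on UNIV f" and d: "set_integrable lebesgue W d"
    and c: "continuous_on UNIV u" "continuous_on UNIV ub" "continuous_on UNIV G" "continuous_on UNIV K"
    and approx: "\<And>e. 0 < e \<Longrightarrow> \<exists>\<phi> p. continuous_on UNIV \<phi> \<and> continuous_on UNIV p \<and> (\<forall>x\<in>W. norm (\<phi> x - f x) \<le> e) \<and>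
       (LINT x:W|lebesgue. norm (p x - d x)) < e \<and> (LINT x:W|lebesgue. u x * K (\<phi> x) * Im (p x) + G (\<phi> x) * ub x) = 0"
  shows "(LINT x:W|lebesgue. u x * K (f x) * Im (d x) + G (f x) * ub x) = 0"
proof -
  obtain R where R: "W \<subseteq> cball 0 R"
    using compact_subset_cball[OF W] by (elim exE)
  obtain M1 M2 where M1: "1 \<le> M1" "\<And>x. x \<in> cball 0 R \<Longrightarrow> \<bar>u x\<bar> \<le> M1" and M2: "1 \<le> M2" "\<And>x. x \<in> cball 0 R \<Longrightarrow> \<bar>ub x\<bar> \<le> M2"
    using continuous_bound_on_compact[OF c(1), of R] continuous_bound_on_compact[OF c(2), of R] by blast
  have "continuous_on UNIV (\<lambda>x. norm (f x))" by (intro continuous_intros f)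
  then obtain Rf where Rf: "\<And>x. x \<in> cball 0 R \<Longrightarrow> norm (f x) \<le> Rf"
    using continuous_bound_on_compact[of "\<lambda>x. norm (f x)" R] unfolding abs_norm_cancel by blast
  obtain M4 where M4: "1 \<le> M4" "\<And>w. w \<in> cball 0 (Rf + 1) \<Longrightarrow> \<bar>K w\<bar> \<le> M4"
    using continuous_bound_on_compact[OF c(4), of "Rf + 1"] by blast
  define M where "M = M1 + M2 + M4"
  have M: "1 \<le> M" using M1(1) M2(1) M4(1) by (simp add: M_def)
  have bu: "\<bar>u x\<bar> \<le> M" "\<bar>ub x\<bar> \<le> M" if "x \<in> W" for x
    using M1(2)[of x] M2(2)[of x] M1(1) M2(1) M4(1) that R unfolding M_def by force+
  have bK: "\<bar>K w\<bar> \<le> M" if "w \<in> cball 0 (Rf + 1)" for w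
    using M4(2)[OF that] M1(1) M2(1) M4(1) unfolding M_def by linarith
  define \<Psi> where "\<Psi> = (\<lambda>x. u x * K (f x) * Im (d x) + G (f x) * ub x)"
  have Imd: "set_integrable lebesgue W (\<lambda>x. Im (d x))"
    using absolutely_integrable_linear[OF d bounded_linear_Im] by (simp add: o_def)
  have fW: "continuous_on W f" by (rule continuous_on_subset[OF f]) simp
  have cW: "continuous_on W (\<lambda>x. v (f x))" if "continuous_on UNIV v" for v :: "complex \<Rightarrow> real"
    by (rule continuous_on_compose2[OF that fW]) simp
  have \<Psi>i: "set_integrable lebesgue W \<Psi>"
    unfolding \<Psi>_def
  proof (rule set_integral_add(1))
    show "set_integrable lebesgue W (\<lambda>x. u x * K (f x) * Im (d x))"
      by (rule set_integrable_mult_continuous[OF W _ Imd]) (intro continuous_intros cW c(4) continuous_on_subset[OF c(1)]; simp)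
    show "set_integrable lebesgue W (\<lambda>x. G (f x) * ub x)"
      by (rule set_integrable_continuous[OF W]) (intro continuous_intros cW c(3) continuous_on_subset[OF c(2)]; simp)
  qed
  define Q where "Q = (LINT x:W|lebesgue. norm (d x))"
  have Q0: "0 \<le> Q" unfolding Q_def set_lebesgue_integral_def by (intro integral_nonneg_AE) auto
  define Tot where "Tot = M\<^sup>2 + M * Q + M * measure lebesgue W"
  have Tot: "0 < Tot"
    unfolding Tot_def by (intro add_pos_nonneg mult_nonneg_nonneg Q0 measure_nonneg) (use M in auto)
  have main: "\<bar>LINT x:W|lebesgue. \<Psi> x\<bar> \<le> Tot * \<epsilon>" if \<epsilon>: "0 < \<epsilon>" for \<epsilon>
  proof -
    have "uniformly_continuous_on (cball 0 (Rf + 1)) K" "uniformly_continuous_on (cball 0 (Rf + 1)) G"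
      by (rule compact_uniformly_continuous; auto intro: continuous_on_subset[OF c(3)] continuous_on_subset[OF c(4)])+
    then obtain \<omega>1 \<omega>2 where \<omega>1: "0 < \<omega>1" "\<And>w v. w \<in> cball 0 (Rf + 1) \<Longrightarrow> v \<in> cball 0 (Rf + 1) \<Longrightarrow> dist v w < \<omega>1 \<Longrightarrow> dist (K v) (K w) < \<epsilon>"
      and \<omega>2: "0 < \<omega>2" "\<And>w v. w \<in> cball 0 (Rf + 1) \<Longrightarrow> v \<in> cball 0 (Rf + 1) \<Longrightarrow> dist v w < \<omega>2 \<Longrightarrow> dist (G v) (G w) < \<epsilon>"
      using \<epsilon> unfolding uniformly_continuous_on_def by metis
    define e where "e = min (min \<omega>1 \<omega>2) (min 1 \<epsilon>) / 2"
    have e: "0 < e" "e < \<omega>1" "e < \<omega>2" "e < 1" "e < \<epsilon>" using \<omega>1(1) \<omega>2(1) \<epsilon> by (auto simp: e_def)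
    obtain \<phi> p where \<phi>: "continuous_on UNIV \<phi>" and p: "continuous_on UNIV p" and \<phi>f: "\<And>x. x \<in> W \<Longrightarrow> norm (\<phi> x - f x) \<le> e"
      and pd: "(LINT x:W|lebesgue. norm (p x - d x)) < e"
      and zero: "(LINT x:W|lebesgue. u x * K (\<phi> x) * Im (p x) + G (\<phi> x) * ub x) = 0"
      using approx[OF e(1)] by blast
    define \<Phi> where "\<Phi> = (\<lambda>x. u x * K (\<phi> x) * Im (p x) + G (\<phi> x) * ub x)"
    have c\<Phi>: "continuous_on W \<Phi>"
    proof -
      have "continuous_on UNIV \<Phi>" unfolding \<Phi>_def
        by (intro continuous_intros c(1,2) p continuous_on_compose2[OF c(3) \<phi>] continuous_on_compose2[OF c(4) \<phi>]; simp)
      then show ?thesis by (rule continuous_on_subset) simp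
    qed
    have \<Phi>i: "set_integrable lebesgue W \<Phi>" by (rule set_integrable_continuous[OF W c\<Phi>])
    have pi: "set_integrable lebesgue W (\<lambda>x. norm (p x - d x))"
      by (intro set_integrable_norm set_integral_diff d set_integrable_continuous[OF W] continuous_on_subset[OF p]) simp
    have ci: "set_integrable lebesgue W (\<lambda>x. M * \<epsilon>)" by (rule set_integrable_continuous[OF W]) simp
    note j1 = set_integrable_mult_right[of "M\<^sup>2", OF pi] and j2 = set_integrable_mult_right[of "M * \<epsilon>", OF set_integrable_norm[OF d]]
    have "\<bar>LINT x:W|lebesgue. \<Psi> x\<bar> = norm (LINT x:W|lebesgue. \<Phi> x - \<Psi> x)"
      using set_integral_diff(2)[OF \<Phi>i \<Psi>i] zero by (simp add: \<Phi>_def)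
    also have "\<dots> \<le> (LINT x:W|lebesgue. norm (\<Phi> x - \<Psi> x))"
      by (rule set_integral_norm_bound[OF set_integral_diff(1)[OF \<Phi>i \<Psi>i]])
    also have "\<dots> \<le> (LINT x:W|lebesgue. M\<^sup>2 * norm (p x - d x) + M * \<epsilon> * norm (d x) + M * \<epsilon>)"
    proof (rule set_integral_mono[OF set_integrable_norm[OF set_integral_diff(1)[OF \<Phi>i \<Psi>i]] set_integral_add(1)[OF set_integral_add(1)[OF j1 j2] ci]])
      fix x assume x: "x \<in> W"
      have xR: "x \<in> cball 0 R" using x R by blast
      have fx: "f x \<in> cball 0 (Rf + 1)" using Rf[OF xR] by simp
      have "norm (\<phi> x) \<le> norm (f x) + norm (\<phi> x - f x)" by (rule norm_triangle_sub)
      then have \<phi>x: "\<phi> x \<in> cball 0 (Rf + 1)" using Rf[OF xR] \<phi>f[OF x] e by simp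
      have "dist (\<phi> x) (f x) \<le> e" using \<phi>f[OF x] by (simp add: dist_norm)
      then have hh: "\<bar>K (\<phi> x) - K (f x)\<bar> \<le> \<epsilon>" "\<bar>G (\<phi> x) - G (f x)\<bar> \<le> \<epsilon>"
        using \<omega>1(2)[OF fx \<phi>x] \<omega>2(2)[OF fx \<phi>x] e by (simp_all add: dist_real_def)
      have T1: "\<bar>u x * K (\<phi> x) * Im (p x - d x)\<bar> \<le> M * M * norm (p x - d x)"
        by (intro abs_mult_le bu[OF x] bK[OF \<phi>x] abs_Im_le_cmod)
      have T2: "\<bar>u x * (K (\<phi> x) - K (f x)) * Im (d x)\<bar> \<le> M * \<epsilon> * norm (d x)"
        by (intro abs_mult_le bu[OF x] hh abs_Im_le_cmod)
      have T3: "\<bar>(G (\<phi> x) - G (f x)) * ub x\<bar> \<le> \<epsilon> * M"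
        by (intro abs_mult_le bu[OF x] hh)
      have "\<Phi> x - \<Psi> x = u x * K (\<phi> x) * Im (p x - d x) + u x * (K (\<phi> x) - K (f x)) * Im (d x) + (G (\<phi> x) - G (f x)) * ub x"
        by (simp add: \<Phi>_def \<Psi>_def algebra_simps)
      then show "norm (\<Phi> x - \<Psi> x) \<le> M\<^sup>2 * norm (p x - d x) + M * \<epsilon> * norm (d x) + M * \<epsilon>"
        using T1 T2 T3 by (simp add: power2_eq_square mult.commute[of \<epsilon> M])
    qed
    also have "\<dots> = M\<^sup>2 * (LINT x:W|lebesgue. norm (p x - d x)) + M * \<epsilon> * Q + M * \<epsilon> * measure lebesgue W"
      unfolding set_integral_add(2)[OF set_integral_add(1)[OF j1 j2] ci] set_integral_add(2)[OF j1 j2] set_integral_mult_right Q_def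
      by (simp add: set_lebesgue_integral_def)
    also have "\<dots> \<le> M\<^sup>2 * \<epsilon> + M * \<epsilon> * Q + M * \<epsilon> * measure lebesgue W"
      using pd e by (intro add_right_mono mult_left_mono) auto
    also have "\<dots> = Tot * \<epsilon>" by (simp add: Tot_def algebra_simps)
    finally show ?thesis .
  qed
  have "(LINT x:W|lebesgue. \<Psi> x) = 0"
  proof (rule ccontr)
    assume nz: "(LINT x:W|lebesgue. \<Psi> x) \<noteq> 0"
    have "\<bar>LINT x:W|lebesgue. \<Psi> x\<bar> \<le> Tot * (\<bar>LINT x:W|lebesgue. \<Psi> x\<bar> / (2 * Tot))"
      using nz Tot by (intro main) simp
    then show False using nz Tot by simp
  qed
  then show ?thesis by (simp add: \<Psi>_def)
qed

text \<open>
  The assumption says that \<open>u\<close> is a weak derivative of the zero function, whose mollifications vanish.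
\<close>

lemma AE_zero_of_test_functions:
  fixes u :: "complex \<Rightarrow> complex"
  assumes \<Omega>: "open \<Omega>" and u: "u \<in> L1_loc \<Omega>" and U: "compact U" "U \<subseteq> \<Omega>"
    and zero: "\<And>\<phi>. \<phi> \<in> test_functions \<Omega> \<Longrightarrow> (LINT x:\<Omega>|lebesgue. \<phi> x *\<^sub>R u x) = 0"
  shows "AE x in lebesgue. x \<in> U \<longrightarrow> u x = 0"
proof -
  have w: "weak_partial \<Omega> 1 (\<lambda>_. 0) u"
    unfolding weak_partial_def using zero by (simp add: set_lebesgue_integral_def)
  have ui: "set_integrable lebesgue U u" using u U unfolding L1_loc_def by auto
  have small: "(LINT x:U|lebesgue. norm (u x)) < e" if e: "0 < e" for e
  proof -
    obtain \<delta> where \<delta>: "0 < \<delta>" "\<And>\<sigma> k. 0 < \<sigma> \<Longrightarrow> \<sigma> < \<delta> \<Longrightarrow> mollifier \<sigma> k \<Longrightarrow>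
      (LINT x:U|lebesgue. norm (conv (\<lambda>y. frechet_derivative k (at y) 1) (\<lambda>_. 0) x - u x)) < e"
      using weak_partial_mollify_L1[OF \<Omega> _ _ u w U e] by auto
    obtain k where k: "mollifier (\<delta> / 2) k" using mollifier_exists[of "\<delta>/2"] \<delta> by auto
    show ?thesis using \<delta>(2)[OF _ _ k] \<delta>(1) by (simp add: conv_def)
  qed
  have i: "integrable lebesgue (\<lambda>x. norm (indicator U x *\<^sub>R u x))"
    by (rule integrable_norm[OF ui[unfolded set_integrable_def]])
  have "(LINT x|lebesgue. norm (indicator U x *\<^sub>R u x)) = 0"
  proof -
    have "(LINT x|lebesgue. norm (indicator U x *\<^sub>R u x)) = (LINT x:U|lebesgue. norm (u x))"
      by (simp add: set_lebesgue_integral_def)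
    moreover have "0 \<le> (LINT x|lebesgue. norm (indicator U x *\<^sub>R u x))" by (rule integral_nonneg_AE) simp
    ultimately show ?thesis using small[of "LINT x:U|lebesgue. norm (u x)"] by (metis less_irrefl order_le_less)
  qed
  then have "AE x in lebesgue. norm (indicator U x *\<^sub>R u x) = 0"
    using integral_nonneg_eq_0_iff_AE[OF i] by simp
  then show ?thesis by eventually_elim (auto simp: indicator_def split: if_splits)
qed

lemma L1_loc_measurable:
  fixes u :: "complex \<Rightarrow> 'b::euclidean_space"
  assumes \<Omega>: "open \<Omega>" and u: "u \<in> L1_loc \<Omega>"
  shows "(\<lambda>x. indicator \<Omega> x *\<^sub>R u x) \<in> borel_measurable lebesgue"
proof -
  obtain C where C: "\<And>n. compact (C n)" "\<And>n. C n \<subseteq> \<Omega>" "\<And>n. C n \<subseteq> interior (C (Suc n))" "\<Union>(range C) = \<Omega>"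
    using open_Union_compact_subsets[OF \<Omega>] by metis
  have mono: "C n \<subseteq> C m" if "n \<le> m" for n m
    using that by (induction rule: dec_induct) (use C(3) interior_subset in blast)+
  show ?thesis
  proof (rule borel_measurable_LIMSEQ_metric[where f="\<lambda>n x. indicator (C n) x *\<^sub>R u x"])
    show "(\<lambda>x. indicator (C n) x *\<^sub>R u x) \<in> borel_measurable lebesgue" for n
      using u C(1,2) unfolding L1_loc_def set_integrable_def by (auto intro!: borel_measurable_integrable)
    fix x
    show "(\<lambda>n. indicator (C n) x *\<^sub>R u x) \<longlonglongrightarrow> indicator \<Omega> x *\<^sub>R u x"
    proof (cases "x \<in> \<Omega>")
      case True
      then obtain n0 where n0: "x \<in> C n0" using C(4) by blast
      have "\<forall>\<^sub>F n in sequentially. indicator \<Omega> x *\<^sub>R u x = indicator (C n) x *\<^sub>R u x"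
        using eventually_ge_at_top[of n0]
      proof eventually_elim
        case (elim n)
        then have "x \<in> C n" using mono n0 by blast
        then show ?case using True by simp
      qed
      then show ?thesis by (rule Lim_transform_eventually[OF tendsto_const])
    next
      case False
      then have "x \<notin> C n" for n using C(2) by blast
      then show ?thesis using False by simp
    qed
  qed
qed

context singular_set
begin

lemma open_compl: "open (- E)" using E(1) by (simp add: compact_imp_closed open_Compl)

text \<open>
  The function \<open>G\<close> depends on the imaginary part only, so this is the chain rule for \<open>G(f)\<close>, tested against \<open>u\<close>.
\<close>

lemma weak_chain_rule_Im:
  assumes G: "C1 G (\<lambda>_. 0) K" and u: "C1 u u1 u2" and W: "compact W" "W \<subseteq> - E" and z: "\<And>x. x \<notin> W \<Longrightarrow> u x = 0"
  shows "(LINT x:W|lebesgue. u x * K (f x) * Im (d1 x) + G (f x) * u1 x) = 0"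
    and "(LINT x:W|lebesgue. u x * K (f x) * Im (d2 x) + G (f x) * u2 x) = 0"
proof -
  note iW = integrable_compact[OF W]
  note cG = C1_continuous[OF G, of UNIV] C1_continuous_partials(2)[OF G, of UNIV]
  note cu = C1_continuous[OF u, of UNIV] C1_continuous_partials[OF u, of UNIV]
  obtain R where R: "W \<subseteq> cball 0 R"
    using compact_subset_cball[OF W(1)] by (elim exE)
  have "open (- W)" using W(1) by (simp add: compact_imp_closed open_Compl)
  then have z12: "u1 x = 0" "u2 x = 0" if "x \<notin> W" for x
  proof -
    have "(u has_derivative (\<lambda>v. 0)) (at x)"
      by (rule has_derivative_transform_within_open[OF has_derivative_const[of 0] \<open>open (- W)\<close>]) (use z that in auto)
    from C1_partials_unique[OF u this] show "u1 x = 0" "u2 x = 0" by simp_all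
  qed
  have ap: "\<exists>\<phi> p q. C1 \<phi> p q \<and> (\<forall>x\<in>W. norm (\<phi> x - f x) \<le> e) \<and>
      (LINT x:W|lebesgue. norm (p x - d1 x)) < e \<and> (LINT x:W|lebesgue. norm (q x - d2 x)) < e \<and>
      (LINT x:W|lebesgue. u x * K (\<phi> x) * Im (p x) + G (\<phi> x) * u1 x) = 0 \<and>
      (LINT x:W|lebesgue. u x * K (\<phi> x) * Im (q x) + G (\<phi> x) * u2 x) = 0" if e: "0 < e" for e
  proof -
    obtain \<phi> p q where \<phi>: "C1 \<phi> p q" and \<phi>f: "\<And>x. x \<in> cball 0 R \<Longrightarrow> norm (\<phi> x - f x) \<le> e"
      and pq: "(LINT x:W|lebesgue. norm (p x - d1 x)) < e" "(LINT x:W|lebesgue. norm (q x - d2 x)) < e"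
      using weak_approx[OF open_compl f d w W e, of R] by blast
    note c\<phi> = C1_continuous[OF \<phi>, of UNIV] C1_continuous_partials[OF \<phi>, of UNIV]
    have C: "C1 (\<lambda>x. u x * G (\<phi> x)) (\<lambda>x. u x * (Re (p x) * 0 + Im (p x) * K (\<phi> x)) + u1 x * G (\<phi> x))
        (\<lambda>x. u x * (Re (q x) * 0 + Im (q x) * K (\<phi> x)) + u2 x * G (\<phi> x))"
      by (rule C1_mult[OF u C1_compose[OF G \<phi>]])
    have far: "u x * G (\<phi> x) = 0" if "R < cmod x" for x using that R z by force
    have tr: "(LINT x:W|lebesgue. F x) = integral\<^sup>L lborel F" if "continuous_on UNIV F" "\<And>x. x \<notin> W \<Longrightarrow> F x = 0" for F :: "complex \<Rightarrow> real"
    proof -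
      have "(\<lambda>x. indicator W x *\<^sub>R F x) = F" using that(2) by (force simp: indicator_def)
      then show ?thesis
        unfolding set_lebesgue_integral_def using borel_measurable_continuous_onI[OF that(1)] by (simp add: integral_completion)
    qed
    have e1: "(\<lambda>x. u x * K (\<phi> x) * Im (p x) + G (\<phi> x) * u1 x) = (\<lambda>x. u x * (Re (p x) * 0 + Im (p x) * K (\<phi> x)) + u1 x * G (\<phi> x))"
      and e2: "(\<lambda>x. u x * K (\<phi> x) * Im (q x) + G (\<phi> x) * u2 x) = (\<lambda>x. u x * (Re (q x) * 0 + Im (q x) * K (\<phi> x)) + u2 x * G (\<phi> x))"
      by (simp_all add: algebra_simps)
    have "(LINT x:W|lebesgue. u x * K (\<phi> x) * Im (p x) + G (\<phi> x) * u1 x) = 0"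
      unfolding e1
      by (subst tr[OF C1_continuous_partials(1)[OF C]]) (use integral_C1_partials_0(1)[OF C far] z z12 in auto)
    moreover have "(LINT x:W|lebesgue. u x * K (\<phi> x) * Im (q x) + G (\<phi> x) * u2 x) = 0"
      unfolding e2
      by (subst tr[OF C1_continuous_partials(2)[OF C]]) (use integral_C1_partials_0(2)[OF C far] z z12 in auto)
    moreover have "\<forall>x\<in>W. norm (\<phi> x - f x) \<le> e" using \<phi>f R by blast
    ultimately show ?thesis using \<phi> pq by blast
  qed
  show "(LINT x:W|lebesgue. u x * K (f x) * Im (d1 x) + G (f x) * u1 x) = 0"
  proof (rule limit_identity[OF W(1) f iW(1) cu(1,2) cG])
    fix e :: real assume "0 < e"
    from ap[OF this] show "\<exists>\<phi> p. continuous_on UNIV \<phi> \<and> continuous_on UNIV p \<and> (\<forall>x\<in>W. norm (\<phi> x - f x) \<le> e) \<and>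
       (LINT x:W|lebesgue. norm (p x - d1 x)) < e \<and> (LINT x:W|lebesgue. u x * K (\<phi> x) * Im (p x) + G (\<phi> x) * u1 x) = 0"
      using C1_continuous C1_continuous_partials(1) by blast
  qed
  show "(LINT x:W|lebesgue. u x * K (f x) * Im (d2 x) + G (f x) * u2 x) = 0"
  proof (rule limit_identity[OF W(1) f iW(2) cu(1,3) cG])
    fix e :: real assume "0 < e"
    from ap[OF this] show "\<exists>\<phi> p. continuous_on UNIV \<phi> \<and> continuous_on UNIV p \<and> (\<forall>x\<in>W. norm (\<phi> x - f x) \<le> e) \<and>
       (LINT x:W|lebesgue. norm (p x - d2 x)) < e \<and> (LINT x:W|lebesgue. u x * K (\<phi> x) * Im (p x) + G (\<phi> x) * u2 x) = 0"
      using C1_continuous C1_continuous_partials(2) by blast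
  qed
qed

end

lemma bump_sequence:
  fixes N :: "complex set"
  assumes N: "compact N" "N \<noteq> {}"
  shows "\<exists>h. (\<forall>k. smooth (h k)) \<and> (\<forall>k w. 0 \<le> h k w \<and> h k w \<le> (1::real)) \<and>
    (\<forall>k w. infdist w N \<le> 1 / (4 * real (Suc k)) \<longrightarrow> h k w = 1) \<and> (\<forall>w. (\<lambda>k. h k w) \<longlonglongrightarrow> indicator N w)"
proof -
  have "\<forall>k. \<exists>u. smooth u \<and> (\<forall>x. 0 \<le> u x \<and> u x \<le> 1) \<and> (\<forall>x. infdist x N \<le> 1 / (4 * real (Suc k)) \<longrightarrow> u x = 1) \<and>
    (\<forall>x. 4 * (1 / (4 * real (Suc k))) \<le> infdist x N \<longrightarrow> u x = 0)"
    by (intro allI smooth_cutoff) simp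
  then obtain h where h: "\<And>k. smooth (h k)" "\<And>k w. 0 \<le> h k w \<and> h k w \<le> (1::real)"
    "\<And>k w. infdist w N \<le> 1 / (4 * real (Suc k)) \<Longrightarrow> h k w = 1"
    "\<And>k w. 4 * (1 / (4 * real (Suc k))) \<le> infdist w N \<Longrightarrow> h k w = 0"
    by metis
  have lim: "(\<lambda>k. h k w) \<longlonglongrightarrow> indicator N w" for w
  proof (cases "w \<in> N")
    case True
    then have "h k w = 1" for k by (intro h(3)) simp
    then show ?thesis using True by simp
  next
    case False
    then have "0 < infdist w N" using N infdist_pos_not_in_closed[of N w] compact_imp_closed by blast
    then obtain n where n: "inverse (real (Suc n)) < infdist w N" using reals_Archimedean by blast
    have "\<forall>\<^sub>F k in sequentially. 0 = h k w"
      using eventually_ge_at_top[of n]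
    proof eventually_elim
      case (elim k)
      have "1 / real (Suc k) \<le> inverse (real (Suc n))" using elim by (simp add: field_simps)
      moreover have "4 * (1 / (4 * real (Suc k))) = 1 / real (Suc k)" by (simp add: field_simps)
      ultimately have "4 * (1 / (4 * real (Suc k))) \<le> infdist w N" using n by (metis less_imp_le order_trans)
      then show ?case using h(4) by metis
    qed
    then have "(\<lambda>k. h k w) \<longlonglongrightarrow> 0" by (rule Lim_transform_eventually[OF tendsto_const])
    then show ?thesis using False by simp
  qed
  show ?thesis using h lim by blast
qed

lemma compact_test_support:
  "\<phi> \<in> test_functions \<Omega> \<Longrightarrow> compact (closure {x. \<phi> x \<noteq> 0}) \<and> closure {x. \<phi> x \<noteq> 0} \<subseteq> \<Omega> \<and> smooth \<phi>"
  by (simp add: test_functions_def smooth_def)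

context singular_set
begin

text \<open>
  The integrals \<open>m k\<close> of \<open>h k\<close> over horizontal segments bound the primitives \<open>H k\<close>. In the limit they become
  the lengths \<open>mi\<close> of the horizontal slices of \<open>N\<close>. These lengths need not vanish at every height, but the
  primitives \<open>G k\<close> of \<open>m k\<close> tend to \<open>0\<close> because \<open>N\<close> has no area, and the chain rule for \<open>G k\<close> then shows that
  \<open>mi (Im f)\<close> annihilates the gradient of \<open>Im f\<close>.
\<close>

lemma slices_of_null_set:
  assumes N: "compact N" "N \<noteq> {}" "negligible N" and R: "0 < Rq" and fS: "f ` cball 0 R1 \<subseteq> square Rq"
  shows "\<exists>h H H2 m. (\<forall>k w. 0 \<le> h k w \<and> h k w \<le> (1::real)) \<and> (\<forall>w. (\<lambda>k. h k w) \<longlonglongrightarrow> indicator N w) \<and>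
     (\<forall>k. C1 (H k) (h k) (H2 k)) \<and> (\<forall>k. \<forall>w\<in>square Rq. 0 \<le> H k w \<and> H k w \<le> m k (Im w)) \<and>
     (\<forall>k y. 0 \<le> m k y \<and> m k y \<le> 2 * Rq) \<and>
     (\<forall>U. compact U \<longrightarrow> U \<subseteq> ball 0 R1 - E \<longrightarrow>
        (AE x in lebesgue. x \<in> U \<longrightarrow> (\<lambda>k. m k (Im (f x)) * (\<bar>Im (d1 x)\<bar> + \<bar>Im (d2 x)\<bar>)) \<longlonglongrightarrow> 0))"
proof -
  obtain h where h: "\<And>k. smooth (h k)" and h01: "\<And>k w. 0 \<le> h k w" "\<And>k w. h k w \<le> (1::real)"
    and hlim: "\<And>w. (\<lambda>k. h k w) \<longlonglongrightarrow> indicator N w"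
    using bump_sequence[OF N(1,2)] by blast
  define P where "P = (\<lambda>k H H2 G (m :: real \<Rightarrow> real). C1 H (h k) H2 \<and> C1 G (\<lambda>_. 0) (\<lambda>w. m (Im w)) \<and>
    (\<forall>y. m y = integral {-Rq..Rq} (\<lambda>s. h k (Complex s y)) \<and> 0 \<le> m y \<and> m y \<le> 2 * Rq) \<and>
    (\<forall>w\<in>square Rq. 0 \<le> H w \<and> H w \<le> m (Im w) \<and> 0 \<le> G w \<and> ennreal (G w) \<le> (\<integral>\<^sup>+ z. ennreal (h k z) * indicator (square Rq) z \<partial>lborel)))"
  have "\<exists>H H2 G m. P k H H2 G m" for k
    unfolding P_def by (rule primitives_of_bump[OF smooth_C1[OF h] h01 R])
  then obtain H H2 G m where P: "\<And>k. P k (H k) (H2 k) (G k) (m k)" by metis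
  have HC: "C1 (H k) (h k) (H2 k)" and GC: "C1 (G k) (\<lambda>_. 0) (\<lambda>w. m k (Im w))"
    and m: "m k y = integral {-Rq..Rq} (\<lambda>s. h k (Complex s y))" "0 \<le> m k y" "m k y \<le> 2 * Rq" for k y
    using P[of k] unfolding P_def by blast+
  have sq: "0 \<le> H k w" "H k w \<le> m k (Im w)" "0 \<le> G k w" "ennreal (G k w) \<le> (\<integral>\<^sup>+ z. ennreal (h k z) * indicator (square Rq) z \<partial>lborel)"
    if "w \<in> square Rq" for k w
    using P[of k] that unfolding P_def by blast+
  have hm [measurable]: "h k \<in> borel_measurable borel" for k
    by (rule borel_measurable_continuous_onI[OF smooth_continuous[OF h]])
  have Nb [measurable]: "N \<in> sets borel" using N(1) by (rule borel_compact)
  have Sb [measurable]: "square Rq \<in> sets borel" by (simp add: square_def)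
  define mi where "mi = (\<lambda>y. LINT s:{-Rq..Rq}|lborel. indicat_real N (Complex s y))"
  have mlim: "(\<lambda>k. m k y) \<longlonglongrightarrow> mi y" for y
  proof -
    have Cm [measurable]: "(\<lambda>s. Complex s y) \<in> borel_measurable borel" unfolding Complex_eq by measurable
    have e: "m k y = (LINT s:{-Rq..Rq}|lborel. h k (Complex s y))" for k
    proof -
      have "continuous_on {-Rq..Rq} (\<lambda>s. h k (Complex s y))"
        unfolding Complex_eq by (intro continuous_on_compose2[OF smooth_continuous[OF h, of UNIV]] continuous_intros) auto
      then have "set_integrable lborel {-Rq..Rq} (\<lambda>s. h k (Complex s y))"
        unfolding set_integrable_def by (intro borel_integrable_compact) auto
      then show ?thesis using set_borel_integral_eq_integral(2) m(1) by metis
    qed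
    show ?thesis
      unfolding e mi_def set_lebesgue_integral_def
    proof (rule integral_dominated_convergence[where w="\<lambda>s. indicator {-Rq..Rq} s"])
      show "(\<lambda>s. indicator {-Rq..Rq} s *\<^sub>R indicat_real N (Complex s y)) \<in> borel_measurable lborel"
        using measurable_compose[OF Cm borel_measurable_indicator[OF Nb]] by simp
      show "(\<lambda>s. indicator {-Rq..Rq} s *\<^sub>R h k (Complex s y)) \<in> borel_measurable lborel" for k
        using measurable_compose[OF Cm hm] by simp
      show "AE s in lborel. (\<lambda>k. indicator {-Rq..Rq} s *\<^sub>R h k (Complex s y)) \<longlonglongrightarrow> indicator {-Rq..Rq} s *\<^sub>R indicat_real N (Complex s y)"
        by (intro AE_I2 tendsto_intros hlim)
      show "AE s in lborel. norm (indicator {-Rq..Rq} s *\<^sub>R h k (Complex s y)) \<le> indicator {-Rq..Rq} s" for k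
        by (rule AE_I2) (use h01 in \<open>auto simp: indicator_def\<close>)
    qed (simp add: integrable_indicator_iff emeasure_lborel_Icc_eq)
  qed
  have mib: "0 \<le> mi y" "mi y \<le> 2 * Rq" for y
    using LIMSEQ_le_const[OF mlim[of y], of 0] LIMSEQ_le_const2[OF mlim[of y], of "2 * Rq"] m(2,3)[of _ y] by blast+
  have mmeas: "mi \<in> borel_measurable borel"
  proof (rule borel_measurable_LIMSEQ_metric[OF _ mlim])
    fix k
    have "continuous_on UNIV (\<lambda>w. m k (Im w))" by (rule C1_continuous_partials(2)[OF GC])
    then have "continuous_on UNIV (\<lambda>y. m k (Im (Complex 0 y)))"
      by (rule continuous_on_compose2) (auto simp: Complex_eq intro!: continuous_intros)
    then show "m k \<in> borel_measurable borel" by (simp add: borel_measurable_continuous_onI)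
  qed
  have elim: "(\<lambda>k. \<integral>\<^sup>+ z. ennreal (h k z) * indicator (square Rq) z \<partial>lborel) \<longlonglongrightarrow> 0"
  proof -
    have "(\<lambda>k. \<integral>\<^sup>+ z. ennreal (h k z) * indicator (square Rq) z \<partial>lborel) \<longlonglongrightarrow> (\<integral>\<^sup>+ z. ennreal (indicator N z) * indicator (square Rq) z \<partial>lborel)"
    proof (rule nn_integral_dominated_convergence[where w="indicator (square Rq)"])
      show "AE z in lborel. ennreal (h k z) * indicator (square Rq) z \<le> indicator (square Rq) z" for k
        by (rule AE_I2) (use h01(2) in \<open>auto simp: indicator_def\<close>)
      show "AE z in lborel. (\<lambda>k. ennreal (h k z) * indicator (square Rq) z) \<longlonglongrightarrow> ennreal (indicator N z) * indicator (square Rq) z"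
      proof (rule AE_I2)
        fix z
        show "(\<lambda>k. ennreal (h k z) * indicator (square Rq) z) \<longlonglongrightarrow> ennreal (indicator N z) * indicator (square Rq) z"
          using tendsto_ennrealI[OF hlim[of z]] by (cases "z \<in> square Rq") auto
      qed
      show "(\<integral>\<^sup>+ z. indicator (square Rq) z \<partial>(lborel :: complex measure)) < \<infinity>"
        using emeasure_lborel_cbox_finite[of "Complex (- Rq) (- Rq)" "Complex Rq Rq"] by (simp add: square_def)
    qed measurable
    also have "(\<integral>\<^sup>+ z. ennreal (indicator N z) * indicator (square Rq) z \<partial>lborel) = 0"
    proof -
      have "AE z in lborel. z \<notin> N"
        using N(3) Nb by (simp add: negligible_iff_null_sets null_sets_completion_iff AE_not_in)
      then have "AE z in lborel. ennreal (indicator N z) * indicator (square Rq) z = 0"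
        by eventually_elim simp
      then show ?thesis by (subst nn_integral_0_iff_AE) auto
    qed
    finally show ?thesis .
  qed
  have Glim: "(\<lambda>k. G k w) \<longlonglongrightarrow> 0" if "w \<in> square Rq" for w
  proof -
    have "(\<lambda>k. ennreal (G k w)) \<longlonglongrightarrow> 0"
      by (rule tendsto_sandwich[OF _ _ tendsto_const elim]) (use sq(4)[OF that] in auto)
    then show ?thesis using sq(3)[OF that] by (simp add: ennreal_tendsto_0_iff)
  qed
  define A where "A = measure lborel (square Rq)"
  have GA: "G k w \<le> A" if "w \<in> square Rq" for k w
  proof -
    have "ennreal (G k w) \<le> (\<integral>\<^sup>+ z. ennreal (h k z) * indicator (square Rq) z \<partial>lborel)" by (rule sq(4)[OF that])
    also have "\<dots> \<le> (\<integral>\<^sup>+ z. indicator (square Rq) z \<partial>lborel)"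
      by (rule nn_integral_mono) (use h01(2) in \<open>auto simp: indicator_def\<close>)
    also have "\<dots> = ennreal A"
      using emeasure_lborel_cbox_finite[of "Complex (- Rq) (- Rq)" "Complex Rq Rq"]
      by (auto simp: A_def square_def intro!: emeasure_eq_ennreal_measure)
    finally show ?thesis by (simp add: A_def ennreal_le_iff)
  qed
  define \<Omega> where "\<Omega> = ball 0 R1 - E"
  have \<Omega>: "open \<Omega>" "\<Omega> \<subseteq> - E" unfolding \<Omega>_def using E(1) by (auto intro: open_Diff compact_imp_closed)
  have f\<Omega>: "f x \<in> square Rq" if "x \<in> \<Omega>" for x using that fS unfolding \<Omega>_def by force
  have fm [measurable]: "(\<lambda>x. mi (Im (f x))) \<in> borel_measurable borel"
  proof -
    have "(\<lambda>x. Im (f x)) \<in> borel_measurable borel" using f by (intro borel_measurable_continuous_onI continuous_intros)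
    then show ?thesis using mmeas by (rule measurable_compose)
  qed
  have fml: "(\<lambda>x. mi (Im (f x))) \<in> borel_measurable lebesgue" using fm by (intro measurable_completion) simp
  have ae: "AE x in lebesgue. x \<in> U \<longrightarrow> mi (Im (f x)) * Im (d x) = 0"
    if U: "compact U" "U \<subseteq> \<Omega>"
      and di: "\<And>C. compact C \<Longrightarrow> C \<subseteq> - E \<Longrightarrow> set_integrable lebesgue C (\<lambda>x. Im (d x))"
      and chain: "\<And>\<phi> W k. smooth \<phi> \<Longrightarrow> compact W \<Longrightarrow> W \<subseteq> - E \<Longrightarrow> (\<And>x. x \<notin> W \<Longrightarrow> \<phi> x = 0) \<Longrightarrow>
        \<exists>\<phi>b. continuous_on UNIV \<phi>b \<and> (\<forall>k. (LINT x:W|lebesgue. \<phi> x * m k (Im (f x)) * Im (d x) + G k (f x) * \<phi>b x) = 0)"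
    for U and d :: "complex \<Rightarrow> complex"
  proof -
    have ui: "set_integrable lebesgue C (\<lambda>x. mi (Im (f x)) * Im (d x))" if C: "compact C" "C \<subseteq> - E" for C
      unfolding set_integrable_def
    proof (rule Bochner_Integration.integrable_bound)
      show "integrable lebesgue (\<lambda>x. (2 * Rq) *\<^sub>R (indicator C x *\<^sub>R Im (d x)))"
        using di[OF C] unfolding set_integrable_def by (rule integrable_scaleR_right)
      have "(\<lambda>x. mi (Im (f x)) * (indicator C x *\<^sub>R Im (d x))) \<in> borel_measurable lebesgue"
        by (rule borel_measurable_times[OF fml borel_measurable_integrable[OF di[OF C, unfolded set_integrable_def]]])
      then show "(\<lambda>x. indicator C x *\<^sub>R (mi (Im (f x)) * Im (d x))) \<in> borel_measurable lebesgue"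
        by (simp add: mult.left_commute)
      show "AE x in lebesgue. norm (indicator C x *\<^sub>R (mi (Im (f x)) * Im (d x))) \<le> norm ((2 * Rq) *\<^sub>R (indicator C x *\<^sub>R Im (d x)))"
        by (rule AE_I2) (use mib R in \<open>auto simp: indicator_def abs_mult intro: mult_right_mono\<close>)
    qed
    have "(\<lambda>x. complex_of_real (mi (Im (f x)) * Im (d x))) \<in> L1_loc \<Omega>"
      unfolding L1_loc_def
    proof (intro CollectI allI impI)
      fix C assume "compact C \<and> C \<subseteq> \<Omega>"
      then have "set_integrable lebesgue C (\<lambda>x. mi (Im (f x)) * Im (d x))" using \<Omega> by (intro ui) auto
      from absolutely_integrable_linear[OF this bounded_linear_of_real]
      show "(\<lambda>x. complex_of_real (mi (Im (f x)) * Im (d x))) absolutely_integrable_on C" by (simp add: o_def)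
    qed
    then have "AE x in lebesgue. x \<in> U \<longrightarrow> complex_of_real (mi (Im (f x)) * Im (d x)) = 0"
    proof (rule AE_zero_of_test_functions[OF \<Omega>(1) _ U])
      fix \<phi> assume \<phi>: "\<phi> \<in> test_functions \<Omega>"
      define W where "W = closure {x. \<phi> x \<noteq> 0}"
      have W: "compact W" "W \<subseteq> \<Omega>" and sm: "smooth \<phi>" using compact_test_support[OF \<phi>] by (auto simp: W_def)
      have WE: "W \<subseteq> - E" using W \<Omega> by blast
      have Wz: "\<phi> x = 0" if "x \<notin> W" for x
      proof (rule ccontr)
        assume "\<phi> x \<noteq> 0"
        then have "x \<in> W" unfolding W_def by (intro closure_subset[THEN subsetD]) simp
        with that show False by simp
      qed
      obtain \<phi>b where \<phi>b: "continuous_on UNIV \<phi>b"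
        and id: "\<And>k. (LINT x:W|lebesgue. \<phi> x * m k (Im (f x)) * Im (d x) + G k (f x) * \<phi>b x) = 0"
        using chain[OF sm W(1) WE Wz] by blast
      have \<phi>c: "continuous_on UNIV \<phi>" by (rule smooth_continuous[OF sm])
      note dW = di[OF W(1) WE]
      have i1: "set_integrable lebesgue W (\<lambda>x. \<phi> x * Im (d x))"
        by (rule set_integrable_mult_continuous[OF W(1) continuous_on_subset[OF \<phi>c] dW]) simp
      have i2: "set_integrable lebesgue W \<phi>b" by (rule set_integrable_continuous[OF W(1) continuous_on_subset[OF \<phi>b]]) simp
      have Wl: "W \<in> sets lebesgue" using borel_compact[OF W(1)] by simp
      have kint: "set_integrable lebesgue W (\<lambda>x. \<phi> x * m k (Im (f x)) * Im (d x) + G k (f x) * \<phi>b x)" for k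
      proof (rule set_integral_add(1))
        show "set_integrable lebesgue W (\<lambda>x. \<phi> x * m k (Im (f x)) * Im (d x))"
          by (rule set_integrable_mult_continuous[OF W(1) _ dW])
             (intro continuous_intros continuous_on_subset[OF \<phi>c] continuous_on_compose2[OF C1_continuous_partials(2)[OF GC, of UNIV] continuous_on_subset[OF f]]; simp)
        show "set_integrable lebesgue W (\<lambda>x. G k (f x) * \<phi>b x)"
          by (rule set_integrable_continuous[OF W(1)])
             (intro continuous_intros continuous_on_subset[OF \<phi>b] continuous_on_compose2[OF C1_continuous[OF GC, of UNIV] continuous_on_subset[OF f]]; simp)
      qed
      have "(\<lambda>k. LINT x:W|lebesgue. \<phi> x * m k (Im (f x)) * Im (d x) + G k (f x) * \<phi>b x) \<longlonglongrightarrow> (LINT x:W|lebesgue. \<phi> x * (mi (Im (f x)) * Im (d x)))"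
        unfolding set_lebesgue_integral_def
      proof (rule integral_dominated_convergence[where w="\<lambda>x. indicator W x *\<^sub>R (2 * Rq * \<bar>\<phi> x * Im (d x)\<bar> + A * \<bar>\<phi>b x\<bar>)"])
        show "(\<lambda>x. indicator W x *\<^sub>R (\<phi> x * m k (Im (f x)) * Im (d x) + G k (f x) * \<phi>b x)) \<in> borel_measurable lebesgue" for k
          using kint[of k] unfolding set_integrable_def by (rule borel_measurable_integrable)
        show "(\<lambda>x. indicator W x *\<^sub>R (\<phi> x * (mi (Im (f x)) * Im (d x)))) \<in> borel_measurable lebesgue"
        proof -
          have "(\<lambda>x. \<phi> x) \<in> borel_measurable lebesgue"
            using borel_measurable_continuous_onI[OF \<phi>c] by (intro measurable_completion) simp
          then have "(\<lambda>x. \<phi> x * (indicator W x *\<^sub>R (mi (Im (f x)) * Im (d x)))) \<in> borel_measurable lebesgue"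
            by (rule borel_measurable_times[OF _ borel_measurable_integrable[OF ui[OF W(1) WE, unfolded set_integrable_def]]])
          then show ?thesis by (simp add: mult.left_commute)
        qed
        show "integrable lebesgue (\<lambda>x. indicator W x *\<^sub>R (2 * Rq * \<bar>\<phi> x * Im (d x)\<bar> + A * \<bar>\<phi>b x\<bar>))"
          using set_integral_add(1)[OF set_integrable_mult_right[of "2 * Rq", OF set_integrable_norm[OF i1]] set_integrable_mult_right[of A, OF set_integrable_norm[OF i2]]]
          by (simp add: set_integrable_def)
        show "AE x in lebesgue. (\<lambda>k. indicator W x *\<^sub>R (\<phi> x * m k (Im (f x)) * Im (d x) + G k (f x) * \<phi>b x)) \<longlonglongrightarrow> indicator W x *\<^sub>R (\<phi> x * (mi (Im (f x)) * Im (d x)))"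
        proof (rule AE_I2)
          fix x
          show "(\<lambda>k. indicator W x *\<^sub>R (\<phi> x * m k (Im (f x)) * Im (d x) + G k (f x) * \<phi>b x)) \<longlonglongrightarrow> indicator W x *\<^sub>R (\<phi> x * (mi (Im (f x)) * Im (d x)))"
          proof (cases "x \<in> W")
            case True
            then have "f x \<in> square Rq" using W(2) f\<Omega> by blast
            then have "(\<lambda>k. indicator W x *\<^sub>R (\<phi> x * m k (Im (f x)) * Im (d x) + G k (f x) * \<phi>b x)) \<longlonglongrightarrow> indicator W x *\<^sub>R (\<phi> x * mi (Im (f x)) * Im (d x) + 0 * \<phi>b x)"
              by (intro tendsto_intros mlim Glim)
            then show ?thesis by (simp add: mult.assoc)
          qed simp
        qed
        show "AE x in lebesgue. norm (indicator W x *\<^sub>R (\<phi> x * m k (Im (f x)) * Im (d x) + G k (f x) * \<phi>b x)) \<le> indicator W x *\<^sub>R (2 * Rq * \<bar>\<phi> x * Im (d x)\<bar> + A * \<bar>\<phi>b x\<bar>)" for k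
        proof (rule AE_I2)
          fix x
          show "norm (indicator W x *\<^sub>R (\<phi> x * m k (Im (f x)) * Im (d x) + G k (f x) * \<phi>b x)) \<le> indicator W x *\<^sub>R (2 * Rq * \<bar>\<phi> x * Im (d x)\<bar> + A * \<bar>\<phi>b x\<bar>)"
          proof (cases "x \<in> W")
            case True
            then have fx: "f x \<in> square Rq" using W(2) f\<Omega> by blast
            have "\<bar>m k (Im (f x)) * (\<phi> x * Im (d x))\<bar> \<le> 2 * Rq * \<bar>\<phi> x * Im (d x)\<bar>"
              by (rule abs_mult_le) (use m(2,3) in auto)
            moreover have "\<bar>G k (f x) * \<phi>b x\<bar> \<le> A * \<bar>\<phi>b x\<bar>"
              by (rule abs_mult_le) (use sq(3)[OF fx] GA[OF fx] in auto)
            ultimately show ?thesis using True by (simp add: mult_ac)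
          qed simp
        qed
      qed
      then have "(LINT x:W|lebesgue. \<phi> x * (mi (Im (f x)) * Im (d x))) = 0"
        using id LIMSEQ_unique[OF tendsto_const] by (simp add: LIMSEQ_const_iff)
      moreover have "(LINT x:\<Omega>|lebesgue. \<phi> x *\<^sub>R complex_of_real (mi (Im (f x)) * Im (d x))) = complex_of_real (LINT x:W|lebesgue. \<phi> x * (mi (Im (f x)) * Im (d x)))"
      proof -
        have "(\<lambda>x. indicator \<Omega> x *\<^sub>R \<phi> x *\<^sub>R complex_of_real (mi (Im (f x)) * Im (d x))) = (\<lambda>x. complex_of_real (indicator W x *\<^sub>R (\<phi> x * (mi (Im (f x)) * Im (d x)))))"
          using W(2) Wz by (force simp: indicator_def scaleR_conv_of_real)
        then show ?thesis unfolding set_lebesgue_integral_def by (simp only: integral_complex_of_real)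
      qed
      ultimately show "(LINT x:\<Omega>|lebesgue. \<phi> x *\<^sub>R complex_of_real (mi (Im (f x)) * Im (d x))) = 0" by simp
    qed
    then show ?thesis by eventually_elim simp
  qed
  have fin: "AE x in lebesgue. x \<in> U \<longrightarrow> (\<lambda>k. m k (Im (f x)) * (\<bar>Im (d1 x)\<bar> + \<bar>Im (d2 x)\<bar>)) \<longlonglongrightarrow> 0"
    if U: "compact U" "U \<subseteq> ball 0 R1 - E" for U
  proof -
    have U\<Omega>: "U \<subseteq> \<Omega>" using U(2) by (simp add: \<Omega>_def)
    have 1: "AE x in lebesgue. x \<in> U \<longrightarrow> mi (Im (f x)) * Im (d1 x) = 0"
    proof (rule ae[OF U(1) U\<Omega>])
      show "set_integrable lebesgue C (\<lambda>x. Im (d1 x))" if "compact C" "C \<subseteq> - E" for C by (rule integrable_compact(5)[OF that])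
      fix \<phi> W assume a: "smooth \<phi>" "compact W" "W \<subseteq> - E" "\<And>x. x \<notin> W \<Longrightarrow> \<phi> x = 0"
      show "\<exists>\<phi>b. continuous_on UNIV \<phi>b \<and> (\<forall>k. (LINT x:W|lebesgue. \<phi> x * m k (Im (f x)) * Im (d1 x) + G k (f x) * \<phi>b x) = 0)"
        using weak_chain_rule_Im(1)[OF GC smooth_C1[OF a(1)] a(2,3,4)] C1_continuous_partials(1)[OF smooth_C1[OF a(1)]] by blast
    qed
    have 2: "AE x in lebesgue. x \<in> U \<longrightarrow> mi (Im (f x)) * Im (d2 x) = 0"
    proof (rule ae[OF U(1) U\<Omega>])
      show "set_integrable lebesgue C (\<lambda>x. Im (d2 x))" if "compact C" "C \<subseteq> - E" for C by (rule integrable_compact(6)[OF that])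
      fix \<phi> W assume a: "smooth \<phi>" "compact W" "W \<subseteq> - E" "\<And>x. x \<notin> W \<Longrightarrow> \<phi> x = 0"
      show "\<exists>\<phi>b. continuous_on UNIV \<phi>b \<and> (\<forall>k. (LINT x:W|lebesgue. \<phi> x * m k (Im (f x)) * Im (d2 x) + G k (f x) * \<phi>b x) = 0)"
        using weak_chain_rule_Im(2)[OF GC smooth_C1[OF a(1)] a(2,3,4)] C1_continuous_partials(2)[OF smooth_C1[OF a(1)]] by blast
    qed
    show ?thesis
      using 1 2
    proof eventually_elim
      case (elim x)
      show ?case
      proof
        assume "x \<in> U"
        then have z: "mi (Im (f x)) * (\<bar>Im (d1 x)\<bar> + \<bar>Im (d2 x)\<bar>) = 0" using elim by auto
        have "(\<lambda>k. m k (Im (f x)) * (\<bar>Im (d1 x)\<bar> + \<bar>Im (d2 x)\<bar>)) \<longlonglongrightarrow> mi (Im (f x)) * (\<bar>Im (d1 x)\<bar> + \<bar>Im (d2 x)\<bar>)"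
          by (intro tendsto_intros mlim)
        then show "(\<lambda>k. m k (Im (f x)) * (\<bar>Im (d1 x)\<bar> + \<bar>Im (d2 x)\<bar>)) \<longlonglongrightarrow> 0" unfolding z .
      qed
    qed
  qed
  show ?thesis
    by (rule exI[of _ h], rule exI[of _ H], rule exI[of _ H2], rule exI[of _ m])
       (use h01 hlim HC sq(1,2) m(2,3) fin in blast)
qed

end

lemma C1_locally_constant:
  assumes u: "C1 u u1 u2" and S: "open S" "x \<in> S" and c: "\<And>y. y \<in> S \<Longrightarrow> u y = c"
  shows "u1 x = 0" "u2 x = 0"
proof -
  have "(u has_derivative (\<lambda>v. 0)) (at x)"
    by (rule has_derivative_transform_within_open[OF has_derivative_const[of c] S]) (use c in auto)
  from C1_partials_unique[OF u this] show "u1 x = 0" "u2 x = 0" by simp_all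
qed

lemma continuous_into_square:
  fixes f :: "complex \<Rightarrow> complex"
  assumes f: "continuous_on UNIV f"
  shows "\<exists>Rq>0. f ` cball 0 R \<subseteq> square Rq"
proof -
  have "continuous_on UNIV (\<lambda>x. norm (f x))" by (intro continuous_intros f)
  then obtain M where M: "1 \<le> M" "\<And>x. x \<in> cball 0 R \<Longrightarrow> norm (f x) \<le> M"
    using continuous_bound_on_compact[of "\<lambda>x. norm (f x)" R] unfolding abs_norm_cancel by blast
  have "f x \<in> square M" if "x \<in> cball 0 R" for x
    using M(2)[OF that] abs_Re_le_cmod[of "f x"] abs_Im_le_cmod[of "f x"] by (simp add: square_iff)
  then show ?thesis using M(1) by (intro exI[of _ M]) auto
qed

context singular_set
begin

text \<open>
  In the pullback identity for bump functions that converge to the indicator function of \<open>N\<close>, the term with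
  the primitive tends to \<open>0\<close> by \<open>slices_of_null_set\<close>. The nonnegative function \<open>J\<close> therefore has integral \<open>0\<close> over
  the part of the preimage of \<open>N\<close> in \<open>U\<close>.
\<close>

lemma jacobian_null_preimage_local:
  assumes pos: "AE x in lebesgue. x \<notin> E \<longrightarrow> 0 \<le> jac (d1 x) (d2 x)"
    and N: "compact N" "N \<noteq> {}" "negligible N" and r: "0 < r" and R: "0 < R"
    and U_def: "U = {x \<in> cball 0 R. r \<le> infdist x E}"
  shows "AE x in lebesgue. x \<in> U \<longrightarrow> f x \<in> N \<longrightarrow> jac (d1 x) (d2 x) = 0"
proof (cases "U = {}")
  case False
  have U: "compact U" unfolding U_def by (rule compact_away[OF r])
  have "0 < r / 8" using r by simp
  from smooth_cutoff[OF this, of U] obtain \<psi> where sm: "smooth \<psi>" and \<psi>01: "\<And>x. 0 \<le> \<psi> x" "\<And>x. \<psi> x \<le> 1"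
    and \<psi>1: "\<And>x. infdist x U \<le> r / 8 \<Longrightarrow> \<psi> x = 1" and \<psi>0: "\<And>x. 4 * (r / 8) \<le> infdist x U \<Longrightarrow> \<psi> x = 0"
    by blast
  define p1 where "p1 = (\<lambda>x. frechet_derivative \<psi> (at x) 1)"
  define p2 where "p2 = (\<lambda>x. frechet_derivative \<psi> (at x) \<i>)"
  have C: "C1 \<psi> p1 p2" unfolding p1_def p2_def by (rule smooth_C1[OF sm])
  note cC = C1_continuous[OF C, of UNIV] C1_continuous_partials[OF C, of UNIV]
  have supp: "cmod x \<le> R + r / 2 \<and> r / 2 \<le> infdist x E" if "\<psi> x \<noteq> 0" for x
  proof -
    have lt: "infdist x U < r / 2" using \<psi>0[of x] that by force
    obtain u where u: "u \<in> U" "infdist x U = dist x u"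
      using infdist_attains_inf[OF compact_imp_closed[OF U] False] by metis
    have "infdist u E \<le> infdist x E + dist u x" by (rule infdist_triangle)
    moreover have "cmod x \<le> cmod u + dist x u" by (metis dist_norm add.commute norm_triangle_sub)
    ultimately show ?thesis using u lt by (auto simp: U_def dist_commute)
  qed
  define R1 where "R1 = R + r + 1"
  define W where "W = {x \<in> cball 0 (R + r). 2 * (r / 4) \<le> infdist x E}"
  have W: "compact W" "W \<subseteq> - E" unfolding W_def using compact_away[of "2 * (r / 4)"] r by auto
  have W1: "W \<subseteq> ball 0 R1 - E" using W(2) by (auto simp: W_def R1_def)
  have UW: "U \<subseteq> W" using r by (auto simp: U_def W_def)
  have Wl: "W \<in> sets lebesgue" using borel_compact[OF W(1)] by simp
  note iW = integrable_compact[OF W]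
  obtain Rq where Rq: "0 < Rq" "f ` cball 0 R1 \<subseteq> square Rq" using continuous_into_square[OF f] by blast
  have fq: "f x \<in> square Rq" if "x \<in> W" for x using that W1 Rq(2) by force
  obtain h H H2 m where T: "(\<forall>k w. 0 \<le> h k w \<and> h k w \<le> (1::real)) \<and> (\<forall>w. (\<lambda>k. h k w) \<longlonglongrightarrow> indicator N w) \<and>
     (\<forall>k. C1 (H k) (h k) (H2 k)) \<and> (\<forall>k. \<forall>w\<in>square Rq. 0 \<le> H k w \<and> H k w \<le> m k (Im w)) \<and>
     (\<forall>k y. 0 \<le> m k y \<and> m k y \<le> 2 * Rq) \<and>
     (\<forall>U. compact U \<longrightarrow> U \<subseteq> ball 0 R1 - E \<longrightarrow>
        (AE x in lebesgue. x \<in> U \<longrightarrow> (\<lambda>k. m k (Im (f x)) * (\<bar>Im (d1 x)\<bar> + \<bar>Im (d2 x)\<bar>)) \<longlonglongrightarrow> 0))"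
    using slices_of_null_set[OF N Rq] by (elim exE) (rule that)
  note T1 = T[THEN conjunct1] and T' = T[THEN conjunct2]
  note T2 = T'[THEN conjunct1] and T3 = T'[THEN conjunct2, THEN conjunct1] and T'' = T'[THEN conjunct2, THEN conjunct2]
  note T4 = T''[THEN conjunct1] and T5 = T''[THEN conjunct2, THEN conjunct1] and T6 = T''[THEN conjunct2, THEN conjunct2]
  have h01: "\<And>k w. 0 \<le> h k w" "\<And>k w. h k w \<le> (1::real)" using T1 by blast+
  note hlim = T2[rule_format] and HC = T3[rule_format]
  have Hm: "\<And>k w. w \<in> square Rq \<Longrightarrow> 0 \<le> H k w" "\<And>k w. w \<in> square Rq \<Longrightarrow> H k w \<le> m k (Im w)" using T4 by blast+
  have m: "\<And>k y. 0 \<le> m k y" "\<And>k y. m k y \<le> 2 * Rq" using T5 by blast+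
  have ae: "AE x in lebesgue. x \<in> U \<longrightarrow> (\<lambda>k. m k (Im (f x)) * (\<bar>Im (d1 x)\<bar> + \<bar>Im (d2 x)\<bar>)) \<longlonglongrightarrow> 0"
    if "compact U" "U \<subseteq> ball 0 R1 - E" for U
    using T6 that by blast
  have flat: "p1 x = 0 \<and> p2 x = 0" if "infdist x E < 2 * (r / 4)" for x
  proof -
    have op: "open {x. infdist x E < r / 2}" by (intro open_Collect_less continuous_intros)
    have "\<psi> y = 0" if "y \<in> {x. infdist x E < r / 2}" for y using supp[of y] that by force
    then show ?thesis using C1_locally_constant[OF C op, of x 0] that by simp
  qed
  have pid: "(LINT x:W|lebesgue. \<psi> x * h k (f x) * jac (d1 x) (d2 x)) + (LINT x:W|lebesgue. H k (f x) * (p1 x * Im (d2 x) - p2 x * Im (d1 x))) = 0"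
    and pi1: "set_integrable lebesgue W (\<lambda>x. \<psi> x * h k (f x) * jac (d1 x) (d2 x))"
    and pi2: "set_integrable lebesgue W (\<lambda>x. H k (f x) * (p1 x * Im (d2 x) - p2 x * Im (d1 x)))" for k
  proof -
    have a1: "\<psi> x = 0" if "R + r < cmod x" for x using supp[of x] that r by force
    have a2: "0 < R + r" "0 < r / 4" using R r by auto
    have a3: "h k w = 0" if "\<psi> x \<noteq> 0" "infdist x E < 2 * (r / 4)" "dist w (f x) < r / 4" for x w
      using supp[OF that(1)] that(2) by simp
    show "(LINT x:W|lebesgue. \<psi> x * h k (f x) * jac (d1 x) (d2 x)) + (LINT x:W|lebesgue. H k (f x) * (p1 x * Im (d2 x) - p2 x * Im (d1 x))) = 0"
      by (rule pullback_identity(1)[OF C a1 a2(1) HC a2(2) flat a3 W_def])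
    show "set_integrable lebesgue W (\<lambda>x. \<psi> x * h k (f x) * jac (d1 x) (d2 x))"
      by (rule pullback_identity(2)[OF C a1 a2(1) HC a2(2) flat a3 W_def])
    show "set_integrable lebesgue W (\<lambda>x. H k (f x) * (p1 x * Im (d2 x) - p2 x * Im (d1 x)))"
      by (rule pullback_identity(3)[OF C a1 a2(1) HC a2(2) flat a3 W_def])
  qed
  obtain M1 M2 where M1: "1 \<le> M1" "\<And>x. x \<in> cball 0 (R + r) \<Longrightarrow> \<bar>p1 x\<bar> \<le> M1" and M2: "1 \<le> M2" "\<And>x. x \<in> cball 0 (R + r) \<Longrightarrow> \<bar>p2 x\<bar> \<le> M2"
    using continuous_bound_on_compact[OF cC(2), of "R + r"] continuous_bound_on_compact[OF cC(3), of "R + r"] by blast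
  define M where "M = M1 + M2"
  have M: "1 \<le> M" using M1(1) M2(1) by (simp add: M_def)
  have pb: "\<bar>p1 x * Im (d2 x) - p2 x * Im (d1 x)\<bar> \<le> M * (\<bar>Im (d1 x)\<bar> + \<bar>Im (d2 x)\<bar>)" if "x \<in> W" for x
  proof -
    have xR: "x \<in> cball 0 (R + r)" using that by (simp add: W_def)
    have "\<bar>p1 x\<bar> \<le> M" "\<bar>p2 x\<bar> \<le> M" using M1(2)[OF xR] M2(2)[OF xR] M1(1) M2(1) by (auto simp: M_def)
    then have "\<bar>p1 x * Im (d2 x)\<bar> \<le> M * \<bar>Im (d2 x)\<bar>" "\<bar>p2 x * Im (d1 x)\<bar> \<le> M * \<bar>Im (d1 x)\<bar>"
      by (auto intro!: abs_mult_le)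
    then show ?thesis by (simp add: algebra_simps)
  qed
  have B: "(\<lambda>k. LINT x:W|lebesgue. H k (f x) * (p1 x * Im (d2 x) - p2 x * Im (d1 x))) \<longlonglongrightarrow> 0"
  proof -
    have "(\<lambda>k. LINT x:W|lebesgue. H k (f x) * (p1 x * Im (d2 x) - p2 x * Im (d1 x))) \<longlonglongrightarrow> integral\<^sup>L lebesgue (\<lambda>_::complex. 0::real)"
      unfolding set_lebesgue_integral_def
    proof (rule integral_dominated_convergence[where w="\<lambda>x. indicator W x *\<^sub>R (2 * Rq * (M * (\<bar>Im (d1 x)\<bar> + \<bar>Im (d2 x)\<bar>)))"])
      show "(\<lambda>x. indicator W x *\<^sub>R (H k (f x) * (p1 x * Im (d2 x) - p2 x * Im (d1 x)))) \<in> borel_measurable lebesgue" for k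
        using pi2[of k] unfolding set_integrable_def by (rule borel_measurable_integrable)
      have "set_integrable lebesgue W (\<lambda>x. 2 * Rq * (M * (\<bar>Im (d1 x)\<bar> + \<bar>Im (d2 x)\<bar>)))"
        by (intro set_integrable_mult_right set_integral_add(1) set_integrable_norm[of lebesgue W "\<lambda>x. Im (d1 x)", unfolded real_norm_def]
            set_integrable_norm[of lebesgue W "\<lambda>x. Im (d2 x)", unfolded real_norm_def] iW)
      then show "integrable lebesgue (\<lambda>x. indicator W x *\<^sub>R (2 * Rq * (M * (\<bar>Im (d1 x)\<bar> + \<bar>Im (d2 x)\<bar>))))"
        by (simp add: set_integrable_def)
      show "AE x in lebesgue. (\<lambda>k. indicator W x *\<^sub>R (H k (f x) * (p1 x * Im (d2 x) - p2 x * Im (d1 x)))) \<longlonglongrightarrow> 0"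
        using ae[OF W(1) W1]
      proof eventually_elim
        case (elim x)
        show ?case
        proof (cases "x \<in> W")
          case True
          have "(\<lambda>k. M * (m k (Im (f x)) * (\<bar>Im (d1 x)\<bar> + \<bar>Im (d2 x)\<bar>))) \<longlonglongrightarrow> M * 0"
            using elim True by (intro tendsto_intros) auto
          then have l: "(\<lambda>k. M * (m k (Im (f x)) * (\<bar>Im (d1 x)\<bar> + \<bar>Im (d2 x)\<bar>))) \<longlonglongrightarrow> 0" by simp
          have "\<bar>H k (f x) * (p1 x * Im (d2 x) - p2 x * Im (d1 x))\<bar> \<le> m k (Im (f x)) * (M * (\<bar>Im (d1 x)\<bar> + \<bar>Im (d2 x)\<bar>))" for k
            using Hm[OF fq[OF True], of k] by (intro abs_mult_le pb[OF True]) auto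
          then have "(\<lambda>k. H k (f x) * (p1 x * Im (d2 x) - p2 x * Im (d1 x))) \<longlonglongrightarrow> 0"
            by (intro Lim_null_comparison[OF _ l] always_eventually) (simp add: mult.left_commute)
          then show ?thesis using True by simp
        qed simp
      qed
      show "AE x in lebesgue. norm (indicator W x *\<^sub>R (H k (f x) * (p1 x * Im (d2 x) - p2 x * Im (d1 x)))) \<le> indicator W x *\<^sub>R (2 * Rq * (M * (\<bar>Im (d1 x)\<bar> + \<bar>Im (d2 x)\<bar>)))" for k
      proof (rule AE_I2)
        fix x
        show "norm (indicator W x *\<^sub>R (H k (f x) * (p1 x * Im (d2 x) - p2 x * Im (d1 x)))) \<le> indicator W x *\<^sub>R (2 * Rq * (M * (\<bar>Im (d1 x)\<bar> + \<bar>Im (d2 x)\<bar>)))"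
        proof (cases "x \<in> W")
          case True
          have "\<bar>H k (f x) * (p1 x * Im (d2 x) - p2 x * Im (d1 x))\<bar> \<le> 2 * Rq * (M * (\<bar>Im (d1 x)\<bar> + \<bar>Im (d2 x)\<bar>))"
            using Hm[OF fq[OF True], of k] m(2)[of k "Im (f x)"] by (intro abs_mult_le pb[OF True]) auto
          then show ?thesis using True by simp
        qed simp
      qed
    qed simp
    then show ?thesis by simp
  qed
  let ?F = "\<lambda>x. indicator W x *\<^sub>R (\<psi> x * indicator N (f x) * jac (d1 x) (d2 x))"
  have fN: "(\<lambda>x. indicator N (f x) :: real) \<in> borel_measurable lebesgue"
    using measurable_compose[OF borel_measurable_continuous_onI[OF f] borel_measurable_indicator[OF borel_compact[OF N(1)]]]
    by (intro measurable_completion) simp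
  have \<psi>m: "\<psi> \<in> borel_measurable lebesgue"
    using borel_measurable_continuous_onI[OF cC(1)] by (intro measurable_completion) simp
  have Fm: "?F \<in> borel_measurable lebesgue"
  proof -
    have "(\<lambda>x. (\<psi> x * indicator N (f x)) * (indicator W x *\<^sub>R jac (d1 x) (d2 x))) \<in> borel_measurable lebesgue"
      by (rule borel_measurable_times[OF borel_measurable_times[OF \<psi>m fN] borel_measurable_integrable[OF iW(3)[unfolded set_integrable_def]]])
    then show ?thesis by (simp add: mult.left_commute)
  qed
  have wi: "integrable lebesgue (\<lambda>x. \<bar>indicator W x *\<^sub>R jac (d1 x) (d2 x)\<bar>)"
    using integrable_norm[OF iW(3)[unfolded set_integrable_def]] by simp
  have km: "(\<lambda>x. indicator W x *\<^sub>R (\<psi> x * h k (f x) * jac (d1 x) (d2 x))) \<in> borel_measurable lebesgue" for k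
    using pi1[of k] unfolding set_integrable_def by (rule borel_measurable_integrable)
  have lim: "AE x in lebesgue. (\<lambda>k. indicator W x *\<^sub>R (\<psi> x * h k (f x) * jac (d1 x) (d2 x))) \<longlonglongrightarrow> ?F x"
    by (intro AE_I2 tendsto_intros hlim)
  have bd: "AE x in lebesgue. norm (indicator W x *\<^sub>R (\<psi> x * h k (f x) * jac (d1 x) (d2 x))) \<le> \<bar>indicator W x *\<^sub>R jac (d1 x) (d2 x)\<bar>" for k
  proof (rule AE_I2)
    fix x
    have "\<bar>\<psi> x * h k (f x) * jac (d1 x) (d2 x)\<bar> \<le> 1 * 1 * \<bar>jac (d1 x) (d2 x)\<bar>"
      by (intro abs_mult_le) (use \<psi>01 h01 in auto)
    then show "norm (indicator W x *\<^sub>R (\<psi> x * h k (f x) * jac (d1 x) (d2 x))) \<le> \<bar>indicator W x *\<^sub>R jac (d1 x) (d2 x)\<bar>"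
      by (auto simp: indicator_def)
  qed
  have A: "(\<lambda>k. LINT x:W|lebesgue. \<psi> x * h k (f x) * jac (d1 x) (d2 x)) \<longlonglongrightarrow> integral\<^sup>L lebesgue ?F"
    unfolding set_lebesgue_integral_def
    by (rule integral_dominated_convergence[OF Fm km wi lim bd])
  have Fi: "integrable lebesgue ?F" by (rule integrable_dominated_convergence[OF Fm km wi lim bd])
  have "(\<lambda>k. - (LINT x:W|lebesgue. H k (f x) * (p1 x * Im (d2 x) - p2 x * Im (d1 x)))) \<longlonglongrightarrow> - 0"
    by (intro tendsto_minus B)
  moreover have "(\<lambda>k. - (LINT x:W|lebesgue. H k (f x) * (p1 x * Im (d2 x) - p2 x * Im (d1 x)))) = (\<lambda>k. LINT x:W|lebesgue. \<psi> x * h k (f x) * jac (d1 x) (d2 x))"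
  proof (rule ext)
    show "- (LINT x:W|lebesgue. H k (f x) * (p1 x * Im (d2 x) - p2 x * Im (d1 x))) = (LINT x:W|lebesgue. \<psi> x * h k (f x) * jac (d1 x) (d2 x))" for k
      using pid[of k] by linarith
  qed
  ultimately have "(\<lambda>k. LINT x:W|lebesgue. \<psi> x * h k (f x) * jac (d1 x) (d2 x)) \<longlonglongrightarrow> 0" by simp
  then have F0: "integral\<^sup>L lebesgue ?F = 0" using A LIMSEQ_unique by blast
  have "AE x in lebesgue. 0 \<le> ?F x"
    using pos
  proof eventually_elim
    case (elim x)
    then show ?case using W(2) \<psi>01(1)[of x] by (auto simp: indicator_def)
  qed
  then have "AE x in lebesgue. ?F x = 0" using integral_nonneg_eq_0_iff_AE[OF Fi] F0 by blast
  then show ?thesis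
  proof eventually_elim
    case (elim x)
    show ?case
    proof (intro impI)
      assume x: "x \<in> U" "f x \<in> N"
      have "infdist x U = 0" using x(1) by simp
      then have "\<psi> x = 1" using r by (intro \<psi>1) simp
      then show "jac (d1 x) (d2 x) = 0" using elim x UW by auto
    qed
  qed
qed simp

lemma jacobian_null_preimage:
  assumes pos: "AE x in lebesgue. x \<notin> E \<longrightarrow> 0 \<le> jac (d1 x) (d2 x)"
    and N: "compact N" "N \<noteq> {}" "negligible N"
  shows "AE x in lebesgue. x \<notin> E \<longrightarrow> f x \<in> N \<longrightarrow> jac (d1 x) (d2 x) = 0"
proof -
  have "AE x in lebesgue. \<forall>n. x \<in> {x \<in> cball 0 (real (Suc n)). inverse (real (Suc n)) \<le> infdist x E} \<longrightarrow> f x \<in> N \<longrightarrow> jac (d1 x) (d2 x) = 0"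
    unfolding AE_all_countable
    by (intro allI jacobian_null_preimage_local[OF pos N _ _ refl]) auto
  then show ?thesis
  proof eventually_elim
    case (elim x)
    show ?case
    proof (intro impI)
      assume x: "x \<notin> E" "f x \<in> N"
      have "0 < infdist x E" using x(1) E infdist_pos_not_in_closed[of E x] compact_imp_closed by blast
      then obtain n1 where n1: "inverse (real (Suc n1)) < infdist x E" using reals_Archimedean by blast
      obtain n2 where n2: "cmod x \<le> real n2" using real_arch_simple by blast
      define n where "n = max n1 n2"
      have "inverse (real (Suc n)) \<le> inverse (real (Suc n1))" by (intro le_imp_inverse_le) (auto simp: n_def)
      moreover have "real n2 \<le> real (Suc n)" by (simp add: n_def)
      ultimately have "inverse (real (Suc n)) \<le> infdist x E" "cmod x \<le> real (Suc n)" using n1 n2 by linarith+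
      then have "x \<in> {x \<in> cball 0 (real (Suc n)). inverse (real (Suc n)) \<le> infdist x E}" by (simp del: of_nat_Suc)
      then show "jac (d1 x) (d2 x) = 0" using elim x(2) by blast
    qed
  qed
qed

text \<open>
  Off the preimage of the null set \<open>f ` E\<close> the Jacobian is exhausted by the pullbacks of forms that vanish
  near \<open>f ` E\<close>. Their primitives are bounded uniformly, so their integrals are bounded by a multiple of the
  integral of the gradient over a compact set disjoint from \<open>E\<close>, which contains the points where the
  cutoff function is not locally constant.
\<close>

lemma jacobian_integrable_across:
  assumes pos: "AE x in lebesgue. x \<notin> E \<longrightarrow> 0 \<le> jac (d1 x) (d2 x)"
    and N: "negligible (f ` E)" and E1: "E \<subseteq> ball 0 1"
  shows "set_integrable lebesgue (cball 0 2 - E) (\<lambda>x. jac (d1 x) (d2 x))"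
proof -
  have fE: "compact (f ` E)" "f ` E \<noteq> {}" using E f continuous_on_subset by (auto intro!: compact_continuous_image)
  have "(0::real) < 3" by simp
  from smooth_cutoff[OF this, of "{0}"] obtain \<psi> where sm: "smooth \<psi>" and \<psi>01: "\<And>x. 0 \<le> \<psi> x"
    and \<psi>1: "\<And>x. cmod x \<le> 3 \<Longrightarrow> \<psi> x = 1" and \<psi>0: "\<And>x. 12 \<le> cmod x \<Longrightarrow> \<psi> x = 0"
    by auto
  define p1 where "p1 = (\<lambda>x. frechet_derivative \<psi> (at x) 1)"
  define p2 where "p2 = (\<lambda>x. frechet_derivative \<psi> (at x) \<i>)"
  have C: "C1 \<psi> p1 p2" unfolding p1_def p2_def by (rule smooth_C1[OF sm])
  note cC = C1_continuous[OF C, of UNIV] C1_continuous_partials[OF C, of UNIV]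
  obtain Rq where Rq: "0 < Rq" "f ` cball 0 12 \<subseteq> square Rq" using continuous_into_square[OF f] by blast
  have near2: "\<exists>e\<in>E. dist x e < s" if "infdist x E < s" for x s
    using infdist_attains_inf[OF compact_imp_closed[OF E(1)] E(2), of x] that by metis
  have near: "cmod x < 2" if xE: "infdist x E < 1" for x
  proof -
    obtain e where e: "e \<in> E" "dist x e < 1" using near2[OF xE] by blast
    have "cmod x \<le> cmod e + dist x e" by (metis dist_norm add.commute norm_triangle_sub)
    then show ?thesis using e E1 by force
  qed
  have p0: "p1 x = 0 \<and> p2 x = 0" if "cmod x < 2" for x
    using C1_locally_constant[OF C open_ball, of x 0 3 1] \<psi>1 that by auto
  define A where "A = {x \<in> cball 0 12. 1 \<le> infdist x E}"
  have A: "compact A" "A \<subseteq> - E" unfolding A_def using compact_away[of 1] by auto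
  obtain M1 M2 where M1: "1 \<le> M1" "\<And>x. x \<in> cball 0 12 \<Longrightarrow> \<bar>p1 x\<bar> \<le> M1" and M2: "1 \<le> M2" "\<And>x. x \<in> cball 0 12 \<Longrightarrow> \<bar>p2 x\<bar> \<le> M2"
    using continuous_bound_on_compact[OF cC(2), of 12] continuous_bound_on_compact[OF cC(3), of 12] by blast
  define M where "M = M1 + M2"
  have M: "1 \<le> M" using M1(1) M2(1) by (simp add: M_def)
  have pb: "\<bar>p1 x * Im (d2 x) - p2 x * Im (d1 x)\<bar> \<le> M * g x" if "x \<in> cball 0 12" for x
  proof -
    have "\<bar>p1 x\<bar> \<le> M" "\<bar>p2 x\<bar> \<le> M" using M1(2)[OF that] M2(2)[OF that] M1(1) M2(1) by (auto simp: M_def)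
    then have "\<bar>p1 x * Im (d2 x)\<bar> \<le> M * norm (d2 x)" "\<bar>p2 x * Im (d1 x)\<bar> \<le> M * norm (d1 x)"
      by (auto intro!: abs_mult_le abs_Im_le_cmod)
    then show ?thesis by (simp add: algebra_simps g_def)
  qed
  define M0 where "M0 = (LINT x:A|lebesgue. 2 * Rq * (M * g x))"
  obtain h where h: "\<And>k. smooth (h k)" and h01: "\<And>k w. 0 \<le> h k w" "\<And>k w. h k w \<le> (1::real)"
    and h1: "\<And>k w. infdist w (f ` E) \<le> 1 / (4 * real (Suc k)) \<Longrightarrow> h k w = 1"
    and hlim: "\<And>w. (\<lambda>k. h k w) \<longlonglongrightarrow> indicator (f ` E) w"
    using bump_sequence[OF fE] by blast
  define X where "X = cball 0 2 - E"
  have Xm: "X \<in> sets lebesgue" unfolding X_def using borel_compact[OF E(1)] by auto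
  have jm: "(\<lambda>x. indicator (- E) x *\<^sub>R jac (d1 x) (d2 x)) \<in> borel_measurable lebesgue"
    by (rule L1_loc_measurable[OF open_compl J])
  have hfm: "(\<lambda>x. 1 - h k (f x)) \<in> borel_measurable lebesgue" for k
  proof -
    have "continuous_on UNIV (\<lambda>x. 1 - h k (f x))"
      by (intro continuous_intros continuous_on_compose2[OF smooth_continuous[OF h, of UNIV] f]) auto
    then show ?thesis by (intro measurable_completion) (simp add: borel_measurable_continuous_onI)
  qed
  have um: "(\<lambda>x. ennreal (indicator X x * ((1 - h k (f x)) * (indicator (- E) x *\<^sub>R jac (d1 x) (d2 x))))) \<in> borel_measurable lebesgue" for k
    by (intro measurable_compose[OF _ measurable_ennreal] borel_measurable_times borel_measurable_indicator Xm hfm jm)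
  have bound: "(\<integral>\<^sup>+ x. ennreal (indicator X x * ((1 - h k (f x)) * (indicator (- E) x *\<^sub>R jac (d1 x) (d2 x)))) \<partial>lebesgue) \<le> ennreal M0" for k
  proof -
    have hc: "C1 (\<lambda>w. 1 - h k w) (\<lambda>w. - frechet_derivative (h k) (at w) 1) (\<lambda>w. - frechet_derivative (h k) (at w) \<i>)"
    proof -
      have "smooth (\<lambda>w. 1 - h k w)" using h[of k] by (simp add: smooth_def Ck_diff)
      note S = smooth_C1[OF this]
      have "((\<lambda>w. 1 - h k w) has_derivative (\<lambda>v. - frechet_derivative (h k) (at w) v)) (at w)" for w
        using h[of k] Ck_Suc_deriv[of 0 "h k" w] unfolding smooth_def by (auto intro!: derivative_eq_intros)
      from C1_partials_unique[OF S this] S show ?thesis by simp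
    qed
    have hc01: "0 \<le> 1 - h k w" "1 - h k w \<le> 1" for w using h01[of k w] by auto
    obtain H H2 m where HC: "C1 H (\<lambda>w. 1 - h k w) H2" and m: "\<And>y. m y \<le> 2 * Rq"
      and Hm: "\<And>w. w \<in> square Rq \<Longrightarrow> 0 \<le> H w \<and> H w \<le> m (Im w)"
      using primitives_of_bump[OF hc hc01 Rq(1)] by blast
    define \<rho> where "\<rho> = 1 / (8 * real (Suc k))"
    have \<rho>: "0 < \<rho>" "2 * \<rho> = 1 / (4 * real (Suc k))" by (auto simp: \<rho>_def field_simps)
    have "uniformly_continuous_on (cball 0 3) f"
      by (rule compact_uniformly_continuous) (use f continuous_on_subset in auto)
    then obtain \<delta> where \<delta>: "0 < \<delta>" "\<And>x z. x \<in> cball 0 3 \<Longrightarrow> z \<in> cball 0 3 \<Longrightarrow> dist z x < \<delta> \<Longrightarrow> dist (f z) (f x) < \<rho>"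
      using \<rho>(1) unfolding uniformly_continuous_on_def by metis
    define \<eta> where "\<eta> = min (min \<delta> 1) \<rho> / 2"
    have \<eta>: "0 < \<eta>" "2 * \<eta> \<le> \<delta>" "2 * \<eta> \<le> 1" "\<eta> < \<rho>" using \<delta>(1) \<rho>(1) by (auto simp: \<eta>_def)
    have away: "1 - h k w = 0" if xE: "\<psi> x \<noteq> 0" "infdist x E < 2 * \<eta>" "dist w (f x) < \<eta>" for x w
    proof -
      obtain e where e: "e \<in> E" "dist x e < 2 * \<eta>" using near2[OF xE(2)] by blast
      have "cmod x < 2" using near xE(2) \<eta> by simp
      then have "dist (f x) (f e) < \<rho>" using e E1 \<eta> by (intro \<delta>(2)) force+
      then have "dist w (f e) < 2 * \<rho>" using dist_triangle[of w "f e" "f x"] xE(3) \<eta> by linarith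
      moreover have "infdist w (f ` E) \<le> dist w (f e)" using e by (intro infdist_le) simp
      ultimately show ?thesis using h1[of w k] \<rho> by simp
    qed
    have flat: "p1 x = 0 \<and> p2 x = 0" if "infdist x E < 2 * \<eta>" for x using that \<eta> near by (intro p0) simp
    define W where "W = {x \<in> cball 0 12. 2 * \<eta> \<le> infdist x E}"
    have W: "compact W" "W \<subseteq> - E" unfolding W_def using compact_away[of "2 * \<eta>"] \<eta> by auto
    have a1: "\<psi> x = 0" if "12 < cmod x" for x using \<psi>0 that by simp
    have a2: "(0::real) < 12" by simp
    have pid: "(LINT x:W|lebesgue. \<psi> x * (1 - h k (f x)) * jac (d1 x) (d2 x)) + (LINT x:W|lebesgue. H (f x) * (p1 x * Im (d2 x) - p2 x * Im (d1 x))) = 0"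
      by (rule pullback_identity(1)[OF C a1 a2 HC \<eta>(1) flat away W_def])
    have pid2: "set_integrable lebesgue W (\<lambda>x. \<psi> x * (1 - h k (f x)) * jac (d1 x) (d2 x))"
      by (rule pullback_identity(2)[OF C a1 a2 HC \<eta>(1) flat away W_def])
    have pid3: "set_integrable lebesgue W (\<lambda>x. H (f x) * (p1 x * Im (d2 x) - p2 x * Im (d1 x)))"
      by (rule pullback_identity(3)[OF C a1 a2 HC \<eta>(1) flat away W_def])
    have "(\<integral>\<^sup>+ x. ennreal (indicator X x * ((1 - h k (f x)) * (indicator (- E) x *\<^sub>R jac (d1 x) (d2 x)))) \<partial>lebesgue)
       \<le> (\<integral>\<^sup>+ x. ennreal (indicator W x *\<^sub>R (\<psi> x * (1 - h k (f x)) * jac (d1 x) (d2 x))) \<partial>lebesgue)"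
    proof (rule nn_integral_mono_AE)
      show "AE x in lebesgue. ennreal (indicator X x * ((1 - h k (f x)) * (indicator (- E) x *\<^sub>R jac (d1 x) (d2 x)))) \<le> ennreal (indicator W x *\<^sub>R (\<psi> x * (1 - h k (f x)) * jac (d1 x) (d2 x)))"
        using pos
      proof eventually_elim
        case (elim x)
        show ?case
        proof (cases "x \<in> X")
          case True
          then have x2: "cmod x \<le> 2" "x \<notin> E" by (auto simp: X_def)
          then have "\<psi> x = 1" by (intro \<psi>1) simp
          show ?thesis
          proof (cases "x \<in> W")
            case True
            then show ?thesis using \<open>x \<in> X\<close> x2 \<open>\<psi> x = 1\<close> by simp
          next
            case False
            then have "infdist x E < 2 * \<eta>" using x2 by (auto simp: W_def)
            then have "1 - h k (f x) = 0" using away[of x "f x"] \<open>\<psi> x = 1\<close> \<eta> by simp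
            then show ?thesis by simp
          qed
        qed simp
      qed
    qed
    also have "\<dots> = ennreal (LINT x:W|lebesgue. \<psi> x * (1 - h k (f x)) * jac (d1 x) (d2 x))"
      unfolding set_lebesgue_integral_def
    proof (rule nn_integral_eq_integral)
      show "integrable lebesgue (\<lambda>x. indicator W x *\<^sub>R (\<psi> x * (1 - h k (f x)) * jac (d1 x) (d2 x)))"
        using pid2 by (simp add: set_integrable_def)
      show "AE x in lebesgue. 0 \<le> indicator W x *\<^sub>R (\<psi> x * (1 - h k (f x)) * jac (d1 x) (d2 x))"
        using pos
      proof eventually_elim
        case (elim x)
        then show ?case using W(2) \<psi>01[of x] hc01(1)[of "f x"] by (auto simp: indicator_def)
      qed
    qed
    also have "\<dots> \<le> ennreal M0"
    proof (rule ennreal_leI)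
      have "(LINT x:W|lebesgue. \<psi> x * (1 - h k (f x)) * jac (d1 x) (d2 x)) \<le> norm (LINT x:W|lebesgue. H (f x) * (p1 x * Im (d2 x) - p2 x * Im (d1 x)))"
        using pid by simp
      also have "\<dots> \<le> (LINT x:W|lebesgue. norm (H (f x) * (p1 x * Im (d2 x) - p2 x * Im (d1 x))))"
        by (rule set_integral_norm_bound[OF pid3])
      also have "\<dots> \<le> M0"
        unfolding M0_def set_lebesgue_integral_def
      proof (rule integral_mono)
        show "integrable lebesgue (\<lambda>x. indicator W x *\<^sub>R norm (H (f x) * (p1 x * Im (d2 x) - p2 x * Im (d1 x))))"
          using set_integrable_norm[OF pid3] by (simp add: set_integrable_def)
        show "integrable lebesgue (\<lambda>x. indicator A x *\<^sub>R (2 * Rq * (M * g x)))"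
          using set_integrable_mult_right[OF set_integrable_mult_right[OF integrable_compact(4)[OF A]]] by (simp add: set_integrable_def)
        fix x
        show "indicator W x *\<^sub>R norm (H (f x) * (p1 x * Im (d2 x) - p2 x * Im (d1 x))) \<le> indicator A x *\<^sub>R (2 * Rq * (M * g x))"
        proof (cases "x \<in> W")
          case True
          then have x12: "x \<in> cball 0 12" by (simp add: W_def)
          have b: "\<bar>H (f x) * (p1 x * Im (d2 x) - p2 x * Im (d1 x))\<bar> \<le> 2 * Rq * (M * g x)"
            using Hm[of "f x"] Rq(2) x12 m[of "Im (f x)"] by (intro abs_mult_le pb[OF x12]) force
          show ?thesis
          proof (cases "infdist x E < 1")
            case True
            then have "p1 x = 0 \<and> p2 x = 0" using near p0 by blast
            then show ?thesis using Rq(1) M by (simp add: g_def indicator_def)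
          next
            case False
            then have "x \<in> A" using x12 by (simp add: A_def)
            then show ?thesis using \<open>x \<in> W\<close> b by simp
          qed
        next
          case False
          then show ?thesis using Rq(1) M by (simp add: g_def indicator_def)
        qed
      qed
      finally show "(LINT x:W|lebesgue. \<psi> x * (1 - h k (f x)) * jac (d1 x) (d2 x)) \<le> M0" .
    qed
    finally show ?thesis .
  qed
  have "(\<integral>\<^sup>+ x. ennreal (norm (indicator X x *\<^sub>R jac (d1 x) (d2 x))) \<partial>lebesgue)
    \<le> (\<integral>\<^sup>+ x. liminf (\<lambda>k. ennreal (indicator X x * ((1 - h k (f x)) * (indicator (- E) x *\<^sub>R jac (d1 x) (d2 x))))) \<partial>lebesgue)"
  proof (rule nn_integral_mono_AE)
    show "AE x in lebesgue. ennreal (norm (indicator X x *\<^sub>R jac (d1 x) (d2 x)))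
       \<le> liminf (\<lambda>k. ennreal (indicator X x * ((1 - h k (f x)) * (indicator (- E) x *\<^sub>R jac (d1 x) (d2 x)))))"
      using pos jacobian_null_preimage[OF pos fE N]
    proof eventually_elim
      case (elim x)
      have "(\<lambda>k. ennreal (indicator X x * ((1 - h k (f x)) * (indicator (- E) x *\<^sub>R jac (d1 x) (d2 x)))))
        \<longlonglongrightarrow> ennreal (indicator X x * ((1 - indicator (f ` E) (f x)) * (indicator (- E) x *\<^sub>R jac (d1 x) (d2 x))))"
        by (intro tendsto_intros hlim)
      then have "liminf (\<lambda>k. ennreal (indicator X x * ((1 - h k (f x)) * (indicator (- E) x *\<^sub>R jac (d1 x) (d2 x)))))
         = ennreal (indicator X x * ((1 - indicator (f ` E) (f x)) * (indicator (- E) x *\<^sub>R jac (d1 x) (d2 x))))"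
        by (rule lim_imp_Liminf[rotated]) simp
      moreover have "norm (indicator X x *\<^sub>R jac (d1 x) (d2 x)) = indicator X x * ((1 - indicator (f ` E) (f x)) * (indicator (- E) x *\<^sub>R jac (d1 x) (d2 x)))"
      proof (cases "x \<in> X")
        case True
        then have "x \<notin> E" by (simp add: X_def)
        then show ?thesis using True elim by (cases "f x \<in> f ` E") auto
      qed simp
      ultimately show ?case by simp
    qed
  qed
  also have "\<dots> \<le> liminf (\<lambda>k. \<integral>\<^sup>+ x. ennreal (indicator X x * ((1 - h k (f x)) * (indicator (- E) x *\<^sub>R jac (d1 x) (d2 x)))) \<partial>lebesgue)"
    by (rule nn_integral_liminf[OF um])
  also have "\<dots> \<le> ennreal M0"
    by (rule Liminf_le) (use bound in simp_all)
  finally have fin: "(\<integral>\<^sup>+ x. ennreal (norm (indicator X x *\<^sub>R jac (d1 x) (d2 x))) \<partial>lebesgue) < \<infinity>"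
    using ennreal_less_top le_less_trans by (metis infinity_ennreal_def)
  have "(\<lambda>x. indicator X x *\<^sub>R jac (d1 x) (d2 x)) \<in> borel_measurable lebesgue"
  proof -
    have "(\<lambda>x. indicator X x *\<^sub>R jac (d1 x) (d2 x)) = (\<lambda>x. indicator X x *\<^sub>R (indicator (- E) x *\<^sub>R jac (d1 x) (d2 x)))"
      by (auto simp: X_def indicator_def)
    then show ?thesis using jm Xm by (simp only: borel_measurable_scaleR borel_measurable_indicator)
  qed
  then have "integrable lebesgue (\<lambda>x. indicator X x *\<^sub>R jac (d1 x) (d2 x))" using fin by (rule integrableI_bounded)
  then show ?thesis by (simp add: set_integrable_def X_def)
qed

end

section \<open>Coverings of sets of small dimension\<close>

lemma hausdorff_premeasure_0_cover:
  assumes A: "hausdorff_measure s A = 0" and \<delta>: "0 < \<delta>" and \<epsilon>: "0 < \<epsilon>"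
  shows "\<exists>U. A \<subseteq> (\<Union>i. U i) \<and> (\<forall>i. bounded (U i) \<and> diameter (U i) \<le> \<delta>) \<and> (\<Sum>i. diam_pow s (U i)) < ennreal \<epsilon>"
proof -
  have "hausdorff_premeasure s \<delta> A \<le> hausdorff_measure s A"
    unfolding hausdorff_measure_def by (rule SUP_upper) (use \<delta> in simp)
  then have "hausdorff_premeasure s \<delta> A < ennreal \<epsilon>" using A \<epsilon> by simp
  then show ?thesis unfolding hausdorff_premeasure_def INF_less_iff by blast
qed

lemma hausdorff_dim_less:
  assumes "hausdorff_dim A < ereal t"
  shows "\<exists>s. 0 \<le> s \<and> s < t \<and> hausdorff_measure s A = 0"
  using assms unfolding hausdorff_dim_def INF_less_iff by auto

text \<open>
  The covering sets with small sum for an exponent \<open>s < t\<close> are replaced by discs whose radii are twice their diameters. A set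
  may consist of a single point; summable numbers \<open>e i\<close> keep the radii positive. For \<open>s = 0\<close> each nonempty set
  contributes \<open>1\<close>, so a small sum forces \<open>E\<close> to be empty.
\<close>

lemma compact_small_cover:
  fixes E :: "complex set"
  assumes E: "compact E" and dim: "hausdorff_dim E < ereal t" and t: "0 < t" and \<epsilon>: "0 < \<epsilon>" and \<rho>: "0 < \<rho>"
  shows "\<exists>(I :: nat set) x r. finite I \<and> (\<forall>i\<in>I. x i \<in> E \<and> 0 < r i \<and> r i < \<rho>) \<and> E \<subseteq> (\<Union>i\<in>I. ball (x i) (r i)) \<and>
    (\<Sum>i\<in>I. r i powr t) < \<epsilon>"
proof -
  obtain s where s: "0 \<le> s" "s < t" and Hs: "hausdorff_measure s E = 0" using hausdorff_dim_less[OF dim] by blast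
  define \<delta> where "\<delta> = min \<rho> 1 / 3"
  have \<delta>: "0 < \<delta>" "2 * \<delta> < \<rho>" "\<delta> \<le> 1" using \<rho> by (auto simp: \<delta>_def)
  define \<epsilon>' where "\<epsilon>' = min \<epsilon> 1 / (2 * 2 powr t)"
  have \<epsilon>': "0 < \<epsilon>'" using \<epsilon> by (simp add: \<epsilon>'_def)
  obtain U where U: "E \<subseteq> (\<Union>i. U i)" "\<And>i. bounded (U i)" "\<And>i. diameter (U i) \<le> \<delta>"
    and sum: "(\<Sum>i. diam_pow s (U i)) < ennreal \<epsilon>'"
    using hausdorff_premeasure_0_cover[OF Hs \<delta>(1) \<epsilon>'] by blast
  show ?thesis
  proof (cases "s = 0")
    case True
    have e1: "\<epsilon>' < 1"
    proof -
      have "1 < 2 powr t" using t by simp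
      then have "min \<epsilon> 1 < 2 * 2 powr t" by linarith
      then show ?thesis by (simp add: \<epsilon>'_def)
    qed
    have "U i = {}" for i
    proof (rule ccontr)
      assume "U i \<noteq> {}"
      then have "1 = diam_pow s (U i)" using True by (simp add: diam_pow_def)
      also have "\<dots> \<le> (\<Sum>i. diam_pow s (U i))" using sum_le_suminf[of "\<lambda>i. diam_pow s (U i)" "{i}"] by simp
      also have "\<dots> < ennreal 1" using sum e1 by (meson ennreal_leI less_imp_le order_less_le_trans)
      finally show False by simp
    qed
    then have "E = {}" using U(1) by auto
    then show ?thesis using \<epsilon> by (intro exI[of _ "{}"]) auto
  next
    case False
    then have s0: "0 < s" using s by simp
    define e where "e = (\<lambda>i. min (\<epsilon> / 4) ((\<rho> / 2) powr t) * (1/2) ^ i)"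
    define r where "r = (\<lambda>i. max (2 * diameter (U i)) (e i powr (1 / t)))"
    have ep: "0 < e i" for i using \<epsilon> \<rho> by (simp add: e_def)
    have e2: "e i \<le> (\<rho> / 2) powr t" for i
    proof -
      have "e i \<le> (\<rho> / 2) powr t * 1" unfolding e_def by (rule mult_mono) (use \<rho> in \<open>auto simp: power_le_one\<close>)
      then show ?thesis by simp
    qed
    have d0: "0 \<le> diameter (U i)" for i using U(2) by (rule diameter_ge_0)
    have rpos: "0 < r i" for i using ep[of i] by (simp add: r_def less_max_iff_disj)
    have r\<rho>: "r i < \<rho>" for i
    proof -
      have "e i powr (1 / t) \<le> ((\<rho> / 2) powr t) powr (1 / t)" using e2[of i] ep[of i] t by (intro powr_mono2) auto
      also have "\<dots> = \<rho> / 2" using t \<rho> by (simp add: powr_powr)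
      finally have "e i powr (1 / t) < \<rho>" using \<rho> by simp
      then show ?thesis using U(3)[of i] \<delta> by (simp add: r_def)
    qed
    have rd: "diameter (U i) < r i" for i
      using d0[of i] ep[of i] by (cases "diameter (U i) = 0") (auto simp: r_def less_max_iff_disj)
    have rt: "ennreal (r i powr t) \<le> ennreal (2 powr t) * diam_pow s (U i) + ennreal (e i)" for i
    proof (cases "2 * diameter (U i) \<le> e i powr (1 / t)")
      case True
      then have "r i powr t = e i" using ep[of i] t by (simp add: r_def powr_powr)
      then show ?thesis by simp
    next
      case False
      then have pos: "0 < diameter (U i)" using ep[of i] by (smt (verit) powr_ge_zero)
      then have ne: "U i \<noteq> {}" by auto
      have "r i powr t = 2 powr t * diameter (U i) powr t" using False pos by (simp add: r_def powr_mult)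
      also have "\<dots> \<le> 2 powr t * diameter (U i) powr s"
        using pos U(3)[of i] \<delta> s by (intro mult_left_mono powr_mono') auto
      finally have "ennreal (r i powr t) \<le> ennreal (2 powr t) * diam_pow s (U i)"
        using ne s0 by (simp add: diam_pow_def ennreal_leI flip: ennreal_mult)
      then show ?thesis by (metis add.right_neutral add_mono zero_le)
    qed
    define J where "J = {i. U i \<inter> E \<noteq> {}}"
    define x where "x = (\<lambda>i. SOME z. z \<in> U i \<inter> E)"
    have x: "x i \<in> U i" "x i \<in> E" if "i \<in> J" for i
      using someI_ex[of "\<lambda>z. z \<in> U i \<inter> E"] that by (auto simp: J_def x_def)
    have "E \<subseteq> (\<Union>i\<in>J. ball (x i) (r i))"
    proof
      fix z assume z: "z \<in> E"
      then obtain i where i: "z \<in> U i" using U(1) by blast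
      then have J: "i \<in> J" using z by (auto simp: J_def)
      have "dist (x i) z \<le> diameter (U i)" using diameter_bounded_bound[OF U(2) x(1)[OF J] i] .
      then show "z \<in> (\<Union>i\<in>J. ball (x i) (r i))" using J rd[of i] by force
    qed
    then obtain I where I: "I \<subseteq> J" "finite I" "E \<subseteq> (\<Union>i\<in>I. ball (x i) (r i))"
      using compactE_image[OF E, of J "\<lambda>i. ball (x i) (r i)"] by blast
    have "ennreal (\<Sum>i\<in>I. r i powr t) = (\<Sum>i\<in>I. ennreal (r i powr t))" by (simp add: sum_ennreal)
    also have "\<dots> \<le> (\<Sum>i. ennreal (r i powr t))" using I(2) by (intro sum_le_suminf) auto
    also have "\<dots> \<le> (\<Sum>i. ennreal (2 powr t) * diam_pow s (U i) + ennreal (e i))" by (rule suminf_le[OF rt]) auto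
    also have "\<dots> = ennreal (2 powr t) * (\<Sum>i. diam_pow s (U i)) + (\<Sum>i. ennreal (e i))"
      using suminf_add[OF summableI summableI, of "\<lambda>i. ennreal (2 powr t) * diam_pow s (U i)" "\<lambda>i. ennreal (e i)"] by simp
    also have "(\<Sum>i. ennreal (e i)) = ennreal (min (\<epsilon> / 4) ((\<rho> / 2) powr t) * 2)"
    proof -
      have "e sums (min (\<epsilon> / 4) ((\<rho> / 2) powr t) * (1 / (1 - 1/2)))"
        unfolding e_def by (intro sums_mult geometric_sums) simp
      then have sm: "e sums (min (\<epsilon> / 4) ((\<rho> / 2) powr t) * 2)" by simp
      have "(\<Sum>i. ennreal (e i)) = ennreal (\<Sum>i. e i)"
        by (rule suminf_ennreal2[OF less_imp_le[OF ep] sums_summable[OF sm]])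
      then show ?thesis unfolding sums_unique[OF sm, symmetric] .
    qed
    finally have le: "ennreal (\<Sum>i\<in>I. r i powr t) \<le> ennreal (2 powr t) * (\<Sum>i. diam_pow s (U i)) + ennreal (min (\<epsilon> / 4) ((\<rho> / 2) powr t) * 2)" .
    obtain S where S: "(\<Sum>i. diam_pow s (U i)) = ennreal S" "0 \<le> S"
      using sum by (cases "\<Sum>i. diam_pow s (U i)") auto
    have S': "S < \<epsilon>'" using sum S by (simp add: ennreal_less_iff)
    have m: "0 \<le> min (\<epsilon> / 4) ((\<rho> / 2) powr t) * 2" using \<epsilon> by simp
    have "ennreal (\<Sum>i\<in>I. r i powr t) \<le> ennreal (2 powr t * S + min (\<epsilon> / 4) ((\<rho> / 2) powr t) * 2)"
      using le S(2) m unfolding S(1) by (simp only: ennreal_mult'[of "2 powr t", OF powr_ge_zero] ennreal_plus[OF mult_nonneg_nonneg[OF powr_ge_zero S(2)] m])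
    then have "(\<Sum>i\<in>I. r i powr t) \<le> 2 powr t * S + min (\<epsilon> / 4) ((\<rho> / 2) powr t) * 2"
      using S(2) m by (subst (asm) ennreal_le_iff) (auto intro!: add_nonneg_nonneg)
    moreover have "2 powr t * S < 2 powr t * \<epsilon>'" using S' by simp
    moreover have "2 powr t * \<epsilon>' \<le> \<epsilon> / 2" unfolding \<epsilon>'_def by simp
    moreover have "min (\<epsilon> / 4) ((\<rho> / 2) powr t) * 2 \<le> \<epsilon> / 2" by simp
    ultimately have "(\<Sum>i\<in>I. r i powr t) < \<epsilon>" by linarith
    moreover have "\<forall>i\<in>I. x i \<in> E \<and> 0 < r i \<and> r i < \<rho>" using x I(1) rpos r\<rho> by blast
    ultimately show ?thesis using I by blast
  qed
qed

lemma negligible_of_small_covers: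
  fixes S :: "complex set"
  assumes "\<And>e. 0 < e \<Longrightarrow> \<exists>(I :: nat set) x r. finite I \<and> (\<forall>i\<in>I. 0 \<le> r i) \<and> S \<subseteq> (\<Union>i\<in>I. cball (x i) (r i)) \<and> (\<Sum>i\<in>I. (r i)\<^sup>2) < e"
  shows "negligible S"
  unfolding negligible_outer
proof (intro allI impI)
  fix e :: real assume e: "0 < e"
  obtain I :: "nat set" and x r where I: "finite I" "\<And>i. i \<in> I \<Longrightarrow> 0 \<le> r i" "S \<subseteq> (\<Union>i\<in>I. cball (x i) (r i))" "(\<Sum>i\<in>I. (r i)\<^sup>2) < e / pi"
    using assms[of "e / pi"] e by (metis divide_pos_pos pi_gt_zero)
  have fm: "cball z s \<in> lmeasurable" for z :: complex and s by (rule lmeasurable_cball)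
  have "measure lebesgue (\<Union>i\<in>I. cball (x i) (r i)) \<le> (\<Sum>i\<in>I. measure lebesgue (cball (x i) (r i)))"
    by (rule measure_UNION_le[OF I(1)]) auto
  also have "\<dots> = (\<Sum>i\<in>I. pi * (r i)\<^sup>2)"
    by (rule sum.cong) (use I(2) measure_cball_complex in auto)
  also have "\<dots> < e" using I(4) by (simp add: sum_distrib_left[symmetric] field_simps)
  finally have "measure lebesgue (\<Union>i\<in>I. cball (x i) (r i)) < e" .
  moreover have "(\<Union>i\<in>I. cball (x i) (r i)) \<in> lmeasurable" using I(1) fm by (intro fmeasurable.finite_UN) auto
  ultimately show "\<exists>T. S \<subseteq> T \<and> T \<in> lmeasurable \<and> measure lebesgue T < e" using I(3) by blast
qed

text \<open>
  The discs are added in the order of decreasing radii. Then the sum of the previous functions already has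
  Lipschitz constant \<open>1 / r k\<close>, and so does the bump \<open>\<psi>\<close> of the new disc. The excess of \<open>\<psi>\<close> over this sum is
  the next function; its Lipschitz constant is at most \<open>2 / r k\<close>, however much the discs overlap. The last clause
  carries the induction.
\<close>

lemma bump_decomposition:
  fixes x :: "nat \<Rightarrow> complex" and r :: "nat \<Rightarrow> real"
  assumes I: "finite I" and r: "\<forall>i\<in>I. 0 < r i"
  shows "\<exists>\<phi>. (\<forall>i\<in>I. (\<forall>y z. \<bar>\<phi> i y - \<phi> i z\<bar> \<le> 2 / r i * dist y z) \<and> (\<forall>y. 0 \<le> \<phi> i y) \<and> (\<forall>y. 2 * r i \<le> dist y (x i) \<longrightarrow> \<phi> i y = 0)) \<and>
    (\<forall>y. (\<Sum>i\<in>I. \<phi> i y) \<le> (1::real)) \<and> (\<forall>i\<in>I. \<forall>y. dist y (x i) \<le> r i \<longrightarrow> (\<Sum>i\<in>I. \<phi> i y) = 1) \<and>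
    (\<forall>c\<ge>0. (\<forall>i\<in>I. 1 / r i \<le> c) \<longrightarrow> (\<forall>y z. \<bar>(\<Sum>i\<in>I. \<phi> i y) - (\<Sum>i\<in>I. \<phi> i z)\<bar> \<le> c * dist y z))"
  using I r
proof (induction I rule: finite_ranking_induct[where f="\<lambda>i. - r i"])
  case empty
  then show ?case by auto
next
  case (insert k S)
  show ?case
  proof (cases "k \<in> S")
    case True
    then show ?thesis using insert by (simp add: insert_absorb)
  next
    case False
    have "\<forall>i\<in>S. 0 < r i" using insert.prems by simp
    from insert.IH[OF this] obtain \<phi> where
      B: "\<forall>i\<in>S. (\<forall>y z. \<bar>\<phi> i y - \<phi> i z\<bar> \<le> 2 / r i * dist y z) \<and> (\<forall>y. 0 \<le> \<phi> i y) \<and> (\<forall>y. 2 * r i \<le> dist y (x i) \<longrightarrow> \<phi> i y = 0)"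
      and s1': "\<forall>y. (\<Sum>i\<in>S. \<phi> i y) \<le> 1" and s2': "\<forall>i\<in>S. \<forall>y. dist y (x i) \<le> r i \<longrightarrow> (\<Sum>i\<in>S. \<phi> i y) = 1"
      and s3': "\<forall>c\<ge>0. (\<forall>i\<in>S. 1 / r i \<le> c) \<longrightarrow> (\<forall>y z. \<bar>(\<Sum>i\<in>S. \<phi> i y) - (\<Sum>i\<in>S. \<phi> i z)\<bar> \<le> c * dist y z)"
      by (elim exE conjE) (rule that)
    have L: "\<And>i y z. i \<in> S \<Longrightarrow> \<bar>\<phi> i y - \<phi> i z\<bar> \<le> 2 / r i * dist y z" and p: "\<And>i y. i \<in> S \<Longrightarrow> 0 \<le> \<phi> i y"
      and z: "\<And>i y. i \<in> S \<Longrightarrow> 2 * r i \<le> dist y (x i) \<Longrightarrow> \<phi> i y = 0"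
      using B by blast+
    note s1 = s1'[rule_format] and s2 = s2'[rule_format] and s3 = s3'[rule_format]
    have rk: "0 < r k" using insert.prems by simp
    define \<Phi> where "\<Phi> = (\<lambda>y. \<Sum>i\<in>S. \<phi> i y)"
    define \<psi> where "\<psi> = (\<lambda>y. max 0 (min 1 (2 - dist y (x k) / r k)))"
    define \<phi>' where "\<phi>' = \<phi>(k := (\<lambda>y. max 0 (\<psi> y - \<Phi> y)))"
    have \<phi>'S: "(\<Sum>i\<in>S. \<phi>' i y) = \<Phi> y" for y
      unfolding \<Phi>_def by (rule sum.cong) (use False in \<open>auto simp: \<phi>'_def\<close>)
    have sum': "(\<Sum>i\<in>insert k S. \<phi>' i y) = max (\<Phi> y) (\<psi> y)" for y
      using False insert.hyps(1) \<phi>'S by (simp add: \<phi>'_def max_def)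
    have \<Phi>0: "0 \<le> \<Phi> y" for y unfolding \<Phi>_def using p by (rule sum_nonneg)
    have \<psi>L: "\<bar>\<psi> y - \<psi> z\<bar> \<le> 1 / r k * dist y z" for y z
    proof -
      have "\<bar>\<psi> y - \<psi> z\<bar> \<le> \<bar>dist y (x k) / r k - dist z (x k) / r k\<bar>" unfolding \<psi>_def by linarith
      also have "\<dots> = \<bar>dist y (x k) - dist z (x k)\<bar> / r k" using rk by (simp flip: diff_divide_distrib add: abs_divide)
      also have "\<dots> \<le> dist y z / r k"
        using rk dist_triangle[of y "x k" z] dist_triangle[of z "x k" y] by (intro divide_right_mono) (auto simp: dist_commute abs_le_iff)
      finally show ?thesis by simp
    qed
    have small: "1 / r i \<le> 1 / r k" if "i \<in> S" for i
      using insert.hyps(2)[OF that] insert.prems that rk by (intro divide_left_mono) auto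
    have \<Phi>L: "\<bar>\<Phi> y - \<Phi> z\<bar> \<le> 1 / r k * dist y z" for y z
      unfolding \<Phi>_def by (rule s3) (use rk small in auto)
    show ?thesis
    proof (intro exI[of _ \<phi>'] conjI ballI allI impI)
      fix i y z assume i: "i \<in> insert k S"
      show "\<bar>\<phi>' i y - \<phi>' i z\<bar> \<le> 2 / r i * dist y z"
      proof (cases "i = k")
        case True
        have "\<bar>max 0 (\<psi> y - \<Phi> y) - max 0 (\<psi> z - \<Phi> z)\<bar> \<le> \<bar>\<psi> y - \<psi> z\<bar> + \<bar>\<Phi> y - \<Phi> z\<bar>" by linarith
        also have "\<dots> \<le> 1 / r k * dist y z + 1 / r k * dist y z" by (rule add_mono[OF \<psi>L \<Phi>L])
        finally show ?thesis using True by (simp add: \<phi>'_def)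
      next
        case False
        then show ?thesis using L[of i y z] i by (simp add: \<phi>'_def)
      qed
    next
      fix i y assume "i \<in> insert k S"
      then show "0 \<le> \<phi>' i y" using p[of i y] by (auto simp: \<phi>'_def)
    next
      fix i y assume i: "i \<in> insert k S" and far: "2 * r i \<le> dist y (x i)"
      show "\<phi>' i y = 0"
      proof (cases "i = k")
        case True
        then have "2 \<le> dist y (x k) / r k" using far rk by (simp add: field_simps)
        then have "\<psi> y = 0" by (simp add: \<psi>_def)
        then show ?thesis using True \<Phi>0[of y] by (simp add: \<phi>'_def)
      next
        case False
        then show ?thesis using z[of i y] i far by (simp add: \<phi>'_def)
      qed
    next
      fix y show "(\<Sum>i\<in>insert k S. \<phi>' i y) \<le> 1" unfolding sum' using s1[of y] by (simp add: \<Phi>_def \<psi>_def)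
    next
      fix i y assume i: "i \<in> insert k S" and near: "dist y (x i) \<le> r i"
      show "(\<Sum>i\<in>insert k S. \<phi>' i y) = 1"
      proof (cases "i = k")
        case True
        then have "dist y (x k) / r k \<le> 1" using near rk by simp
        then have "\<psi> y = 1" by (simp add: \<psi>_def)
        then show ?thesis unfolding sum' using s1[of y] by (simp add: \<Phi>_def)
      next
        case False
        then have "\<Phi> y = 1" using s2[of i y] i near by (simp add: \<Phi>_def)
        then show ?thesis unfolding sum' by (simp add: \<psi>_def)
      qed
    next
      fix c :: real and y z assume c: "0 \<le> c" "\<forall>i\<in>insert k S. 1 / r i \<le> c"
      have 1: "\<bar>\<Phi> y - \<Phi> z\<bar> \<le> c * dist y z" unfolding \<Phi>_def by (rule s3) (use c in auto)
      have "1 / r k * dist y z \<le> c * dist y z" using c(2) by (intro mult_right_mono) auto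
      then have 2: "\<bar>\<psi> y - \<psi> z\<bar> \<le> c * dist y z" using \<psi>L[of y z] by linarith
      show "\<bar>(\<Sum>i\<in>insert k S. \<phi>' i y) - (\<Sum>i\<in>insert k S. \<phi>' i z)\<bar> \<le> c * dist y z"
        unfolding sum' using 1 2 by linarith
    qed
  qed
qed

section \<open>Removability for weak derivatives\<close>

lemma smooth_mult: "smooth u \<Longrightarrow> smooth v \<Longrightarrow> smooth (\<lambda>x. u x * v x)"
  by (simp add: smooth_def Ck_mult)

lemma smooth_diff: "smooth u \<Longrightarrow> smooth v \<Longrightarrow> smooth (\<lambda>x. u x - v x)"
  by (simp add: smooth_def Ck_diff)

lemma smooth_sum: "(\<And>i. i \<in> I \<Longrightarrow> smooth (u i)) \<Longrightarrow> smooth (\<lambda>x. \<Sum>i\<in>I. u i x)"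
  unfolding smooth_def by (induction I rule: infinite_finite_induct) (auto intro: Ck_add)

lemma smooth_has_derivative: "smooth u \<Longrightarrow> (u has_derivative frechet_derivative u (at x)) (at x)"
  for u :: "complex \<Rightarrow> real"
  using Ck_Suc_deriv unfolding smooth_def by blast

lemma frechet_derivative_smooth_mult:
  fixes u v :: "complex \<Rightarrow> real"
  assumes "smooth u" "smooth v"
  shows "frechet_derivative (\<lambda>x. u x * v x) (at x) b = u x * frechet_derivative v (at x) b + frechet_derivative u (at x) b * v x"
  using frechet_derivative_at[OF has_derivative_mult[OF smooth_has_derivative[OF assms(1)] smooth_has_derivative[OF assms(2)], of x]]
  by metis

lemma frechet_derivative_smooth_sum:
  fixes u :: "'i \<Rightarrow> complex \<Rightarrow> real"
  assumes "\<And>i. i \<in> I \<Longrightarrow> smooth (u i)"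
  shows "frechet_derivative (\<lambda>x. \<Sum>i\<in>I. u i x) (at x) b = (\<Sum>i\<in>I. frechet_derivative (u i) (at x) b)"
proof -
  have "((\<lambda>x. \<Sum>i\<in>I. u i x) has_derivative (\<lambda>v. \<Sum>i\<in>I. frechet_derivative (u i) (at x) v)) (at x)"
    by (rule has_derivative_sum) (use assms smooth_has_derivative in blast)
  from frechet_derivative_at[OF this] show ?thesis by metis
qed

lemma frechet_derivative_locally_constant:
  fixes u :: "complex \<Rightarrow> real"
  assumes "open S" "x \<in> S" "\<And>y. y \<in> S \<Longrightarrow> u y = c"
  shows "frechet_derivative u (at x) b = 0"
proof -
  have "(u has_derivative (\<lambda>v. 0)) (at x)"
    by (rule has_derivative_transform_within_open[OF has_derivative_const[of c] assms(1,2)]) (use assms(3) in auto)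
  from frechet_derivative_at[OF this] show ?thesis by metis
qed

lemma frechet_derivative_0_outside:
  fixes u :: "complex \<Rightarrow> real"
  assumes "\<And>x. R < cmod x \<Longrightarrow> u x = 0" and "R < cmod x"
  shows "frechet_derivative u (at x) b = 0"
  by (rule frechet_derivative_locally_constant[of "{x. R < cmod x}" x _ 0])
    (use assms in \<open>auto intro!: open_Collect_less continuous_intros\<close>)

lemma integral_smooth_partial_0:
  fixes u :: "complex \<Rightarrow> real"
  assumes u: "smooth u" and b: "b \<in> {1, \<i>}" and z: "\<And>x. R < cmod x \<Longrightarrow> u x = 0"
  shows "(LINT x|lebesgue. frechet_derivative u (at x) b) = 0"
proof -
  have "(\<lambda>x. frechet_derivative u (at x) b) \<in> borel_measurable borel"
    by (rule borel_measurable_continuous_onI[OF smooth_continuous[OF smooth_partial_smooth[OF u b]]])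
  then show ?thesis
    using integral_C1_partials_0[OF smooth_C1[OF u] z] b by (auto simp: integral_completion)
qed

lemma continuous_compact_support_integrable_lebesgue:
  fixes u :: "complex \<Rightarrow> 'b::euclidean_space"
  assumes "continuous_on UNIV u" and "\<And>x. R < cmod x \<Longrightarrow> u x = 0"
  shows "integrable lebesgue u"
  using continuous_compact_support_integrable[OF assms] borel_measurable_continuous_onI[OF assms(1)]
  by (simp add: integrable_completion)

lemma norm_integral_le_disc:
  fixes F :: "complex \<Rightarrow> 'b::euclidean_space"
  assumes F: "integrable lebesgue F" and b: "\<And>x. norm (F x) \<le> B * indicator (cball c s) x" and s: "0 \<le> s"
  shows "norm (integral\<^sup>L lebesgue F) \<le> B * (pi * s\<^sup>2)"
proof -
  have i: "integrable lebesgue (\<lambda>x. B * indicator (cball c s) x)"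
    by (intro integrable_mult_right integrable_real_indicator) (auto simp: emeasure_cball_complex s)
  have "norm (integral\<^sup>L lebesgue F) \<le> (LINT x|lebesgue. norm (F x))" by (rule integral_norm_bound)
  also have "\<dots> \<le> (LINT x|lebesgue. B * indicator (cball c s) x)"
    by (rule integral_mono[OF integrable_norm[OF F] i b])
  also have "\<dots> = B * (pi * s\<^sup>2)" using s by (simp add: measure_cball_complex)
  finally show ?thesis .
qed

text \<open>
  Mollification at a scale of at most the smallest radius preserves the Lipschitz constants and enlarges the supports
  slightly. The sum remains \<open>1\<close> on a neighbourhood of \<open>E\<close> if the scale is also small compared with the distance
  from \<open>E\<close> to the complement of the discs.
\<close>

lemma smooth_bump_decomposition:
  fixes x :: "nat \<Rightarrow> complex" and r :: "nat \<Rightarrow> real"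
  assumes I: "finite I" and r: "\<forall>i\<in>I. 0 < r i" and E: "compact E" "E \<subseteq> (\<Union>i\<in>I. ball (x i) (r i))"
  shows "\<exists>\<eta> V. (\<forall>i\<in>I. smooth (\<eta> i) \<and> (\<forall>y. \<forall>b\<in>{1, \<i>}. \<bar>frechet_derivative (\<eta> i) (at y) b\<bar> \<le> 2 / r i) \<and>
      (\<forall>y. 0 \<le> \<eta> i y) \<and> (\<forall>y. 3 * r i \<le> dist y (x i) \<longrightarrow> \<eta> i y = 0)) \<and>
    (\<forall>y. (\<Sum>i\<in>I. \<eta> i y) \<le> (1::real)) \<and> open V \<and> E \<subseteq> V \<and> (\<forall>y\<in>V. (\<Sum>i\<in>I. \<eta> i y) = 1)"
proof -
  from bump_decomposition[of I r x, OF I r] obtain \<phi> where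
    B: "\<forall>i\<in>I. (\<forall>y z. \<bar>\<phi> i y - \<phi> i z\<bar> \<le> 2 / r i * dist y z) \<and> (\<forall>y. 0 \<le> \<phi> i y) \<and> (\<forall>y. 2 * r i \<le> dist y (x i) \<longrightarrow> \<phi> i y = 0)"
    and s1: "\<forall>y. (\<Sum>i\<in>I. \<phi> i y) \<le> (1::real)" and s2: "\<forall>i\<in>I. \<forall>y. dist y (x i) \<le> r i \<longrightarrow> (\<Sum>i\<in>I. \<phi> i y) = 1"
    by (elim exE conjE) (rule that)
  have L: "\<And>i y z. i \<in> I \<Longrightarrow> \<bar>\<phi> i y - \<phi> i z\<bar> \<le> 2 / r i * dist y z" and p: "\<And>i y. i \<in> I \<Longrightarrow> 0 \<le> \<phi> i y"
    and z: "\<And>i y. i \<in> I \<Longrightarrow> 2 * r i \<le> dist y (x i) \<Longrightarrow> \<phi> i y = 0"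
    using B by blast+
  have "open (\<Union>i\<in>I. ball (x i) (r i))" by auto
  from compact_subset_open_imp_ball_epsilon_subset[OF E(1) this E(2)]
  obtain e where e: "0 < e" "(\<Union>y\<in>E. ball y e) \<subseteq> (\<Union>i\<in>I. ball (x i) (r i))" by blast
  define \<sigma> where "\<sigma> = Min (insert (e / 2) (r ` I))"
  have "finite (insert (e / 2) (r ` I))" using I by simp
  then have \<sigma>: "0 < \<sigma>" "\<sigma> \<le> e / 2" unfolding \<sigma>_def using r e(1) Min_le[of "insert (e / 2) (r ` I)" "e / 2"] by (auto simp: Min_gr_iff)
  have \<sigma>r: "\<sigma> \<le> r i" if "i \<in> I" for i unfolding \<sigma>_def using that I by (intro Min_le) auto
  obtain k where k: "mollifier \<sigma> k" using mollifier_exists[OF \<sigma>(1)] by blast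
  have c\<phi>: "continuous_on UNIV (\<phi> i)" if i: "i \<in> I" for i
  proof (rule lipschitz_on_continuous_on[of "2 / r i"], rule lipschitz_onI)
    show "dist (\<phi> i y) (\<phi> i z) \<le> 2 / r i * dist y z" for y z using L[OF i] by (simp add: dist_real_def)
    show "0 \<le> 2 / r i" using r i by (auto intro: less_imp_le)
  qed
  have sm: "smooth (conv k (\<phi> i))" if "i \<in> I" for i
    by (rule conv_smooth[OF mollifierD(1)[OF k] mollifierD(3)[OF k] c\<phi>[OF that]])
  have cs: "continuous_on UNIV (\<lambda>y. \<Sum>i\<in>I. \<phi> i y)" by (intro continuous_on_sum c\<phi>)
  have ki: "integrable lborel (\<lambda>z. k (y - z) *\<^sub>R u z)" if "continuous_on UNIV u" for u :: "complex \<Rightarrow> real" and y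
  proof (rule continuous_compact_support_integrable)
    show "continuous_on UNIV (\<lambda>z. k (y - z) *\<^sub>R u z)"
      by (intro continuous_intros that continuous_on_compose2[OF mollifierD(5)[OF k, of UNIV]]) auto
    show "k (y - z) *\<^sub>R u z = 0" if "cmod y + \<sigma> < cmod z" for z
      using that norm_triangle_ineq2[of z y] mollifierD(3)[OF k, of "y - z"] by (simp add: norm_minus_commute)
  qed
  have lin: "(\<Sum>i\<in>I. conv k (\<phi> i) y) = conv k (\<lambda>z. \<Sum>i\<in>I. \<phi> i z) y" for y
    unfolding conv_def by (simp add: scaleR_sum_right Bochner_Integration.integral_sum ki[OF c\<phi>, unfolded real_scaleR_def] sum_distrib_left)
  define V where "V = (\<Union>y\<in>E. ball y (e / 2))"
  show ?thesis
  proof (intro exI[of _ "\<lambda>i. conv k (\<phi> i)"] exI[of _ V] conjI ballI allI impI)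
    fix i y and b :: complex assume i: "i \<in> I" and b: "b \<in> {1, \<i>}"
    have Lc: "norm (conv k (\<phi> i) y - conv k (\<phi> i) z) \<le> 2 / r i * dist y z" for y z
      using conv_Lipschitz[OF k L[OF i], of y z] by simp
    show "\<bar>frechet_derivative (conv k (\<phi> i)) (at y) b\<bar> \<le> 2 / r i"
      using C1_Lipschitz_partials[OF smooth_C1[OF sm[OF i]] Lc, of y] b by auto
  next
    fix i y assume i: "i \<in> I"
    show "0 \<le> conv k (\<phi> i) y" unfolding conv_def using mollifierD(2)[OF k] p[OF i] by (intro integral_nonneg_AE) auto
  next
    fix i y assume i: "i \<in> I" and far: "3 * r i \<le> dist y (x i)"
    have zz: "\<phi> i z = 0" if "dist z y \<le> \<sigma>" for z
      by (rule z[OF i]) (use that far \<sigma>r[OF i] dist_triangle[of y "x i" z] in \<open>simp add: dist_commute\<close>)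
    have "norm (conv k (\<phi> i) y - \<phi> i y) \<le> 0"
      by (rule conv_diff_bound[OF k c\<phi>[OF i]]) (use zz \<sigma> in simp)
    then show "conv k (\<phi> i) y = 0" using zz[of y] \<sigma> by simp
  next
    fix y
    have "conv k (\<lambda>z. \<Sum>i\<in>I. \<phi> i z) y \<le> (LINT z|lborel. k (y - z))"
      unfolding conv_def
    proof (rule integral_mono[OF ki[OF cs] mollifier_translate(2)[OF k]])
      show "k (y - z) *\<^sub>R (\<Sum>i\<in>I. \<phi> i z) \<le> k (y - z)" for z
        using mult_left_mono[OF s1[rule_format, of z] mollifierD(2)[OF k, of "y - z"]] by simp
    qed
    then show "(\<Sum>i\<in>I. conv k (\<phi> i) y) \<le> 1" unfolding lin mollifier_translate(1)[OF k] .
  next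
    show "open V" "E \<subseteq> V" using e by (auto simp: V_def)
  next
    fix y assume "y \<in> V"
    then obtain w where w: "w \<in> E" "dist w y < e / 2" by (auto simp: V_def)
    have one: "(\<Sum>i\<in>I. \<phi> i z) = 1" if "dist z y \<le> \<sigma>" for z
    proof -
      have "dist w z < e" using w \<sigma> that dist_triangle[of w z y] by (simp add: dist_commute)
      then have "z \<in> (\<Union>y\<in>E. ball y e)" using w(1) by auto
      then have "z \<in> (\<Union>i\<in>I. ball (x i) (r i))" by (rule subsetD[OF e(2)])
      then obtain i where "i \<in> I" "dist (x i) z < r i" by auto
      then show ?thesis using s2[rule_format, of i z] by (simp add: dist_commute)
    qed
    have "norm (conv k (\<lambda>z. \<Sum>i\<in>I. \<phi> i z) y - (\<Sum>i\<in>I. \<phi> i y)) \<le> 0"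
      by (rule conv_diff_bound[OF k cs]) (use one \<sigma> in simp)
    then show "(\<Sum>i\<in>I. conv k (\<phi> i) y) = 1" unfolding lin using one[of y] \<sigma> by simp
  qed (rule sm)
qed

lemma smooth_bound:
  assumes u: "smooth u" and R: "\<And>x. R < cmod x \<Longrightarrow> u x = 0"
  shows "\<exists>M\<ge>1. \<forall>x. \<bar>u x\<bar> \<le> M"
proof -
  obtain M where M: "1 \<le> M" "\<forall>x\<in>cball 0 R. \<bar>u x\<bar> \<le> M"
    using continuous_bound_on_compact[OF smooth_continuous[OF u], of R] by blast
  have "\<bar>u x\<bar> \<le> M" for x using M R[of x] by (cases "R < cmod x") auto
  then show ?thesis using M(1) by blast
qed

text \<open>
  Subtracting the constant \<open>f c\<close> from \<open>f\<close> costs nothing because the derivative of a compactly supported function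
  has integral \<open>0\<close>; after that the integrand is of size \<open>r powr (\<alpha> - 1)\<close> on a disc of area \<open>9 * pi * r\<^sup>2\<close>.
\<close>

lemma Holder_bump_integral:
  fixes f :: "complex \<Rightarrow> complex"
  assumes f: "continuous_on UNIV f" and Hol: "\<And>z w. dist z w < 1 \<Longrightarrow> dist (f z) (f w) \<le> C * dist z w powr \<alpha>"
    and \<alpha>: "0 < \<alpha>" "\<alpha> \<le> 1" and C: "0 \<le> C" and b: "b \<in> {1, \<i>}"
    and \<phi>: "smooth \<phi>" "\<And>x. R < cmod x \<Longrightarrow> \<phi> x = 0" and M: "0 \<le> M" "\<And>y. \<bar>\<phi> y\<bar> \<le> M" "\<And>y. \<bar>frechet_derivative \<phi> (at y) b\<bar> \<le> M"
    and \<eta>: "smooth \<eta>" "\<And>y. \<bar>frechet_derivative \<eta> (at y) b\<bar> \<le> 2 / r" "\<And>y. \<bar>\<eta> y\<bar> \<le> 1" "\<And>y. 3 * r \<le> dist y c \<Longrightarrow> \<eta> y = 0"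
    and r: "0 < r" "3 * r < 1"
  shows "integrable lebesgue (\<lambda>x. frechet_derivative (\<lambda>y. \<phi> y * \<eta> y) (at x) b *\<^sub>R f x)"
    and "norm (LINT x|lebesgue. frechet_derivative (\<lambda>y. \<phi> y * \<eta> y) (at x) b *\<^sub>R f x) \<le> 81 * pi * M * C * r powr (1 + \<alpha>)"
proof -
  let ?g = "\<lambda>x. frechet_derivative (\<lambda>y. \<phi> y * \<eta> y) (at x) b"
  have sm: "smooth (\<lambda>y. \<phi> y * \<eta> y)" by (rule smooth_mult[OF \<phi>(1) \<eta>(1)])
  have gc: "continuous_on UNIV ?g" by (rule smooth_continuous[OF smooth_partial_smooth[OF sm b]])
  have gR: "?g x = 0" if "R < cmod x" for x
    by (rule frechet_derivative_0_outside[OF _ that]) (simp add: \<phi>(2))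
  have gs: "?g x = 0" if "3 * r < dist x c" for x
    by (rule frechet_derivative_locally_constant[of "{x. 3 * r < dist x c}" x _ 0]) (use that \<eta>(4) in \<open>auto intro!: open_Collect_less continuous_intros\<close>)
  show i1: "integrable lebesgue (\<lambda>x. ?g x *\<^sub>R f x)"
    by (rule continuous_compact_support_integrable_lebesgue[of _ R]) (auto intro!: continuous_intros gc f simp: gR)
  have i2: "integrable lebesgue (\<lambda>x. ?g x *\<^sub>R f c)"
    by (rule continuous_compact_support_integrable_lebesgue[of _ R]) (auto intro!: continuous_intros gc simp: gR)
  have i3: "integrable lebesgue ?g"
    by (rule continuous_compact_support_integrable_lebesgue[of _ R]) (auto intro!: gc simp: gR)
  have "(LINT x|lebesgue. ?g x *\<^sub>R f c) = (LINT x|lebesgue. ?g x) *\<^sub>R f c" using i3 by (intro integral_scaleR_left) auto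
  also have "(LINT x|lebesgue. ?g x) = 0" by (rule integral_smooth_partial_0[OF sm b, of R]) (simp add: \<phi>(2))
  finally have "(LINT x|lebesgue. ?g x *\<^sub>R f x) = (LINT x|lebesgue. ?g x *\<^sub>R f x - ?g x *\<^sub>R f c)"
    using i1 i2 by simp
  also have "norm \<dots> \<le> (3 * M / r) * (3 * C * r powr \<alpha>) * (pi * (3 * r)\<^sup>2)"
  proof (rule norm_integral_le_disc[where c=c])
    show "integrable lebesgue (\<lambda>x. ?g x *\<^sub>R f x - ?g x *\<^sub>R f c)" using i1 i2 by simp
    show "0 \<le> 3 * r" using r by simp
    fix x
    show "norm (?g x *\<^sub>R f x - ?g x *\<^sub>R f c) \<le> (3 * M / r) * (3 * C * r powr \<alpha>) * indicator (cball c (3 * r)) x"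
    proof (cases "3 * r < dist x c")
      case True
      then show ?thesis using gs[OF True] by (simp add: dist_commute)
    next
      case False
      have "\<bar>?g x\<bar> \<le> M * (2 / r) + M * 1"
        unfolding frechet_derivative_smooth_mult[OF \<phi>(1) \<eta>(1)]
        using abs_mult_le[OF M(2)[of x] \<eta>(2)[of x]] abs_mult_le[OF M(3)[of x] \<eta>(3)[of x]] by linarith
      also have "\<dots> \<le> M * (2 / r) + M * (1 / r)" using M(1) r by (intro add_left_mono mult_left_mono) auto
      finally have 1: "\<bar>?g x\<bar> \<le> 3 * M / r" by (simp add: field_simps)
      have "norm (f x - f c) \<le> C * dist x c powr \<alpha>" using Hol[of x c] False r by (simp add: dist_norm)
      also have "\<dots> \<le> C * (3 * r) powr \<alpha>" using False C \<alpha> by (intro mult_left_mono powr_mono2) auto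
      also have "\<dots> = C * (3 powr \<alpha> * r powr \<alpha>)" using r by (simp add: powr_mult)
      also have "\<dots> \<le> C * (3 powr 1 * r powr \<alpha>)" using \<alpha> C by (intro mult_left_mono mult_right_mono powr_mono) auto
      finally have 2: "norm (f x - f c) \<le> 3 * C * r powr \<alpha>" by simp
      have "norm (?g x *\<^sub>R f x - ?g x *\<^sub>R f c) = \<bar>?g x\<bar> * norm (f x - f c)" by (simp flip: scaleR_diff_right)
      also have "\<dots> \<le> (3 * M / r) * (3 * C * r powr \<alpha>)" using M(1) r by (intro mult_mono 1 2) auto
      finally show ?thesis using False by (simp add: dist_commute)
    qed
  qed
  also have "\<dots> = 81 * pi * M * C * (r * r powr \<alpha>)" using r by (simp add: power2_eq_square)
  also have "r * r powr \<alpha> = r powr (1 + \<alpha>)" using r by (simp add: powr_add)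
  finally show "norm (LINT x|lebesgue. ?g x *\<^sub>R f x) \<le> 81 * pi * M * C * r powr (1 + \<alpha>)" .
qed

text \<open>
  A test function \<open>\<phi>\<close> is split into a part \<open>u\<close> that vanishes near \<open>E\<close>, for which the identity is assumed, and the
  part \<open>v\<close> near \<open>E\<close>. For \<open>v\<close> the term with \<open>f\<close> is a sum of integrals estimated by \<open>Holder_bump_integral\<close>, and the
  term with \<open>d\<close> is small by absolute continuity, because \<open>v\<close> is supported in a set of small area.
\<close>

lemma weak_partial_removable:
  fixes f d :: "complex \<Rightarrow> complex"
  assumes f: "continuous_on UNIV f" and Hol: "\<And>z w. dist z w < 1 \<Longrightarrow> dist (f z) (f w) \<le> C * dist z w powr \<alpha>"
    and \<alpha>: "0 < \<alpha>" "\<alpha> \<le> 1" and C: "0 \<le> C" and b: "b \<in> {1, \<i>}" and E: "compact E"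
    and d: "d \<in> L1_loc UNIV" and w: "weak_partial (- E) b f d"
    and covers: "\<And>e. 0 < e \<Longrightarrow> \<exists>(I :: nat set) x r. finite I \<and> (\<forall>i\<in>I. 0 < r i \<and> 3 * r i < 1) \<and> E \<subseteq> (\<Union>i\<in>I. ball (x i) (r i)) \<and> (\<Sum>i\<in>I. r i powr (1 + \<alpha>)) < e"
  shows "weak_partial UNIV b f d"
  unfolding weak_partial_def
proof
  fix \<phi> :: "complex \<Rightarrow> real" assume "\<phi> \<in> test_functions UNIV"
  then have cl: "compact (closure {x. \<phi> x \<noteq> 0})" and sm: "smooth \<phi>" using compact_test_support by blast+
  obtain R where R: "closure {x. \<phi> x \<noteq> 0} \<subseteq> cball 0 R" using compact_subset_cball[OF cl] by (elim exE)
  have \<phi>R: "\<phi> x = 0" if "R < cmod x" for x using R that closure_subset[of "{x. \<phi> x \<noteq> 0}"] by force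
  let ?D = "\<lambda>u x. frechet_derivative u (at x) b"
  have D\<phi>R: "?D \<phi> x = 0" if "R < cmod x" for x
    by (rule frechet_derivative_0_outside[OF \<phi>R that])
  obtain M1 where M1: "1 \<le> M1" "\<forall>x. \<bar>\<phi> x\<bar> \<le> M1" using smooth_bound[OF sm \<phi>R] by blast
  obtain M2 where M2: "1 \<le> M2" "\<forall>x. \<bar>?D \<phi> x\<bar> \<le> M2" using smooth_bound[OF smooth_partial_smooth[OF sm b] D\<phi>R] by blast
  define M where "M = M1 + M2"
  have M: "1 \<le> M" and M\<phi>: "\<bar>\<phi> x\<bar> \<le> M" and MD: "\<bar>?D \<phi> x\<bar> \<le> M" for x
    using M1 M2 by (auto simp: M_def intro: order_trans)
  have di: "integrable lebesgue (\<lambda>x. indicator (cball 0 R) x *\<^sub>R d x)"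
    using d unfolding L1_loc_def set_integrable_def by auto
  have ud: "integrable lebesgue (\<lambda>x. u x *\<^sub>R d x)" if u: "smooth u" "\<And>x. R < cmod x \<Longrightarrow> u x = 0" "\<And>x. \<bar>u x\<bar> \<le> M" for u
  proof (rule Bochner_Integration.integrable_bound[OF integrable_mult_right[OF integrable_norm[OF di], of M]])
    have "u \<in> borel_measurable lebesgue"
      using borel_measurable_continuous_onI[OF smooth_continuous[OF u(1)]] by (intro measurable_completion) simp
    then have "(\<lambda>x. u x *\<^sub>R (indicator (cball 0 R) x *\<^sub>R d x)) \<in> borel_measurable lebesgue"
      using borel_measurable_integrable[OF di] by (rule borel_measurable_scaleR)
    moreover have "(\<lambda>x. u x *\<^sub>R (indicator (cball 0 R) x *\<^sub>R d x)) = (\<lambda>x. u x *\<^sub>R d x)"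
      using u(2) by (force simp: indicator_def)
    ultimately show "(\<lambda>x. u x *\<^sub>R d x) \<in> borel_measurable lebesgue" by simp
    show "AE x in lebesgue. norm (u x *\<^sub>R d x) \<le> norm (M * norm (indicator (cball 0 R) x *\<^sub>R d x))"
    proof (rule AE_I2)
      fix x
      show "norm (u x *\<^sub>R d x) \<le> norm (M * norm (indicator (cball 0 R) x *\<^sub>R d x))"
        using u(2)[of x] mult_right_mono[OF u(3)[of x] norm_ge_zero[of "d x"]] M by (cases "R < cmod x") auto
    qed
  qed
  have df: "integrable lebesgue (\<lambda>x. ?D u x *\<^sub>R f x)" if u: "smooth u" "\<And>x. R < cmod x \<Longrightarrow> u x = 0" for u
  proof (rule continuous_compact_support_integrable_lebesgue[of _ R])
    show "continuous_on UNIV (\<lambda>x. ?D u x *\<^sub>R f x)"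
      by (intro continuous_intros f smooth_continuous[OF smooth_partial_smooth[OF u(1) b]])
    show "?D u x *\<^sub>R f x = 0" if "R < cmod x" for x
      using frechet_derivative_0_outside[OF u(2) that] by simp
  qed
  define A where "A = (LINT x|lebesgue. ?D \<phi> x *\<^sub>R f x) + (LINT x|lebesgue. \<phi> x *\<^sub>R d x)"
  have small: "norm A \<le> e" if e: "0 < e" for e
  proof -
    have nn: "0 \<le> norm (indicator (cball 0 R) x *\<^sub>R d x)" for x by simp
    have e2: "0 < e / (2 * M)" using e M by simp
    from integral_small_on_small_sets[OF integrable_norm[OF di] nn e2]
    obtain \<delta> where \<delta>: "0 < \<delta>" "\<forall>S\<in>sets lebesgue. emeasure lebesgue S < ennreal \<delta> \<longrightarrow> (LINT x:S|lebesgue. norm (indicator (cball 0 R) x *\<^sub>R d x)) < e / (2 * M)"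
      by blast
    define T where "T = 81 * pi * M * (C + 1)"
    have T: "0 < T" using M C by (simp add: T_def)
    have "0 < min (e / (2 * T)) (\<delta> / (9 * pi))" using e T \<delta> by simp
    from covers[OF this] obtain I :: "nat set" and x r where I: "finite I" and r: "\<forall>i\<in>I. 0 < r i \<and> 3 * r i < 1"
      and EI: "E \<subseteq> (\<Union>i\<in>I. ball (x i) (r i))" and S: "(\<Sum>i\<in>I. r i powr (1 + \<alpha>)) < min (e / (2 * T)) (\<delta> / (9 * pi))"
      by (elim exE conjE) (rule that)
    have r0: "\<And>i. i \<in> I \<Longrightarrow> 0 < r i" and r1: "\<And>i. i \<in> I \<Longrightarrow> 3 * r i < 1" using r by blast+
    have r0': "\<forall>i\<in>I. 0 < r i" using r by blast
    from smooth_bump_decomposition[of I r E x, OF I r0' E EI] obtain \<eta> V where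
      \<eta>: "\<forall>i\<in>I. smooth (\<eta> i) \<and> (\<forall>y. \<forall>b\<in>{1, \<i>}. \<bar>frechet_derivative (\<eta> i) (at y) b\<bar> \<le> 2 / r i) \<and>
      (\<forall>y. 0 \<le> \<eta> i y) \<and> (\<forall>y. 3 * r i \<le> dist y (x i) \<longrightarrow> \<eta> i y = 0)"
      and X1: "\<forall>y. (\<Sum>i\<in>I. \<eta> i y) \<le> 1" and V: "open V" "E \<subseteq> V" and XV: "\<forall>y\<in>V. (\<Sum>i\<in>I. \<eta> i y) = 1"
      by (elim exE conjE) (rule that)
    have c1: "\<And>i. i \<in> I \<Longrightarrow> smooth (\<eta> i)" and c2: "\<And>i y. i \<in> I \<Longrightarrow> \<bar>?D (\<eta> i) y\<bar> \<le> 2 / r i"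
      and c3: "\<And>i y. i \<in> I \<Longrightarrow> 0 \<le> \<eta> i y" and c4: "\<And>i y. i \<in> I \<Longrightarrow> 3 * r i \<le> dist y (x i) \<Longrightarrow> \<eta> i y = 0"
      using \<eta> b by blast+
    define X where "X = (\<lambda>y. \<Sum>i\<in>I. \<eta> i y)"
    have X01: "0 \<le> X y" "X y \<le> 1" for y using X1 c3 by (auto simp: X_def intro: sum_nonneg)
    have c5: "\<bar>\<eta> i y\<bar> \<le> 1" if "i \<in> I" for i y
      using member_le_sum[of i I "\<lambda>i. \<eta> i y"] that I c3 X01(2)[of y] by (simp add: X_def)
    have Xs: "smooth X" unfolding X_def by (rule smooth_sum[OF c1])
    define u where "u = (\<lambda>y. \<phi> y * (1 - X y))"
    have us: "smooth u" unfolding u_def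
      by (intro smooth_mult sm smooth_diff Xs) (simp add: smooth_def)
    have uV: "u y = 0" if "y \<in> V" for y using XV that by (simp add: u_def X_def)
    have uR: "u y = 0" if "R < cmod y" for y using \<phi>R[OF that] by (simp add: u_def)
    have uM: "\<bar>u y\<bar> \<le> M" for y
      using abs_mult_le[OF M\<phi>[of y], of "1 - X y" 1] X01[of y] by (simp add: u_def)
    have "u \<in> test_functions (- E)"
      unfolding test_functions_def
    proof (intro CollectI conjI)
      show "\<forall>k. Ck k u" using us by (simp add: smooth_def)
      have "closure {x. u x \<noteq> 0} \<subseteq> closure {x. \<phi> x \<noteq> 0}" by (rule closure_mono) (auto simp: u_def)
      then have "closure {x. u x \<noteq> 0} = closure {x. \<phi> x \<noteq> 0} \<inter> closure {x. u x \<noteq> 0}" by blast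
      then show "compact (closure {x. u x \<noteq> 0})" using compact_Int_closed[OF cl closed_closure] by metis
      have "closure {x. u x \<noteq> 0} \<subseteq> - V" by (rule closure_minimal) (use uV V(1) in auto)
      then show "closure {x. u x \<noteq> 0} \<subseteq> - E" using V(2) by blast
    qed
    with w have "(LINT x:-E|lebesgue. ?D u x *\<^sub>R f x) = - (LINT x:-E|lebesgue. u x *\<^sub>R d x)"
      unfolding weak_partial_def by blast
    moreover have "(LINT x:-E|lebesgue. ?D u x *\<^sub>R f x) = (LINT x|lebesgue. ?D u x *\<^sub>R f x)"
      unfolding set_lebesgue_integral_def
    proof (rule Bochner_Integration.integral_cong[OF refl])
      fix y
      show "indicator (- E) y *\<^sub>R ?D u y *\<^sub>R f y = ?D u y *\<^sub>R f y"
        using frechet_derivative_locally_constant[of V y u 0 b] uV V by (cases "y \<in> E") auto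
    qed
    moreover have "(LINT x:-E|lebesgue. u x *\<^sub>R d x) = (LINT x|lebesgue. u x *\<^sub>R d x)"
      unfolding set_lebesgue_integral_def
      by (rule Bochner_Integration.integral_cong[OF refl]) (use uV V(2) in \<open>auto simp: indicator_def\<close>)
    ultimately have u0: "(LINT x|lebesgue. ?D u x *\<^sub>R f x) + (LINT x|lebesgue. u x *\<^sub>R d x) = 0" by simp
    define v where "v = (\<lambda>y. \<Sum>i\<in>I. \<phi> y * \<eta> i y)"
    have vX: "v y = \<phi> y * X y" for y by (simp add: v_def X_def sum_distrib_left)
    have vs: "smooth v" unfolding v_def by (rule smooth_sum[OF smooth_mult[OF sm c1]])
    have vR: "v y = 0" if "R < cmod y" for y using \<phi>R[OF that] by (simp add: vX)
    have vM: "\<bar>v y\<bar> \<le> M" for y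
      using abs_mult_le[OF M\<phi>[of y], of "X y" 1] X01[of y] by (simp add: vX)
    have split: "\<phi> = (\<lambda>y. u y + v y)" by (rule ext) (simp add: u_def vX algebra_simps)
    have D\<phi>: "?D \<phi> y = ?D u y + ?D v y" for y
      unfolding split
      using frechet_derivative_at[OF has_derivative_add[OF smooth_has_derivative[OF us] smooth_has_derivative[OF vs], of y]] by metis
    have split': "\<phi> y = u y + v y" for y using split by meson
    have "A = (LINT x|lebesgue. ?D u x *\<^sub>R f x + ?D v x *\<^sub>R f x) + (LINT x|lebesgue. u x *\<^sub>R d x + v x *\<^sub>R d x)"
      unfolding A_def D\<phi> unfolding split' scaleR_add_left ..
    also have "\<dots> = (LINT x|lebesgue. ?D v x *\<^sub>R f x) + (LINT x|lebesgue. v x *\<^sub>R d x)"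
      using u0 by (simp add: df[OF us uR] df[OF vs vR] ud[OF us uR uM] ud[OF vs vR vM] add.assoc add_eq_0_iff)
    finally have A: "A = (LINT x|lebesgue. ?D v x *\<^sub>R f x) + (LINT x|lebesgue. v x *\<^sub>R d x)" .
    have "norm (LINT x|lebesgue. ?D v x *\<^sub>R f x) \<le> e / 2"
    proof -
      have M0: "0 \<le> M" using M by simp
      note hb = Holder_bump_integral[OF f Hol \<alpha> C b sm \<phi>R M0 M\<phi> MD c1 c2 c5 c4 r0 r1]
      have Dv: "?D v y = (\<Sum>i\<in>I. ?D (\<lambda>y. \<phi> y * \<eta> i y) y)" for y
        unfolding v_def by (rule frechet_derivative_smooth_sum[OF smooth_mult[OF sm c1]])
      have "(LINT x|lebesgue. ?D v x *\<^sub>R f x) = (LINT x|lebesgue. (\<Sum>i\<in>I. ?D (\<lambda>y. \<phi> y * \<eta> i y) x *\<^sub>R f x))"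
        unfolding Dv scaleR_sum_left ..
      also have "\<dots> = (\<Sum>i\<in>I. LINT x|lebesgue. ?D (\<lambda>y. \<phi> y * \<eta> i y) x *\<^sub>R f x)"
        by (rule Bochner_Integration.integral_sum) (rule hb(1))
      also have "norm \<dots> \<le> (\<Sum>i\<in>I. 81 * pi * M * C * r i powr (1 + \<alpha>))"
        by (rule sum_norm_le) (rule hb(2))
      also have "\<dots> = 81 * pi * M * C * (\<Sum>i\<in>I. r i powr (1 + \<alpha>))" by (simp add: sum_distrib_left)
      also have "\<dots> \<le> T * (\<Sum>i\<in>I. r i powr (1 + \<alpha>))" unfolding T_def
        using M C by (intro mult_right_mono mult_left_mono sum_nonneg) auto
      also have "\<dots> \<le> T * (e / (2 * T))" using S T by (intro mult_left_mono) auto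
      also have "\<dots> = e / 2" using T by simp
      finally show ?thesis .
    qed
    moreover have "norm (LINT x|lebesgue. v x *\<^sub>R d x) \<le> e / 2"
    proof -
      define U where "U = (\<Union>i\<in>I. cball (x i) (3 * r i))"
      have Ul: "U \<in> sets lebesgue" unfolding U_def using I by auto
      have "emeasure lebesgue U \<le> (\<Sum>i\<in>I. emeasure lebesgue (cball (x i) (3 * r i)))"
        unfolding U_def by (rule emeasure_subadditive_finite[OF I]) auto
      also have "\<dots> = (\<Sum>i\<in>I. ennreal (9 * pi * (r i)\<^sup>2))"
        by (rule sum.cong) (use r0 in \<open>auto simp: emeasure_cball_complex less_imp_le power_mult_distrib mult_ac\<close>)
      also have "\<dots> = ennreal (\<Sum>i\<in>I. 9 * pi * (r i)\<^sup>2)" by (rule sum_ennreal) simp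
      also have "(\<Sum>i\<in>I. 9 * pi * (r i)\<^sup>2) \<le> 9 * pi * (\<Sum>i\<in>I. r i powr (1 + \<alpha>))"
        unfolding sum_distrib_left
      proof (intro sum_mono mult_left_mono)
        fix i assume i: "i \<in> I"
        have "(r i)\<^sup>2 = r i powr 2" using r0[OF i] by (simp add: powr_numeral)
        also have "\<dots> \<le> r i powr (1 + \<alpha>)" using r0[OF i] r1[OF i] \<alpha> by (intro powr_mono') auto
        finally show "(r i)\<^sup>2 \<le> r i powr (1 + \<alpha>)" .
      qed simp
      then have "ennreal (\<Sum>i\<in>I. 9 * pi * (r i)\<^sup>2) \<le> ennreal (9 * pi * (\<Sum>i\<in>I. r i powr (1 + \<alpha>)))" by (rule ennreal_leI)
      also have "\<dots> < ennreal \<delta>"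
        using S \<delta>(1) by (intro ennreal_lessI) (auto simp: field_simps)
      finally have "emeasure lebesgue U < ennreal \<delta>" .
      with \<delta>(2) Ul have sU: "(LINT x:U|lebesgue. norm (indicator (cball 0 R) x *\<^sub>R d x)) < e / (2 * M)" by blast
      have iU: "integrable lebesgue (\<lambda>x. indicator U x *\<^sub>R norm (indicator (cball 0 R) x *\<^sub>R d x))"
        by (rule integrable_mult_indicator[OF Ul integrable_norm[OF di]])
      have "norm (LINT x|lebesgue. v x *\<^sub>R d x) \<le> (LINT x|lebesgue. norm (v x *\<^sub>R d x))" by (rule integral_norm_bound)
      also have "\<dots> \<le> (LINT x|lebesgue. M * (indicator U x *\<^sub>R norm (indicator (cball 0 R) x *\<^sub>R d x)))"
      proof (rule integral_mono[OF integrable_norm[OF ud[OF vs vR vM]] integrable_mult_right[OF iU]])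
        fix y
        show "norm (v y *\<^sub>R d y) \<le> M * (indicator U y *\<^sub>R norm (indicator (cball 0 R) y *\<^sub>R d y))"
        proof (cases "y \<in> U \<and> cmod y \<le> R")
          case True
          then show ?thesis using mult_right_mono[OF vM[of y] norm_ge_zero[of "d y"]] by simp
        next
          case False
          have "v y = 0"
          proof (cases "R < cmod y")
            case True then show ?thesis by (rule vR)
          next
            case nR: False
            then have "y \<notin> U" using False by simp
            then have "\<eta> i y = 0" if "i \<in> I" for i
              using that by (intro c4[OF that]) (auto simp: U_def dist_commute)
            then show ?thesis by (simp add: v_def)
          qed
          then show ?thesis using M by simp
        qed
      qed
      also have "\<dots> = M * (LINT x:U|lebesgue. norm (indicator (cball 0 R) x *\<^sub>R d x))"
        unfolding set_lebesgue_integral_def by simp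
      also have "\<dots> \<le> M * (e / (2 * M))" using sU M by (intro mult_left_mono) auto
      also have "\<dots> = e / 2" using M by simp
      finally show ?thesis .
    qed
    ultimately show ?thesis unfolding A using norm_triangle_ineq[of "LINT x|lebesgue. ?D v x *\<^sub>R f x" "LINT x|lebesgue. v x *\<^sub>R d x"] by linarith
  qed
  have "A = 0"
  proof (rule ccontr)
    assume "A \<noteq> 0"
    then show False using small[of "norm A / 2"] by simp
  qed
  then show "(LINT x:UNIV|lebesgue. ?D \<phi> x *\<^sub>R f x) = - (LINT x:UNIV|lebesgue. \<phi> x *\<^sub>R d x)"
    unfolding A_def set_lebesgue_integral_def by (simp add: add_eq_0_iff)
qed

section \<open>Removability for mappings of finite distortion\<close>

text \<open>
  The image of a disc of radius \<open>r\<close> has area at most a multiple of \<open>r powr (2 * \<alpha>)\<close>.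
\<close>

lemma negligible_Holder_image:
  fixes h :: "complex \<Rightarrow> complex"
  assumes Hol: "\<And>z w. dist z w < 1 \<Longrightarrow> dist (h z) (h w) \<le> C * dist z w powr \<alpha>"
    and C: "0 \<le> C" and \<alpha>: "0 < \<alpha>" and E: "compact E" and dim: "hausdorff_dim E < ereal (2 * \<alpha>)"
  shows "negligible (h ` E)"
proof (rule negligible_of_small_covers)
  fix e :: real assume e: "0 < e"
  have "0 < e / (C + 1)\<^sup>2" using e C by simp
  from compact_small_cover[OF E dim _ this zero_less_one] \<alpha>
  obtain I :: "nat set" and x r where I: "finite I" and r: "\<forall>i\<in>I. x i \<in> E \<and> 0 < r i \<and> r i < 1"
    and EI: "E \<subseteq> (\<Union>i\<in>I. ball (x i) (r i))" and S: "(\<Sum>i\<in>I. r i powr (2 * \<alpha>)) < e / (C + 1)\<^sup>2"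
    by auto
  have "h ` E \<subseteq> (\<Union>i\<in>I. cball (h (x i)) (C * r i powr \<alpha>))"
  proof
    fix y assume "y \<in> h ` E"
    then obtain z i where z: "y = h z" "i \<in> I" "dist (x i) z < r i" using EI by force
    have "dist (h (x i)) (h z) \<le> C * dist (x i) z powr \<alpha>" using Hol[of "x i" z] z r by force
    also have "\<dots> \<le> C * r i powr \<alpha>" using z C \<alpha> by (intro mult_left_mono powr_mono2) auto
    finally show "y \<in> (\<Union>i\<in>I. cball (h (x i)) (C * r i powr \<alpha>))" using z by auto
  qed
  moreover have "(\<Sum>i\<in>I. (C * r i powr \<alpha>)\<^sup>2) < e"
  proof -
    have "(\<Sum>i\<in>I. (C * r i powr \<alpha>)\<^sup>2) = C\<^sup>2 * (\<Sum>i\<in>I. r i powr (2 * \<alpha>))"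
      unfolding sum_distrib_left
      by (rule sum.cong) (auto simp: power_mult_distrib power2_eq_square simp flip: powr_add)
    also have "\<dots> \<le> (C + 1)\<^sup>2 * (\<Sum>i\<in>I. r i powr (2 * \<alpha>))"
      using C by (intro mult_right_mono power_mono sum_nonneg) auto
    also have "\<dots> < (C + 1)\<^sup>2 * (e / (C + 1)\<^sup>2)" using S C by (intro mult_strict_left_mono) auto
    also have "\<dots> = e" using C by simp
    finally show ?thesis .
  qed
  ultimately show "\<exists>(I :: nat set) x r. finite I \<and> (\<forall>i\<in>I. 0 \<le> r i) \<and> h ` E \<subseteq> (\<Union>i\<in>I. cball (x i) (r i)) \<and> (\<Sum>i\<in>I. (r i)\<^sup>2) < e"
    using I C by (intro exI[of _ I] exI[of _ "\<lambda>i. h (x i)"] exI[of _ "\<lambda>i. C * r i powr \<alpha>"]) auto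
qed

text \<open>
  Combine \<open>exp y \<ge> y\<^sup>2 / 2\<close> with the crude estimate \<open>(log (e + K))\<^sup>2 \<le> 16 K\<close>.
\<close>

lemma distortion_le_exp:
  assumes p: "0 < p" and K: "1 \<le> (K::real)"
  shows "K \<le> 32 / p\<^sup>2 * exp (p * (K / ln (exp 1 + K)))"
proof -
  let ?L = "ln (exp 1 + K)"
  have e0: "0 < exp 1 + K" using K by (simp add: add_pos_pos)
  have e3: "exp (1::real) \<le> 3" by (rule exp_le)
  have L1: "1 \<le> ?L" using K e0 by (simp add: ln_ge_iff)
  have "?L = 2 * ln (sqrt (exp 1 + K))" using e0 by (simp add: ln_sqrt)
  also have "\<dots> \<le> 2 * sqrt (exp 1 + K)" using ln_le_minus_one[of "sqrt (exp 1 + K)"] e0 by simp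
  finally have "?L\<^sup>2 \<le> (2 * sqrt (exp 1 + K))\<^sup>2" using L1 by (intro power_mono) auto
  also have "\<dots> = 4 * (exp 1 + K)" using e0 by (simp add: power_mult_distrib)
  also have "\<dots> \<le> 16 * K" using e3 K by simp
  finally have L2: "?L\<^sup>2 \<le> 16 * K" .
  have "K = 32 / p\<^sup>2 * ((p * K)\<^sup>2 / (16 * K) / 2)" using K p by (simp add: power2_eq_square field_simps)
  also have "\<dots> \<le> 32 / p\<^sup>2 * ((p * K)\<^sup>2 / ?L\<^sup>2 / 2)"
    using L2 L1 K p by (intro mult_left_mono divide_right_mono divide_left_mono) auto
  also have "(p * K)\<^sup>2 / ?L\<^sup>2 / 2 = (p * (K / ?L))\<^sup>2 / 2" by (simp add: power_divide)
  also have "32 / p\<^sup>2 * ((p * (K / ?L))\<^sup>2 / 2) \<le> 32 / p\<^sup>2 * exp (p * (K / ?L))"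
  proof (rule mult_left_mono)
    have "0 \<le> p * (K / ?L)" using p K L1 by (intro mult_nonneg_nonneg divide_nonneg_nonneg) auto
    then show "(p * (K / ?L))\<^sup>2 / 2 \<le> exp (p * (K / ?L))"
      using exp_lower_Taylor_quadratic[of "p * (K / ?L)"] by linarith
  qed simp
  finally show ?thesis .
qed

lemma L1_loc_across:
  fixes u :: "complex \<Rightarrow> 'b::euclidean_space"
  assumes E: "compact E" "E \<subseteq> ball 0 1" and u: "u \<in> L1_loc (- E)" and i: "set_integrable lebesgue (cball 0 2 - E) u"
  shows "(\<lambda>x. if x \<in> E then 0 else u x) \<in> L1_loc UNIV"
  unfolding L1_loc_def
proof (intro CollectI allI impI)
  fix C :: "complex set" assume "compact C \<and> C \<subseteq> UNIV"
  then have C: "compact C" by simp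
  have m: "C \<in> sets lebesgue" "E \<in> sets lebesgue" using borel_compact[OF C] borel_compact[OF E(1)] by simp_all
  have "compact (C - ball 0 2)" by (rule compact_diff[OF C]) simp
  moreover have "C - ball 0 2 \<subseteq> - E" using E(2) by force
  ultimately have 1: "set_integrable lebesgue (C - ball 0 2) u" using u unfolding L1_loc_def by blast
  have m': "C \<inter> (cball 0 2 - E) \<in> sets lebesgue" "C - ball 0 2 \<in> sets lebesgue"
    by (intro sets.Int sets.Diff m fmeasurableD[OF lmeasurable_cball] fmeasurableD[OF lmeasurable_ball])+
  have "set_integrable lebesgue (C \<inter> (cball 0 2 - E)) u"
    by (rule set_integrable_subset[OF i m'(1)]) blast
  from set_integrable_Un[OF 1 this m'(2,1)]
  have "set_integrable lebesgue ((C - ball 0 2) \<union> (C \<inter> (cball 0 2 - E))) u" .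
  also have "(C - ball 0 2) \<union> (C \<inter> (cball 0 2 - E)) = C - E" using E(2) by force
  finally have "integrable lebesgue (\<lambda>x. indicator (C - E) x *\<^sub>R u x)" by (simp add: set_integrable_def)
  moreover have "(\<lambda>x. indicator (C - E) x *\<^sub>R u x) = (\<lambda>x. indicator C x *\<^sub>R (if x \<in> E then 0 else u x))"
    by (auto simp: indicator_def)
  ultimately show "set_integrable lebesgue C (\<lambda>x. if x \<in> E then 0 else u x)" by (simp add: set_integrable_def)
qed

lemma Holder_continuous:
  fixes f :: "complex \<Rightarrow> complex"
  assumes Hol: "\<And>z w. dist z w < 1 \<Longrightarrow> dist (f z) (f w) \<le> C * dist z w powr \<alpha>" and \<alpha>: "0 < \<alpha>"
  shows "continuous_on UNIV f"
proof (rule continuous_at_imp_continuous_on, rule ballI)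
  fix x :: complex
  have "((\<lambda>y. C * dist y x powr \<alpha>) \<longlongrightarrow> C * 0 powr \<alpha>) (at x)"
    using \<alpha> by (intro tendsto_intros tendsto_powr2) (auto intro!: tendsto_eq_intros eventually_mono[OF eventually_True])
  then have l: "((\<lambda>y. C * dist y x powr \<alpha>) \<longlongrightarrow> 0) (at x)" by simp
  have "\<forall>\<^sub>F y in at x. dist y x < 1" using eventually_at by (force intro: zero_less_one)
  then have "\<forall>\<^sub>F y in at x. norm (f y - f x) \<le> C * dist y x powr \<alpha>"
    by eventually_elim (use Hol in \<open>auto simp: dist_norm\<close>)
  from Lim_null_comparison[OF this l] show "isCont f x" unfolding isCont_def by (rule LIM_zero_cancel)
qed

theorem corollary3:
  fixes \<alpha> p :: real and f :: "complex \<Rightarrow> complex" and E :: "complex set" and K :: "complex \<Rightarrow> real"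
  assumes "0 < \<alpha>" and "\<alpha> \<le> 1"
    and "f \<in> Lip \<alpha>"
    and "compact E" and "E \<subseteq> ball 0 1"
    and "finite_distortion (UNIV - E) f K"
    and "\<And>z. cmod z > 1 \<Longrightarrow> K z = 1"
    and "0 < p"
    and "(\<lambda>z. exp (K z / ln (exp 1 + K z))) \<in> Lp_on p (ball 0 1 - E)"
    and "hausdorff_dim E < ereal (2 * \<alpha>)"
  shows "\<exists>K'. finite_distortion UNIV f K'"
proof (cases "E = {}")
  case True
  then show ?thesis using assms(6) by (intro exI[of _ K]) simp
next
  case False
  note \<alpha> = assms(1,2) and E = assms(4) and E1 = assms(5) and p = assms(8) and dim = assms(10)
  obtain C0 where C0: "\<forall>z w. cmod (z - w) < 1 \<longrightarrow> cmod (f z - f w) \<le> C0 * cmod (z - w) powr \<alpha>"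
    using assms(3) unfolding Lip_def by blast
  define C where "C = \<bar>C0\<bar>"
  have C: "0 \<le> C" by (simp add: C_def)
  have Hol: "dist (f z) (f w) \<le> C * dist z w powr \<alpha>" if "dist z w < 1" for z w
  proof -
    have "dist (f z) (f w) \<le> C0 * dist z w powr \<alpha>" using C0 that by (simp add: dist_norm)
    also have "\<dots> \<le> C * dist z w powr \<alpha>" unfolding C_def by (intro mult_right_mono) auto
    finally show ?thesis .
  qed
  have f: "continuous_on UNIV f" by (rule Holder_continuous[OF Hol \<alpha>(1)])
  have fE0: "negligible (f ` E)" by (rule negligible_Holder_image[OF Hol C \<alpha>(1) E dim])
  have El: "E \<in> sets lebesgue" using borel_compact[OF E] by simp
  have op: "open (- E)" using E by (simp add: compact_imp_closed open_Compl)
  have El': "- E \<inter> space lebesgue \<in> sets lebesgue" using borel_open[OF op] by simp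
  from assms(6) obtain D where Km: "K \<in> borel_measurable (lebesgue_on (- E))"
    and K1: "AE z in lebesgue_on (- E). 1 \<le> K z" and W: "W11_loc_differential (- E) f D"
    and J: "(\<lambda>z. jacobian (D z)) \<in> L1_loc (- E)"
    and dist: "AE z in lebesgue_on (- E). (norm (D z))\<^sup>2 \<le> K z * jacobian (D z)"
    unfolding finite_distortion_def Compl_eq_Diff_UNIV[symmetric] by blast
  have d: "(\<lambda>x. D x b) \<in> L1_loc (- E)" and w: "weak_partial (- E) b f (\<lambda>x. D x b)" if "b \<in> {1, \<i>}" for b
    using W that by (auto simp: W11_loc_differential_def Basis_complex_def)
  have jac: "jacobian (D x) = jac (D x 1) (D x \<i>)" for x by (simp add: jacobian_def jac_def)
  have ae: "AE x in lebesgue. x \<notin> E \<longrightarrow> 1 \<le> K x \<and> (norm (D x))\<^sup>2 \<le> K x * jacobian (D x) \<and> 0 \<le> jacobian (D x)"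
  proof -
    have "AE x in lebesgue. x \<in> - E \<longrightarrow> 1 \<le> K x" "AE x in lebesgue. x \<in> - E \<longrightarrow> (norm (D x))\<^sup>2 \<le> K x * jacobian (D x)"
      by (rule AE_restrict_space_iff[OF El', THEN iffD1], rule K1)
        (rule AE_restrict_space_iff[OF El', THEN iffD1], rule dist)
    then show ?thesis
    proof eventually_elim
      case (elim x)
      show ?case
      proof
        assume "x \<notin> E"
        then have 1: "1 \<le> K x" "(norm (D x))\<^sup>2 \<le> K x * jacobian (D x)" using elim by auto
        have "0 \<le> K x * jacobian (D x)" using 1(2) zero_le_power2[of "norm (D x)"] by linarith
        then show "1 \<le> K x \<and> (norm (D x))\<^sup>2 \<le> K x * jacobian (D x) \<and> 0 \<le> jacobian (D x)"
          using 1 by (simp add: zero_le_mult_iff)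
      qed
    qed
  qed
  \<comment> \<open>Outside the closed unit disc \<open>K = 1\<close>, and the unit circle is a null set.\<close>
  define P where "P = (\<lambda>x. if x \<in> ball 0 1 then \<bar>exp (K x / ln (exp 1 + K x))\<bar> powr p else exp (p * (1 / ln (exp 1 + 1))))"
  have aeP: "AE x in lebesgue. exp (p * (K x / ln (exp 1 + K x))) \<le> P x"
  proof -
    have "negligible (sphere (0::complex) 1)" by (rule negligible_sphere)
    then have "AE x in lebesgue. x \<notin> sphere (0::complex) 1"
      by (intro AE_not_in) (simp add: negligible_iff_null_sets)
    then show ?thesis
    proof eventually_elim
      case (elim x)
      show ?case
      proof (cases "cmod x < 1")
        case True
        then show ?thesis by (simp add: P_def powr_def)
      next
        case False
        then have "K x = 1" using elim assms(7) by simp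
        then show ?thesis using False by (simp add: P_def)
      qed
    qed
  qed
  have Pi: "set_integrable lebesgue U P" if U: "U \<in> sets lebesgue" "bounded U" "U \<inter> E = {}" for U
  proof -
    have "set_integrable lebesgue (ball 0 1 - E) (\<lambda>x. \<bar>exp (K x / ln (exp 1 + K x))\<bar> powr p)"
      using assms(9) unfolding Lp_on_def by blast
    then have "set_integrable lebesgue (U \<inter> ball 0 1) (\<lambda>x. \<bar>exp (K x / ln (exp 1 + K x))\<bar> powr p)"
      by (rule set_integrable_subset) (use U in auto)
    then have 1: "set_integrable lebesgue (U \<inter> ball 0 1) P"
      by (rule set_integrable_cong[THEN iffD1, rotated -1]) (auto simp: P_def)
    obtain R where R: "U \<subseteq> ball 0 R" using bounded_subset_ballD[OF U(2), of 0] by blast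
    have "set_integrable lebesgue (cball 0 R) (\<lambda>x::complex. exp (p * (1 / ln (exp 1 + 1))))"
      by (rule set_integrable_continuous) auto
    then have "set_integrable lebesgue (U - ball 0 1) (\<lambda>x. exp (p * (1 / ln (exp 1 + 1))))"
      by (rule set_integrable_subset) (use U(1) R ball_subset_cball in \<open>auto simp: subset_iff\<close>)
    then have 2: "set_integrable lebesgue (U - ball 0 1) P"
      by (rule set_integrable_cong[THEN iffD1, rotated -1]) (auto simp: P_def)
    have "set_integrable lebesgue ((U \<inter> ball 0 1) \<union> (U - ball 0 1)) P"
      by (rule set_integrable_Un[OF 1 2]) (use U in auto)
    then show ?thesis by (simp add: Int_Diff_Un)
  qed
  interpret S: singular_set E f "\<lambda>x. D x 1" "\<lambda>x. D x \<i>"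
  proof
    show "compact E" "E \<noteq> {}" "continuous_on UNIV f" using E False f by auto
    show "(\<lambda>x. D x 1) \<in> L1_loc (- E)" "(\<lambda>x. D x \<i>) \<in> L1_loc (- E)" using d by auto
    show "weak_partial (- E) 1 f (\<lambda>x. D x 1)" "weak_partial (- E) \<i> f (\<lambda>x. D x \<i>)" using w by auto
    show "(\<lambda>x. jac (D x 1) (D x \<i>)) \<in> L1_loc (- E)" using J by (simp add: jac)
    fix U and e L :: real
    assume U: "compact U" "U \<subseteq> - E" and e: "0 < e"
    have Ul: "U \<in> sets lebesgue" using borel_compact[OF U(1)] by simp
    let ?g = "\<lambda>x. norm (D x 1) + norm (D x \<i>)"
    have dU: "set_integrable lebesgue U (\<lambda>x. D x b)" if "b \<in> {1, \<i>}" for b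
      using d[OF that] U unfolding L1_loc_def by blast
    have gU: "set_integrable lebesgue U ?g"
      by (intro set_integral_add(1) set_integrable_norm dU) auto
    have JU: "set_integrable lebesgue U (\<lambda>x. jacobian (D x))" using J U unfolding L1_loc_def by blast
    have PU: "set_integrable lebesgue U P" by (rule Pi[OF Ul compact_imp_bounded[OF U(1)]]) (use U(2) in auto)
    have conv: "integrable (lebesgue_on U) h" if "set_integrable lebesgue U h" for h :: "complex \<Rightarrow> real"
      using that Ul by (simp add: integrable_restrict_space set_integrable_def)
    have g4: "(?g x)\<^sup>2 \<le> 4 * (norm (D x))\<^sup>2" for x
    proof -
      have "norm (D x 1) \<le> norm (D x) * 1" "norm (D x \<i>) \<le> norm (D x) * 1"
        using norm_blinfun[of "D x" 1] norm_blinfun[of "D x" \<i>] by simp_all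
      then have "?g x \<le> 2 * norm (D x)" by simp
      then have "(?g x)\<^sup>2 \<le> (2 * norm (D x))\<^sup>2" by (intro power_mono) auto
      then show ?thesis by (simp add: power_mult_distrib)
    qed
    have "AE x in lebesgue_on U. 0 \<le> jacobian (D x) \<and> (?g x)\<^sup>2 \<le> 4 * (K x * jacobian (D x)) \<and> exp (p * (K x / ln (exp 1 + K x))) \<le> P x"
    proof -
      have "AE x in lebesgue. x \<in> U \<longrightarrow> 0 \<le> jacobian (D x) \<and> (?g x)\<^sup>2 \<le> 4 * (K x * jacobian (D x)) \<and> exp (p * (K x / ln (exp 1 + K x))) \<le> P x"
        using ae aeP
      proof eventually_elim
        case (elim x)
        then show ?case using g4[of x] U(2) by fastforce
      qed
      then show ?thesis by (subst AE_restrict_space_iff) (use Ul in simp)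
    qed
    from tail_integral_small[OF conv[OF gU] _ conv[OF JU] conv[OF PU] p this _ e, of L]
    obtain l where "L < l" "l * (LINT x|lebesgue_on U. ?g x * indicator {x. l < ?g x} x) < e" by auto
    moreover have "(LINT x|lebesgue_on U. ?g x * indicator {x. l < ?g x} x) = (LINT x:U|lebesgue. ?g x * indicator {x. l < ?g x} x)"
      using Ul by (simp add: integral_restrict_space set_lebesgue_integral_def)
    ultimately show "\<exists>l>L. l * (LINT x:U|lebesgue. ?g x * indicator {x. l < ?g x} x) < e" by auto
  qed
  let ?Q = "cball 0 2 - E"
  have Q: "?Q \<in> sets lebesgue" "bounded ?Q" "?Q \<inter> E = {}" using El by (auto intro: bounded_subset[OF bounded_cball])
  have JQ: "set_integrable lebesgue ?Q (\<lambda>x. jacobian (D x))"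
    unfolding jac
  proof (rule S.jacobian_integrable_across[OF _ fE0 E1])
    show "AE x in lebesgue. x \<notin> E \<longrightarrow> 0 \<le> jac (D x 1) (D x \<i>)"
      using ae by eventually_elim (auto simp: jac)
  qed
  have dQ: "set_integrable lebesgue ?Q (\<lambda>x. D x b)" if b: "b \<in> {1, \<i>}" for b
    unfolding set_integrable_def
  proof (rule Bochner_Integration.integrable_bound)
    have "set_integrable lebesgue ?Q (\<lambda>x. 32 / p\<^sup>2 * P x + jacobian (D x))"
      by (intro set_integral_add(1) set_integrable_mult_right Pi[OF Q] JQ)
    then show "integrable lebesgue (\<lambda>x. indicator ?Q x *\<^sub>R (32 / p\<^sup>2 * P x + jacobian (D x)))" by (simp add: set_integrable_def)
    have "(\<lambda>x. indicator ?Q x *\<^sub>R (indicator (- E) x *\<^sub>R D x b)) \<in> borel_measurable lebesgue"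
      by (rule borel_measurable_scaleR[OF borel_measurable_indicator[OF Q(1)] L1_loc_measurable[OF op d[OF b]]])
    moreover have "(\<lambda>x. indicator ?Q x *\<^sub>R (indicator (- E) x *\<^sub>R D x b)) = (\<lambda>x. indicator ?Q x *\<^sub>R D x b)"
      by (auto simp: indicator_def)
    ultimately show "(\<lambda>x. indicator ?Q x *\<^sub>R D x b) \<in> borel_measurable lebesgue" by simp
    show "AE x in lebesgue. norm (indicator ?Q x *\<^sub>R D x b) \<le> norm (indicator ?Q x *\<^sub>R (32 / p\<^sup>2 * P x + jacobian (D x)))"
      using ae aeP
    proof eventually_elim
      case (elim x)
      show ?case
      proof (cases "x \<in> ?Q")
        case True
        then have 1: "1 \<le> K x" "(norm (D x))\<^sup>2 \<le> K x * jacobian (D x)" "0 \<le> jacobian (D x)" using elim(1) by auto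
        have "K x \<le> 32 / p\<^sup>2 * exp (p * (K x / ln (exp 1 + K x)))" by (rule distortion_le_exp[OF p 1(1)])
        also have "\<dots> \<le> 32 / p\<^sup>2 * P x" using elim(2) by (intro mult_left_mono) auto
        finally have K: "K x \<le> 32 / p\<^sup>2 * P x" .
        \<comment> \<open>the geometric mean of \<open>K\<close> and \<open>J\<close> is at most their sum\<close>
        have "(norm (D x))\<^sup>2 \<le> (K x + jacobian (D x))\<^sup>2"
        proof -
          have "0 \<le> K x * jacobian (D x)" using 1 by simp
          then have "K x * jacobian (D x) \<le> (K x + jacobian (D x))\<^sup>2"
            using zero_le_power2[of "K x"] zero_le_power2[of "jacobian (D x)"] unfolding power2_sum by linarith
          then show ?thesis using 1(2) by linarith
        qed
        then have "norm (D x) \<le> K x + jacobian (D x)" by (rule power2_le_imp_le) (use 1(1,3) in linarith)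
        moreover have "norm (D x b) \<le> norm (D x)" using norm_blinfun[of "D x" b] b by auto
        ultimately show ?thesis using True K 1 by simp
      qed simp
    qed
  qed
  define D' where "D' = (\<lambda>x. if x \<in> E then 0 else D x)"
  define K' where "K' = (\<lambda>x. if x \<in> E then 1 else K x)"
  have D'b: "(\<lambda>x. D' x b) = (\<lambda>x. if x \<in> E then 0 else D x b)" for b by (auto simp: D'_def)
  have D'L: "(\<lambda>x. D' x b) \<in> L1_loc UNIV" if "b \<in> {1, \<i>}" for b
    unfolding D'b by (rule L1_loc_across[OF E E1 d[OF that] dQ[OF that]])
  have D'w: "weak_partial UNIV b f (\<lambda>x. D' x b)" if b: "b \<in> {1, \<i>}" for b
  proof (rule weak_partial_removable[OF f Hol \<alpha> C b E D'L[OF b]])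
    have "(LINT x:-E|lebesgue. \<phi> x *\<^sub>R D' x b) = (LINT x:-E|lebesgue. \<phi> x *\<^sub>R D x b)" for \<phi>
      unfolding set_lebesgue_integral_def
      by (rule Bochner_Integration.integral_cong[OF refl]) (auto simp: D'_def indicator_def)
    then show "weak_partial (- E) b f (\<lambda>x. D' x b)" using w[OF b] by (simp add: weak_partial_def)
    fix e :: real assume e: "0 < e"
    have "0 < 2 * \<alpha>" using \<alpha> by simp
    moreover have "(0::real) < 1 / 3" by simp
    ultimately obtain I :: "nat set" and x r where I: "finite I" "\<forall>i\<in>I. x i \<in> E \<and> 0 < r i \<and> r i < 1 / 3"
      "E \<subseteq> (\<Union>i\<in>I. ball (x i) (r i))" "(\<Sum>i\<in>I. r i powr (2 * \<alpha>)) < e"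
      using compact_small_cover[OF E dim _ e] by meson
    have "(\<Sum>i\<in>I. r i powr (1 + \<alpha>)) \<le> (\<Sum>i\<in>I. r i powr (2 * \<alpha>))"
      using I(2) \<alpha> by (intro sum_mono powr_mono') force+
    then have "(\<Sum>i\<in>I. r i powr (1 + \<alpha>)) < e" using I(4) by simp
    moreover have "\<forall>i\<in>I. 0 < r i \<and> 3 * r i < 1" using I(2) by force
    ultimately show "\<exists>(I :: nat set) x r. finite I \<and> (\<forall>i\<in>I. 0 < r i \<and> 3 * r i < 1) \<and> E \<subseteq> (\<Union>i\<in>I. ball (x i) (r i)) \<and> (\<Sum>i\<in>I. r i powr (1 + \<alpha>)) < e"
      using I(1,3) by blast
  qed
  have "finite_distortion UNIV f K'"
    unfolding finite_distortion_def
  proof (intro conjI exI[of _ D'])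
    show "K' \<in> borel_measurable (lebesgue_on UNIV)"
    proof -
      have "(\<lambda>x. indicator (- E) x *\<^sub>R K x) \<in> borel_measurable lebesgue"
        using Km unfolding borel_measurable_restrict_space_iff[OF El'] .
      moreover have "K' = (\<lambda>x. indicator E x + indicator (- E) x *\<^sub>R K x)" by (auto simp: K'_def indicator_def)
      ultimately show ?thesis using El by simp
    qed
    show "AE z in lebesgue_on UNIV. 1 \<le> K' z"
      unfolding lebesgue_on_UNIV_eq using ae by eventually_elim (auto simp: K'_def)
    have "f \<in> L1_loc UNIV"
      unfolding L1_loc_def using set_integrable_continuous continuous_on_subset[OF f] by blast
    then show "W11_loc_differential UNIV f D'"
      unfolding W11_loc_differential_def using D'L D'w by (simp add: Basis_complex_def)
    have "(\<lambda>z. jacobian (D' z)) = (\<lambda>z. if z \<in> E then 0 else jacobian (D z))" by (auto simp: D'_def jacobian_def)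
    then show "(\<lambda>z. jacobian (D' z)) \<in> L1_loc UNIV" using L1_loc_across[OF E E1 J JQ] by simp
    show "AE z in lebesgue_on UNIV. (norm (D' z))\<^sup>2 \<le> K' z * jacobian (D' z)"
      unfolding lebesgue_on_UNIV_eq using ae by eventually_elim (auto simp: K'_def D'_def jacobian_def)
  qed simp
  then show ?thesis by blast
qed

end
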